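(* The category $\mathrm{MV}_R$ of MV-algebras over $R$ is equivalent to the category $\mathrm{Chn}^\circ_R$ of pointed complexes over $R$, defined as follows. Objects of $\mathrm{Chn}^\circ_R$ are graded $\Bbbk$-vector spaces $V$ together with a continuous degree $+1$ $R$-linear differential $\Delta: V\widehat\otimes R\to V\widehat\otimes R$ (so $\Delta^2=0$) and a $\Bbbk$-linear monomorphism $\eta:\Bbbk\to V$ such that $\Delta\circ\eta=0$. A morphism from $(V',\Delta',\eta')$ to $(V'',\Delta'',\eta'')$ is a continuous degree-$0$ $R$-linear map $\varphi: V'\widehat\otimes R\to V''\widehat\otimes R$ that is a chain map ($\Delta''\circ\varphi=\varphi\circ\Delta'$) and satisfies $\varphi\circ\eta'\equiv\eta''\mod V''\widehat\otimes\mathfrak m$; composition is the usual composition of maps.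
   Context: $\Bbbk$ is a field of characteristic zero, $\otimes=\otimes_\Bbbk$, and Koszul signs are used throughout. $R$ is a complete local Noetherian commutative ring (a $\Bbbk$-algebra, in degree $0$) with residue field $\Bbbk$ and maximal ideal $\mathfrak m$. For a graded vector space $V$, $V\widehat\otimes R:=\varprojlim_n V\otimes R/V\otimes\mathfrak m^n$ and $V\widehat\otimes\mathfrak m$ is the kernel of $V\widehat\otimes R\to V$; convergence is $\mathfrak m$-adic. Maps and their $R$-linear extensions are denoted by the same symbol. An MV-algebra over $R$ is $V=(V,\mu,\delta,\Delta)$ where (i) $(V,\mu)$ is a unital graded commutative associative $\Bbbk$-algebra; (ii) $(V,\delta)$ is a conilpotent counital graded cocommutative coassociative $\Bbbk$-coalgebra; (iii) $\Delta:V\widehat\otimes R\to V\widehat\otimes R$ is a continuous degree $+1$ $R$-linear map with $\Delta^2=0$, $\Delta(1)=0$. The unit $\eta:\Bbbk\to V$ of $\mu$ is required to be a coaugmentation for $(V,\delta)$ and the counit $\epsilon:V\to\Bbbk$ of $\delta$ to be an augmentation for $(V,\mu)$. Conilpotent means: with $\bar\delta(v)=\delta(v)-v\otimes1-1\otimes v$ for $v\in\ker\epsilon$ and $\bar\delta(1)=0$, for every $v$ the iterates $\bar\delta^{[k]}(v)$ vanish for $k$ large, where $\bar\delta^{[0]}(v)=v$, $\bar\delta^{[k]}=(\bar\delta\otimes \mathrm{id}^{\otimes k-1})\bar\delta^{[k-1]}$. No compatibility between $\mu$ and $\delta$ is required. For MV-algebras $V',V''$, $\mathrm{Lin}_R(V',V'')$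 denotes the continuous degree-$0$ $R$-linear maps $V'\widehat\otimes R\to V''\widehat\otimes R$, a commutative algebra under convolution $f\star g=\mu''(f\otimes g)\delta'$ (extended $R$-linearly) with unit $\mathsf e=\eta''\circ\epsilon'$. $\mathrm{Lin}^0_R(V',V'')$ is the ideal of those $f$ with $\mathrm{Im}(f\circ\eta')\subset V''\widehat\otimes\mathfrak m$. For $f,g\in\mathrm{Lin}_R^0(V',V'')$ the (pointwise $\mathfrak m$-adically convergent) series, with powers with respect to $\star$, $\exp(f)=\mathsf e+f+f^2/2!+\cdots$ and $\log(\mathsf e+g)=g-g^2/2+g^3/3-\cdots$ define mutually inverse bijections between $\mathrm{Lin}_R^0$ and $\mathsf e+\mathrm{Lin}_R^0$. The category $\mathrm{MV}_R$ has MV-algebras over $R$ as objects, morphisms $\mathrm{MV}_R(V',V'')=\{f\in\mathrm{Lin}_R^0(V',V'')\mid \Delta''\circ\exp(f)=\exp(f)\circ\Delta'\}$, composition $f\diamond g=\log(\exp(f)\circ\exp(g))$, and identities $\mathbf 1_V=\log(\mathrm{id}_{V\widehat\otimes R})$. *)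

theory Defs
  imports "HOL-Algebra.Algebra"
begin

section \<open>Categories\<close>

text \<open>Arrows are typed by explicitly given source and target objects: in a category \<open>C\<close>,
  \<open>Cmp C a b c g f\<close> is the composite of \<open>f \<in> Mor C a b\<close> followed by \<open>g \<in> Mor C b c\<close>.\<close>

record ('o, 'm) cat =
  Obj :: "'o set"
  Mor :: "'o \<Rightarrow> 'o \<Rightarrow> 'm set"
  Cmp :: "'o \<Rightarrow> 'o \<Rightarrow> 'o \<Rightarrow> 'm \<Rightarrow> 'm \<Rightarrow> 'm"
  Idt :: "'o \<Rightarrow> 'm"

locale category =
  fixes C :: "('o, 'm) cat"
  assumes Idt_mem: "a \<in> Obj C \<Longrightarrow> Idt C a \<in> Mor C a a"
    and Cmp_mem: "\<lbrakk>a \<in> Obj C; b \<in> Obj C; c \<in> Obj C; f \<in> Mor C a b; g \<in> Mor C b c\<rbrakk>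
      \<Longrightarrow> Cmp C a b c g f \<in> Mor C a c"
    and Cmp_assoc: "\<lbrakk>a \<in> Obj C; b \<in> Obj C; c \<in> Obj C; d \<in> Obj C;
        f \<in> Mor C a b; g \<in> Mor C b c; h \<in> Mor C c d\<rbrakk>
      \<Longrightarrow> Cmp C a b d (Cmp C b c d h g) f = Cmp C a c d h (Cmp C a b c g f)"
    and Cmp_Idt: "\<lbrakk>a \<in> Obj C; b \<in> Obj C; f \<in> Mor C a b\<rbrakk> \<Longrightarrow> Cmp C a a b f (Idt C a) = f"
    and Idt_Cmp: "\<lbrakk>a \<in> Obj C; b \<in> Obj C; f \<in> Mor C a b\<rbrakk> \<Longrightarrow> Cmp C a b b (Idt C b) f = f"

locale cat_functor = C: category C + D: category D
  for C :: "('o, 'm) cat" and D :: "('p, 'n) cat" +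
  fixes Fo :: "'o \<Rightarrow> 'p" and Fm :: "'o \<Rightarrow> 'o \<Rightarrow> 'm \<Rightarrow> 'n"
  assumes Fo_mem: "a \<in> Obj C \<Longrightarrow> Fo a \<in> Obj D"
    and Fm_mem: "\<lbrakk>a \<in> Obj C; b \<in> Obj C; f \<in> Mor C a b\<rbrakk> \<Longrightarrow> Fm a b f \<in> Mor D (Fo a) (Fo b)"
    and Fm_Idt: "a \<in> Obj C \<Longrightarrow> Fm a a (Idt C a) = Idt D (Fo a)"
    and Fm_Cmp: "\<lbrakk>a \<in> Obj C; b \<in> Obj C; c \<in> Obj C; f \<in> Mor C a b; g \<in> Mor C b c\<rbrakk>
      \<Longrightarrow> Fm a c (Cmp C a b c g f) = Cmp D (Fo a) (Fo b) (Fo c) (Fm b c g) (Fm a b f)"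

definition is_iso :: "('o, 'm) cat \<Rightarrow> 'o \<Rightarrow> 'o \<Rightarrow> 'm \<Rightarrow> bool" where
  "is_iso C a b f \<longleftrightarrow> f \<in> Mor C a b \<and>
    (\<exists>g \<in> Mor C b a. Cmp C a b a g f = Idt C a \<and> Cmp C b a b f g = Idt C b)"

locale natural_isomorphism = F: cat_functor C D Fo Fm + G: cat_functor C D Go Gm
  for C :: "('o, 'm) cat" and D :: "('p, 'n) cat" and Fo Fm Go Gm +
  fixes \<alpha> :: "'o \<Rightarrow> 'n"
  assumes component_iso: "a \<in> Obj C \<Longrightarrow> is_iso D (Fo a) (Go a) (\<alpha> a)"
    and naturality: "\<lbrakk>a \<in> Obj C; b \<in> Obj C; f \<in> Mor C a b\<rbrakk>
      \<Longrightarrow> Cmp D (Fo a) (Fo b) (Go b) (\<alpha> b) (Fm a b f) = Cmp D (Fo a) (Go a) (Go b) (Gm a b f) (\<alpha> a)"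

definition equivalent_categories :: "('o, 'm) cat \<Rightarrow> ('p, 'n) cat \<Rightarrow> bool" where
  "equivalent_categories C D \<longleftrightarrow> category C \<and> category D \<and>
    (\<exists>Fo Fm Go Gm \<alpha> \<beta>. cat_functor C D Fo Fm \<and> cat_functor D C Go Gm \<and>
      natural_isomorphism C C (\<lambda>a. a) (\<lambda>a b f. f) (Go \<circ> Fo) (\<lambda>a b f. Gm (Fo a) (Fo b) (Fm a b f)) \<alpha> \<and>
      natural_isomorphism D D (Fo \<circ> Go) (\<lambda>a b f. Fm (Go a) (Go b) (Gm a b f)) (\<lambda>a. a) (\<lambda>a b f. f) \<beta>)"


section \<open>Linear algebra\<close>

definition linear_map ::
  "('k, 'x) ring_scheme \<Rightarrow> ('k, 'a, 'y) module_scheme \<Rightarrow> ('k, 'b, 'z) module_scheme \<Rightarrow> ('a \<Rightarrow> 'b) \<Rightarrow> bool"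
  where "linear_map K M N f \<longleftrightarrow> f \<in> carrier M \<rightarrow> carrier N \<and>
    (\<forall>x \<in> carrier M. \<forall>y \<in> carrier M. f (x \<oplus>\<^bsub>M\<^esub> y) = f x \<oplus>\<^bsub>N\<^esub> f y) \<and>
    (\<forall>a \<in> carrier K. \<forall>x \<in> carrier M. f (a \<odot>\<^bsub>M\<^esub> x) = a \<odot>\<^bsub>N\<^esub> f x)"

definition self_module :: "('k, 'x) ring_scheme \<Rightarrow> ('k, 'k) module" where
  "self_module K = \<lparr>carrier = carrier K, monoid.mult = monoid.mult K, monoid.one = \<one>\<^bsub>K\<^esub>,
    ring.zero = \<zero>\<^bsub>K\<^esub>, ring.add = ring.add K, smult = monoid.mult K\<rparr>"

definition lin_span ::
  "('k, 'x) ring_scheme \<Rightarrow> ('k, 'a, 'y) module_scheme \<Rightarrow> 'a set \<Rightarrow> 'a set" where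
  "lin_span K M S = (\<lambda>N. submodule N K M) hull S"

text \<open>For the constructions below, which are plain modules, the record fields \<open>mult\<close> and \<open>one\<close>
  carry no information.\<close>

definition quotient_module :: "('k, 'a, 'y) module_scheme \<Rightarrow> 'a set \<Rightarrow> ('k, 'a set) module" where
  "quotient_module M N = \<lparr>carrier = a_rcosets\<^bsub>M\<^esub> N, monoid.mult = undefined, monoid.one = undefined,
    ring.zero = N, ring.add = set_add M, smult = (\<lambda>a S. \<Union>x\<in>S. N +>\<^bsub>M\<^esub> (a \<odot>\<^bsub>M\<^esub> x))\<rparr>"

definition free_module :: "('k, 'x) ring_scheme \<Rightarrow> 'a set \<Rightarrow> ('k, 'a \<Rightarrow> 'k) module" where
  "free_module K S = \<lparr>carrier = {\<phi>. range \<phi> \<subseteq> carrier K \<and> finite {x. \<phi> x \<noteq> \<zero>\<^bsub>K\<^esub>} \<and> {x. \<phi> x \<noteq> \<zero>\<^bsub>K\<^esub>} \<subseteq> S},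
    monoid.mult = undefined, monoid.one = undefined, ring.zero = (\<lambda>x. \<zero>\<^bsub>K\<^esub>),
    ring.add = (\<lambda>\<phi> \<psi> x. \<phi> x \<oplus>\<^bsub>K\<^esub> \<psi> x), smult = (\<lambda>a \<phi> x. a \<otimes>\<^bsub>K\<^esub> \<phi> x)\<rparr>"

definition free_gen :: "('k, 'x) ring_scheme \<Rightarrow> 'a \<Rightarrow> 'a \<Rightarrow> 'k" where
  "free_gen K x = (\<lambda>y. if y = x then \<one>\<^bsub>K\<^esub> else \<zero>\<^bsub>K\<^esub>)"

definition tensor_relations ::
  "('k, 'x) ring_scheme \<Rightarrow> ('k, 'a, 'y) module_scheme \<Rightarrow> ('k, 'b, 'z) module_scheme \<Rightarrow> ('a \<times> 'b \<Rightarrow> 'k) set"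
  where "tensor_relations K V W = (let F = free_module K (carrier V \<times> carrier W) in
    lin_span K F
     ({free_gen K (u \<oplus>\<^bsub>V\<^esub> v, w) \<ominus>\<^bsub>F\<^esub> (free_gen K (u, w) \<oplus>\<^bsub>F\<^esub> free_gen K (v, w)) | u v w.
         u \<in> carrier V \<and> v \<in> carrier V \<and> w \<in> carrier W} \<union>
      {free_gen K (v, u \<oplus>\<^bsub>W\<^esub> w) \<ominus>\<^bsub>F\<^esub> (free_gen K (v, u) \<oplus>\<^bsub>F\<^esub> free_gen K (v, w)) | v u w.
         v \<in> carrier V \<and> u \<in> carrier W \<and> w \<in> carrier W} \<union>
      {free_gen K (a \<odot>\<^bsub>V\<^esub> v, w) \<ominus>\<^bsub>F\<^esub> (a \<odot>\<^bsub>F\<^esub> free_gen K (v, w)) | a v w.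
         a \<in> carrier K \<and> v \<in> carrier V \<and> w \<in> carrier W} \<union>
      {free_gen K (v, a \<odot>\<^bsub>W\<^esub> w) \<ominus>\<^bsub>F\<^esub> (a \<odot>\<^bsub>F\<^esub> free_gen K (v, w)) | a v w.
         a \<in> carrier K \<and> v \<in> carrier V \<and> w \<in> carrier W}))"

definition tensor ::
  "('k, 'x) ring_scheme \<Rightarrow> ('k, 'a, 'y) module_scheme \<Rightarrow> ('k, 'b, 'z) module_scheme
    \<Rightarrow> ('k, ('a \<times> 'b \<Rightarrow> 'k) set) module"
  where "tensor K V W =
    quotient_module (free_module K (carrier V \<times> carrier W)) (tensor_relations K V W)"

definition pure_tensor ::
  "('k, 'x) ring_scheme \<Rightarrow> ('k, 'a, 'y) module_scheme \<Rightarrow> ('k, 'b, 'z) module_scheme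
    \<Rightarrow> 'a \<Rightarrow> 'b \<Rightarrow> ('a \<times> 'b \<Rightarrow> 'k) set"
  where "pure_tensor K V W v w =
    tensor_relations K V W +>\<^bsub>free_module K (carrier V \<times> carrier W)\<^esub> free_gen K (v, w)"

text \<open>The tensor powers of \<open>V\<close>, all of one type: the \<open>n\<close>-th one is the free module on the lists
  of \<open>n\<close> vectors, modulo multilinearity. Consequently no associativity isomorphisms are needed.\<close>

definition words :: "('k, 'a, 'y) module_scheme \<Rightarrow> nat \<Rightarrow> 'a list set" where
  "words V n = {vs. length vs = n \<and> set vs \<subseteq> carrier V}"

definition tensor_power_relations ::
  "('k, 'x) ring_scheme \<Rightarrow> ('k, 'a, 'y) module_scheme \<Rightarrow> nat \<Rightarrow> ('a list \<Rightarrow> 'k) set"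
  where "tensor_power_relations K V n = (let F = free_module K (words V n) in
    lin_span K F
     ({free_gen K (us @ (v \<oplus>\<^bsub>V\<^esub> w) # ws) \<ominus>\<^bsub>F\<^esub>
           (free_gen K (us @ v # ws) \<oplus>\<^bsub>F\<^esub> free_gen K (us @ w # ws)) | us v w ws.
         us @ v # ws \<in> words V n \<and> us @ w # ws \<in> words V n} \<union>
      {free_gen K (us @ (a \<odot>\<^bsub>V\<^esub> v) # ws) \<ominus>\<^bsub>F\<^esub> (a \<odot>\<^bsub>F\<^esub> free_gen K (us @ v # ws)) | a us v ws.
         a \<in> carrier K \<and> us @ v # ws \<in> words V n}))"

definition tensor_power ::
  "('k, 'x) ring_scheme \<Rightarrow> ('k, 'a, 'y) module_scheme \<Rightarrow> nat \<Rightarrow> ('k, ('a list \<Rightarrow> 'k) set) module"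
  where "tensor_power K V n =
    quotient_module (free_module K (words V n)) (tensor_power_relations K V n)"

definition pure_power ::
  "('k, 'x) ring_scheme \<Rightarrow> ('k, 'a, 'y) module_scheme \<Rightarrow> 'a list \<Rightarrow> ('a list \<Rightarrow> 'k) set"
  where "pure_power K V vs = tensor_power_relations K V (length vs)
    +>\<^bsub>free_module K (words V (length vs))\<^esub> free_gen K vs"

text \<open>The linear map to \<open>M\<close> induced on a tensor product or tensor power by a multilinear map \<open>b\<close>:
  the class of \<open>\<Sum>x. \<phi> x \<cdot> x\<close> is sent to \<open>\<Sum>x. \<phi> x \<cdot> b x\<close>.\<close>

definition tensor_lift ::
  "('k, 'x) ring_scheme \<Rightarrow> ('k, 'c, 'y) module_scheme \<Rightarrow> ('a \<Rightarrow> 'c) \<Rightarrow> ('a \<Rightarrow> 'k) set \<Rightarrow> 'c"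
  where "tensor_lift K M b S = (let \<phi> = SOME \<phi>. \<phi> \<in> S in
    \<Oplus>\<^bsub>M\<^esub>x \<in> {x. \<phi> x \<noteq> \<zero>\<^bsub>K\<^esub>}. \<phi> x \<odot>\<^bsub>M\<^esub> b x)"

text \<open>For \<open>D : V \<rightarrow> V \<otimes> V\<close>, the map \<open>id \<otimes> \<dots> \<otimes> D \<otimes> \<dots> \<otimes> id\<close> from the \<open>n\<close>-th to the
  \<open>(n+1)\<close>-st tensor power, with \<open>D\<close> in position \<open>i\<close> (counting from 0).
  There is no Koszul sign as \<open>D\<close> will have degree 0.\<close>

definition apply_at ::
  "('k, 'x) ring_scheme \<Rightarrow> ('k, 'a, 'y) module_scheme \<Rightarrow> nat \<Rightarrow> nat \<Rightarrow> ('a \<Rightarrow> ('a list \<Rightarrow> 'k) set)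
    \<Rightarrow> ('a list \<Rightarrow> 'k) set \<Rightarrow> ('a list \<Rightarrow> 'k) set"
  where "apply_at K V n i D =
    tensor_lift K (tensor_power K V (Suc n))
      (\<lambda>vs. tensor_lift K (tensor_power K V (Suc n))
        (\<lambda>ws. pure_power K V (take i vs @ ws @ drop (Suc i) vs)) (D (vs ! i)))"


section \<open>Graded vector spaces\<close>

record ('k, 'v) graded_module = "('k, 'v) module" +
  component :: "int \<Rightarrow> 'v set"

definition homogeneous_decomposition ::
  "('k, 'v, 'y) graded_module_scheme \<Rightarrow> 'v \<Rightarrow> (int \<Rightarrow> 'v) \<Rightarrow> bool" where
  "homogeneous_decomposition V v c \<longleftrightarrow> (\<forall>i. c i \<in> component V i) \<and> finite {i. c i \<noteq> \<zero>\<^bsub>V\<^esub>} \<and>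
    v = (\<Oplus>\<^bsub>V\<^esub>i \<in> {i. c i \<noteq> \<zero>\<^bsub>V\<^esub>}. c i)"

definition graded_vector_space ::
  "('k, 'x) ring_scheme \<Rightarrow> ('k, 'v, 'y) graded_module_scheme \<Rightarrow> bool" where
  "graded_vector_space K V \<longleftrightarrow> module K V \<and> (\<forall>i. submodule (component V i) K V) \<and>
    (\<forall>v \<in> carrier V. \<exists>!c. homogeneous_decomposition V v c)"

definition hom_part :: "('k, 'v, 'y) graded_module_scheme \<Rightarrow> 'v \<Rightarrow> int \<Rightarrow> 'v" where
  "hom_part V v = (THE c. homogeneous_decomposition V v c)"

definition koszul :: "('k, 'a, 'y) module_scheme \<Rightarrow> int \<Rightarrow> int \<Rightarrow> 'a \<Rightarrow> 'a" where
  "koszul M i j x = (if odd (i * j) then \<ominus>\<^bsub>M\<^esub> x else x)"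

text \<open>The symmetry \<open>v \<otimes> w \<mapsto> (-1)\<^sup>i\<^sup>j w \<otimes> v\<close>, for \<open>v\<close>, \<open>w\<close> homogeneous of degrees \<open>i\<close>, \<open>j\<close>.\<close>

definition koszul_swap ::
  "('k, 'x) ring_scheme \<Rightarrow> ('k, 'v, 'y) graded_module_scheme \<Rightarrow> ('v list \<Rightarrow> 'k) set \<Rightarrow> ('v list \<Rightarrow> 'k) set"
  where "koszul_swap K V = tensor_lift K (tensor_power K V 2)
    (\<lambda>vs. let c = hom_part V (vs ! 0); d = hom_part V (vs ! 1) in
      \<Oplus>\<^bsub>tensor_power K V 2\<^esub>i \<in> {i. c i \<noteq> \<zero>\<^bsub>V\<^esub>}.
        \<Oplus>\<^bsub>tensor_power K V 2\<^esub>j \<in> {j. d j \<noteq> \<zero>\<^bsub>V\<^esub>}.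
          koszul (tensor_power K V 2) i j (pure_power K V [d j, c i]))"

definition square_component ::
  "('k, 'x) ring_scheme \<Rightarrow> ('k, 'v, 'y) graded_module_scheme \<Rightarrow> int \<Rightarrow> ('v list \<Rightarrow> 'k) set set" where
  "square_component K V n = lin_span K (tensor_power K V 2)
    {pure_power K V [v, w] | v w i j. v \<in> component V i \<and> w \<in> component V j \<and> i + j = n}"


section \<open>Algebras and coalgebras\<close>

text \<open>The product and the unit of an algebra are the record fields \<open>mult\<close> and \<open>one\<close>; the unit
  map is \<open>a \<mapsto> a \<cdot> 1\<close>.\<close>

definition graded_comm_algebra ::
  "('k, 'x) ring_scheme \<Rightarrow> ('k, 'v, 'y) graded_module_scheme \<Rightarrow> bool" where
  "graded_comm_algebra K V \<longleftrightarrow> graded_vector_space K V \<and> ring V \<and>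
    (\<forall>a \<in> carrier K. \<forall>v \<in> carrier V. \<forall>w \<in> carrier V.
      (a \<odot>\<^bsub>V\<^esub> v) \<otimes>\<^bsub>V\<^esub> w = a \<odot>\<^bsub>V\<^esub> (v \<otimes>\<^bsub>V\<^esub> w) \<and> v \<otimes>\<^bsub>V\<^esub> (a \<odot>\<^bsub>V\<^esub> w) = a \<odot>\<^bsub>V\<^esub> (v \<otimes>\<^bsub>V\<^esub> w)) \<and>
    \<one>\<^bsub>V\<^esub> \<in> component V 0 \<and>
    (\<forall>i j. \<forall>v \<in> component V i. \<forall>w \<in> component V j.
      v \<otimes>\<^bsub>V\<^esub> w \<in> component V (i + j) \<and> v \<otimes>\<^bsub>V\<^esub> w = koszul V i j (w \<otimes>\<^bsub>V\<^esub> v))"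

record ('k, 'v) graded_bimodule = "('k, 'v) graded_module" +
  comult :: "'v \<Rightarrow> ('v list \<Rightarrow> 'k) set"
  counit :: "'v \<Rightarrow> 'k"

definition graded_cocomm_coalgebra ::
  "('k, 'x) ring_scheme \<Rightarrow> ('k, 'v, 'y) graded_bimodule_scheme \<Rightarrow> bool" where
  "graded_cocomm_coalgebra K V \<longleftrightarrow> graded_vector_space K V \<and>
    linear_map K V (tensor_power K V 2) (comult V) \<and>
    linear_map K V (self_module K) (counit V) \<and>
    (\<forall>n. \<forall>v \<in> component V n. comult V v \<in> square_component K V n) \<and>
    (\<forall>n. \<forall>v \<in> component V n. n \<noteq> 0 \<longrightarrow> counit V v = \<zero>\<^bsub>K\<^esub>) \<and>
    (\<forall>v \<in> carrier V.
      apply_at K V 2 0 (comult V) (comult V v) = apply_at K V 2 1 (comult V) (comult V v) \<and>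
      tensor_lift K V (\<lambda>vs. counit V (vs ! 0) \<odot>\<^bsub>V\<^esub> (vs ! 1)) (comult V v) = v \<and>
      tensor_lift K V (\<lambda>vs. counit V (vs ! 1) \<odot>\<^bsub>V\<^esub> (vs ! 0)) (comult V v) = v \<and>
      koszul_swap K V (comult V v) = comult V v)"

text \<open>The reduced coproduct: \<open>v\<close> is first projected to the kernel of the counit
  along the span of the unit, which makes the reduced coproduct vanish on the unit.\<close>

definition reduced_comult ::
  "('k, 'x) ring_scheme \<Rightarrow> ('k, 'v, 'y) graded_bimodule_scheme \<Rightarrow> 'v \<Rightarrow> ('v list \<Rightarrow> 'k) set" where
  "reduced_comult K V v = (let u = v \<ominus>\<^bsub>V\<^esub> (counit V v \<odot>\<^bsub>V\<^esub> \<one>\<^bsub>V\<^esub>); T = tensor_power K V 2 in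
    comult V u \<ominus>\<^bsub>T\<^esub> pure_power K V [u, \<one>\<^bsub>V\<^esub>] \<ominus>\<^bsub>T\<^esub> pure_power K V [\<one>\<^bsub>V\<^esub>, u])"

primrec iterated_reduced_comult ::
  "('k, 'x) ring_scheme \<Rightarrow> ('k, 'v, 'y) graded_bimodule_scheme \<Rightarrow> nat \<Rightarrow> 'v \<Rightarrow> ('v list \<Rightarrow> 'k) set" where
  "iterated_reduced_comult K V 0 v = pure_power K V [v]"
| "iterated_reduced_comult K V (Suc k) v =
    apply_at K V (Suc k) 0 (reduced_comult K V) (iterated_reduced_comult K V k v)"

definition conilpotent ::
  "('k, 'x) ring_scheme \<Rightarrow> ('k, 'v, 'y) graded_bimodule_scheme \<Rightarrow> bool" where
  "conilpotent K V \<longleftrightarrow> (\<forall>v \<in> carrier V. \<exists>N. \<forall>k \<ge> N.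
    iterated_reduced_comult K V k v = \<zero>\<^bsub>tensor_power K V (Suc k)\<^esub>)"

text \<open>The unit is a morphism of coalgebras from the ground field, the counit a morphism of
  algebras to it.\<close>

definition coaugmented :: "('k, 'x) ring_scheme \<Rightarrow> ('k, 'v, 'y) graded_bimodule_scheme \<Rightarrow> bool" where
  "coaugmented K V \<longleftrightarrow>
    comult V \<one>\<^bsub>V\<^esub> = pure_power K V [\<one>\<^bsub>V\<^esub>, \<one>\<^bsub>V\<^esub>] \<and> counit V \<one>\<^bsub>V\<^esub> = \<one>\<^bsub>K\<^esub>"

definition augmented :: "('k, 'x) ring_scheme \<Rightarrow> ('k, 'v, 'y) graded_bimodule_scheme \<Rightarrow> bool" where
  "augmented K V \<longleftrightarrow> counit V \<one>\<^bsub>V\<^esub> = \<one>\<^bsub>K\<^esub> \<and>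
    (\<forall>v \<in> carrier V. \<forall>w \<in> carrier V. counit V (v \<otimes>\<^bsub>V\<^esub> w) = counit V v \<otimes>\<^bsub>K\<^esub> counit V w)"


section \<open>Complete tensor products\<close>

text \<open>Elements of the completion of \<open>V \<otimes> R\<close>: compatible families of cosets in \<open>V \<otimes> R\<close>.\<close>

type_synonym ('v, 'r, 'k) hat = "nat \<Rightarrow> ('v \<times> 'r \<Rightarrow> 'k) set set"

record ('k, 'v, 'r) mv_algebra = "('k, 'v) graded_bimodule" +
  mv_diff :: "('v, 'r, 'k) hat \<Rightarrow> ('v, 'r, 'k) hat"

text \<open>For pointed complexes the inherited record fields \<open>mult\<close> and \<open>one\<close> carry no information.\<close>

record ('k, 'v, 'r) pointed_complex = "('k, 'v) graded_module" +
  pc_diff :: "('v, 'r, 'k) hat \<Rightarrow> ('v, 'r, 'k) hat"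
  pc_point :: "'k \<Rightarrow> 'v"

locale complete_local_algebra =
  fixes K :: "('k, 'x) ring_scheme" and R :: "('k, 'r, 'y) module_scheme" and \<mm> :: "'r set"
  assumes field_K: "field K"
    and char_zero: "0 < n \<Longrightarrow> add_pow K (n::nat) \<one>\<^bsub>K\<^esub> \<noteq> \<zero>\<^bsub>K\<^esub>"
    and algebra_R: "algebra K R"
    and noetherian: "noetherian_ring R"
    and maximal: "maximalideal \<mm> R"
    and local: "maximalideal I R \<Longrightarrow> I = \<mm>"
    and residue_field: "bij_betw (\<lambda>a. \<mm> +>\<^bsub>R\<^esub> (a \<odot>\<^bsub>R\<^esub> \<one>\<^bsub>R\<^esub>)) (carrier K) (carrier (R Quot \<mm>))"
    and complete: "bij_betw (\<lambda>r n. (\<mm> [^]\<^bsub>ideals_set R\<^esub> (n::nat)) +>\<^bsub>R\<^esub> r) (carrier R)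
      {x. \<forall>n. x n \<in> carrier (R Quot (\<mm> [^]\<^bsub>ideals_set R\<^esub> n)) \<and> x (Suc n) \<subseteq> x n}"
begin

definition residue :: "'r \<Rightarrow> 'k" where
  "residue r = (THE a. a \<in> carrier K \<and> r \<ominus>\<^bsub>R\<^esub> (a \<odot>\<^bsub>R\<^esub> \<one>\<^bsub>R\<^esub>) \<in> \<mm>)"

definition ext :: "('k, 'v, 'z) module_scheme \<Rightarrow> ('k, ('v \<times> 'r \<Rightarrow> 'k) set) module" where
  "ext V = tensor K V R"

definition ext_smult :: "('k, 'v, 'z) module_scheme \<Rightarrow> 'r \<Rightarrow> ('v \<times> 'r \<Rightarrow> 'k) set \<Rightarrow> ('v \<times> 'r \<Rightarrow> 'k) set" where
  "ext_smult V r = tensor_lift K (ext V) (\<lambda>(v, s). pure_tensor K V R v (r \<otimes>\<^bsub>R\<^esub> s))"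

definition ext_mult ::
  "('k, 'v, 'z) module_scheme \<Rightarrow> ('v \<times> 'r \<Rightarrow> 'k) set \<Rightarrow> ('v \<times> 'r \<Rightarrow> 'k) set \<Rightarrow> ('v \<times> 'r \<Rightarrow> 'k) set" where
  "ext_mult V t t' = tensor_lift K (ext V)
    (\<lambda>(v, r). tensor_lift K (ext V) (\<lambda>(w, s). pure_tensor K V R (v \<otimes>\<^bsub>V\<^esub> w) (r \<otimes>\<^bsub>R\<^esub> s)) t') t"

text \<open>The image of \<open>V \<otimes> \<mm>\<^sup>n\<close> in \<open>V \<otimes> R\<close>.\<close>

definition filt :: "('k, 'v, 'z) module_scheme \<Rightarrow> nat \<Rightarrow> ('v \<times> 'r \<Rightarrow> 'k) set set" where
  "filt V n = lin_span K (ext V)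
    {pure_tensor K V R v r | v r. v \<in> carrier V \<and> r \<in> \<mm> [^]\<^bsub>ideals_set R\<^esub> n}"

text \<open>The inverse limit of the quotients of \<open>V \<otimes> R\<close> by \<open>V \<otimes> \<mm>\<^sup>n\<close>, as an \<open>R\<close>-module. The transition
  maps send a coset of \<open>V \<otimes> \<mm>\<^sup>n\<^sup>+\<^sup>1\<close> to the coset of \<open>V \<otimes> \<mm>\<^sup>n\<close> containing it.\<close>

definition hat :: "('k, 'v, 'z) module_scheme \<Rightarrow> ('r, ('v, 'r, 'k) hat) module" where
  "hat V = \<lparr>carrier = {x. \<forall>n. x n \<in> carrier (quotient_module (ext V) (filt V n)) \<and> x (Suc n) \<subseteq> x n},
    monoid.mult = undefined, monoid.one = undefined, ring.zero = (\<lambda>n. filt V n),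
    ring.add = (\<lambda>x y n. x n <+>\<^bsub>ext V\<^esub> y n),
    smult = (\<lambda>r x n. \<Union>t \<in> x n. filt V n +>\<^bsub>ext V\<^esub> ext_smult V r t)\<rparr>"

definition hat_over_field :: "('k, 'v, 'z) module_scheme \<Rightarrow> ('k, ('v, 'r, 'k) hat) module" where
  "hat_over_field V = \<lparr>carrier = carrier (hat V), monoid.mult = undefined, monoid.one = undefined,
    ring.zero = \<zero>\<^bsub>hat V\<^esub>, ring.add = ring.add (hat V), smult = (\<lambda>a x. (a \<odot>\<^bsub>R\<^esub> \<one>\<^bsub>R\<^esub>) \<odot>\<^bsub>hat V\<^esub> x)\<rparr>"

definition incl :: "('k, 'v, 'z) module_scheme \<Rightarrow> 'v \<Rightarrow> ('v, 'r, 'k) hat" where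
  "incl V v = (\<lambda>n. filt V n +>\<^bsub>ext V\<^esub> pure_tensor K V R v \<one>\<^bsub>R\<^esub>)"

definition hat_mult ::
  "('k, 'v, 'z) module_scheme \<Rightarrow> ('v, 'r, 'k) hat \<Rightarrow> ('v, 'r, 'k) hat \<Rightarrow> ('v, 'r, 'k) hat" where
  "hat_mult V x y = (\<lambda>n. \<Union>t \<in> x n. \<Union>t' \<in> y n. filt V n +>\<^bsub>ext V\<^esub> ext_mult V t t')"

text \<open>The canonical projection to \<open>V\<close>, induced by the residue map, and its kernel.\<close>

definition reduction :: "('k, 'v, 'z) module_scheme \<Rightarrow> ('v, 'r, 'k) hat \<Rightarrow> 'v" where
  "reduction V x = tensor_lift K V (\<lambda>(v, r). residue r \<odot>\<^bsub>V\<^esub> v) (SOME t. t \<in> x 1)"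

definition hat_max :: "('k, 'v, 'z) module_scheme \<Rightarrow> ('v, 'r, 'k) hat set" where
  "hat_max V = {x \<in> carrier (hat V). reduction V x = \<zero>\<^bsub>V\<^esub>}"

definition hat_component :: "('k, 'v, 'z) graded_module_scheme \<Rightarrow> int \<Rightarrow> ('v, 'r, 'k) hat set" where
  "hat_component V i = {x \<in> carrier (hat V). \<forall>n.
    \<exists>t \<in> lin_span K (ext V) {pure_tensor K V R v r | v r. v \<in> component V i \<and> r \<in> carrier R}.
      x n = filt V n +>\<^bsub>ext V\<^esub> t}"

text \<open>Continuity refers to the inverse limit topologies, in which the sets \<open>{y. y n = x n}\<close>
  form a neighbourhood basis of \<open>x\<close>.\<close>

definition lin_maps ::
  "('k, 'v, 'z) graded_module_scheme \<Rightarrow> ('k, 'w, 'u) graded_module_scheme \<Rightarrow> int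
    \<Rightarrow> (('v, 'r, 'k) hat \<Rightarrow> ('w, 'r, 'k) hat) set" where
  "lin_maps V W d = {f \<in> carrier (hat V) \<rightarrow>\<^sub>E carrier (hat W).
    linear_map R (hat V) (hat W) f \<and>
    (\<forall>x \<in> carrier (hat V). \<forall>n. \<exists>N. \<forall>y \<in> carrier (hat V). y N = x N \<longrightarrow> f y n = f x n) \<and>
    (\<forall>i. f ` hat_component V i \<subseteq> hat_component W (i + d))}"

text \<open>The degree 0 continuous \<open>R\<close>-linear extension of a map from \<open>V\<close> to the completion of
  \<open>W \<otimes> R\<close>.\<close>

definition hat_extend ::
  "('k, 'v, 'z) graded_module_scheme \<Rightarrow> ('k, 'w, 'u) graded_module_scheme
    \<Rightarrow> ('v \<Rightarrow> ('w, 'r, 'k) hat) \<Rightarrow> ('v, 'r, 'k) hat \<Rightarrow> ('w, 'r, 'k) hat" where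
  "hat_extend V W c = (THE f. f \<in> lin_maps V W 0 \<and> (\<forall>v \<in> carrier V. f (incl V v) = c v))"

definition hat_sum ::
  "('k, 'v, 'z) module_scheme \<Rightarrow> (nat \<Rightarrow> ('v, 'r, 'k) hat) \<Rightarrow> ('v, 'r, 'k) hat" where
  "hat_sum V a = (THE x. x \<in> carrier (hat V) \<and>
    (\<forall>n. \<exists>N. \<forall>k \<ge> N. (\<Oplus>\<^bsub>hat V\<^esub>i \<in> {..<k}. a i) n = x n))"


section \<open>The convolution algebra\<close>

definition conv_unit ::
  "('k, 'v, 'z) graded_bimodule_scheme \<Rightarrow> ('k, 'w, 'u) graded_bimodule_scheme
    \<Rightarrow> ('v, 'r, 'k) hat \<Rightarrow> ('w, 'r, 'k) hat" where
  "conv_unit V W = hat_extend V W (\<lambda>v. incl W (counit V v \<odot>\<^bsub>W\<^esub> \<one>\<^bsub>W\<^esub>))"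

definition conv ::
  "('k, 'v, 'z) graded_bimodule_scheme \<Rightarrow> ('k, 'w, 'u) graded_bimodule_scheme
    \<Rightarrow> (('v, 'r, 'k) hat \<Rightarrow> ('w, 'r, 'k) hat) \<Rightarrow> (('v, 'r, 'k) hat \<Rightarrow> ('w, 'r, 'k) hat)
    \<Rightarrow> ('v, 'r, 'k) hat \<Rightarrow> ('w, 'r, 'k) hat" where
  "conv V W f g = hat_extend V W (\<lambda>v. tensor_lift K (hat_over_field W)
    (\<lambda>vs. hat_mult W (f (incl V (vs ! 0))) (g (incl V (vs ! 1)))) (comult V v))"

primrec conv_pow ::
  "('k, 'v, 'z) graded_bimodule_scheme \<Rightarrow> ('k, 'w, 'u) graded_bimodule_scheme
    \<Rightarrow> (('v, 'r, 'k) hat \<Rightarrow> ('w, 'r, 'k) hat) \<Rightarrow> nat \<Rightarrow> ('v, 'r, 'k) hat \<Rightarrow> ('w, 'r, 'k) hat" where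
  "conv_pow V W f 0 = conv_unit V W"
| "conv_pow V W f (Suc n) = conv V W f (conv_pow V W f n)"

definition lin0 ::
  "('k, 'v, 'z) graded_bimodule_scheme \<Rightarrow> ('k, 'w, 'u) graded_bimodule_scheme
    \<Rightarrow> (('v, 'r, 'k) hat \<Rightarrow> ('w, 'r, 'k) hat) set" where
  "lin0 V W = {f \<in> lin_maps V W 0. \<forall>a \<in> carrier K. f (incl V (a \<odot>\<^bsub>V\<^esub> \<one>\<^bsub>V\<^esub>)) \<in> hat_max W}"

definition conv_exp ::
  "('k, 'v, 'z) graded_bimodule_scheme \<Rightarrow> ('k, 'w, 'u) graded_bimodule_scheme
    \<Rightarrow> (('v, 'r, 'k) hat \<Rightarrow> ('w, 'r, 'k) hat) \<Rightarrow> ('v, 'r, 'k) hat \<Rightarrow> ('w, 'r, 'k) hat" where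
  "conv_exp V W f = (\<lambda>x \<in> carrier (hat V). hat_sum W (\<lambda>n.
    inv\<^bsub>K\<^esub> (add_pow K (fact n :: nat) \<one>\<^bsub>K\<^esub>) \<odot>\<^bsub>hat_over_field W\<^esub> conv_pow V W f n x))"

text \<open>\<open>conv_log V W \<phi>\<close> is the logarithm of \<open>\<phi> = \<e> + g\<close>, a series in the convolution powers of
  \<open>g = \<phi> - \<e>\<close>, where \<open>\<e>\<close> is the convolution unit.\<close>

definition conv_log ::
  "('k, 'v, 'z) graded_bimodule_scheme \<Rightarrow> ('k, 'w, 'u) graded_bimodule_scheme
    \<Rightarrow> (('v, 'r, 'k) hat \<Rightarrow> ('w, 'r, 'k) hat) \<Rightarrow> ('v, 'r, 'k) hat \<Rightarrow> ('w, 'r, 'k) hat" where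
  "conv_log V W \<phi> = (let g = (\<lambda>x \<in> carrier (hat V). \<phi> x \<ominus>\<^bsub>hat W\<^esub> conv_unit V W x) in
    (\<lambda>x \<in> carrier (hat V). hat_sum W (\<lambda>n.
      ((\<ominus>\<^bsub>K\<^esub> \<one>\<^bsub>K\<^esub>) [^]\<^bsub>K\<^esub> n \<otimes>\<^bsub>K\<^esub> inv\<^bsub>K\<^esub> (add_pow K (Suc n) \<one>\<^bsub>K\<^esub>))
        \<odot>\<^bsub>hat_over_field W\<^esub> conv_pow V W g (Suc n) x)))"


section \<open>The two categories\<close>

text \<open>The objects are all structures whose underlying set is contained in the type \<open>'v\<close>.\<close>

definition is_mv_algebra :: "('k, 'v, 'r) mv_algebra \<Rightarrow> bool" where
  "is_mv_algebra V \<longleftrightarrow> graded_comm_algebra K V \<and> graded_cocomm_coalgebra K V \<and>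
    coaugmented K V \<and> augmented K V \<and> conilpotent K V \<and>
    mv_diff V \<in> lin_maps V V 1 \<and>
    (\<forall>x \<in> carrier (hat V). mv_diff V (mv_diff V x) = \<zero>\<^bsub>hat V\<^esub>) \<and>
    mv_diff V (incl V \<one>\<^bsub>V\<^esub>) = \<zero>\<^bsub>hat V\<^esub>"

definition MV :: "(('k, 'v, 'r) mv_algebra, ('v, 'r, 'k) hat \<Rightarrow> ('v, 'r, 'k) hat) cat" where
  "MV = \<lparr>Obj = {V. is_mv_algebra V},
    Mor = (\<lambda>V W. {f \<in> lin0 V W.
      compose (carrier (hat V)) (mv_diff W) (conv_exp V W f)
        = compose (carrier (hat V)) (conv_exp V W f) (mv_diff V)}),
    Cmp = (\<lambda>U V W g f. conv_log U W (compose (carrier (hat U)) (conv_exp V W g) (conv_exp U V f))),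
    Idt = (\<lambda>V. conv_log V V (\<lambda>x \<in> carrier (hat V). x))\<rparr>"

text \<open>As a map of graded vector spaces, the point has degree 0, the ground field being
  concentrated in degree 0.\<close>

definition is_pointed_complex :: "('k, 'v, 'r) pointed_complex \<Rightarrow> bool" where
  "is_pointed_complex V \<longleftrightarrow> graded_vector_space K V \<and>
    pc_diff V \<in> lin_maps V V 1 \<and>
    (\<forall>x \<in> carrier (hat V). pc_diff V (pc_diff V x) = \<zero>\<^bsub>hat V\<^esub>) \<and>
    linear_map K (self_module K) V (pc_point V) \<and> inj_on (pc_point V) (carrier K) \<and>
    (\<forall>a \<in> carrier K. pc_point V a \<in> component V 0) \<and>
    (\<forall>a \<in> carrier K. pc_diff V (incl V (pc_point V a)) = \<zero>\<^bsub>hat V\<^esub>)"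

definition Chn :: "(('k, 'v, 'r) pointed_complex, ('v, 'r, 'k) hat \<Rightarrow> ('v, 'r, 'k) hat) cat" where
  "Chn = \<lparr>Obj = {V. is_pointed_complex V},
    Mor = (\<lambda>V W. {\<phi> \<in> lin_maps V W 0.
      compose (carrier (hat V)) (pc_diff W) \<phi> = compose (carrier (hat V)) \<phi> (pc_diff V) \<and>
      (\<forall>a \<in> carrier K. \<phi> (incl V (pc_point V a)) \<ominus>\<^bsub>hat W\<^esub> incl W (pc_point W a) \<in> hat_max W)}),
    Cmp = (\<lambda>U V W g f. compose (carrier (hat U)) g f),
    Idt = (\<lambda>V. (\<lambda>x \<in> carrier (hat V). x))\<rparr>"

end

end

theory Submission
  imports Defs "HOL-Computational_Algebra.Polynomial_FPS"
begin

text \<open>The equivalence sends an MV-algebra \<open>V\<close> to the complex that underlies it, pointed by the unit,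
  and a morphism \<open>f\<close> to \<open>exp f\<close>. Composition and identities of MV-algebras are those of maps,
  conjugated by \<open>exp\<close> and \<open>log\<close>, and compatibility with the differentials is a condition on \<open>exp f\<close>
  that is the same on both sides. Hence the functor is fully faithful as soon as \<open>exp\<close> and \<open>log\<close> are
  mutually inverse bijections between the maps that are \<open>0\<close> on the unit modulo the maximal ideal and
  the maps that preserve the unit modulo the maximal ideal
  (\<open>conv_exp_pointed\<close>, \<open>conv_log_exp\<close>, \<open>conv_log_lin0\<close>, \<open>conv_exp_log\<close>).

  Continuous \<open>R\<close>-linear maps on the completion of \<open>V \<otimes> R\<close> correspond to linear maps on \<open>V\<close>, and
  convolution is computed in the algebra of the latter, which is associative and unital
  (\<open>K_algebra_conv\<close>). Convergence of power series in \<open>c\<close> rests on \<open>locally_nilpotent\<close>: split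
  \<open>c = s + g\<close>, where \<open>s\<close> is the counit times \<open>c(1)\<close> and \<open>g(1) = 0\<close>, and expand a high power of \<open>c\<close>.
  Words with many factors \<open>s\<close> take values in a high power of the maximal ideal, since \<open>c(1)\<close> is in the
  maximal ideal; words with many factors \<open>g\<close> factor through a high iterate of the reduced coproduct,
  which kills any given vector by conilpotence. So each value, at each level, of a power series in
  \<open>c\<close> is that of a polynomial in \<open>c\<close>; therefore substitution of formal power series is respected
  (\<open>series_compose\<close>), and the identities \<open>log (exp x) = x\<close> and \<open>exp (log (1 + x)) = 1 + x\<close> of rational
  power series carry over.

  For essential surjectivity, choose a graded complement of the line spanned by the point of a given
  complex, declare the point to be the unit, and let all products on the complement vanish and all its
  elements be primitive. The result is an MV-algebra (\<open>trivial_algebra\<close>, \<open>trivial_coalgebra\<close>,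
  \<open>trivial_conilpotent\<close>), and the identity map is an isomorphism from its underlying complex to the
  given one. The formal part of the argument
  is \<open>equivalent_categories_by_transport\<close>.\<close>


section \<open>Fully faithful and essentially surjective functors\<close>

text \<open>The category axioms for \<open>C\<close> are a conclusion: they are transported from \<open>D\<close> along the
  injections \<open>E a b\<close>, so that they need not be verified for the composition of \<open>C\<close>, which is
  typically given by conjugation with \<open>E\<close>.\<close>

lemma equivalent_categories_by_transport:
  fixes C :: "('o, 'm) cat" and D :: "('p, 'n) cat"
  assumes D: "category D"
    and Fo: "\<And>a. a \<in> Obj C \<Longrightarrow> Fo a \<in> Obj D"
    and E: "\<And>a b. a \<in> Obj C \<Longrightarrow> b \<in> Obj C \<Longrightarrow> bij_betw (E a b) (Mor C a b) (Mor D (Fo a) (Fo b))"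
    and Idt: "\<And>a. a \<in> Obj C \<Longrightarrow> Idt C a \<in> Mor C a a \<and> E a a (Idt C a) = Idt D (Fo a)"
    and Cmp: "\<And>a b c f g. a \<in> Obj C \<Longrightarrow> b \<in> Obj C \<Longrightarrow> c \<in> Obj C \<Longrightarrow> f \<in> Mor C a b \<Longrightarrow> g \<in> Mor C b c
      \<Longrightarrow> Cmp C a b c g f \<in> Mor C a c \<and>
        E a c (Cmp C a b c g f) = Cmp D (Fo a) (Fo b) (Fo c) (E b c g) (E a b f)"
    and Go: "\<And>b. b \<in> Obj D \<Longrightarrow> Go b \<in> Obj C"
    and \<beta>: "\<And>b. b \<in> Obj D \<Longrightarrow> is_iso D (Fo (Go b)) b (\<beta> b)"
  shows "equivalent_categories C D"
proof -
  interpret D: category D by (rule D)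
  have Em: "E a b f \<in> Mor D (Fo a) (Fo b)" if "a \<in> Obj C" "b \<in> Obj C" "f \<in> Mor C a b" for a b f
    using E[OF that(1,2)] that(3) by (auto simp: bij_betw_def)
  have Einj: "f = g" if "a \<in> Obj C" "b \<in> Obj C" "f \<in> Mor C a b" "g \<in> Mor C a b" "E a b f = E a b g"
    for a b f g
    using E[OF that(1,2)] that(3-) by (auto simp: bij_betw_def inj_on_def)
  interpret C: category C
  proof
    fix a b c d f g h
    assume *: "a \<in> Obj C" "b \<in> Obj C" "c \<in> Obj C" "d \<in> Obj C"
      "f \<in> Mor C a b" "g \<in> Mor C b c" "h \<in> Mor C c d"
    show "Cmp C a b d (Cmp C b c d h g) f = Cmp C a c d h (Cmp C a b c g f)"
      by (rule Einj[of a d]) (use * in \<open>simp_all add: Cmp Em Fo D.Cmp_assoc\<close>)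
  next
    fix a b f assume *: "a \<in> Obj C" "b \<in> Obj C" "f \<in> Mor C a b"
    show "Cmp C a a b f (Idt C a) = f"
      by (rule Einj[of a b]) (use * in \<open>simp_all add: Cmp Idt Em Fo D.Cmp_Idt\<close>)
    show "Cmp C a b b (Idt C b) f = f"
      by (rule Einj[of a b]) (use * in \<open>simp_all add: Cmp Idt Em Fo D.Idt_Cmp\<close>)
  qed (use Idt Cmp in auto)
  define L where "L a b = inv_into (Mor C a b) (E a b)" for a b
  have L: "L a b \<phi> \<in> Mor C a b" "E a b (L a b \<phi>) = \<phi>"
    if "a \<in> Obj C" "b \<in> Obj C" "\<phi> \<in> Mor D (Fo a) (Fo b)" for a b \<phi>
    using E[OF that(1,2)] that(3) unfolding L_def bij_betw_def
    by (auto intro: inv_into_into f_inv_into_f)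
  have \<beta>m: "\<beta> b \<in> Mor D (Fo (Go b)) b" if "b \<in> Obj D" for b
    using \<beta>[OF that] by (simp add: is_iso_def)
  have "\<forall>b \<in> Obj D. \<exists>\<gamma>. \<gamma> \<in> Mor D b (Fo (Go b)) \<and>
      Cmp D (Fo (Go b)) b (Fo (Go b)) \<gamma> (\<beta> b) = Idt D (Fo (Go b)) \<and>
      Cmp D b (Fo (Go b)) b (\<beta> b) \<gamma> = Idt D b"
    using \<beta> by (auto simp: is_iso_def)
  then obtain \<gamma> where \<gamma>m: "\<And>b. b \<in> Obj D \<Longrightarrow> \<gamma> b \<in> Mor D b (Fo (Go b))"
    and \<gamma>\<beta>: "\<And>b. b \<in> Obj D \<Longrightarrow> Cmp D (Fo (Go b)) b (Fo (Go b)) (\<gamma> b) (\<beta> b) = Idt D (Fo (Go b))"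
    and \<beta>\<gamma>: "\<And>b. b \<in> Obj D \<Longrightarrow> Cmp D b (Fo (Go b)) b (\<beta> b) (\<gamma> b) = Idt D b"
    by metis
  \<comment> \<open>Conjugation by the isomorphisms \<open>\<beta>\<close> turns arrows of \<open>D\<close> into arrows between objects of the
    image of \<open>Fo\<close>, where the inverse of \<open>E\<close> applies; this makes \<open>Go\<close> a functor.\<close>
  define conj where "conj b c \<phi> =
    Cmp D (Fo (Go b)) c (Fo (Go c)) (\<gamma> c) (Cmp D (Fo (Go b)) b c \<phi> (\<beta> b))" for b c \<phi>
  have conjm: "conj b c \<phi> \<in> Mor D (Fo (Go b)) (Fo (Go c))"
    if "b \<in> Obj D" "c \<in> Obj D" "\<phi> \<in> Mor D b c" for b c \<phi>
    unfolding conj_def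
    by (rule D.Cmp_mem[of _ c] D.Cmp_mem[of _ b] | use that in \<open>simp add: \<beta>m \<gamma>m Fo Go\<close>)+
  have \<beta>conj: "Cmp D (Fo (Go b)) (Fo (Go c)) c (\<beta> c) (conj b c \<phi>) = Cmp D (Fo (Go b)) b c \<phi> (\<beta> b)"
    if "b \<in> Obj D" "c \<in> Obj D" "\<phi> \<in> Mor D b c" for b c \<phi>
  proof -
    have m: "Cmp D (Fo (Go b)) b c \<phi> (\<beta> b) \<in> Mor D (Fo (Go b)) c"
      by (rule D.Cmp_mem) (use that in \<open>simp_all add: \<beta>m Fo Go\<close>)
    show ?thesis
      unfolding conj_def using that m
      by (subst D.Cmp_assoc[symmetric]) (simp_all add: \<beta>m \<gamma>m Fo Go \<beta>\<gamma> D.Idt_Cmp)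
  qed
  have conj\<gamma>: "Cmp D b (Fo (Go b)) (Fo (Go c)) (conj b c \<phi>) (\<gamma> b) = Cmp D b c (Fo (Go c)) (\<gamma> c) \<phi>"
    if "b \<in> Obj D" "c \<in> Obj D" "\<phi> \<in> Mor D b c" for b c \<phi>
  proof -
    have m: "Cmp D (Fo (Go b)) b c \<phi> (\<beta> b) \<in> Mor D (Fo (Go b)) c"
      by (rule D.Cmp_mem) (use that in \<open>simp_all add: \<beta>m Fo Go\<close>)
    have "Cmp D b (Fo (Go b)) c (Cmp D (Fo (Go b)) b c \<phi> (\<beta> b)) (\<gamma> b) = \<phi>"
      using that by (simp add: D.Cmp_assoc \<beta>m \<gamma>m Fo Go \<beta>\<gamma> D.Cmp_Idt)
    then show ?thesis
      unfolding conj_def using that m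
      by (subst D.Cmp_assoc) (simp_all add: \<beta>m \<gamma>m Fo Go)
  qed
  have conj_Idt: "conj b b (Idt D b) = Idt D (Fo (Go b))" if "b \<in> Obj D" for b
    using that by (simp add: conj_def D.Idt_Cmp \<beta>m Fo Go \<gamma>\<beta>)
  have conj_Cmp: "conj b d (Cmp D b c d \<psi> \<phi>) =
      Cmp D (Fo (Go b)) (Fo (Go c)) (Fo (Go d)) (conj c d \<psi>) (conj b c \<phi>)"
    if "b \<in> Obj D" "c \<in> Obj D" "d \<in> Obj D" "\<phi> \<in> Mor D b c" "\<psi> \<in> Mor D c d" for b c d \<phi> \<psi>
  proof -
    have m: "Cmp D (Fo (Go c)) c d \<psi> (\<beta> c) \<in> Mor D (Fo (Go c)) d"
      by (rule D.Cmp_mem) (use that in \<open>simp_all add: \<beta>m Fo Go\<close>)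
    have m': "Cmp D (Fo (Go b)) b c \<phi> (\<beta> b) \<in> Mor D (Fo (Go b)) c"
      by (rule D.Cmp_mem) (use that in \<open>simp_all add: \<beta>m Fo Go\<close>)
    have "Cmp D (Fo (Go b)) (Fo (Go c)) (Fo (Go d)) (conj c d \<psi>) (conj b c \<phi>)
      = Cmp D (Fo (Go b)) d (Fo (Go d)) (\<gamma> d)
          (Cmp D (Fo (Go b)) c d \<psi> (Cmp D (Fo (Go b)) (Fo (Go c)) c (\<beta> c) (conj b c \<phi>)))"
      using that conjm[of b c \<phi>] m unfolding conj_def[of c d]
      by (simp add: D.Cmp_assoc \<beta>m \<gamma>m Fo Go)
    also have "\<dots> = conj b d (Cmp D b c d \<psi> \<phi>)"
      using that by (simp add: \<beta>conj conj_def[of b d] D.Cmp_assoc \<beta>m Fo Go)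
    finally show ?thesis by simp
  qed
  define Gm where "Gm b c \<phi> = L (Go b) (Go c) (conj b c \<phi>)" for b c \<phi>
  define \<alpha> where "\<alpha> a = L a (Go (Fo a)) (\<gamma> (Fo a))" for a
  have F: "cat_functor C D Fo E"
    by unfold_locales (use Fo Em Idt Cmp in auto)
  have Gm: "Gm b c \<phi> \<in> Mor C (Go b) (Go c)" "E (Go b) (Go c) (Gm b c \<phi>) = conj b c \<phi>"
    if "b \<in> Obj D" "c \<in> Obj D" "\<phi> \<in> Mor D b c" for b c \<phi>
    unfolding Gm_def using L conjm that Go by auto
  have G: "cat_functor D C Go Gm"
  proof
    fix b assume b: "b \<in> Obj D"
    show "Gm b b (Idt D b) = Idt C (Go b)"
      by (rule Einj[of "Go b" "Go b"]) (use b in \<open>simp_all add: Go Gm D.Idt_mem Idt conj_Idt\<close>)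
  next
    fix b c d \<phi> \<psi> assume *: "b \<in> Obj D" "c \<in> Obj D" "d \<in> Obj D" "\<phi> \<in> Mor D b c" "\<psi> \<in> Mor D c d"
    then have "Cmp D b c d \<psi> \<phi> \<in> Mor D b d" by (simp add: D.Cmp_mem)
    then show "Gm b d (Cmp D b c d \<psi> \<phi>) = Cmp C (Go b) (Go c) (Go d) (Gm c d \<psi>) (Gm b c \<phi>)"
      by (intro Einj[of "Go b" "Go d"]) (use * in \<open>simp_all add: Go Gm Cmp conj_Cmp\<close>)
  qed (use Go Gm in auto)
  have idC: "cat_functor C C (\<lambda>a. a) (\<lambda>a b f. f)" and idD: "cat_functor D D (\<lambda>a. a) (\<lambda>a b f. f)"
    by (unfold_locales; simp)+
  have GF: "cat_functor C C (Go \<circ> Fo) (\<lambda>a b f. Gm (Fo a) (Fo b) (E a b f))"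
    by unfold_locales
      (use Fo Go Em in \<open>auto simp: Gm(1) cat_functor.Fm_Idt[OF F] cat_functor.Fm_Idt[OF G]
        cat_functor.Fm_Cmp[OF F] cat_functor.Fm_Cmp[OF G]\<close>)
  have FG: "cat_functor D D (Fo \<circ> Go) (\<lambda>a b f. E (Go a) (Go b) (Gm a b f))"
    by unfold_locales
      (use Fo Go in \<open>auto simp: Gm(1) Em cat_functor.Fm_Idt[OF F] cat_functor.Fm_Idt[OF G]
        cat_functor.Fm_Cmp[OF F] cat_functor.Fm_Cmp[OF G]\<close>)
  have \<alpha>: "\<alpha> a \<in> Mor C a (Go (Fo a))" "E a (Go (Fo a)) (\<alpha> a) = \<gamma> (Fo a)" if "a \<in> Obj C" for a
    unfolding \<alpha>_def using that L Go Fo \<gamma>m by auto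
  have \<alpha>_iso: "is_iso C a (Go (Fo a)) (\<alpha> a)" if a: "a \<in> Obj C" for a
  proof -
    let ?g = "L (Go (Fo a)) a (\<beta> (Fo a))"
    have g: "?g \<in> Mor C (Go (Fo a)) a" "E (Go (Fo a)) a ?g = \<beta> (Fo a)"
      using a L Go Fo \<beta>m by auto
    have "Cmp C a (Go (Fo a)) a ?g (\<alpha> a) = Idt C a"
      by (rule Einj[of a a]) (use a g in \<open>simp_all add: Fo Go Cmp \<alpha> Idt \<beta>\<gamma>\<close>)
    moreover have "Cmp C (Go (Fo a)) a (Go (Fo a)) (\<alpha> a) ?g = Idt C (Go (Fo a))"
      by (rule Einj[of "Go (Fo a)" "Go (Fo a)"]) (use a g in \<open>simp_all add: Fo Go Cmp \<alpha> Idt \<gamma>\<beta>\<close>)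
    ultimately show ?thesis using g \<alpha> a by (auto simp: is_iso_def)
  qed
  have "natural_isomorphism C C (\<lambda>a. a) (\<lambda>a b f. f) (Go \<circ> Fo)
      (\<lambda>a b f. Gm (Fo a) (Fo b) (E a b f)) \<alpha>"
  proof (intro natural_isomorphism.intro idC GF natural_isomorphism_axioms.intro)
    fix a b f assume *: "a \<in> Obj C" "b \<in> Obj C" "f \<in> Mor C a b"
    have "Cmp C a b (Go (Fo b)) (\<alpha> b) f =
        Cmp C a (Go (Fo a)) (Go (Fo b)) (Gm (Fo a) (Fo b) (E a b f)) (\<alpha> a)"
      by (rule Einj[of a "Go (Fo b)"]) (use * in \<open>simp_all add: Fo Go Cmp \<alpha> Em Gm conj\<gamma>\<close>)
    then show "Cmp C a b ((Go \<circ> Fo) b) (\<alpha> b) f =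
        Cmp C a ((Go \<circ> Fo) a) ((Go \<circ> Fo) b) (Gm (Fo a) (Fo b) (E a b f)) (\<alpha> a)"
      by simp
  qed (use \<alpha>_iso in auto)
  moreover have "natural_isomorphism D D (Fo \<circ> Go) (\<lambda>a b f. E (Go a) (Go b) (Gm a b f))
      (\<lambda>a. a) (\<lambda>a b f. f) \<beta>"
    by (intro natural_isomorphism.intro idD FG natural_isomorphism_axioms.intro)
      (use \<beta> in \<open>auto simp: Gm \<beta>conj\<close>)
  ultimately show ?thesis
    unfolding equivalent_categories_def using C.category_axioms D F G by blast
qed

section \<open>Linear maps, spans and quotients\<close>

lemma (in abelian_group) minus_eq_zero_iff:
  assumes "x \<in> carrier G" "y \<in> carrier G"
  shows "x \<ominus> y = \<zero> \<longleftrightarrow> x = y"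
  using assms minus_equality[of x "\<ominus> y"] by (auto simp: a_minus_def r_neg)

lemma linear_mapI:
  assumes "\<And>x. x \<in> carrier M \<Longrightarrow> f x \<in> carrier N"
    and "\<And>x y. x \<in> carrier M \<Longrightarrow> y \<in> carrier M \<Longrightarrow> f (x \<oplus>\<^bsub>M\<^esub> y) = f x \<oplus>\<^bsub>N\<^esub> f y"
    and "\<And>a x. a \<in> carrier K \<Longrightarrow> x \<in> carrier M \<Longrightarrow> f (a \<odot>\<^bsub>M\<^esub> x) = a \<odot>\<^bsub>N\<^esub> f x"
  shows "linear_map K M N f"
  using assms by (auto simp: linear_map_def)

lemma linear_map_closed: "linear_map K M N f \<Longrightarrow> x \<in> carrier M \<Longrightarrow> f x \<in> carrier N"
  and linear_map_add: "linear_map K M N f \<Longrightarrow> x \<in> carrier M \<Longrightarrow> y \<in> carrier M \<Longrightarrow>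
    f (x \<oplus>\<^bsub>M\<^esub> y) = f x \<oplus>\<^bsub>N\<^esub> f y"
  and linear_map_smult: "linear_map K M N f \<Longrightarrow> a \<in> carrier K \<Longrightarrow> x \<in> carrier M \<Longrightarrow>
    f (a \<odot>\<^bsub>M\<^esub> x) = a \<odot>\<^bsub>N\<^esub> f x"
  by (auto simp: linear_map_def)

lemma linear_map_zero:
  assumes "module K M" "module K N" "linear_map K M N f"
  shows "f \<zero>\<^bsub>M\<^esub> = \<zero>\<^bsub>N\<^esub>"
proof -
  interpret M: module K M by fact
  interpret N: module K N by fact
  have "f (\<zero>\<^bsub>K\<^esub> \<odot>\<^bsub>M\<^esub> \<zero>\<^bsub>M\<^esub>) = \<zero>\<^bsub>K\<^esub> \<odot>\<^bsub>N\<^esub> f \<zero>\<^bsub>M\<^esub>"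
    using assms by (intro linear_map_smult) auto
  then show ?thesis using linear_map_closed[OF assms(3), of "\<zero>\<^bsub>M\<^esub>"] by simp
qed

lemma linear_map_neg:
  assumes "module K M" "module K N" "linear_map K M N f" "x \<in> carrier M"
  shows "f (\<ominus>\<^bsub>M\<^esub> x) = \<ominus>\<^bsub>N\<^esub> f x"
proof -
  interpret M: module K M by fact
  interpret N: module K N by fact
  have "f (\<ominus>\<^bsub>M\<^esub> x) \<oplus>\<^bsub>N\<^esub> f x = f (\<ominus>\<^bsub>M\<^esub> x \<oplus>\<^bsub>M\<^esub> x)"
    using assms by (simp add: linear_map_add)
  then show ?thesis using assms linear_map_closed[OF assms(3)]
    by (simp add: M.l_neg linear_map_zero[OF assms(1-3)] N.minus_equality)
qed

lemma linear_map_minus: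
  assumes "module K M" "module K N" "linear_map K M N f" "x \<in> carrier M" "y \<in> carrier M"
  shows "f (x \<ominus>\<^bsub>M\<^esub> y) = f x \<ominus>\<^bsub>N\<^esub> f y"
proof -
  interpret M: module K M by fact
  show ?thesis
    using assms by (simp add: a_minus_def linear_map_add linear_map_neg)
qed

lemma linear_map_comp:
  assumes "linear_map K M N f" "linear_map K N P g"
  shows "linear_map K M P (\<lambda>x. g (f x))"
  using assms by (auto simp: linear_map_def Pi_iff)

lemma linear_map_cong:
  assumes "module K M" "linear_map K M N f" "\<And>x. x \<in> carrier M \<Longrightarrow> f x = g x"
  shows "linear_map K M N g"
proof -
  interpret M: module K M by fact
  show ?thesis using assms(2,3) by (auto simp: linear_map_def Pi_iff)
qed

lemma linear_map_sum:
  assumes "module K M" "module K N" "linear_map K M N f" "linear_map K M N g"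
  shows "linear_map K M N (\<lambda>x. f x \<oplus>\<^bsub>N\<^esub> g x)"
proof -
  interpret M: module K M by fact
  interpret N: module K N by fact
  note cl = linear_map_closed[OF assms(3)] linear_map_closed[OF assms(4)]
  show ?thesis
    by (rule linear_mapI)
      (use assms cl in \<open>simp_all add: linear_map_add linear_map_smult N.smult_r_distr N.a_ac\<close>)
qed

lemma linear_map_scale:
  assumes "module K M" "module K N" "linear_map K M N f" "a \<in> carrier K"
  shows "linear_map K M N (\<lambda>x. a \<odot>\<^bsub>N\<^esub> f x)"
proof -
  interpret M: module K M by fact
  interpret N: module K N by fact
  note cl = linear_map_closed[OF assms(3)]
  show ?thesis
    by (rule linear_mapI)
      (use assms cl in \<open>simp_all add: linear_map_add linear_map_smult N.smult_r_distr
        N.smult_assoc1[symmetric] M.R.m_comm\<close>)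
qed

lemma linear_map_const_zero:
  assumes "module K M" "module K N"
  shows "linear_map K M N (\<lambda>x. \<zero>\<^bsub>N\<^esub>)"
proof -
  interpret M: module K M by fact
  interpret N: module K N by fact
  show ?thesis by (rule linear_mapI) auto
qed

lemma submodule_kernel:
  assumes "module K M" "module K N" "linear_map K M N f"
  shows "submodule {x \<in> carrier M. f x = \<zero>\<^bsub>N\<^esub>} K M"
proof -
  interpret M: module K M by fact
  interpret N: module K N by fact
  show ?thesis
    by (rule M.submoduleI)
      (use assms in \<open>auto simp: linear_map_zero linear_map_neg linear_map_add linear_map_smult\<close>)
qed

context
  fixes K :: "('k, 'x) ring_scheme" and M :: "('k, 'a, 'y) module_scheme"
  assumes M: "module K M"
begin

interpretation M: module K M by (rule M)

lemma submodule_lin_span: "S \<subseteq> carrier M \<Longrightarrow> submodule (lin_span K M S) K M"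
proof (rule M.submoduleI)
  assume S: "S \<subseteq> carrier M"
  show "lin_span K M S \<subseteq> carrier M"
    using hull_minimal[of S "carrier M" "\<lambda>N. submodule N K M"] S M.carrier_is_submodule by (simp add: lin_span_def)
  show "\<zero>\<^bsub>M\<^esub> \<in> lin_span K M S"
    using subgroup.one_closed[OF submodule.axioms(1)] by (fastforce simp: lin_span_def hull_def)
qed (auto simp: lin_span_def hull_def M.submoduleE)

lemma lin_span_superset: "x \<in> S \<Longrightarrow> x \<in> lin_span K M S"
  unfolding lin_span_def by (rule hull_inc)

lemma lin_span_minimal: "submodule N K M \<Longrightarrow> S \<subseteq> N \<Longrightarrow> lin_span K M S \<subseteq> N"
  unfolding lin_span_def by (rule hull_minimal)

lemma lin_span_induct [consumes 2, case_names zero gen add smult]: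
  assumes "x \<in> lin_span K M S" "S \<subseteq> carrier M"
    and zero: "P \<zero>\<^bsub>M\<^esub>"
    and gen: "\<And>x. x \<in> S \<Longrightarrow> P x"
    and add: "\<And>x y. x \<in> carrier M \<Longrightarrow> y \<in> carrier M \<Longrightarrow> P x \<Longrightarrow> P y \<Longrightarrow> P (x \<oplus>\<^bsub>M\<^esub> y)"
    and smult: "\<And>a x. a \<in> carrier K \<Longrightarrow> x \<in> carrier M \<Longrightarrow> P x \<Longrightarrow> P (a \<odot>\<^bsub>M\<^esub> x)"
  shows "P x"
proof -
  have "submodule {x \<in> carrier M. P x} K M"
  proof (rule M.submoduleI)
    fix a assume a: "a \<in> {x \<in> carrier M. P x}"
    then have "P ((\<ominus>\<^bsub>K\<^esub> \<one>\<^bsub>K\<^esub>) \<odot>\<^bsub>M\<^esub> a)" by (intro smult) auto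
    then show "\<ominus>\<^bsub>M\<^esub> a \<in> {x \<in> carrier M. P x}" using a by (simp add: M.smult_l_minus)
  qed (use zero add smult in auto)
  from lin_span_minimal[OF this, of S] assms(1,2) gen show ?thesis by auto
qed

lemma linear_map_lin_span_zero:
  assumes "module K N" "linear_map K M N f" "S \<subseteq> carrier M" "\<And>x. x \<in> S \<Longrightarrow> f x = \<zero>\<^bsub>N\<^esub>"
    "x \<in> lin_span K M S"
  shows "f x = \<zero>\<^bsub>N\<^esub>"
  using lin_span_minimal[OF submodule_kernel[OF M assms(1,2)], of S] assms(3-5) by auto

lemma abelian_subgroup_submodule: "submodule N K M \<Longrightarrow> abelian_subgroup N M"
  by (rule abelian_subgroupI3[OF additive_subgroup.intro])
    (auto intro: submodule.axioms(1) M.abelian_group_axioms)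

context
  fixes N assumes N: "submodule N K M"
begin

interpretation N: abelian_subgroup N M by (rule abelian_subgroup_submodule[OF N])

lemma quotient_carrier: "carrier (quotient_module M N) = {N +>\<^bsub>M\<^esub> x | x. x \<in> carrier M}"
  by (auto simp: quotient_module_def A_RCOSETS_def RCOSETS_def a_r_coset_def)

lemma quotient_zero: "\<zero>\<^bsub>quotient_module M N\<^esub> = N" "N +>\<^bsub>M\<^esub> \<zero>\<^bsub>M\<^esub> = N"
  using N.a_subset by (auto simp: quotient_module_def)

lemma quotient_add: "x \<in> carrier M \<Longrightarrow> y \<in> carrier M \<Longrightarrow>
    (N +>\<^bsub>M\<^esub> x) \<oplus>\<^bsub>quotient_module M N\<^esub> (N +>\<^bsub>M\<^esub> y) = N +>\<^bsub>M\<^esub> (x \<oplus>\<^bsub>M\<^esub> y)"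
  by (simp add: quotient_module_def N.a_rcos_sum)

lemma coset_eq_iff: "x \<in> carrier M \<Longrightarrow> y \<in> carrier M \<Longrightarrow>
    N +>\<^bsub>M\<^esub> x = N +>\<^bsub>M\<^esub> y \<longleftrightarrow> x \<ominus>\<^bsub>M\<^esub> y \<in> N"
  using N.a_rcos_module[of y x] N.a_repr_independence'[of x y] N.a_rcos_self
  by (auto simp: a_minus_def)

lemma coset_mem_iff: "x \<in> carrier M \<Longrightarrow> y \<in> carrier M \<Longrightarrow> y \<in> N +>\<^bsub>M\<^esub> x \<longleftrightarrow> N +>\<^bsub>M\<^esub> y = N +>\<^bsub>M\<^esub> x"
  using N.a_repr_independence'[of y x] N.a_rcos_self by auto

lemma coset_self: "x \<in> carrier M \<Longrightarrow> x \<in> N +>\<^bsub>M\<^esub> x"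
  by (rule N.a_rcos_self)

lemma coset_subset: "x \<in> carrier M \<Longrightarrow> N +>\<^bsub>M\<^esub> x \<subseteq> carrier M"
  using M.a_r_coset_subset_G N.a_subset by auto

lemma coset_eq_self_iff: "x \<in> carrier M \<Longrightarrow> N +>\<^bsub>M\<^esub> x = N \<longleftrightarrow> x \<in> N"
  using coset_eq_iff[of x "\<zero>\<^bsub>M\<^esub>"] quotient_zero M.minus_equality[of "\<zero>\<^bsub>M\<^esub>" "\<zero>\<^bsub>M\<^esub>"]
  by (simp add: a_minus_def)

text \<open>A union of cosets over representatives is how functions on a quotient are written; it
  collapses once the function respects the cosets.\<close>

lemma coset_UN:
  assumes "x \<in> carrier M" "\<And>y. y \<in> N +>\<^bsub>M\<^esub> x \<Longrightarrow> F y = F x"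
  shows "(\<Union>y \<in> N +>\<^bsub>M\<^esub> x. F y) = F x"
  by (rule SUP_eq_const) (use assms coset_self[OF assms(1)] in blast)+

lemma quotient_smult: "a \<in> carrier K \<Longrightarrow> x \<in> carrier M \<Longrightarrow>
    a \<odot>\<^bsub>quotient_module M N\<^esub> (N +>\<^bsub>M\<^esub> x) = N +>\<^bsub>M\<^esub> (a \<odot>\<^bsub>M\<^esub> x)"
proof -
  assume a: "a \<in> carrier K" and x: "x \<in> carrier M"
  have "N +>\<^bsub>M\<^esub> (a \<odot>\<^bsub>M\<^esub> y) = N +>\<^bsub>M\<^esub> (a \<odot>\<^bsub>M\<^esub> x)" if "y \<in> N +>\<^bsub>M\<^esub> x" for y
  proof -
    have y: "y \<in> carrier M" using that coset_subset[OF x] by auto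
    have "y \<ominus>\<^bsub>M\<^esub> x \<in> N" using that coset_mem_iff[OF x y] coset_eq_iff[OF y x] by simp
    then have "a \<odot>\<^bsub>M\<^esub> (y \<ominus>\<^bsub>M\<^esub> x) \<in> N" using M.submoduleE(4)[OF N a] by simp
    then show ?thesis
      using a x y by (simp add: coset_eq_iff a_minus_def M.smult_r_distr M.smult_r_minus)
  qed
  from coset_UN[OF x, of "\<lambda>y. N +>\<^bsub>M\<^esub> (a \<odot>\<^bsub>M\<^esub> y)", OF this]
  show ?thesis by (simp add: quotient_module_def)
qed

lemma quotient_mem: "x \<in> carrier M \<Longrightarrow> N +>\<^bsub>M\<^esub> x \<in> carrier (quotient_module M N)"
  unfolding quotient_carrier by blast

lemma quotient_cases:
  "U \<in> carrier (quotient_module M N) \<Longrightarrow> (\<And>x. x \<in> carrier M \<Longrightarrow> U = N +>\<^bsub>M\<^esub> x \<Longrightarrow> P) \<Longrightarrow> P"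
  unfolding quotient_carrier by blast

lemma module_quotient: "module K (quotient_module M N)"
proof (rule moduleI)
  let ?Q = "quotient_module M N"
  show "cring K" by (rule M.R.is_cring)
  show "abelian_group ?Q"
  proof (rule abelian_groupI)
    fix U assume "U \<in> carrier ?Q"
    then obtain x where x: "x \<in> carrier M" "U = N +>\<^bsub>M\<^esub> x" by (rule quotient_cases)
    have "(N +>\<^bsub>M\<^esub> (\<ominus>\<^bsub>M\<^esub> x)) \<oplus>\<^bsub>?Q\<^esub> U = \<zero>\<^bsub>?Q\<^esub>"
      using x by (simp add: quotient_add quotient_zero M.l_neg)
    moreover have "N +>\<^bsub>M\<^esub> (\<ominus>\<^bsub>M\<^esub> x) \<in> carrier ?Q"
      using x by (simp add: quotient_mem)
    ultimately show "\<exists>Y\<in>carrier ?Q. Y \<oplus>\<^bsub>?Q\<^esub> U = \<zero>\<^bsub>?Q\<^esub>" by blast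
    have "(N +>\<^bsub>M\<^esub> \<zero>\<^bsub>M\<^esub>) \<oplus>\<^bsub>?Q\<^esub> U = U"
      using x by (simp only: quotient_add M.zero_closed M.l_zero)
    then show "\<zero>\<^bsub>?Q\<^esub> \<oplus>\<^bsub>?Q\<^esub> U = U" by (simp only: quotient_zero)
    fix Y assume "Y \<in> carrier ?Q"
    then obtain y where y: "y \<in> carrier M" "Y = N +>\<^bsub>M\<^esub> y" by (rule quotient_cases)
    show "U \<oplus>\<^bsub>?Q\<^esub> Y \<in> carrier ?Q" using x y by (simp add: quotient_add quotient_mem)
    show "U \<oplus>\<^bsub>?Q\<^esub> Y = Y \<oplus>\<^bsub>?Q\<^esub> U" using x y by (simp add: quotient_add M.a_comm)
    fix Z assume "Z \<in> carrier ?Q"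
    then obtain z where z: "z \<in> carrier M" "Z = N +>\<^bsub>M\<^esub> z" by (rule quotient_cases)
    show "U \<oplus>\<^bsub>?Q\<^esub> Y \<oplus>\<^bsub>?Q\<^esub> Z = U \<oplus>\<^bsub>?Q\<^esub> (Y \<oplus>\<^bsub>?Q\<^esub> Z)"
      using x y z by (simp add: quotient_add M.a_assoc)
  next
    have "N +>\<^bsub>M\<^esub> \<zero>\<^bsub>M\<^esub> \<in> carrier ?Q" by (rule quotient_mem) simp
    then show "\<zero>\<^bsub>?Q\<^esub> \<in> carrier ?Q" by (simp only: quotient_zero)
  qed
  fix a b U assume ab: "a \<in> carrier K" "b \<in> carrier K" and "U \<in> carrier ?Q"
  then obtain x where x: "x \<in> carrier M" "U = N +>\<^bsub>M\<^esub> x" by (rule_tac quotient_cases)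
  show "(a \<oplus>\<^bsub>K\<^esub> b) \<odot>\<^bsub>?Q\<^esub> U = a \<odot>\<^bsub>?Q\<^esub> U \<oplus>\<^bsub>?Q\<^esub> b \<odot>\<^bsub>?Q\<^esub> U"
    using x ab by (simp add: quotient_smult quotient_add M.smult_l_distr)
  show "(a \<otimes>\<^bsub>K\<^esub> b) \<odot>\<^bsub>?Q\<^esub> U = a \<odot>\<^bsub>?Q\<^esub> (b \<odot>\<^bsub>?Q\<^esub> U)"
    using x ab by (simp add: quotient_smult M.smult_assoc1)
next
  let ?Q = "quotient_module M N"
  fix a U assume a: "a \<in> carrier K" and "U \<in> carrier ?Q"
  then obtain x where x: "x \<in> carrier M" "U = N +>\<^bsub>M\<^esub> x" by (rule_tac quotient_cases)
  show "a \<odot>\<^bsub>?Q\<^esub> U \<in> carrier ?Q" using x a by (simp add: quotient_smult quotient_mem)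
  fix Y assume "Y \<in> carrier ?Q"
  then obtain y where y: "y \<in> carrier M" "Y = N +>\<^bsub>M\<^esub> y" by (rule quotient_cases)
  show "a \<odot>\<^bsub>?Q\<^esub> (U \<oplus>\<^bsub>?Q\<^esub> Y) = a \<odot>\<^bsub>?Q\<^esub> U \<oplus>\<^bsub>?Q\<^esub> a \<odot>\<^bsub>?Q\<^esub> Y"
    using x y a by (simp add: quotient_smult quotient_add M.smult_r_distr)
next
  let ?Q = "quotient_module M N"
  fix U assume "U \<in> carrier ?Q"
  then obtain x where x: "x \<in> carrier M" "U = N +>\<^bsub>M\<^esub> x" by (rule quotient_cases)
  show "\<one>\<^bsub>K\<^esub> \<odot>\<^bsub>?Q\<^esub> U = U" using x by (simp add: quotient_smult)
qed

end

end


section \<open>Free modules and modules given by generators and relations\<close>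

definition lincomb :: "('k, 'x) ring_scheme \<Rightarrow> ('k, 'c, 'y) module_scheme \<Rightarrow> ('a \<Rightarrow> 'c) \<Rightarrow> ('a \<Rightarrow> 'k) \<Rightarrow> 'c"
  where "lincomb K M b \<phi> = (\<Oplus>\<^bsub>M\<^esub>x \<in> {x. \<phi> x \<noteq> \<zero>\<^bsub>K\<^esub>}. \<phi> x \<odot>\<^bsub>M\<^esub> b x)"

lemma tensor_lift_lincomb: "tensor_lift K M b S = lincomb K M b (SOME \<phi>. \<phi> \<in> S)"
  by (simp add: tensor_lift_def lincomb_def Let_def)

text \<open>Tensor products and tensor powers are both of this form, which lets their universal properties
  be proved once.\<close>

definition presented_module ::
  "('k, 'x) ring_scheme \<Rightarrow> 'a set \<Rightarrow> ('a \<Rightarrow> 'k) set \<Rightarrow> ('k, ('a \<Rightarrow> 'k) set) module" where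
  "presented_module K S G = quotient_module (free_module K S) (lin_span K (free_module K S) G)"

definition presented_gen :: "('k, 'x) ring_scheme \<Rightarrow> 'a set \<Rightarrow> ('a \<Rightarrow> 'k) set \<Rightarrow> 'a \<Rightarrow> ('a \<Rightarrow> 'k) set" where
  "presented_gen K S G x = lin_span K (free_module K S) G +>\<^bsub>free_module K S\<^esub> free_gen K x"

context
  fixes K :: "('k, 'x) ring_scheme" and S :: "'a set"
  assumes K: "field K"
begin

interpretation K: field K by (rule K)

lemma free_module_carrier: "\<phi> \<in> carrier (free_module K S) \<longleftrightarrow>
    (\<forall>x. \<phi> x \<in> carrier K) \<and> finite {x. \<phi> x \<noteq> \<zero>\<^bsub>K\<^esub>} \<and> (\<forall>x. \<phi> x \<noteq> \<zero>\<^bsub>K\<^esub> \<longrightarrow> x \<in> S)"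
  by (auto simp: free_module_def)

lemma free_module_ops:
  "\<zero>\<^bsub>free_module K S\<^esub> = (\<lambda>x. \<zero>\<^bsub>K\<^esub>)"
  "\<phi> \<oplus>\<^bsub>free_module K S\<^esub> \<psi> = (\<lambda>x. \<phi> x \<oplus>\<^bsub>K\<^esub> \<psi> x)"
  "a \<odot>\<^bsub>free_module K S\<^esub> \<phi> = (\<lambda>x. a \<otimes>\<^bsub>K\<^esub> \<phi> x)"
  by (auto simp: free_module_def)

lemma free_module_closed:
  assumes "\<phi> \<in> carrier (free_module K S)"
  shows "\<psi> \<in> carrier (free_module K S) \<Longrightarrow> (\<lambda>x. \<phi> x \<oplus>\<^bsub>K\<^esub> \<psi> x) \<in> carrier (free_module K S)"
    and "a \<in> carrier K \<Longrightarrow> (\<lambda>x. a \<otimes>\<^bsub>K\<^esub> \<phi> x) \<in> carrier (free_module K S)"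
proof -
  assume \<psi>: "\<psi> \<in> carrier (free_module K S)"
  have "finite {x. \<phi> x \<oplus>\<^bsub>K\<^esub> \<psi> x \<noteq> \<zero>\<^bsub>K\<^esub>}"
    by (rule finite_subset[of _ "{x. \<phi> x \<noteq> \<zero>\<^bsub>K\<^esub>} \<union> {x. \<psi> x \<noteq> \<zero>\<^bsub>K\<^esub>}"])
      (use assms \<psi> in \<open>auto simp: free_module_carrier\<close>)
  then show "(\<lambda>x. \<phi> x \<oplus>\<^bsub>K\<^esub> \<psi> x) \<in> carrier (free_module K S)"
    using assms \<psi> unfolding free_module_carrier by (metis K.add.m_closed K.r_zero)
next
  assume a: "a \<in> carrier K"
  have "finite {x. a \<otimes>\<^bsub>K\<^esub> \<phi> x \<noteq> \<zero>\<^bsub>K\<^esub>}"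
    by (rule finite_subset[of _ "{x. \<phi> x \<noteq> \<zero>\<^bsub>K\<^esub>}"])
      (use assms a in \<open>auto simp: free_module_carrier\<close>)
  then show "(\<lambda>x. a \<otimes>\<^bsub>K\<^esub> \<phi> x) \<in> carrier (free_module K S)"
    using assms a unfolding free_module_carrier by (metis K.m_closed K.r_null)
qed

lemma module_free: "module K (free_module K S)"
proof (rule moduleI)
  let ?F = "free_module K S"
  note c = free_module_carrier free_module_ops
  show "cring K" by (rule K.is_cring)
  show "abelian_group ?F"
  proof (rule abelian_groupI)
    fix \<phi> assume p: "\<phi> \<in> carrier ?F"
    have "(\<lambda>x. (\<ominus>\<^bsub>K\<^esub> \<one>\<^bsub>K\<^esub>) \<otimes>\<^bsub>K\<^esub> \<phi> x) \<in> carrier ?F" using p by (intro free_module_closed) auto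
    moreover have "(\<lambda>x. (\<ominus>\<^bsub>K\<^esub> \<one>\<^bsub>K\<^esub>) \<otimes>\<^bsub>K\<^esub> \<phi> x) \<oplus>\<^bsub>?F\<^esub> \<phi> = \<zero>\<^bsub>?F\<^esub>"
      using p by (auto simp: c K.l_minus K.l_neg)
    ultimately show "\<exists>\<psi>\<in>carrier ?F. \<psi> \<oplus>\<^bsub>?F\<^esub> \<phi> = \<zero>\<^bsub>?F\<^esub>" by blast
  next
    fix \<phi> \<psi> assume p: "\<phi> \<in> carrier ?F" "\<psi> \<in> carrier ?F"
    show "\<phi> \<oplus>\<^bsub>?F\<^esub> \<psi> \<in> carrier ?F" unfolding free_module_ops by (rule free_module_closed(1)[OF p])
  qed (auto simp: c K.a_ac)
next
  fix a \<phi> assume "a \<in> carrier K" "\<phi> \<in> carrier (free_module K S)"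
  then show "a \<odot>\<^bsub>free_module K S\<^esub> \<phi> \<in> carrier (free_module K S)"
    unfolding free_module_ops by (intro free_module_closed)
qed (auto simp: free_module_carrier free_module_ops K.l_distr K.r_distr K.m_assoc)

lemma free_gen_carrier: "x \<in> S \<Longrightarrow> free_gen K x \<in> carrier (free_module K S)"
  by (auto simp: free_module_carrier free_gen_def)

lemma free_module_induct [consumes 1, case_names zero gen add smult]:
  assumes "\<phi> \<in> carrier (free_module K S)"
    and zero: "P \<zero>\<^bsub>free_module K S\<^esub>"
    and gen: "\<And>x. x \<in> S \<Longrightarrow> P (free_gen K x)"
    and add: "\<And>\<phi> \<psi>. \<phi> \<in> carrier (free_module K S) \<Longrightarrow> \<psi> \<in> carrier (free_module K S) \<Longrightarrow>
      P \<phi> \<Longrightarrow> P \<psi> \<Longrightarrow> P (\<phi> \<oplus>\<^bsub>free_module K S\<^esub> \<psi>)"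
    and smult: "\<And>a \<phi>. a \<in> carrier K \<Longrightarrow> \<phi> \<in> carrier (free_module K S) \<Longrightarrow> P \<phi> \<Longrightarrow>
      P (a \<odot>\<^bsub>free_module K S\<^esub> \<phi>)"
  shows "P \<phi>"
proof -
  interpret F: module K "free_module K S" by (rule module_free)
  have "finite A \<Longrightarrow> \<phi> \<in> carrier (free_module K S) \<Longrightarrow> {x. \<phi> x \<noteq> \<zero>\<^bsub>K\<^esub>} \<subseteq> A \<Longrightarrow> P \<phi>" for A \<phi>
  proof (induction A arbitrary: \<phi> rule: finite_induct)
    case empty
    then have "\<phi> = \<zero>\<^bsub>free_module K S\<^esub>" by (auto simp: free_module_ops)
    then show ?case using zero by simp
  next
    case (insert x A)
    show ?case
    proof (cases "\<phi> x = \<zero>\<^bsub>K\<^esub>")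
      case True
      then show ?thesis using insert by (intro insert.IH) auto
    next
      case False
      then have x: "x \<in> S" "\<phi> x \<in> carrier K" using insert.prems by (auto simp: free_module_carrier)
      define \<psi> where "\<psi> = \<phi>(x := \<zero>\<^bsub>K\<^esub>)"
      have "finite {y. \<psi> y \<noteq> \<zero>\<^bsub>K\<^esub>}"
        by (rule finite_subset[of _ "{y. \<phi> y \<noteq> \<zero>\<^bsub>K\<^esub>}"])
          (use insert.prems in \<open>auto simp: free_module_carrier \<psi>_def\<close>)
      then have \<psi>: "\<psi> \<in> carrier (free_module K S)"
        using insert.prems unfolding \<psi>_def free_module_carrier by (auto simp: fun_upd_def)
      have "{y. \<psi> y \<noteq> \<zero>\<^bsub>K\<^esub>} \<subseteq> A" using insert.prems by (auto simp: \<psi>_def)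
      then have "P \<psi>" by (rule insert.IH[OF \<psi>])
      moreover have "\<phi> = \<psi> \<oplus>\<^bsub>free_module K S\<^esub> (\<phi> x \<odot>\<^bsub>free_module K S\<^esub> free_gen K x)"
        using insert.prems by (auto simp: free_module_ops free_gen_def free_module_carrier \<psi>_def)
      moreover have "P (\<psi> \<oplus>\<^bsub>free_module K S\<^esub> (\<phi> x \<odot>\<^bsub>free_module K S\<^esub> free_gen K x))"
        using \<psi> \<open>P \<psi>\<close> x gen[OF x(1)] free_gen_carrier[OF x(1)] by (intro add smult) auto
      ultimately show ?thesis by metis
    qed
  qed
  then show ?thesis using assms(1) by (auto simp: free_module_carrier)
qed

context
  fixes M :: "('k, 'c, 'y) module_scheme" and b :: "'a \<Rightarrow> 'c"
  assumes M: "module K M" and b: "\<And>x. x \<in> S \<Longrightarrow> b x \<in> carrier M"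
begin

interpretation M: module K M by (rule M)

lemma lincomb_superset:
  assumes "\<phi> \<in> carrier (free_module K S)" "finite A" "{x. \<phi> x \<noteq> \<zero>\<^bsub>K\<^esub>} \<subseteq> A" "A \<subseteq> S"
  shows "lincomb K M b \<phi> = (\<Oplus>\<^bsub>M\<^esub>x \<in> A. \<phi> x \<odot>\<^bsub>M\<^esub> b x)"
  unfolding lincomb_def
  by (rule M.add.finprod_mono_neutral_cong_left)
    (use assms b in \<open>auto simp: free_module_carrier subset_iff\<close>)

lemma linear_map_lincomb: "linear_map K (free_module K S) M (lincomb K M b)"
proof (rule linear_mapI)
  fix \<phi> assume p: "\<phi> \<in> carrier (free_module K S)"
  let ?A = "{x. \<phi> x \<noteq> \<zero>\<^bsub>K\<^esub>}"
  have A: "finite ?A" "?A \<subseteq> S" using p by (auto simp: free_module_carrier)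
  have cl: "(\<lambda>x. \<phi> x \<odot>\<^bsub>M\<^esub> b x) \<in> ?A \<rightarrow> carrier M" using p b by (auto simp: free_module_carrier)
  show "lincomb K M b \<phi> \<in> carrier M" unfolding lincomb_def using cl by (rule M.finsum_closed)
  {
    fix a assume a: "a \<in> carrier K"
    have "lincomb K M b (a \<odot>\<^bsub>free_module K S\<^esub> \<phi>) = (\<Oplus>\<^bsub>M\<^esub>x \<in> ?A. (a \<otimes>\<^bsub>K\<^esub> \<phi> x) \<odot>\<^bsub>M\<^esub> b x)"
      unfolding free_module_ops
      by (rule lincomb_superset[OF free_module_closed(2)[OF p a] A(1) _ A(2)]) (use a in auto)
    also have "\<dots> = (\<Oplus>\<^bsub>M\<^esub>x \<in> ?A. a \<odot>\<^bsub>M\<^esub> (\<phi> x \<odot>\<^bsub>M\<^esub> b x))"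
      by (rule M.finsum_cong') (use p a b A in \<open>auto simp: free_module_carrier M.smult_assoc1\<close>)
    also have "\<dots> = a \<odot>\<^bsub>M\<^esub> lincomb K M b \<phi>"
      unfolding lincomb_def using M.finsum_smult_ldistr[OF A(1) a cl] by simp
    finally show "lincomb K M b (a \<odot>\<^bsub>free_module K S\<^esub> \<phi>) = a \<odot>\<^bsub>M\<^esub> lincomb K M b \<phi>" .
  }
  {
    fix \<psi> assume q: "\<psi> \<in> carrier (free_module K S)"
    let ?B = "?A \<union> {x. \<psi> x \<noteq> \<zero>\<^bsub>K\<^esub>}"
    have B: "finite ?B" "?B \<subseteq> S" using p q by (auto simp: free_module_carrier)
    have pc: "\<And>x. \<phi> x \<in> carrier K" "\<And>x. \<psi> x \<in> carrier K" using p q by (auto simp: free_module_carrier)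
    have "lincomb K M b (\<phi> \<oplus>\<^bsub>free_module K S\<^esub> \<psi>) = (\<Oplus>\<^bsub>M\<^esub>x \<in> ?B. (\<phi> x \<oplus>\<^bsub>K\<^esub> \<psi> x) \<odot>\<^bsub>M\<^esub> b x)"
      unfolding free_module_ops
      by (rule lincomb_superset[OF free_module_closed(1)[OF p q] B(1) _ B(2)]) auto
    also have "\<dots> = (\<Oplus>\<^bsub>M\<^esub>x \<in> ?B. \<phi> x \<odot>\<^bsub>M\<^esub> b x \<oplus>\<^bsub>M\<^esub> \<psi> x \<odot>\<^bsub>M\<^esub> b x)"
      by (rule M.finsum_cong') (use pc b B in \<open>auto simp: M.smult_l_distr\<close>)
    also have "\<dots> = (\<Oplus>\<^bsub>M\<^esub>x \<in> ?B. \<phi> x \<odot>\<^bsub>M\<^esub> b x) \<oplus>\<^bsub>M\<^esub> (\<Oplus>\<^bsub>M\<^esub>x \<in> ?B. \<psi> x \<odot>\<^bsub>M\<^esub> b x)"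
      by (rule M.finsum_addf) (use pc b B in auto)
    also have "\<dots> = lincomb K M b \<phi> \<oplus>\<^bsub>M\<^esub> lincomb K M b \<psi>"
      using lincomb_superset[OF p B(1)] lincomb_superset[OF q B(1)] B(2) by auto
    finally show "lincomb K M b (\<phi> \<oplus>\<^bsub>free_module K S\<^esub> \<psi>) = lincomb K M b \<phi> \<oplus>\<^bsub>M\<^esub> lincomb K M b \<psi>" .
  }
qed

lemma lincomb_gen: "x \<in> S \<Longrightarrow> lincomb K M b (free_gen K x) = b x"
proof -
  assume x: "x \<in> S"
  have "lincomb K M b (free_gen K x) = (\<Oplus>\<^bsub>M\<^esub>y \<in> {x}. free_gen K x y \<odot>\<^bsub>M\<^esub> b y)"
    by (rule lincomb_superset) (use x free_gen_carrier in \<open>auto simp: free_gen_def\<close>)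
  then show ?thesis using b[OF x] by (simp add: free_gen_def)
qed

end

context
  fixes G :: "('a \<Rightarrow> 'k) set"
  assumes G: "G \<subseteq> carrier (free_module K S)"
begin

interpretation F: module K "free_module K S" by (rule module_free)

lemma module_presented: "module K (presented_module K S G)"
  unfolding presented_module_def
  by (rule module_quotient[OF module_free submodule_lin_span[OF module_free G]])

lemma presented_gen_carrier: "x \<in> S \<Longrightarrow> presented_gen K S G x \<in> carrier (presented_module K S G)"
  unfolding presented_module_def presented_gen_def
    quotient_carrier[OF module_free submodule_lin_span[OF module_free G]]
  using free_gen_carrier by blast

lemma linear_map_presented_proj:
  "linear_map K (free_module K S) (presented_module K S G)
    (\<lambda>\<phi>. lin_span K (free_module K S) G +>\<^bsub>free_module K S\<^esub> \<phi>)"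
  unfolding presented_module_def
  by (rule linear_mapI)
    (auto simp: quotient_mem[OF module_free submodule_lin_span[OF module_free G]]
      quotient_add[OF module_free submodule_lin_span[OF module_free G]]
      quotient_smult[OF module_free submodule_lin_span[OF module_free G]])

lemma presented_induct [consumes 1, case_names zero gen add smult]:
  assumes "t \<in> carrier (presented_module K S G)"
    and zero: "P \<zero>\<^bsub>presented_module K S G\<^esub>"
    and gen: "\<And>x. x \<in> S \<Longrightarrow> P (presented_gen K S G x)"
    and add: "\<And>t u. t \<in> carrier (presented_module K S G) \<Longrightarrow> u \<in> carrier (presented_module K S G) \<Longrightarrow>
      P t \<Longrightarrow> P u \<Longrightarrow> P (t \<oplus>\<^bsub>presented_module K S G\<^esub> u)"
    and smult: "\<And>a t. a \<in> carrier K \<Longrightarrow> t \<in> carrier (presented_module K S G) \<Longrightarrow> P t \<Longrightarrow>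
      P (a \<odot>\<^bsub>presented_module K S G\<^esub> t)"
  shows "P t"
proof -
  let ?p = "\<lambda>\<phi>. lin_span K (free_module K S) G +>\<^bsub>free_module K S\<^esub> \<phi>"
  note p = linear_map_presented_proj
  obtain \<phi> where \<phi>: "\<phi> \<in> carrier (free_module K S)" "t = ?p \<phi>"
    using assms(1) unfolding presented_module_def
      quotient_carrier[OF module_free submodule_lin_span[OF module_free G]] by auto
  from \<phi>(1) have "P (?p \<phi>)"
  proof (induction \<phi> rule: free_module_induct)
    case zero
    then show ?case using assms(2) linear_map_zero[OF module_free module_presented p] by simp
  next
    case (gen x)
    then show ?case using assms(3) by (simp add: presented_gen_def)
  next
    case (add \<phi> \<psi>)
    then show ?case using assms(4) linear_map_add[OF p] linear_map_closed[OF p] by simp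
  next
    case (smult a \<phi>)
    then show ?case using assms(5) linear_map_smult[OF p] linear_map_closed[OF p] by simp
  qed
  with \<phi>(2) show ?thesis by simp
qed

lemma presented_rel: "g \<in> G \<Longrightarrow> lin_span K (free_module K S) G +>\<^bsub>free_module K S\<^esub> g = \<zero>\<^bsub>presented_module K S G\<^esub>"
  using coset_eq_self_iff[OF module_free submodule_lin_span[OF module_free G], of g] G
    lin_span_superset[OF module_free, of g G]
  by (auto simp: presented_module_def quotient_zero[OF module_free submodule_lin_span[OF module_free G]])

context
  fixes M :: "('k, 'c, 'y) module_scheme" and b :: "'a \<Rightarrow> 'c"
  assumes M: "module K M" and b: "\<And>x. x \<in> S \<Longrightarrow> b x \<in> carrier M"
    and rel: "\<And>g. g \<in> G \<Longrightarrow> lincomb K M b g = \<zero>\<^bsub>M\<^esub>"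
begin

text \<open>The value does not depend on the representative chosen in the definition of \<open>tensor_lift\<close>
  because two representatives differ by a combination of relators.\<close>

lemma tensor_lift_coset:
  assumes "\<phi> \<in> carrier (free_module K S)"
  shows "tensor_lift K M b (lin_span K (free_module K S) G +>\<^bsub>free_module K S\<^esub> \<phi>) = lincomb K M b \<phi>"
proof -
  interpret M: module K M by (rule M)
  let ?N = "lin_span K (free_module K S) G"
  note N = submodule_lin_span[OF module_free G]
  note L = linear_map_lincomb[OF M b]
  define \<psi> where "\<psi> = (SOME \<psi>. \<psi> \<in> ?N +>\<^bsub>free_module K S\<^esub> \<phi>)"
  have \<psi>: "\<psi> \<in> ?N +>\<^bsub>free_module K S\<^esub> \<phi>"
    unfolding \<psi>_def by (rule someI[of _ \<phi>]) (rule coset_self[OF module_free N assms])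
  then have c: "\<psi> \<in> carrier (free_module K S)" using coset_subset[OF module_free N assms] by auto
  have "\<psi> \<ominus>\<^bsub>free_module K S\<^esub> \<phi> \<in> ?N"
    using \<psi> coset_mem_iff[OF module_free N assms c] coset_eq_iff[OF module_free N c assms] by simp
  then have "lincomb K M b (\<psi> \<ominus>\<^bsub>free_module K S\<^esub> \<phi>) = \<zero>\<^bsub>M\<^esub>"
    by (intro linear_map_lin_span_zero[OF module_free M L G rel])
  then have "lincomb K M b \<psi> \<ominus>\<^bsub>M\<^esub> lincomb K M b \<phi> = \<zero>\<^bsub>M\<^esub>"
    using linear_map_minus[OF module_free M L c assms] by simp
  then have "lincomb K M b \<psi> = lincomb K M b \<phi>"
    using linear_map_closed[OF L c] linear_map_closed[OF L assms] M.minus_eq_zero_iff by simp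
  then show ?thesis by (simp add: tensor_lift_lincomb \<psi>_def)
qed

lemma tensor_lift_gen: "x \<in> S \<Longrightarrow> tensor_lift K M b (presented_gen K S G x) = b x"
  unfolding presented_gen_def
  by (simp add: tensor_lift_coset free_gen_carrier lincomb_gen[OF M b])

lemma linear_map_tensor_lift: "linear_map K (presented_module K S G) M (tensor_lift K M b)"
proof -
  note N = submodule_lin_span[OF module_free G]
  note L = linear_map_lincomb[OF M b]
  note c = presented_module_def quotient_carrier[OF module_free N]
    quotient_add[OF module_free N] quotient_smult[OF module_free N]
  show ?thesis
    by (rule linear_mapI)
      (auto simp: c tensor_lift_coset linear_map_closed[OF L] linear_map_add[OF L] linear_map_smult[OF L])
qed

end

text \<open>If the generators are sent to elements that depend linearly on a parameter, then so does the
  image of every element. This is what makes iterated lifts, in two tensor arguments, bilinear.\<close>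

lemma linear_map_tensor_lift_param:
  fixes M :: "('k, 'c, 'y) module_scheme" and N :: "('k, 'd, 'z) module_scheme"
  assumes M: "module K M" and N: "module K N"
    and b: "\<And>p x. p \<in> carrier N \<Longrightarrow> x \<in> S \<Longrightarrow> b p x \<in> carrier M"
    and rel: "\<And>p g. p \<in> carrier N \<Longrightarrow> g \<in> G \<Longrightarrow> lincomb K M (b p) g = \<zero>\<^bsub>M\<^esub>"
    and lin: "\<And>x. x \<in> S \<Longrightarrow> linear_map K N M (\<lambda>p. b p x)"
    and t: "t \<in> carrier (presented_module K S G)"
  shows "linear_map K N M (\<lambda>p. tensor_lift K M (b p) t)"
  using t
proof (induction t rule: presented_induct)
  case zero
  show ?case
    by (rule linear_map_cong[OF N linear_map_const_zero[OF N M]])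
      (simp add: linear_map_zero[OF module_presented M linear_map_tensor_lift[OF M b rel]])
next
  case (gen x)
  show ?case
    by (rule linear_map_cong[OF N lin[OF gen]]) (simp add: tensor_lift_gen[OF M b rel gen])
next
  case (add t u)
  show ?case
    by (rule linear_map_cong[OF N linear_map_sum[OF N M add.IH]])
      (simp add: linear_map_add[OF linear_map_tensor_lift[OF M b rel]] add.hyps)
next
  case (smult a t)
  show ?case
    by (rule linear_map_cong[OF N linear_map_scale[OF N M smult.IH smult.hyps(1)]])
      (simp add: linear_map_smult[OF linear_map_tensor_lift[OF M b rel]] smult.hyps)
qed

end

end

section \<open>Tensor products and tensor powers\<close>

definition bilinear_map ::
  "('k, 'x) ring_scheme \<Rightarrow> ('k, 'a, 'y) module_scheme \<Rightarrow> ('k, 'b, 'z) module_scheme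
    \<Rightarrow> ('k, 'c, 'u) module_scheme \<Rightarrow> ('a \<times> 'b \<Rightarrow> 'c) \<Rightarrow> bool" where
  "bilinear_map K V W M b \<longleftrightarrow> (\<forall>v \<in> carrier V. linear_map K W M (\<lambda>w. b (v, w))) \<and>
    (\<forall>w \<in> carrier W. linear_map K V M (\<lambda>v. b (v, w)))"

text \<open>The relators without the passage to their span, as needed to view the tensor product as a
  module given by generators and relations.\<close>

definition bilinearity_relations ::
  "('k, 'x) ring_scheme \<Rightarrow> ('k, 'a, 'y) module_scheme \<Rightarrow> ('k, 'b, 'z) module_scheme \<Rightarrow> ('a \<times> 'b \<Rightarrow> 'k) set"
  where "bilinearity_relations K V W = (let F = free_module K (carrier V \<times> carrier W) in
     ({free_gen K (u \<oplus>\<^bsub>V\<^esub> v, w) \<ominus>\<^bsub>F\<^esub> (free_gen K (u, w) \<oplus>\<^bsub>F\<^esub> free_gen K (v, w)) | u v w.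
         u \<in> carrier V \<and> v \<in> carrier V \<and> w \<in> carrier W} \<union>
      {free_gen K (v, u \<oplus>\<^bsub>W\<^esub> w) \<ominus>\<^bsub>F\<^esub> (free_gen K (v, u) \<oplus>\<^bsub>F\<^esub> free_gen K (v, w)) | v u w.
         v \<in> carrier V \<and> u \<in> carrier W \<and> w \<in> carrier W} \<union>
      {free_gen K (a \<odot>\<^bsub>V\<^esub> v, w) \<ominus>\<^bsub>F\<^esub> (a \<odot>\<^bsub>F\<^esub> free_gen K (v, w)) | a v w.
         a \<in> carrier K \<and> v \<in> carrier V \<and> w \<in> carrier W} \<union>
      {free_gen K (v, a \<odot>\<^bsub>W\<^esub> w) \<ominus>\<^bsub>F\<^esub> (a \<odot>\<^bsub>F\<^esub> free_gen K (v, w)) | a v w.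
         a \<in> carrier K \<and> v \<in> carrier V \<and> w \<in> carrier W}))"

lemma bilinear_map_closed:
  "bilinear_map K V W M b \<Longrightarrow> v \<in> carrier V \<Longrightarrow> w \<in> carrier W \<Longrightarrow> b (v, w) \<in> carrier M"
  by (auto simp: bilinear_map_def linear_map_def)

lemma tensor_presented:
  "tensor K V W = presented_module K (carrier V \<times> carrier W) (bilinearity_relations K V W)"
  "pure_tensor K V W v w = presented_gen K (carrier V \<times> carrier W) (bilinearity_relations K V W) (v, w)"
  by (simp_all add: tensor_def pure_tensor_def presented_module_def presented_gen_def
      tensor_relations_def bilinearity_relations_def Let_def)

text \<open>A difference of generators becomes zero under a linear map exactly if the linear map
  respects the relation; this turns relators into equations.\<close>

lemma linear_map_relator_sum:
  assumes "module K M" "module K N" "linear_map K M N f" "x \<in> carrier M" "y \<in> carrier M" "z \<in> carrier M"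
  shows "f (x \<ominus>\<^bsub>M\<^esub> (y \<oplus>\<^bsub>M\<^esub> z)) = \<zero>\<^bsub>N\<^esub> \<longleftrightarrow> f x = f y \<oplus>\<^bsub>N\<^esub> f z"
proof -
  interpret M: module K M by fact
  interpret N: module K N by fact
  show ?thesis using assms linear_map_closed[OF assms(3)]
    by (simp add: linear_map_minus linear_map_add N.minus_eq_zero_iff)
qed

lemma linear_map_relator_scale:
  assumes "module K M" "module K N" "linear_map K M N f" "x \<in> carrier M" "y \<in> carrier M" "a \<in> carrier K"
  shows "f (x \<ominus>\<^bsub>M\<^esub> (a \<odot>\<^bsub>M\<^esub> y)) = \<zero>\<^bsub>N\<^esub> \<longleftrightarrow> f x = a \<odot>\<^bsub>N\<^esub> f y"
proof -
  interpret M: module K M by fact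
  interpret N: module K N by fact
  show ?thesis using assms linear_map_closed[OF assms(3)]
    by (simp add: linear_map_minus linear_map_smult N.minus_eq_zero_iff)
qed

context
  fixes K :: "('k, 'x) ring_scheme" and V :: "('k, 'a, 'y) module_scheme" and W :: "('k, 'b, 'z) module_scheme"
  assumes K: "field K" and V: "module K V" and W: "module K W"
begin

interpretation V: module K V by (rule V)
interpretation W: module K W by (rule W)
interpretation F: module K "free_module K (carrier V \<times> carrier W)" by (rule module_free[OF K])

lemma bilinearity_relations_carrier:
  "bilinearity_relations K V W \<subseteq> carrier (free_module K (carrier V \<times> carrier W))"
  unfolding bilinearity_relations_def Let_def
  by (auto intro!: F.minus_closed F.a_closed F.smult_closed free_gen_carrier[OF K])

lemma module_tensor: "module K (tensor K V W)"
  unfolding tensor_presented by (rule module_presented[OF K bilinearity_relations_carrier])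

lemma pure_tensor_closed: "v \<in> carrier V \<Longrightarrow> w \<in> carrier W \<Longrightarrow> pure_tensor K V W v w \<in> carrier (tensor K V W)"
  unfolding tensor_presented by (rule presented_gen_carrier[OF K bilinearity_relations_carrier]) simp

lemma bilinear_lincomb_rel:
  assumes M: "module K M" and b: "bilinear_map K V W M b" and g: "g \<in> bilinearity_relations K V W"
  shows "lincomb K M b g = \<zero>\<^bsub>M\<^esub>"
proof -
  let ?S = "carrier V \<times> carrier W"
  have bc: "b x \<in> carrier M" if "x \<in> ?S" for x
    using that b by (cases x) (auto simp: bilinear_map_def linear_map_def)
  have b1: "linear_map K W M (\<lambda>w. b (v, w))" if "v \<in> carrier V" for v
    using b that by (simp add: bilinear_map_def)
  have b2: "linear_map K V M (\<lambda>v. b (v, w))" if "w \<in> carrier W" for w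
    using b that by (simp add: bilinear_map_def)
  note L = linear_map_lincomb[OF K M bc]
  note r = linear_map_relator_sum[OF module_free[OF K] M L, THEN iffD2]
    linear_map_relator_scale[OF module_free[OF K] M L, THEN iffD2]
  note G = lincomb_gen[OF K M bc, simplified] free_gen_carrier[OF K]
  from g show ?thesis
    unfolding bilinearity_relations_def Let_def
    by (auto intro!: r simp: G linear_map_add[OF b1] linear_map_add[OF b2]
        linear_map_smult[OF b1] linear_map_smult[OF b2])
qed

lemma
  assumes M: "module K M" and b: "bilinear_map K V W M b"
  shows linear_map_bilinear_lift: "linear_map K (tensor K V W) M (tensor_lift K M b)"
    and bilinear_lift_pure: "v \<in> carrier V \<Longrightarrow> w \<in> carrier W \<Longrightarrow>
      tensor_lift K M b (pure_tensor K V W v w) = b (v, w)"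
proof -
  have bc: "b x \<in> carrier M" if "x \<in> carrier V \<times> carrier W" for x
    using that b by (cases x) (auto simp: bilinear_map_def linear_map_def)
  show "linear_map K (tensor K V W) M (tensor_lift K M b)"
    unfolding tensor_presented
    by (rule linear_map_tensor_lift[OF K bilinearity_relations_carrier M bc bilinear_lincomb_rel[OF M b]])
  show "v \<in> carrier V \<Longrightarrow> w \<in> carrier W \<Longrightarrow> tensor_lift K M b (pure_tensor K V W v w) = b (v, w)"
    unfolding tensor_presented
    by (rule tensor_lift_gen[OF K bilinearity_relations_carrier M bc bilinear_lincomb_rel[OF M b]]) auto
qed

lemma bilinear_pure_tensor: "bilinear_map K V W (tensor K V W) (\<lambda>(v, w). pure_tensor K V W v w)"
proof -
  let ?S = "carrier V \<times> carrier W" and ?G = "bilinearity_relations K V W"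
  note p = linear_map_presented_proj[OF K bilinearity_relations_carrier]
  note r = linear_map_relator_sum[OF module_free[OF K] module_presented[OF K bilinearity_relations_carrier] p, THEN iffD1]
    linear_map_relator_scale[OF module_free[OF K] module_presented[OF K bilinearity_relations_carrier] p, THEN iffD1]
  have rel: "g \<in> ?G \<Longrightarrow> lin_span K (free_module K ?S) ?G +>\<^bsub>free_module K ?S\<^esub> g = \<zero>\<^bsub>presented_module K ?S ?G\<^esub>" for g
    by (rule presented_rel[OF K bilinearity_relations_carrier])
  have mem: "u \<in> carrier V \<Longrightarrow> v \<in> carrier V \<Longrightarrow> w \<in> carrier W \<Longrightarrow>
      free_gen K (u \<oplus>\<^bsub>V\<^esub> v, w) \<ominus>\<^bsub>free_module K ?S\<^esub> (free_gen K (u, w) \<oplus>\<^bsub>free_module K ?S\<^esub> free_gen K (v, w)) \<in> ?G"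
    "v \<in> carrier V \<Longrightarrow> x \<in> carrier W \<Longrightarrow> w \<in> carrier W \<Longrightarrow>
      free_gen K (v, x \<oplus>\<^bsub>W\<^esub> w) \<ominus>\<^bsub>free_module K ?S\<^esub> (free_gen K (v, x) \<oplus>\<^bsub>free_module K ?S\<^esub> free_gen K (v, w)) \<in> ?G"
    "a \<in> carrier K \<Longrightarrow> v \<in> carrier V \<Longrightarrow> w \<in> carrier W \<Longrightarrow>
      free_gen K (a \<odot>\<^bsub>V\<^esub> v, w) \<ominus>\<^bsub>free_module K ?S\<^esub> (a \<odot>\<^bsub>free_module K ?S\<^esub> free_gen K (v, w)) \<in> ?G"
    "a \<in> carrier K \<Longrightarrow> v \<in> carrier V \<Longrightarrow> w \<in> carrier W \<Longrightarrow>
      free_gen K (v, a \<odot>\<^bsub>W\<^esub> w) \<ominus>\<^bsub>free_module K ?S\<^esub> (a \<odot>\<^bsub>free_module K ?S\<^esub> free_gen K (v, w)) \<in> ?G"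
    for u v w a x
    unfolding bilinearity_relations_def Let_def by blast+
  note eqs = mem[THEN rel]
  show ?thesis
    unfolding bilinear_map_def
  proof (intro conjI ballI linear_mapI; unfold prod.case)
    fix v w assume "v \<in> carrier V" "w \<in> carrier W"
    then show "pure_tensor K V W v w \<in> carrier (tensor K V W)" "pure_tensor K V W v w \<in> carrier (tensor K V W)"
      by (simp_all add: pure_tensor_closed)
  next
    fix v x y assume *: "v \<in> carrier V" "x \<in> carrier W" "y \<in> carrier W"
    then show "pure_tensor K V W v (x \<oplus>\<^bsub>W\<^esub> y) = pure_tensor K V W v x \<oplus>\<^bsub>tensor K V W\<^esub> pure_tensor K V W v y"
      unfolding tensor_presented presented_gen_def
      by (intro r(1) eqs) (auto intro!: free_gen_carrier[OF K])
  next
    fix v x a assume *: "v \<in> carrier V" "x \<in> carrier W" "a \<in> carrier K"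
    then show "pure_tensor K V W v (a \<odot>\<^bsub>W\<^esub> x) = a \<odot>\<^bsub>tensor K V W\<^esub> pure_tensor K V W v x"
      unfolding tensor_presented presented_gen_def
      by (intro r(2) eqs) (auto intro!: free_gen_carrier[OF K])
  next
    fix w x y assume *: "w \<in> carrier W" "x \<in> carrier V" "y \<in> carrier V"
    then show "pure_tensor K V W (x \<oplus>\<^bsub>V\<^esub> y) w = pure_tensor K V W x w \<oplus>\<^bsub>tensor K V W\<^esub> pure_tensor K V W y w"
      unfolding tensor_presented presented_gen_def
      by (intro r(1) eqs) (auto intro!: free_gen_carrier[OF K])
  next
    fix w x a assume *: "w \<in> carrier W" "x \<in> carrier V" "a \<in> carrier K"
    then show "pure_tensor K V W (a \<odot>\<^bsub>V\<^esub> x) w = a \<odot>\<^bsub>tensor K V W\<^esub> pure_tensor K V W x w"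
      unfolding tensor_presented presented_gen_def
      by (intro r(2) eqs) (auto intro!: free_gen_carrier[OF K])
  qed
qed

lemma linear_pure_tensor:
  "v \<in> carrier V \<Longrightarrow> linear_map K W (tensor K V W) (pure_tensor K V W v)"
  "w \<in> carrier W \<Longrightarrow> linear_map K V (tensor K V W) (\<lambda>v. pure_tensor K V W v w)"
  using bilinear_pure_tensor by (auto simp: bilinear_map_def)

lemma tensor_induct [consumes 1, case_names pure add]:
  assumes "t \<in> carrier (tensor K V W)"
    and pure: "\<And>v w. v \<in> carrier V \<Longrightarrow> w \<in> carrier W \<Longrightarrow> P (pure_tensor K V W v w)"
    and add: "\<And>t u. t \<in> carrier (tensor K V W) \<Longrightarrow> u \<in> carrier (tensor K V W) \<Longrightarrow>
      P t \<Longrightarrow> P u \<Longrightarrow> P (t \<oplus>\<^bsub>tensor K V W\<^esub> u)"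
  shows "P t"
proof -
  interpret T: module K "tensor K V W" by (rule module_tensor)
  have "\<forall>a \<in> carrier K. P (a \<odot>\<^bsub>tensor K V W\<^esub> t)"
    using assms(1) unfolding tensor_presented(1)
  proof (induction t rule: presented_induct[OF K bilinearity_relations_carrier, consumes 1,
      case_names zero gen add smult])
    case zero
    have "P (pure_tensor K V W \<zero>\<^bsub>V\<^esub> \<zero>\<^bsub>W\<^esub>)" by (rule pure) auto
    moreover have "pure_tensor K V W \<zero>\<^bsub>V\<^esub> \<zero>\<^bsub>W\<^esub> = \<zero>\<^bsub>tensor K V W\<^esub>"
      using linear_map_zero[OF W module_tensor linear_pure_tensor(1)[of "\<zero>\<^bsub>V\<^esub>"]] by simp
    ultimately show ?case unfolding tensor_presented(1)[symmetric] by simp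
  next
    case (gen x)
    then obtain v w where x: "x = (v, w)" "v \<in> carrier V" "w \<in> carrier W" by auto
    have "P (a \<odot>\<^bsub>tensor K V W\<^esub> pure_tensor K V W v w)" if "a \<in> carrier K" for a
      using pure[of "a \<odot>\<^bsub>V\<^esub> v" w] x that
      by (simp add: linear_map_smult[OF linear_pure_tensor(2)])
    then show ?case by (simp add: x(1) tensor_presented)
  next
    case (add t u)
    then show ?case
      unfolding tensor_presented(1)[symmetric] by (simp add: T.smult_r_distr assms(3))
  next
    case (smult a t)
    then show ?case
      unfolding tensor_presented(1)[symmetric] by (simp add: T.smult_assoc1[symmetric])
  qed
  from this[rule_format, of "\<one>\<^bsub>K\<^esub>"] show ?thesis using assms(1) by simp
qed

lemma linear_map_bilinear_lift_param:
  assumes M: "module K M" and N: "module K N"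
    and b: "\<And>p. p \<in> carrier N \<Longrightarrow> bilinear_map K V W M (b p)"
    and lin: "\<And>v w. v \<in> carrier V \<Longrightarrow> w \<in> carrier W \<Longrightarrow> linear_map K N M (\<lambda>p. b p (v, w))"
    and t: "t \<in> carrier (tensor K V W)"
  shows "linear_map K N M (\<lambda>p. tensor_lift K M (b p) t)"
proof (rule linear_map_tensor_lift_param[OF K bilinearity_relations_carrier M N])
  show "t \<in> carrier (presented_module K (carrier V \<times> carrier W) (bilinearity_relations K V W))"
    using t by (simp add: tensor_presented)
qed (use bilinear_map_closed[OF b] lin bilinear_lincomb_rel[OF M b] in auto)

end


definition multilinear_map ::
  "('k, 'x) ring_scheme \<Rightarrow> ('k, 'a, 'y) module_scheme \<Rightarrow> nat \<Rightarrow> ('k, 'c, 'u) module_scheme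
    \<Rightarrow> ('a list \<Rightarrow> 'c) \<Rightarrow> bool" where
  "multilinear_map K V n M b \<longleftrightarrow> (\<forall>vs \<in> words V n. b vs \<in> carrier M) \<and>
    (\<forall>us ws. set us \<subseteq> carrier V \<and> set ws \<subseteq> carrier V \<and> Suc (length us + length ws) = n \<longrightarrow>
      linear_map K V M (\<lambda>v. b (us @ v # ws)))"

definition multilinearity_relations ::
  "('k, 'x) ring_scheme \<Rightarrow> ('k, 'a, 'y) module_scheme \<Rightarrow> nat \<Rightarrow> ('a list \<Rightarrow> 'k) set"
  where "multilinearity_relations K V n = (let F = free_module K (words V n) in
     ({free_gen K (us @ (v \<oplus>\<^bsub>V\<^esub> w) # ws) \<ominus>\<^bsub>F\<^esub>
           (free_gen K (us @ v # ws) \<oplus>\<^bsub>F\<^esub> free_gen K (us @ w # ws)) | us v w ws.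
         us @ v # ws \<in> words V n \<and> us @ w # ws \<in> words V n} \<union>
      {free_gen K (us @ (a \<odot>\<^bsub>V\<^esub> v) # ws) \<ominus>\<^bsub>F\<^esub> (a \<odot>\<^bsub>F\<^esub> free_gen K (us @ v # ws)) | a us v ws.
         a \<in> carrier K \<and> us @ v # ws \<in> words V n}))"

lemma tensor_power_presented:
  "tensor_power K V n = presented_module K (words V n) (multilinearity_relations K V n)"
  "length vs = n \<Longrightarrow> pure_power K V vs = presented_gen K (words V n) (multilinearity_relations K V n) vs"
  by (simp_all add: tensor_power_def pure_power_def presented_module_def presented_gen_def
      tensor_power_relations_def multilinearity_relations_def Let_def)

lemma words_length: "vs \<in> words V n \<Longrightarrow> length vs = n"
  by (simp add: words_def)

lemma words_append: "us @ v # ws \<in> words V n \<longleftrightarrow>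
    set us \<subseteq> carrier V \<and> v \<in> carrier V \<and> set ws \<subseteq> carrier V \<and> Suc (length us + length ws) = n"
  by (auto simp: words_def)

context
  fixes K :: "('k, 'x) ring_scheme" and V :: "('k, 'a, 'y) module_scheme"
  assumes K: "field K" and V: "module K V"
begin

interpretation V: module K V by (rule V)

lemma multilinearity_relations_carrier:
  "multilinearity_relations K V n \<subseteq> carrier (free_module K (words V n))"
proof -
  interpret F: module K "free_module K (words V n)" by (rule module_free[OF K])
  show ?thesis
    unfolding multilinearity_relations_def Let_def
    by (intro subsetI; elim UnE CollectE exE conjE; simp only:;
        intro F.minus_closed F.a_closed F.smult_closed free_gen_carrier[OF K]; simp add: words_append)
qed

lemma module_tensor_power: "module K (tensor_power K V n)"
  unfolding tensor_power_presented by (rule module_presented[OF K multilinearity_relations_carrier])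

lemma pure_power_closed: "vs \<in> words V n \<Longrightarrow> pure_power K V vs \<in> carrier (tensor_power K V n)"
  using presented_gen_carrier[OF K multilinearity_relations_carrier, of vs n]
    tensor_power_presented(2)[of vs n K V]
  by (simp add: words_length tensor_power_presented(1))

lemma multilinear_lincomb_rel:
  assumes M: "module K M" and b: "multilinear_map K V n M b" and g: "g \<in> multilinearity_relations K V n"
  shows "lincomb K M b g = \<zero>\<^bsub>M\<^esub>"
proof -
  let ?S = "words V n"
  have bc: "b x \<in> carrier M" if "x \<in> ?S" for x
    using that b by (auto simp: multilinear_map_def)
  have b1: "linear_map K V M (\<lambda>v. b (us @ v # ws))" if "us @ x # ws \<in> words V n" for us ws x
    using b that by (simp add: multilinear_map_def words_append)
  note L = linear_map_lincomb[OF K M bc]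
  note r = linear_map_relator_sum[OF module_free[OF K] M L, THEN iffD2]
    linear_map_relator_scale[OF module_free[OF K] M L, THEN iffD2]
  note G = lincomb_gen[OF K M bc, simplified] free_gen_carrier[OF K]
  show ?thesis
    using g unfolding multilinearity_relations_def Let_def
  proof (elim UnE CollectE exE conjE)
    fix us v w ws
    assume *: "us @ v # ws \<in> words V n" "us @ w # ws \<in> words V n" and
      g: "g = free_gen K (us @ (v \<oplus>\<^bsub>V\<^esub> w) # ws) \<ominus>\<^bsub>free_module K ?S\<^esub>
           (free_gen K (us @ v # ws) \<oplus>\<^bsub>free_module K ?S\<^esub> free_gen K (us @ w # ws))"
    then have m: "us @ (v \<oplus>\<^bsub>V\<^esub> w) # ws \<in> words V n" by (simp add: words_append)
    show ?thesis unfolding g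
      by (rule r(1)) (use * m linear_map_add[OF b1[OF *(1)], of v w] in \<open>simp_all add: G words_append\<close>)
  next
    fix a us v ws
    assume *: "us @ v # ws \<in> words V n" "a \<in> carrier K" and
      g: "g = free_gen K (us @ (a \<odot>\<^bsub>V\<^esub> v) # ws) \<ominus>\<^bsub>free_module K ?S\<^esub>
           (a \<odot>\<^bsub>free_module K ?S\<^esub> free_gen K (us @ v # ws))"
    then have m: "us @ (a \<odot>\<^bsub>V\<^esub> v) # ws \<in> words V n" by (simp add: words_append)
    show ?thesis unfolding g
      by (rule r(2)) (use * m linear_map_smult[OF b1[OF *(1)], of a v] in \<open>simp_all add: G words_append\<close>)
  qed
qed

lemma
  assumes M: "module K M" and b: "multilinear_map K V n M b"
  shows linear_map_multilinear_lift: "linear_map K (tensor_power K V n) M (tensor_lift K M b)"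
    and multilinear_lift_pure: "vs \<in> words V n \<Longrightarrow> tensor_lift K M b (pure_power K V vs) = b vs"
proof -
  have bc: "b x \<in> carrier M" if "x \<in> words V n" for x
    using that b by (auto simp: multilinear_map_def)
  show "linear_map K (tensor_power K V n) M (tensor_lift K M b)"
    unfolding tensor_power_presented
    by (rule linear_map_tensor_lift[OF K multilinearity_relations_carrier M bc multilinear_lincomb_rel[OF M b]])
  show "vs \<in> words V n \<Longrightarrow> tensor_lift K M b (pure_power K V vs) = b vs"
    using tensor_lift_gen[OF K multilinearity_relations_carrier M bc multilinear_lincomb_rel[OF M b]]
      tensor_power_presented(2)[of vs n K V]
    by (simp add: words_length)
qed

lemma multilinear_pure_power: "multilinear_map K V n (tensor_power K V n) (pure_power K V)"
proof -
  let ?S = "words V n" and ?G = "multilinearity_relations K V n"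
  note p = linear_map_presented_proj[OF K multilinearity_relations_carrier]
  note r = linear_map_relator_sum[OF module_free[OF K] module_presented[OF K multilinearity_relations_carrier] p, THEN iffD1]
    linear_map_relator_scale[OF module_free[OF K] module_presented[OF K multilinearity_relations_carrier] p, THEN iffD1]
  have rel: "g \<in> ?G \<Longrightarrow> lin_span K (free_module K ?S) ?G +>\<^bsub>free_module K ?S\<^esub> g = \<zero>\<^bsub>presented_module K ?S ?G\<^esub>" for g
    by (rule presented_rel[OF K multilinearity_relations_carrier])
  have mem: "us @ v # ws \<in> words V n \<Longrightarrow> us @ w # ws \<in> words V n \<Longrightarrow>
      free_gen K (us @ (v \<oplus>\<^bsub>V\<^esub> w) # ws) \<ominus>\<^bsub>free_module K ?S\<^esub>
           (free_gen K (us @ v # ws) \<oplus>\<^bsub>free_module K ?S\<^esub> free_gen K (us @ w # ws)) \<in> ?G"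
    "us @ v # ws \<in> words V n \<Longrightarrow> a \<in> carrier K \<Longrightarrow>
      free_gen K (us @ (a \<odot>\<^bsub>V\<^esub> v) # ws) \<ominus>\<^bsub>free_module K ?S\<^esub> (a \<odot>\<^bsub>free_module K ?S\<^esub> free_gen K (us @ v # ws)) \<in> ?G"
    for us v w ws a
    unfolding multilinearity_relations_def Let_def by blast+
  note eqs = mem[THEN rel]
  show ?thesis
    unfolding multilinear_map_def
  proof (intro conjI allI ballI impI linear_mapI; (elim conjE)?)
    fix us ws x y assume *: "set us \<subseteq> carrier V" "set ws \<subseteq> carrier V" "Suc (length us + length ws) = n"
      "x \<in> carrier V" "y \<in> carrier V"
    then have n: "length (us @ v # ws) = n" for v by simp
    from * show "pure_power K V (us @ (x \<oplus>\<^bsub>V\<^esub> y) # ws) =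
        pure_power K V (us @ x # ws) \<oplus>\<^bsub>tensor_power K V n\<^esub> pure_power K V (us @ y # ws)"
      unfolding tensor_power_presented(1) tensor_power_presented(2)[OF n] presented_gen_def
      by (intro r(1) eqs) (auto intro!: free_gen_carrier[OF K] simp: words_append)
  next
    fix us ws x a assume *: "set us \<subseteq> carrier V" "set ws \<subseteq> carrier V" "Suc (length us + length ws) = n"
      "x \<in> carrier V" "a \<in> carrier K"
    then have n: "length (us @ v # ws) = n" for v by simp
    from * show "pure_power K V (us @ (a \<odot>\<^bsub>V\<^esub> x) # ws) =
        a \<odot>\<^bsub>tensor_power K V n\<^esub> pure_power K V (us @ x # ws)"
      unfolding tensor_power_presented(1) tensor_power_presented(2)[OF n] presented_gen_def
      by (intro r(2) eqs) (auto intro!: free_gen_carrier[OF K] simp: words_append)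
  qed (auto intro!: pure_power_closed simp: words_append)
qed

lemma tensor_power_induct [consumes 1, case_names zero pure add smult]:
  assumes "t \<in> carrier (tensor_power K V n)"
    and zero: "P \<zero>\<^bsub>tensor_power K V n\<^esub>"
    and pure: "\<And>vs. vs \<in> words V n \<Longrightarrow> P (pure_power K V vs)"
    and add: "\<And>t u. t \<in> carrier (tensor_power K V n) \<Longrightarrow> u \<in> carrier (tensor_power K V n) \<Longrightarrow>
      P t \<Longrightarrow> P u \<Longrightarrow> P (t \<oplus>\<^bsub>tensor_power K V n\<^esub> u)"
    and smult: "\<And>a t. a \<in> carrier K \<Longrightarrow> t \<in> carrier (tensor_power K V n) \<Longrightarrow> P t \<Longrightarrow>
      P (a \<odot>\<^bsub>tensor_power K V n\<^esub> t)"
  shows "P t"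
  using assms(1) unfolding tensor_power_presented(1)
proof (induction t rule: presented_induct[OF K multilinearity_relations_carrier, consumes 1,
      case_names zero gen add smult])
  case (gen x)
  then show ?case using pure[OF gen] tensor_power_presented(2)[of x n K V] by (simp add: words_def)
qed (use zero add smult in \<open>simp_all add: tensor_power_presented(1)\<close>)

lemma linear_map_multilinear_lift_param:
  assumes M: "module K M" and N: "module K N"
    and b: "\<And>p. p \<in> carrier N \<Longrightarrow> multilinear_map K V n M (b p)"
    and lin: "\<And>vs. vs \<in> words V n \<Longrightarrow> linear_map K N M (\<lambda>p. b p vs)"
    and t: "t \<in> carrier (tensor_power K V n)"
  shows "linear_map K N M (\<lambda>p. tensor_lift K M (b p) t)"
proof (rule linear_map_tensor_lift_param[OF K multilinearity_relations_carrier M N])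
  show "t \<in> carrier (presented_module K (words V n) (multilinearity_relations K V n))"
    using t by (simp add: tensor_power_presented)
qed (use b lin multilinear_lincomb_rel[OF M b] in \<open>auto simp: multilinear_map_def\<close>)

lemma tensor_power_map_eqI:
  assumes M: "module K M"
    and f: "linear_map K (tensor_power K V n) M f" and g: "linear_map K (tensor_power K V n) M g"
    and eq: "\<And>vs. vs \<in> words V n \<Longrightarrow> f (pure_power K V vs) = g (pure_power K V vs)"
    and t: "t \<in> carrier (tensor_power K V n)"
  shows "f t = g t"
  using t
  by (induction t rule: tensor_power_induct)
    (simp_all add: linear_map_zero[OF module_tensor_power M] f g eq linear_map_add[OF f] linear_map_add[OF g]
      linear_map_smult[OF f] linear_map_smult[OF g])


subsection \<open>Applying a map at one position\<close>

context
  fixes D :: "'a \<Rightarrow> ('a list \<Rightarrow> 'k) set" and i n :: nat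
  assumes D: "linear_map K V (tensor_power K V 2) D" and i: "i < n"
begin

text \<open>Substituting \<open>D\<close> at position \<open>i\<close> into a multilinear map of \<open>n + 1\<close> arguments. Linearity
  in the argument at position \<open>i\<close> comes from \<open>D\<close>, elsewhere from \<open>b\<close>.\<close>

lemma multilinear_insert:
  assumes M: "module K M" and b: "multilinear_map K V (Suc n) M b"
  shows "vs \<in> words V n \<Longrightarrow> multilinear_map K V 2 M (\<lambda>ws. b (take i vs @ ws @ drop (Suc i) vs))"
    and "multilinear_map K V n M
      (\<lambda>vs. tensor_lift K M (\<lambda>ws. b (take i vs @ ws @ drop (Suc i) vs)) (D (vs ! i)))"
proof -
  have sub: "set (take k vs) \<subseteq> carrier V" "set (drop k vs) \<subseteq> carrier V"
    if "set vs \<subseteq> carrier V" for vs k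
    using that set_take_subset[of k vs] set_drop_subset[of k vs] by auto
  have bl: "linear_map K V M (\<lambda>v. b (us @ v # ws))"
    if "set us \<subseteq> carrier V" "set ws \<subseteq> carrier V" "length us + length ws = n" for us ws
    using b that by (simp add: multilinear_map_def)
  have ml: "multilinear_map K V 2 M (\<lambda>ws. b (take i vs @ ws @ drop (Suc i) vs))"
    if vs: "vs \<in> words V n" for vs
    unfolding multilinear_map_def
  proof (intro conjI ballI allI impI; (elim conjE)?)
    fix ws assume "ws \<in> words V 2"
    then have "take i vs @ ws @ drop (Suc i) vs \<in> words V (Suc n)"
      using vs i sub[of vs] by (auto simp: words_def)
    then show "b (take i vs @ ws @ drop (Suc i) vs) \<in> carrier M"
      using b by (auto simp: multilinear_map_def)
  next
    fix us ws assume *: "set us \<subseteq> carrier V" "set ws \<subseteq> carrier V" "Suc (length us + length ws) = 2"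
    have "linear_map K V M (\<lambda>v. b ((take i vs @ us) @ v # (ws @ drop (Suc i) vs)))"
      by (rule bl) (use vs * i sub[of vs] in \<open>auto simp: words_def\<close>)
    then show "linear_map K V M (\<lambda>v. b (take i vs @ (us @ v # ws) @ drop (Suc i) vs))" by simp
  qed
  then show "vs \<in> words V n \<Longrightarrow> multilinear_map K V 2 M (\<lambda>ws. b (take i vs @ ws @ drop (Suc i) vs))" .
  let ?E = "\<lambda>vs. tensor_lift K M (\<lambda>ws. b (take i vs @ ws @ drop (Suc i) vs))"
  show "multilinear_map K V n M (\<lambda>vs. ?E vs (D (vs ! i)))"
    unfolding multilinear_map_def
  proof (intro conjI ballI allI impI; (elim conjE)?)
    fix vs assume vs: "vs \<in> words V n"
    then have "vs ! i \<in> carrier V" using i by (auto simp: words_def)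
    then show "?E vs (D (vs ! i)) \<in> carrier M"
      using linear_map_closed[OF linear_map_multilinear_lift[OF M ml[OF vs]]] linear_map_closed[OF D]
      by simp
  next
    fix us ws assume *: "set us \<subseteq> carrier V" "set ws \<subseteq> carrier V" "Suc (length us + length ws) = n"
    have w: "us @ v # ws \<in> words V n" if "v \<in> carrier V" for v
      using * that by (simp add: words_append)
    consider "i = length us" | "i < length us" | "length us < i" by linarith
    then show "linear_map K V M (\<lambda>v. ?E (us @ v # ws) (D ((us @ v # ws) ! i)))"
    proof cases
      case 1
      show ?thesis
        by (rule linear_map_cong[OF V
              linear_map_comp[OF D linear_map_multilinear_lift[OF M ml[OF w[OF V.zero_closed]]]]])
          (simp add: 1)
    next
      case 2
      have "linear_map K V M (\<lambda>v. ?E (us @ v # ws) (D (us ! i)))"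
      proof (rule linear_map_multilinear_lift_param[OF M V])
        fix xs assume "xs \<in> words V 2"
        then have "linear_map K V M (\<lambda>v. b ((take i us @ xs @ drop (Suc i) us) @ v # ws))"
          by (intro bl) (use * 2 i sub[of us] in \<open>auto simp: words_def\<close>)
        then show "linear_map K V M (\<lambda>v. b (take i (us @ v # ws) @ xs @ drop (Suc i) (us @ v # ws)))"
          using 2 by simp
      next
        have "us ! i \<in> carrier V" using * 2 nth_mem[of i us] by auto
        then show "D (us ! i) \<in> carrier (tensor_power K V 2)" by (rule linear_map_closed[OF D])
      qed (rule ml[OF w])
      then show ?thesis using 2 by (simp add: nth_append)
    next
      case 3
      then obtain k where k: "i = Suc (length us + k)" using less_imp_Suc_add by blast
      have "linear_map K V M (\<lambda>v. ?E (us @ v # ws) (D (ws ! k)))"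
      proof (rule linear_map_multilinear_lift_param[OF M V])
        fix xs assume "xs \<in> words V 2"
        then have "linear_map K V M (\<lambda>v. b (us @ v # (take k ws @ xs @ drop (Suc k) ws)))"
          by (intro bl) (use * k i sub[of ws] in \<open>auto simp: words_def\<close>)
        then show "linear_map K V M (\<lambda>v. b (take i (us @ v # ws) @ xs @ drop (Suc i) (us @ v # ws)))"
          using k by simp
      next
        have "ws ! k \<in> carrier V" using * k i nth_mem[of k ws] by auto
        then show "D (ws ! k) \<in> carrier (tensor_power K V 2)" by (rule linear_map_closed[OF D])
      qed (rule ml[OF w])
      then show ?thesis using k by (simp add: nth_append)
    qed
  qed
qed

lemma linear_map_apply_at: "linear_map K (tensor_power K V n) (tensor_power K V (Suc n)) (apply_at K V n i D)"
  unfolding apply_at_def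
  by (rule linear_map_multilinear_lift[OF module_tensor_power
        multilinear_insert(2)[OF module_tensor_power multilinear_pure_power]])

lemma apply_at_pure: "vs \<in> words V n \<Longrightarrow> apply_at K V n i D (pure_power K V vs) =
    tensor_lift K (tensor_power K V (Suc n))
      (\<lambda>ws. pure_power K V (take i vs @ ws @ drop (Suc i) vs)) (D (vs ! i))"
  unfolding apply_at_def
  by (rule multilinear_lift_pure[OF module_tensor_power
        multilinear_insert(2)[OF module_tensor_power multilinear_pure_power]])

text \<open>Lifting after an application of \<open>D\<close> at one position is lifting with \<open>D\<close> substituted into the
  multilinear map; so identities between such applications, like coassociativity, may be tested on
  multilinear maps.\<close>

lemma multilinear_lift_apply_at:
  assumes M: "module K M" and b: "multilinear_map K V (Suc n) M b" and t: "t \<in> carrier (tensor_power K V n)"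
  shows "tensor_lift K M b (apply_at K V n i D t) =
    tensor_lift K M (\<lambda>vs. tensor_lift K M (\<lambda>ws. b (take i vs @ ws @ drop (Suc i) vs)) (D (vs ! i))) t"
proof (rule tensor_power_map_eqI[OF M _ _ _ t])
  note L = linear_map_multilinear_lift[OF M b]
  show "linear_map K (tensor_power K V n) M (\<lambda>t. tensor_lift K M b (apply_at K V n i D t))"
    by (rule linear_map_comp[OF linear_map_apply_at L])
  show "linear_map K (tensor_power K V n) M
      (tensor_lift K M (\<lambda>vs. tensor_lift K M (\<lambda>ws. b (take i vs @ ws @ drop (Suc i) vs)) (D (vs ! i))))"
    by (rule linear_map_multilinear_lift[OF M multilinear_insert(2)[OF M b]])
  fix vs assume vs: "vs \<in> words V n"
  then have "vs ! i \<in> carrier V" using i by (auto simp: words_def)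
  note pp = multilinear_insert(1)[OF module_tensor_power multilinear_pure_power vs]
  have "tensor_lift K M b (tensor_lift K (tensor_power K V (Suc n))
      (\<lambda>ws. pure_power K V (take i vs @ ws @ drop (Suc i) vs)) t) =
    tensor_lift K M (\<lambda>ws. b (take i vs @ ws @ drop (Suc i) vs)) t"
    if t: "t \<in> carrier (tensor_power K V 2)" for t
  proof (rule tensor_power_map_eqI[OF M _ _ _ t])
    fix ws assume ws: "ws \<in> words V 2"
    have "take i vs @ ws @ drop (Suc i) vs \<in> words V (Suc n)"
      using vs ws i set_take_subset[of i vs] set_drop_subset[of "Suc i" vs] by (auto simp: words_def)
    then show "tensor_lift K M b (tensor_lift K (tensor_power K V (Suc n))
          (\<lambda>ws. pure_power K V (take i vs @ ws @ drop (Suc i) vs)) (pure_power K V ws)) =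
        tensor_lift K M (\<lambda>ws. b (take i vs @ ws @ drop (Suc i) vs)) (pure_power K V ws)"
      using multilinear_lift_pure[OF module_tensor_power pp ws] multilinear_lift_pure[OF M b]
        multilinear_lift_pure[OF M multilinear_insert(1)[OF M b vs] ws] by simp
  qed (rule linear_map_comp[OF linear_map_multilinear_lift[OF module_tensor_power pp] L]
      linear_map_multilinear_lift[OF M multilinear_insert(1)[OF M b vs]])+
  then show "tensor_lift K M b (apply_at K V n i D (pure_power K V vs)) =
      tensor_lift K M (\<lambda>vs. tensor_lift K M (\<lambda>ws. b (take i vs @ ws @ drop (Suc i) vs)) (D (vs ! i)))
        (pure_power K V vs)"
    unfolding apply_at_pure[OF vs] multilinear_lift_pure[OF M multilinear_insert(2)[OF M b] vs]
    using linear_map_closed[OF D \<open>vs ! i \<in> carrier V\<close>] by simp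
qed

end

end

section \<open>The completed scalar extension\<close>

context complete_local_algebra
begin

interpretation K: field K by (rule field_K)
interpretation R: algebra K R by (rule algebra_R)
interpretation I: comm_monoid "ideals_set R" by (rule R.ideals_set_is_comm_monoid)

lemma module_R: "module K R"
  by (rule R.module)

abbreviation mpow :: "nat \<Rightarrow> 'r set" where
  "mpow n \<equiv> \<mm> [^]\<^bsub>ideals_set R\<^esub> n"

lemma max_in_ideals: "\<mm> \<in> carrier (ideals_set R)"
  using maximal by (simp add: ideals_set_def maximalideal_def)

lemma ideal_mpow: "ideal (mpow n) R"
  using I.nat_pow_closed[OF max_in_ideals, of n] by (simp add: ideals_set_def)

lemma one_ideals: "\<one>\<^bsub>ideals_set R\<^esub> = carrier R"
  by (simp add: ideals_set_def)

lemma mpow_1: "mpow (Suc 0) = \<mm>"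
  using I.nat_pow_eone[OF max_in_ideals] by simp

lemma mpow_carrier: "r \<in> mpow n \<Longrightarrow> r \<in> carrier R"
  using ideal.Icarr[OF ideal_mpow] .

lemma mpow_mult: "r \<in> mpow m \<Longrightarrow> s \<in> mpow n \<Longrightarrow> r \<otimes>\<^bsub>R\<^esub> s \<in> mpow (m + n)"
  using I.nat_pow_mult[OF max_in_ideals, of m n] ideal_prod.prod[of r "mpow m" s "mpow n" R]
  by (simp add: ideals_set_def)

lemma mpow_mono: "m \<le> n \<Longrightarrow> mpow n \<subseteq> mpow m"
proof -
  assume "m \<le> n"
  have "mpow (m + k) \<subseteq> mpow m" for k
    using I.nat_pow_mult[OF max_in_ideals, of m k] R.ideal_prod_inter[OF ideal_mpow ideal_mpow, of m k]
    by (auto simp: ideals_set_def)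
  from this[of "n - m"] show ?thesis using \<open>m \<le> n\<close> by simp
qed

text \<open>The structure map of the \<open>K\<close>-algebra \<open>R\<close>.\<close>

abbreviation scal :: "'k \<Rightarrow> 'r" where
  "scal a \<equiv> a \<odot>\<^bsub>R\<^esub> \<one>\<^bsub>R\<^esub>"

lemma scal_mult: "a \<in> carrier K \<Longrightarrow> r \<in> carrier R \<Longrightarrow> scal a \<otimes>\<^bsub>R\<^esub> r = a \<odot>\<^bsub>R\<^esub> r"
  by (simp add: R.smult_assoc2)

text \<open>An element of the uncompleted scalar extension, viewed in the completion.\<close>

definition const_hat :: "('k, 'v, 'z) module_scheme \<Rightarrow> ('v \<times> 'r \<Rightarrow> 'k) set \<Rightarrow> ('v, 'r, 'k) hat" where
  "const_hat V t = (\<lambda>n. filt V n +>\<^bsub>ext V\<^esub> t)"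

definition ext_lift :: "('k, 'w, 'u) module_scheme \<Rightarrow> ('v \<Rightarrow> ('w, 'r, 'k) hat) \<Rightarrow> ('v \<times> 'r \<Rightarrow> 'k) set
    \<Rightarrow> ('w, 'r, 'k) hat" where
  "ext_lift W c = tensor_lift K (hat_over_field W) (\<lambda>(v, r). r \<odot>\<^bsub>hat W\<^esub> c v)"

text \<open>By \<open>R\<close>-linearity and continuity, the only possible value at level \<open>n\<close> is the one on any
  representative of level \<open>n\<close>.\<close>

definition extension :: "('k, 'w, 'u) module_scheme \<Rightarrow> ('v \<Rightarrow> ('w, 'r, 'k) hat) \<Rightarrow> ('v, 'r, 'k) hat
    \<Rightarrow> ('w, 'r, 'k) hat" where
  "extension W c x = (\<lambda>n. ext_lift W c (SOME t. t \<in> x n) n)"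

lemma module_restrict_scal:
  assumes "module R M" and N: "carrier N = carrier M" "ring.zero N = ring.zero M" "ring.add N = ring.add M"
    "\<And>a x. a \<odot>\<^bsub>N\<^esub> x = scal a \<odot>\<^bsub>M\<^esub> x"
  shows "module K N"
proof -
  interpret M: module R M by fact
  have ab: "abelian_group N"
  proof (rule abelian_groupI)
    fix x assume "x \<in> carrier N"
    then have "\<ominus>\<^bsub>M\<^esub> x \<in> carrier N \<and> \<ominus>\<^bsub>M\<^esub> x \<oplus>\<^bsub>N\<^esub> x = \<zero>\<^bsub>N\<^esub>" by (simp add: N M.l_neg)
    then show "\<exists>y\<in>carrier N. y \<oplus>\<^bsub>N\<^esub> x = \<zero>\<^bsub>N\<^esub>" by blast
  qed (auto simp: N M.a_ac)
  show ?thesis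
  proof (rule moduleI[OF K.is_cring ab], unfold N)
    fix a b x assume *: "a \<in> carrier K" "b \<in> carrier K" "x \<in> carrier M"
    have "scal (a \<otimes>\<^bsub>K\<^esub> b) = scal a \<otimes>\<^bsub>R\<^esub> scal b"
      using * by (simp add: scal_mult R.smult_assoc1)
    then show "scal (a \<otimes>\<^bsub>K\<^esub> b) \<odot>\<^bsub>M\<^esub> x = scal a \<odot>\<^bsub>M\<^esub> (scal b \<odot>\<^bsub>M\<^esub> x)"
      using * by (simp add: M.smult_assoc1)
  qed (auto simp: R.smult_l_distr M.smult_l_distr M.smult_r_distr)
qed

lemma smult_mpow: "a \<in> carrier K \<Longrightarrow> r \<in> mpow n \<Longrightarrow> a \<odot>\<^bsub>R\<^esub> r \<in> mpow n"
  using ideal.I_l_closed[OF ideal_mpow, of r n "scal a"] mpow_carrier[of r n] by (simp add: scal_mult)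


subsection \<open>Scalar extension and its filtration\<close>

context
  fixes V :: "('k, 'v, 'z) module_scheme"
  assumes V: "module K V"
begin

interpretation V: module K V by (rule V)

lemma module_ext: "module K (ext V)"
  unfolding ext_def by (rule module_tensor[OF field_K V module_R])

interpretation E: module K "ext V" by (rule module_ext)

lemma pure_closed: "v \<in> carrier V \<Longrightarrow> r \<in> carrier R \<Longrightarrow> pure_tensor K V R v r \<in> carrier (ext V)"
  unfolding ext_def by (rule pure_tensor_closed[OF field_K V module_R])

lemma linear_pure:
  "v \<in> carrier V \<Longrightarrow> linear_map K R (ext V) (pure_tensor K V R v)"
  "r \<in> carrier R \<Longrightarrow> linear_map K V (ext V) (\<lambda>v. pure_tensor K V R v r)"
  unfolding ext_def by (rule linear_pure_tensor[OF field_K V module_R]; assumption)+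

lemma ext_induct [consumes 1, case_names pure add]:
  assumes "t \<in> carrier (ext V)"
    "\<And>v r. v \<in> carrier V \<Longrightarrow> r \<in> carrier R \<Longrightarrow> P (pure_tensor K V R v r)"
    "\<And>t u. t \<in> carrier (ext V) \<Longrightarrow> u \<in> carrier (ext V) \<Longrightarrow> P t \<Longrightarrow> P u \<Longrightarrow> P (t \<oplus>\<^bsub>ext V\<^esub> u)"
  shows "P t"
  using tensor_induct[OF field_K V module_R, of t P] assms unfolding ext_def by blast

lemma
  assumes "module K M" "bilinear_map K V R M b"
  shows linear_ext_lift: "linear_map K (ext V) M (tensor_lift K M b)"
    and ext_lift_pure: "v \<in> carrier V \<Longrightarrow> r \<in> carrier R \<Longrightarrow> tensor_lift K M b (pure_tensor K V R v r) = b (v, r)"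
  unfolding ext_def
  by (rule linear_map_bilinear_lift[OF field_K V module_R assms],
      rule bilinear_lift_pure[OF field_K V module_R assms])

lemma linear_R_mult: "r \<in> carrier R \<Longrightarrow> linear_map K R R (\<lambda>s. r \<otimes>\<^bsub>R\<^esub> s)"
  by (rule linear_mapI) (simp_all add: R.r_distr R.m_comm[of r] R.smult_assoc2)

lemma bilinear_ext_smult: "r \<in> carrier R \<Longrightarrow>
    bilinear_map K V R (ext V) (\<lambda>(v, s). pure_tensor K V R v (r \<otimes>\<^bsub>R\<^esub> s))"
  unfolding bilinear_map_def
  using linear_map_comp[OF linear_R_mult linear_pure(1)] linear_pure(2) by auto

lemma linear_ext_smult: "r \<in> carrier R \<Longrightarrow> linear_map K (ext V) (ext V) (ext_smult V r)"
  unfolding ext_smult_def by (rule linear_ext_lift[OF module_ext bilinear_ext_smult])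

lemma ext_smult_pure: "r \<in> carrier R \<Longrightarrow> v \<in> carrier V \<Longrightarrow> s \<in> carrier R \<Longrightarrow>
    ext_smult V r (pure_tensor K V R v s) = pure_tensor K V R v (r \<otimes>\<^bsub>R\<^esub> s)"
  unfolding ext_smult_def by (subst ext_lift_pure[OF module_ext bilinear_ext_smult]) auto

lemma ext_smult_closed: "r \<in> carrier R \<Longrightarrow> t \<in> carrier (ext V) \<Longrightarrow> ext_smult V r t \<in> carrier (ext V)"
  by (rule linear_map_closed[OF linear_ext_smult])

lemma ext_smult_r_distr: "r \<in> carrier R \<Longrightarrow> t \<in> carrier (ext V) \<Longrightarrow> u \<in> carrier (ext V) \<Longrightarrow>
    ext_smult V r (t \<oplus>\<^bsub>ext V\<^esub> u) = ext_smult V r t \<oplus>\<^bsub>ext V\<^esub> ext_smult V r u"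
  by (rule linear_map_add[OF linear_ext_smult])

lemma ext_smult_l_distr: "t \<in> carrier (ext V) \<Longrightarrow> r \<in> carrier R \<Longrightarrow> s \<in> carrier R \<Longrightarrow>
    ext_smult V (r \<oplus>\<^bsub>R\<^esub> s) t = ext_smult V r t \<oplus>\<^bsub>ext V\<^esub> ext_smult V s t"
  by (induction t rule: ext_induct)
    (simp_all add: ext_smult_pure ext_smult_r_distr ext_smult_closed R.l_distr
      linear_map_add[OF linear_pure(1)] E.a_ac)

lemma ext_smult_assoc: "t \<in> carrier (ext V) \<Longrightarrow> r \<in> carrier R \<Longrightarrow> s \<in> carrier R \<Longrightarrow>
    ext_smult V (r \<otimes>\<^bsub>R\<^esub> s) t = ext_smult V r (ext_smult V s t)"
  by (induction t rule: ext_induct)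
    (simp_all add: ext_smult_pure ext_smult_r_distr ext_smult_closed R.m_assoc)

lemma ext_smult_one: "t \<in> carrier (ext V) \<Longrightarrow> ext_smult V \<one>\<^bsub>R\<^esub> t = t"
  by (induction t rule: ext_induct) (simp_all add: ext_smult_pure ext_smult_r_distr)

lemma ext_smult_scal: "t \<in> carrier (ext V) \<Longrightarrow> a \<in> carrier K \<Longrightarrow> ext_smult V (scal a) t = a \<odot>\<^bsub>ext V\<^esub> t"
  by (induction t rule: ext_induct)
    (simp_all add: ext_smult_pure ext_smult_r_distr scal_mult E.smult_r_distr linear_map_smult[OF linear_pure(1)])

lemma filt_gens_carrier: "{pure_tensor K V R v r | v r. v \<in> carrier V \<and> r \<in> mpow n} \<subseteq> carrier (ext V)"
  using pure_closed mpow_carrier by blast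

lemma submodule_filt: "submodule (filt V n) K (ext V)"
  unfolding filt_def by (rule submodule_lin_span[OF module_ext filt_gens_carrier])

lemma filt_carrier: "t \<in> filt V n \<Longrightarrow> t \<in> carrier (ext V)"
  using E.submoduleE(1)[OF submodule_filt] by auto

lemma filt_pure: "v \<in> carrier V \<Longrightarrow> r \<in> mpow n \<Longrightarrow> pure_tensor K V R v r \<in> filt V n"
  unfolding filt_def by (rule lin_span_superset[OF module_ext]) blast

lemma filt_closed:
  "\<zero>\<^bsub>ext V\<^esub> \<in> filt V n"
  "t \<in> filt V n \<Longrightarrow> u \<in> filt V n \<Longrightarrow> t \<oplus>\<^bsub>ext V\<^esub> u \<in> filt V n"
  "a \<in> carrier K \<Longrightarrow> t \<in> filt V n \<Longrightarrow> a \<odot>\<^bsub>ext V\<^esub> t \<in> filt V n"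
  "t \<in> filt V n \<Longrightarrow> u \<in> filt V n \<Longrightarrow> t \<ominus>\<^bsub>ext V\<^esub> u \<in> filt V n"
  using E.submoduleE(3-5)[OF submodule_filt]
    subgroup.one_closed[OF submodule.axioms(1)[OF submodule_filt]]
  by (auto simp: a_minus_def)

lemma filt_induct [consumes 1, case_names pure add]:
  assumes "t \<in> filt V n"
    and pure: "\<And>v r. v \<in> carrier V \<Longrightarrow> r \<in> mpow n \<Longrightarrow> P (pure_tensor K V R v r)"
    and add: "\<And>t u. t \<in> carrier (ext V) \<Longrightarrow> u \<in> carrier (ext V) \<Longrightarrow> P t \<Longrightarrow> P u \<Longrightarrow> P (t \<oplus>\<^bsub>ext V\<^esub> u)"
  shows "P t"
proof -
  have "\<forall>a \<in> carrier K. P (a \<odot>\<^bsub>ext V\<^esub> t)"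
    using assms(1) filt_gens_carrier[of n] unfolding filt_def
  proof (induction t rule: lin_span_induct[OF module_ext, consumes 2, case_names zero gen add smult])
    case zero
    have "P (pure_tensor K V R \<zero>\<^bsub>V\<^esub> \<zero>\<^bsub>R\<^esub>)"
      using additive_subgroup.zero_closed[OF ideal.axioms(1)[OF ideal_mpow]] by (intro pure) auto
    then show ?case using linear_map_zero[OF module_R module_ext linear_pure(1)[of "\<zero>\<^bsub>V\<^esub>"]] by simp
  next
    case (gen x)
    then obtain v r where x: "x = pure_tensor K V R v r" "v \<in> carrier V" "r \<in> mpow n" by auto
    show ?case
    proof
      fix a assume "a \<in> carrier K"
      then show "P (a \<odot>\<^bsub>ext V\<^esub> x)"
        using pure[of v "a \<odot>\<^bsub>R\<^esub> r"] x smult_mpow mpow_carrier[OF x(3)]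
        by (simp add: linear_map_smult[OF linear_pure(1)])
    qed
  next
    case (add x y)
    then show ?case by (simp add: E.smult_r_distr assms(3))
  next
    case (smult a x)
    then show ?case by (simp add: E.smult_assoc1[symmetric])
  qed
  from this[rule_format, of "\<one>\<^bsub>K\<^esub>"] show ?thesis using filt_carrier[OF assms(1)] by simp
qed

lemma filt_0: "filt V 0 = carrier (ext V)"
proof
  show "carrier (ext V) \<subseteq> filt V 0"
  proof
    fix t assume "t \<in> carrier (ext V)"
    then show "t \<in> filt V 0"
      by (induction t rule: ext_induct) (auto intro: filt_pure filt_closed simp: one_ideals)
  qed
qed (use filt_carrier in auto)

lemma filt_mono: "m \<le> n \<Longrightarrow> filt V n \<subseteq> filt V m"
proof
  fix t assume "m \<le> n" "t \<in> filt V n"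
  from this(2,1) show "t \<in> filt V m"
    by (induction t rule: filt_induct) (use mpow_mono[of m n] in \<open>auto intro: filt_pure filt_closed\<close>)
qed

lemma filt_ext_smult: "t \<in> filt V n \<Longrightarrow> r \<in> mpow m \<Longrightarrow> ext_smult V r t \<in> filt V (m + n)"
  by (induction t rule: filt_induct)
    (simp_all add: ext_smult_pure mpow_carrier ext_smult_r_distr filt_closed filt_pure mpow_mult)

abbreviation cls :: "nat \<Rightarrow> ('v \<times> 'r \<Rightarrow> 'k) set \<Rightarrow> ('v \<times> 'r \<Rightarrow> 'k) set set" where
  "cls n t \<equiv> filt V n +>\<^bsub>ext V\<^esub> t"

lemmas cls_eq_iff = coset_eq_iff[OF module_ext submodule_filt]
  and cls_eq_filt_iff = coset_eq_self_iff[OF module_ext submodule_filt]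
  and cls_self = coset_self[OF module_ext submodule_filt]
  and cls_subset = coset_subset[OF module_ext submodule_filt]
  and cls_mem_iff = coset_mem_iff[OF module_ext submodule_filt]

lemma cls_mono: "m \<le> n \<Longrightarrow> t \<in> carrier (ext V) \<Longrightarrow> u \<in> carrier (ext V) \<Longrightarrow> cls n t = cls n u \<Longrightarrow> cls m t = cls m u"
  using filt_mono[of m n] by (auto simp: cls_eq_iff)

lemma cls_ext_smult_cong: "r \<in> carrier R \<Longrightarrow> t \<in> carrier (ext V) \<Longrightarrow> u \<in> carrier (ext V) \<Longrightarrow> cls n t = cls n u \<Longrightarrow>
    cls n (ext_smult V r t) = cls n (ext_smult V r u)"
  using filt_ext_smult[of "t \<ominus>\<^bsub>ext V\<^esub> u" n r 0]
  by (simp add: cls_eq_iff ext_smult_closed one_ideals linear_map_minus[OF module_ext module_ext linear_ext_smult])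


subsection \<open>The completion\<close>

lemma hat_carrier: "x \<in> carrier (hat V) \<longleftrightarrow> (\<forall>n. \<exists>t \<in> carrier (ext V). x n = cls n t) \<and> (\<forall>n. x (Suc n) \<subseteq> x n)"
  unfolding hat_def by (simp add: quotient_carrier[OF module_ext submodule_filt]) blast

lemma hat_rep:
  assumes "x \<in> carrier (hat V)"
  obtains t where "t \<in> carrier (ext V)" "x n = cls n t"
  using assms unfolding hat_carrier by blast

lemma hat_rep_mono:
  assumes x: "x \<in> carrier (hat V)" and "m \<le> n" and t: "t \<in> carrier (ext V)" "x n = cls n t"
  shows "x m = cls m t"
  using \<open>m \<le> n\<close> t(2)
proof (induction n rule: dec_induct)
  case (step k)
  obtain u where u: "u \<in> carrier (ext V)" "x k = cls k u" by (rule hat_rep[OF x])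
  have "t \<in> x k" using x step.prems cls_self[OF t(1)] unfolding hat_carrier by blast
  then have "x k = cls k t" using u cls_mem_iff t(1) by auto
  then show ?case by (rule step.IH)
qed

lemma hat_level_mono:
  assumes "x \<in> carrier (hat V)" "y \<in> carrier (hat V)" "m \<le> n" "x n = y n"
  shows "x m = y m"
proof -
  obtain t where t: "t \<in> carrier (ext V)" "x n = cls n t" by (rule hat_rep[OF assms(1)])
  show ?thesis
    using hat_rep_mono[OF assms(1,3) t] hat_rep_mono[OF assms(2,3) t(1)] assms(4) t(2) by simp
qed

text \<open>The transition maps of the inverse system are expressed by inclusion of cosets; this translates
  compatible families of representatives into that form.\<close>

lemma hat_memI:
  assumes "\<And>n. t n \<in> carrier (ext V)" "\<And>n. cls n (t (Suc n)) = cls n (t n)"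
  shows "(\<lambda>n. cls n (t n)) \<in> carrier (hat V)"
  unfolding hat_carrier
proof (intro conjI allI)
  fix n
  have "u \<in> cls n (t n)" if "u \<in> cls (Suc n) (t (Suc n))" for u
  proof -
    have u: "u \<in> carrier (ext V)" by (rule subsetD[OF cls_subset[OF assms(1)] that])
    then have "cls (Suc n) u = cls (Suc n) (t (Suc n))"
      using that cls_mem_iff[OF assms(1) u] by simp
    then have "cls n u = cls n (t n)"
      using cls_mono[OF _ u assms(1), of n "Suc n" "Suc n"] assms(2)[of n] by simp
    then show ?thesis using cls_mem_iff[OF assms(1) u] by simp
  qed
  then show "cls (Suc n) (t (Suc n)) \<subseteq> cls n (t n)" by blast
qed (use assms(1) in auto)

text \<open>Elements of the completion are determined by, and may be glued from, their levels.\<close>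

lemma hat_glue:
  assumes "\<And>n. y n \<in> carrier (hat V)" "\<And>n. y (Suc n) n = y n n"
  shows "(\<lambda>n. y n n) \<in> carrier (hat V)"
proof -
  have "\<forall>n. \<exists>t \<in> carrier (ext V). y n n = cls n t" using assms(1) by (auto simp: hat_carrier)
  then obtain t where t: "\<And>n. t n \<in> carrier (ext V)" "\<And>n. y n n = cls n (t n)" by metis
  have "cls n (t (Suc n)) = cls n (t n)" for n
    using hat_rep_mono[OF assms(1) _ t(1)[of "Suc n"] t(2)[of "Suc n"], of n] assms(2)[of n] t(2)[of n] by simp
  then have "(\<lambda>n. cls n (t n)) \<in> carrier (hat V)" by (rule hat_memI[OF t(1)])
  then show ?thesis using t(2) by simp
qed

lemma hat_zero: "\<zero>\<^bsub>hat V\<^esub> n = filt V n"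
  by (simp add: hat_def)

lemma hat_add_level: "(x \<oplus>\<^bsub>hat V\<^esub> y) n = x n <+>\<^bsub>ext V\<^esub> y n"
  by (simp add: hat_def)

lemma hat_add_rep: "t \<in> carrier (ext V) \<Longrightarrow> u \<in> carrier (ext V) \<Longrightarrow> x n = cls n t \<Longrightarrow> y n = cls n u \<Longrightarrow>
    (x \<oplus>\<^bsub>hat V\<^esub> y) n = cls n (t \<oplus>\<^bsub>ext V\<^esub> u)"
  using quotient_add[OF module_ext submodule_filt, of t u n] by (simp add: hat_def quotient_module_def)

lemma hat_smult_level: "x n = y n \<Longrightarrow> (r \<odot>\<^bsub>hat V\<^esub> x) n = (r \<odot>\<^bsub>hat V\<^esub> y) n"
  by (simp add: hat_def)

lemma hat_smult_rep: "r \<in> carrier R \<Longrightarrow> t \<in> carrier (ext V) \<Longrightarrow> x n = cls n t \<Longrightarrow>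
    (r \<odot>\<^bsub>hat V\<^esub> x) n = cls n (ext_smult V r t)"
proof -
  assume r: "r \<in> carrier R" and t: "t \<in> carrier (ext V)" and x: "x n = cls n t"
  have "(\<Union>u \<in> cls n t. cls n (ext_smult V r u)) = cls n (ext_smult V r t)"
  proof (rule coset_UN[OF module_ext submodule_filt t])
    fix u assume "u \<in> cls n t"
    then show "cls n (ext_smult V r u) = cls n (ext_smult V r t)"
      using cls_ext_smult_cong[OF r _ t] cls_mem_iff[OF t] cls_subset[OF t, of n] by blast
  qed
  then show ?thesis by (simp add: hat_def x)
qed

lemma hat_add_closed: "x \<in> carrier (hat V) \<Longrightarrow> y \<in> carrier (hat V) \<Longrightarrow> x \<oplus>\<^bsub>hat V\<^esub> y \<in> carrier (hat V)"
proof -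
  assume x: "x \<in> carrier (hat V)" and y: "y \<in> carrier (hat V)"
  then have "\<forall>n. \<exists>t \<in> carrier (ext V). x n = cls n t" "\<forall>n. \<exists>t \<in> carrier (ext V). y n = cls n t" 
    by (auto simp: hat_carrier)
  then obtain t u where t: "\<And>n. t n \<in> carrier (ext V)" "\<And>n. x n = cls n (t n)"
    and u: "\<And>n. u n \<in> carrier (ext V)" "\<And>n. y n = cls n (u n)" by metis
  have e: "x \<oplus>\<^bsub>hat V\<^esub> y = (\<lambda>n. cls n (t n \<oplus>\<^bsub>ext V\<^esub> u n))"
    by (rule HOL.ext, rule hat_add_rep[OF t(1) u(1)]; fact)
  have "cls n (t (Suc n)) = cls n (t n)" "cls n (u (Suc n)) = cls n (u n)" for n
    using hat_rep_mono[OF x _ t(1) t(2), of n "Suc n"] hat_rep_mono[OF y _ u(1) u(2), of n "Suc n"]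
      t(2)[of n] u(2)[of n] by simp_all
  then show ?thesis
    unfolding e using t u by (intro hat_memI) (auto simp flip: quotient_add[OF module_ext submodule_filt])
qed

lemma hat_smult_closed: "r \<in> carrier R \<Longrightarrow> x \<in> carrier (hat V) \<Longrightarrow> r \<odot>\<^bsub>hat V\<^esub> x \<in> carrier (hat V)"
proof -
  assume r: "r \<in> carrier R" and x: "x \<in> carrier (hat V)"
  then have "\<forall>n. \<exists>t \<in> carrier (ext V). x n = cls n t"
    by (auto simp: hat_carrier)
  then obtain t where t: "\<And>n. t n \<in> carrier (ext V)" "\<And>n. x n = cls n (t n)" by metis
  have e: "r \<odot>\<^bsub>hat V\<^esub> x = (\<lambda>n. cls n (ext_smult V r (t n)))"
    by (rule HOL.ext, rule hat_smult_rep[OF r t(1)]; fact)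
  have "cls n (t (Suc n)) = cls n (t n)" for n
    using hat_rep_mono[OF x _ t(1) t(2), of n "Suc n"] t(2)[of n] by simp
  then show ?thesis
    unfolding e using t r by (intro hat_memI cls_ext_smult_cong ext_smult_closed) auto
qed

lemma hat_zero_rep: "\<zero>\<^bsub>hat V\<^esub> n = cls n \<zero>\<^bsub>ext V\<^esub>"
  by (simp only: hat_zero quotient_zero(2)[OF module_ext submodule_filt])

lemma module_hat: "module R (hat V)"
proof (rule moduleI)
  show "cring R" by (rule R.M_cring)
  show ag: "abelian_group (hat V)"
  proof (rule abelian_groupI)
    have "(\<lambda>n. cls n \<zero>\<^bsub>ext V\<^esub>) \<in> carrier (hat V)" by (rule hat_memI) auto
    then show "\<zero>\<^bsub>hat V\<^esub> \<in> carrier (hat V)" by (simp flip: hat_zero_rep)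
    fix x assume x: "x \<in> carrier (hat V)"
    show "\<zero>\<^bsub>hat V\<^esub> \<oplus>\<^bsub>hat V\<^esub> x = x"
    proof
      fix n
      obtain t where t: "t \<in> carrier (ext V)" "x n = cls n t" by (rule hat_rep[OF x])
      show "(\<zero>\<^bsub>hat V\<^esub> \<oplus>\<^bsub>hat V\<^esub> x) n = x n"
        using hat_add_rep[where t = "\<zero>\<^bsub>ext V\<^esub>" and u = t and x = "\<zero>\<^bsub>hat V\<^esub>" and n = n and y = x] t hat_zero_rep by simp
    qed
    let ?y = "(\<ominus>\<^bsub>R\<^esub> \<one>\<^bsub>R\<^esub>) \<odot>\<^bsub>hat V\<^esub> x"
    have "?y \<oplus>\<^bsub>hat V\<^esub> x = \<zero>\<^bsub>hat V\<^esub>"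
    proof
      fix n
      obtain t where t: "t \<in> carrier (ext V)" "x n = cls n t" by (rule hat_rep[OF x])
      have "ext_smult V (\<ominus>\<^bsub>R\<^esub> \<one>\<^bsub>R\<^esub>) t \<oplus>\<^bsub>ext V\<^esub> t = ext_smult V (\<ominus>\<^bsub>R\<^esub> \<one>\<^bsub>R\<^esub> \<oplus>\<^bsub>R\<^esub> \<one>\<^bsub>R\<^esub>) t"
        using t(1) by (simp only: ext_smult_l_distr R.a_inv_closed R.one_closed ext_smult_one)
      also have "\<dots> = ext_smult V (scal \<zero>\<^bsub>K\<^esub>) t" by (simp add: R.l_neg)
      also have "\<dots> = \<zero>\<^bsub>ext V\<^esub>" using t(1) by (simp only: ext_smult_scal K.zero_closed E.smult_l_null)
      finally show "(?y \<oplus>\<^bsub>hat V\<^esub> x) n = \<zero>\<^bsub>hat V\<^esub> n"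
        using hat_add_rep[where x = ?y and y = x and n = n and t = "ext_smult V (\<ominus>\<^bsub>R\<^esub> \<one>\<^bsub>R\<^esub>) t", OF _ t(1) _ t(2)]
          hat_smult_rep[where x = x and n = n, OF _ t, of "\<ominus>\<^bsub>R\<^esub> \<one>\<^bsub>R\<^esub>"] t(1)
        by (simp add: ext_smult_closed hat_zero_rep)
    qed
    then show "\<exists>y\<in>carrier (hat V). y \<oplus>\<^bsub>hat V\<^esub> x = \<zero>\<^bsub>hat V\<^esub>" using x by (intro bexI[of _ ?y] hat_smult_closed) auto
    fix y assume y: "y \<in> carrier (hat V)"
    show "x \<oplus>\<^bsub>hat V\<^esub> y = y \<oplus>\<^bsub>hat V\<^esub> x"
    proof
      fix n
      obtain t where t: "t \<in> carrier (ext V)" "x n = cls n t" by (rule hat_rep[OF x])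
      obtain u where u: "u \<in> carrier (ext V)" "y n = cls n u" by (rule hat_rep[OF y])
      show "(x \<oplus>\<^bsub>hat V\<^esub> y) n = (y \<oplus>\<^bsub>hat V\<^esub> x) n"
        using hat_add_rep[of t u x n y] hat_add_rep[of u t y n x] t u by (simp add: E.a_comm)
    qed
    fix z assume z: "z \<in> carrier (hat V)"
    show "x \<oplus>\<^bsub>hat V\<^esub> y \<oplus>\<^bsub>hat V\<^esub> z = x \<oplus>\<^bsub>hat V\<^esub> (y \<oplus>\<^bsub>hat V\<^esub> z)"
    proof
      fix n
      obtain t where t: "t \<in> carrier (ext V)" "x n = cls n t" by (rule hat_rep[OF x])
      obtain u where u: "u \<in> carrier (ext V)" "y n = cls n u" by (rule hat_rep[OF y])
      obtain w where w: "w \<in> carrier (ext V)" "z n = cls n w" by (rule hat_rep[OF z])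
      show "(x \<oplus>\<^bsub>hat V\<^esub> y \<oplus>\<^bsub>hat V\<^esub> z) n = (x \<oplus>\<^bsub>hat V\<^esub> (y \<oplus>\<^bsub>hat V\<^esub> z)) n"
        using hat_add_rep[of "t \<oplus>\<^bsub>ext V\<^esub> u" w "x \<oplus>\<^bsub>hat V\<^esub> y" n z] hat_add_rep[of t u x n y]
          hat_add_rep[of t "u \<oplus>\<^bsub>ext V\<^esub> w" x n "y \<oplus>\<^bsub>hat V\<^esub> z"] hat_add_rep[of u w y n z] t u w by (simp add: E.a_assoc)
    qed
  qed (rule hat_add_closed)
  fix r x assume r: "r \<in> carrier R" and x: "x \<in> carrier (hat V)"
  show "r \<odot>\<^bsub>hat V\<^esub> x \<in> carrier (hat V)" using r x by (rule hat_smult_closed)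
  {
    fix s assume s: "s \<in> carrier R"
    show "(r \<oplus>\<^bsub>R\<^esub> s) \<odot>\<^bsub>hat V\<^esub> x = r \<odot>\<^bsub>hat V\<^esub> x \<oplus>\<^bsub>hat V\<^esub> s \<odot>\<^bsub>hat V\<^esub> x"
    proof
      fix n
      obtain t where t: "t \<in> carrier (ext V)" "x n = cls n t" by (rule hat_rep[OF x])
      show "((r \<oplus>\<^bsub>R\<^esub> s) \<odot>\<^bsub>hat V\<^esub> x) n = (r \<odot>\<^bsub>hat V\<^esub> x \<oplus>\<^bsub>hat V\<^esub> s \<odot>\<^bsub>hat V\<^esub> x) n"
        using hat_add_rep[of "ext_smult V r t" "ext_smult V s t" "r \<odot>\<^bsub>hat V\<^esub> x" n "s \<odot>\<^bsub>hat V\<^esub> x"] r s t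
        by (simp add: hat_smult_rep[of _ t x n] ext_smult_closed ext_smult_l_distr)
    qed
    show "(r \<otimes>\<^bsub>R\<^esub> s) \<odot>\<^bsub>hat V\<^esub> x = r \<odot>\<^bsub>hat V\<^esub> (s \<odot>\<^bsub>hat V\<^esub> x)"
    proof
      fix n
      obtain t where t: "t \<in> carrier (ext V)" "x n = cls n t" by (rule hat_rep[OF x])
      show "((r \<otimes>\<^bsub>R\<^esub> s) \<odot>\<^bsub>hat V\<^esub> x) n = (r \<odot>\<^bsub>hat V\<^esub> (s \<odot>\<^bsub>hat V\<^esub> x)) n"
        using hat_smult_rep[of r "ext_smult V s t" "s \<odot>\<^bsub>hat V\<^esub> x" n] r s t
        by (simp add: hat_smult_rep[of _ t x n] ext_smult_closed ext_smult_assoc)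
    qed
  }
  fix y assume y: "y \<in> carrier (hat V)"
  show "r \<odot>\<^bsub>hat V\<^esub> (x \<oplus>\<^bsub>hat V\<^esub> y) = r \<odot>\<^bsub>hat V\<^esub> x \<oplus>\<^bsub>hat V\<^esub> r \<odot>\<^bsub>hat V\<^esub> y"
  proof
    fix n
    obtain t where t: "t \<in> carrier (ext V)" "x n = cls n t" by (rule hat_rep[OF x])
    obtain u where u: "u \<in> carrier (ext V)" "y n = cls n u" by (rule hat_rep[OF y])
    show "(r \<odot>\<^bsub>hat V\<^esub> (x \<oplus>\<^bsub>hat V\<^esub> y)) n = (r \<odot>\<^bsub>hat V\<^esub> x \<oplus>\<^bsub>hat V\<^esub> r \<odot>\<^bsub>hat V\<^esub> y) n"
      using hat_add_rep[of "ext_smult V r t" "ext_smult V r u" "r \<odot>\<^bsub>hat V\<^esub> x" n "r \<odot>\<^bsub>hat V\<^esub> y"]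
        hat_smult_rep[of r "t \<oplus>\<^bsub>ext V\<^esub> u" "x \<oplus>\<^bsub>hat V\<^esub> y" n] hat_add_rep[of t u x n y] r t u
      by (simp add: hat_smult_rep[of r t x n] hat_smult_rep[of r u y n] ext_smult_closed ext_smult_r_distr)
  qed
next
  fix x assume x: "x \<in> carrier (hat V)"
  show "\<one>\<^bsub>R\<^esub> \<odot>\<^bsub>hat V\<^esub> x = x"
  proof
    fix n
    obtain t where t: "t \<in> carrier (ext V)" "x n = cls n t" by (rule hat_rep[OF x])
    show "(\<one>\<^bsub>R\<^esub> \<odot>\<^bsub>hat V\<^esub> x) n = x n" using hat_smult_rep[of "\<one>\<^bsub>R\<^esub>" t x n] t by (simp add: ext_smult_one)
  qed
qed

lemma hat_over_field_simps:
  "carrier (hat_over_field V) = carrier (hat V)"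
  "\<zero>\<^bsub>hat_over_field V\<^esub> = \<zero>\<^bsub>hat V\<^esub>"
  "x \<oplus>\<^bsub>hat_over_field V\<^esub> y = x \<oplus>\<^bsub>hat V\<^esub> y"
  "a \<odot>\<^bsub>hat_over_field V\<^esub> x = scal a \<odot>\<^bsub>hat V\<^esub> x"
  "\<ominus>\<^bsub>hat_over_field V\<^esub> x = \<ominus>\<^bsub>hat V\<^esub> x"
  "x \<ominus>\<^bsub>hat_over_field V\<^esub> y = x \<ominus>\<^bsub>hat V\<^esub> y"
  by (simp_all add: hat_over_field_def a_minus_def a_inv_def m_inv_def)

lemma module_hat_over_field: "module K (hat_over_field V)"
  by (rule module_restrict_scal[OF module_hat]) (simp_all add: hat_over_field_def)

interpretation H: module R "hat V" by (rule module_hat)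

lemma hat_level_linear: "linear_map K (hat_over_field V) (quotient_module (ext V) (filt V n)) (\<lambda>x. x n)"
proof (rule linear_mapI; unfold hat_over_field_simps)
  fix x assume x: "x \<in> carrier (hat V)"
  obtain t where t: "t \<in> carrier (ext V)" "x n = cls n t" by (rule hat_rep[OF x])
  show "x n \<in> carrier (quotient_module (ext V) (filt V n))"
    using t quotient_mem[OF module_ext submodule_filt] by simp
  show "(x \<oplus>\<^bsub>hat V\<^esub> y) n = x n \<oplus>\<^bsub>quotient_module (ext V) (filt V n)\<^esub> y n" for y
    by (simp add: hat_add_level quotient_module_def)
  show "(scal a \<odot>\<^bsub>hat V\<^esub> x) n = a \<odot>\<^bsub>quotient_module (ext V) (filt V n)\<^esub> x n" if "a \<in> carrier K" for a
    using that t by (simp add: hat_smult_rep ext_smult_scal quotient_smult[OF module_ext submodule_filt])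
qed

lemmas module_level = module_quotient[OF module_ext submodule_filt]

lemma hat_level_minus: "x \<in> carrier (hat V) \<Longrightarrow> y \<in> carrier (hat V) \<Longrightarrow>
    (x \<ominus>\<^bsub>hat V\<^esub> y) n = x n \<ominus>\<^bsub>quotient_module (ext V) (filt V n)\<^esub> y n"
  using linear_map_minus[OF module_hat_over_field module_level hat_level_linear, of x y n]
  by (simp add: hat_over_field_simps)

lemma hat_level_eq_iff: "x \<in> carrier (hat V) \<Longrightarrow> y \<in> carrier (hat V) \<Longrightarrow>
    x n = y n \<longleftrightarrow> (x \<ominus>\<^bsub>hat V\<^esub> y) n = \<zero>\<^bsub>hat V\<^esub> n"
proof -
  assume x: "x \<in> carrier (hat V)" and y: "y \<in> carrier (hat V)"
  interpret L: module K "quotient_module (ext V) (filt V n)" by (rule module_level)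
  show ?thesis
    using L.minus_eq_zero_iff[of "x n" "y n"] linear_map_closed[OF hat_level_linear, of _ n] x y
    by (simp add: hat_level_minus hat_zero quotient_zero(1)[OF module_ext submodule_filt] hat_over_field_simps)
qed

lemma hat_level_zero_iff: "x \<in> carrier (hat V) \<Longrightarrow> t \<in> carrier (ext V) \<Longrightarrow> x n = cls n t \<Longrightarrow>
    x n = \<zero>\<^bsub>hat V\<^esub> n \<longleftrightarrow> t \<in> filt V n"
  by (simp add: hat_zero cls_eq_filt_iff)

lemma hat_level_0: "x \<in> carrier (hat V) \<Longrightarrow> x 0 = \<zero>\<^bsub>hat V\<^esub> 0"
proof -
  assume x: "x \<in> carrier (hat V)"
  obtain t where t: "t \<in> carrier (ext V)" "x 0 = cls 0 t" by (rule hat_rep[OF x])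
  then show ?thesis using hat_level_zero_iff[OF x t] filt_0 by blast
qed

lemma hat_level_add_zero: "x \<in> carrier (hat V) \<Longrightarrow> y \<in> carrier (hat V) \<Longrightarrow>
    x n = \<zero>\<^bsub>hat V\<^esub> n \<Longrightarrow> y n = \<zero>\<^bsub>hat V\<^esub> n \<Longrightarrow> (x \<oplus>\<^bsub>hat V\<^esub> y) n = \<zero>\<^bsub>hat V\<^esub> n"
  by (metis H.l_zero H.zero_closed hat_add_level)

lemma hat_smult_mpow:
  assumes r: "r \<in> mpow m" and x: "x \<in> carrier (hat V)" "x n = \<zero>\<^bsub>hat V\<^esub> n"
  shows "(r \<odot>\<^bsub>hat V\<^esub> x) (m + n) = \<zero>\<^bsub>hat V\<^esub> (m + n)"
proof -
  obtain t where t: "t \<in> carrier (ext V)" "x (m + n) = cls (m + n) t" by (rule hat_rep[OF x(1)])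
  have "x n = cls n t" by (rule hat_rep_mono[OF x(1) _ t]) simp
  then have "t \<in> filt V n" using hat_level_zero_iff[OF x(1) t(1), of n] \<open>x n = cls n t\<close> x(2) by simp
  then have "ext_smult V r t \<in> filt V (m + n)" by (rule filt_ext_smult[OF _ r])
  then show ?thesis
    using t r by (simp add: hat_smult_rep[where x = x and n = "m + n", OF mpow_carrier[OF r] t] hat_zero cls_eq_filt_iff
        ext_smult_closed mpow_carrier)
qed


subsection \<open>Density of the uncompleted scalar extension\<close>

lemma const_hat_closed: "t \<in> carrier (ext V) \<Longrightarrow> const_hat V t \<in> carrier (hat V)"
  unfolding const_hat_def by (rule hat_memI) auto

lemma const_hat_add: "t \<in> carrier (ext V) \<Longrightarrow> u \<in> carrier (ext V) \<Longrightarrow>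
    const_hat V (t \<oplus>\<^bsub>ext V\<^esub> u) = const_hat V t \<oplus>\<^bsub>hat V\<^esub> const_hat V u"
  by (rule HOL.ext) (subst hat_add_rep, auto simp: const_hat_def)

lemma const_hat_smult: "t \<in> carrier (ext V) \<Longrightarrow> r \<in> carrier R \<Longrightarrow>
    const_hat V (ext_smult V r t) = r \<odot>\<^bsub>hat V\<^esub> const_hat V t"
  by (rule HOL.ext) (subst hat_smult_rep, auto simp: const_hat_def)

lemma incl_const_hat: "incl V v = const_hat V (pure_tensor K V R v \<one>\<^bsub>R\<^esub>)"
  by (simp add: incl_def const_hat_def)

lemma incl_closed: "v \<in> carrier V \<Longrightarrow> incl V v \<in> carrier (hat V)"
  by (simp add: incl_const_hat const_hat_closed pure_closed)

lemma const_hat_pure: "v \<in> carrier V \<Longrightarrow> r \<in> carrier R \<Longrightarrow>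
    const_hat V (pure_tensor K V R v r) = r \<odot>\<^bsub>hat V\<^esub> incl V v"
  using const_hat_smult[of "pure_tensor K V R v \<one>\<^bsub>R\<^esub>" r]
  by (simp add: pure_closed ext_smult_pure incl_const_hat)

lemma linear_incl: "linear_map K V (hat_over_field V) (incl V)"
  by (rule linear_mapI)
    (simp_all add: hat_over_field_simps incl_closed incl_const_hat const_hat_closed const_hat_add[symmetric] pure_closed
      linear_map_add[OF linear_pure(2)] linear_map_smult[OF linear_pure(2)] ext_smult_scal
      const_hat_smult[symmetric])

lemma hat_approx:
  assumes "x \<in> carrier (hat V)"
  obtains t where "t \<in> carrier (ext V)" "x n = const_hat V t n"
  using hat_rep[OF assms, of n] by (auto simp: const_hat_def)

end


subsection \<open>Continuous linear maps\<close>

definition continuous_hat :: "('k, 'v, 'z) module_scheme \<Rightarrow> (('v, 'r, 'k) hat \<Rightarrow> ('w, 'r, 'k) hat) \<Rightarrow> bool" where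
  "continuous_hat V f \<longleftrightarrow>
    (\<forall>x \<in> carrier (hat V). \<forall>n. \<exists>N. \<forall>y \<in> carrier (hat V). y N = x N \<longrightarrow> f y n = f x n)"

context
  fixes V :: "('k, 'v, 'z) module_scheme" and W :: "('k, 'w, 'u) module_scheme"
  assumes V: "module K V" and W: "module K W"
begin

interpretation V: module K V by (rule V)
interpretation W: module K W by (rule W)
interpretation EV: module K "ext V" by (rule module_ext[OF V])
interpretation HV: module R "hat V" by (rule module_hat[OF V])
interpretation HW: module R "hat W" by (rule module_hat[OF W])

lemma linear_R_imp_K: "linear_map R (hat V) (hat W) f \<Longrightarrow> linear_map K (hat_over_field V) (hat_over_field W) f"
  by (rule linear_mapI)
    (simp_all add: hat_over_field_simps V W linear_map_closed linear_map_add linear_map_smult)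

text \<open>A continuous linear map does not lower the level: elements of level zero are limits of
  sums of \<open>r \<cdot> v\<close> with \<open>r \<in> \<mm>\<^sup>n\<close>, and linearity moves the coefficient \<open>r\<close> to the image.\<close>

lemma continuous_level_zero:
  assumes f: "linear_map R (hat V) (hat W) f" "continuous_hat V f"
    and x: "x \<in> carrier (hat V)" "x n = \<zero>\<^bsub>hat V\<^esub> n"
  shows "f x n = \<zero>\<^bsub>hat W\<^esub> n"
proof -
  obtain N where N: "\<And>y. y \<in> carrier (hat V) \<Longrightarrow> y N = x N \<Longrightarrow> f y n = f x n"
    using f(2)[unfolded continuous_hat_def, rule_format, OF x(1), of n] by auto
  define N' where "N' = max n N"
  obtain t where t: "t \<in> carrier (ext V)" "x N' = const_hat V t N'" by (rule hat_approx[OF V x(1)])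
  note c = const_hat_closed[OF V t(1)]
  have "x N = const_hat V t N" "x n = const_hat V t n"
    using hat_level_mono[OF V x(1) c _ t(2)] by (auto simp: N'_def)
  then have "f x n = f (const_hat V t) n" "t \<in> filt V n"
    using N[OF c] hat_level_zero_iff[OF V x(1) t(1), of n] x(2) by (auto simp: const_hat_def)
  from this(2) have "f (const_hat V t) n = \<zero>\<^bsub>hat W\<^esub> n"
  proof (induction t rule: filt_induct[OF V, consumes 1, case_names pure add])
    case (pure v r)
    note iv = incl_closed[OF V pure(1)]
    have "f (const_hat V (pure_tensor K V R v r)) = r \<odot>\<^bsub>hat W\<^esub> f (incl V v)"
      using pure mpow_carrier by (simp add: const_hat_pure[OF V] linear_map_smult[OF f(1)] iv)
    then show ?case
      using hat_smult_mpow[OF W pure(2) linear_map_closed[OF f(1) iv] hat_level_0[OF W linear_map_closed[OF f(1) iv]]]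
      by simp
  next
    case (add t u)
    then show ?case
      using hat_level_add_zero[OF W, of "f (const_hat V t)" "f (const_hat V u)" n]
      by (simp add: const_hat_add[OF V] linear_map_add[OF f(1)] const_hat_closed[OF V] linear_map_closed[OF f(1)])
  qed
  then show ?thesis using \<open>f x n = f (const_hat V t) n\<close> by simp
qed

lemma continuous_level_cong:
  assumes f: "linear_map R (hat V) (hat W) f" "continuous_hat V f"
    and x: "x \<in> carrier (hat V)" "y \<in> carrier (hat V)" "x n = y n"
  shows "f x n = f y n"
proof -
  have "f (x \<ominus>\<^bsub>hat V\<^esub> y) n = \<zero>\<^bsub>hat W\<^esub> n"
    using x hat_level_eq_iff[OF V x(1,2)] by (intro continuous_level_zero[OF f]) auto
  then show ?thesis
    using hat_level_eq_iff[OF W, of "f x" "f y" n] x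
    by (simp add: linear_map_minus[OF module_hat[OF V] module_hat[OF W] f(1)] linear_map_closed[OF f(1)])
qed

text \<open>Two continuous linear maps that agree on \<open>V\<close> agree, since \<open>V\<close> spans a dense \<open>R\<close>-submodule.\<close>

lemma continuous_linear_eqI:
  assumes f: "linear_map R (hat V) (hat W) f" "continuous_hat V f"
    and g: "linear_map R (hat V) (hat W) g" "continuous_hat V g"
    and eq: "\<And>v. v \<in> carrier V \<Longrightarrow> f (incl V v) n = g (incl V v) n"
    and x: "x \<in> carrier (hat V)"
  shows "f x n = g x n"
proof -
  obtain t where t: "t \<in> carrier (ext V)" "x n = const_hat V t n" by (rule hat_approx[OF V x])
  from t(1) have "f (const_hat V t) n = g (const_hat V t) n"
  proof (induction t rule: ext_induct[OF V, consumes 1, case_names pure add])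
    case (pure v r)
    then show ?case
      using hat_smult_level[where x = "f (incl V v)" and y = "g (incl V v)" and n = n, OF W eq[OF pure(1)]]
      by (simp add: const_hat_pure[OF V] linear_map_smult[OF f(1)] linear_map_smult[OF g(1)] incl_closed[OF V])
  next
    case (add t u)
    then show ?case
      by (simp add: const_hat_add[OF V] linear_map_add[OF f(1)] linear_map_add[OF g(1)] const_hat_closed[OF V]
          hat_add_level[OF W])
  qed
  then show ?thesis
    using continuous_level_cong[OF f x const_hat_closed[OF V t(1)] t(2)]
      continuous_level_cong[OF g x const_hat_closed[OF V t(1)] t(2)] by simp
qed

text \<open>Every linear map on \<open>V\<close> extends to the completion.\<close>

context
  fixes c :: "'v \<Rightarrow> ('w, 'r, 'k) hat"
  assumes c: "linear_map K V (hat_over_field W) c"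
begin

lemma c_closed: "v \<in> carrier V \<Longrightarrow> c v \<in> carrier (hat W)"
  using linear_map_closed[OF c] by (simp add: hat_over_field_simps W)

lemma bilinear_ext_lift: "bilinear_map K V R (hat_over_field W) (\<lambda>(v, r). r \<odot>\<^bsub>hat W\<^esub> c v)"
  unfolding bilinear_map_def prod.case
proof (intro conjI ballI; rule linear_mapI)
  fix v r assume v: "v \<in> carrier V" and r: "r \<in> carrier R"
  show "(a \<odot>\<^bsub>R\<^esub> r) \<odot>\<^bsub>hat W\<^esub> c v = a \<odot>\<^bsub>hat_over_field W\<^esub> (r \<odot>\<^bsub>hat W\<^esub> c v)" if "a \<in> carrier K" for a
    using v r that by (simp add: hat_over_field_simps W c_closed HW.smult_assoc1[symmetric] scal_mult)
  show "r \<odot>\<^bsub>hat W\<^esub> c (a \<odot>\<^bsub>V\<^esub> v) = a \<odot>\<^bsub>hat_over_field W\<^esub> (r \<odot>\<^bsub>hat W\<^esub> c v)" if "a \<in> carrier K" for a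
    using v r that
    by (simp add: hat_over_field_simps W c_closed HW.smult_assoc1[symmetric] linear_map_smult[OF c] R.m_comm)
qed (simp_all add: hat_over_field_simps W c_closed HW.smult_l_distr HW.smult_r_distr linear_map_add[OF c])

lemma linear_K_ext_lift: "linear_map K (ext V) (hat_over_field W) (ext_lift W c)"
  unfolding ext_lift_def by (rule linear_ext_lift[OF V module_hat_over_field[OF W] bilinear_ext_lift])

lemma ext_lift_pure_tensor: "v \<in> carrier V \<Longrightarrow> r \<in> carrier R \<Longrightarrow>
    ext_lift W c (pure_tensor K V R v r) = r \<odot>\<^bsub>hat W\<^esub> c v"
  unfolding ext_lift_def by (simp add: ext_lift_pure[OF V module_hat_over_field[OF W] bilinear_ext_lift])

lemma ext_lift_closed: "t \<in> carrier (ext V) \<Longrightarrow> ext_lift W c t \<in> carrier (hat W)"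
  using linear_map_closed[OF linear_K_ext_lift] by (simp add: hat_over_field_simps W)

lemma ext_lift_add: "t \<in> carrier (ext V) \<Longrightarrow> u \<in> carrier (ext V) \<Longrightarrow>
    ext_lift W c (t \<oplus>\<^bsub>ext V\<^esub> u) = ext_lift W c t \<oplus>\<^bsub>hat W\<^esub> ext_lift W c u"
  using linear_map_add[OF linear_K_ext_lift] by (simp add: hat_over_field_simps W)

lemma ext_lift_minus: "t \<in> carrier (ext V) \<Longrightarrow> u \<in> carrier (ext V) \<Longrightarrow>
    ext_lift W c (t \<ominus>\<^bsub>ext V\<^esub> u) = ext_lift W c t \<ominus>\<^bsub>hat W\<^esub> ext_lift W c u"
  using linear_map_minus[OF module_ext[OF V] module_hat_over_field[OF W] linear_K_ext_lift]
  by (simp add: hat_over_field_simps W)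

lemma ext_lift_smult: "t \<in> carrier (ext V) \<Longrightarrow> r \<in> carrier R \<Longrightarrow>
    ext_lift W c (ext_smult V r t) = r \<odot>\<^bsub>hat W\<^esub> ext_lift W c t"
  by (induction t rule: ext_induct[OF V, consumes 1, case_names pure add])
    (simp_all add: ext_smult_pure[OF V] ext_lift_pure_tensor HW.smult_assoc1 c_closed ext_smult_r_distr[OF V]
      ext_lift_add ext_smult_closed[OF V] ext_lift_closed HW.smult_r_distr)

text \<open>This is the reason why the extension is well defined on cosets, level by level.\<close>

lemma ext_lift_filt: "t \<in> filt V n \<Longrightarrow> ext_lift W c t n = \<zero>\<^bsub>hat W\<^esub> n"
proof (induction t rule: filt_induct[OF V, consumes 1, case_names pure add])
  case (pure v r)
  then show ?case
    using hat_smult_mpow[OF W pure(2) c_closed[OF pure(1)] hat_level_0[OF W c_closed[OF pure(1)]]]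
    by (simp add: ext_lift_pure_tensor mpow_carrier)
qed (simp add: ext_lift_add hat_level_add_zero[OF W] ext_lift_closed)

lemma extension_rep:
  assumes t: "t \<in> carrier (ext V)" "x n = const_hat V t n"
  shows "extension W c x n = ext_lift W c t n"
proof -
  let ?u = "SOME u. u \<in> x n"
  have "?u \<in> x n" by (rule someI[of _ t]) (simp add: t const_hat_def cls_self[OF V])
  then have u: "?u \<in> carrier (ext V)" "?u \<ominus>\<^bsub>ext V\<^esub> t \<in> filt V n"
    using t(2) subsetD[OF cls_subset[OF V t(1), of n], of ?u] cls_mem_iff[OF V t(1), of ?u n]
      cls_eq_iff[OF V _ t(1), of ?u n] by (simp_all add: const_hat_def)
  then show ?thesis
    using ext_lift_filt[OF u(2)] hat_level_eq_iff[OF W, of "ext_lift W c ?u" "ext_lift W c t" n] t(1)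
    by (simp add: extension_def ext_lift_closed ext_lift_minus)
qed

lemma extension_closed: "x \<in> carrier (hat V) \<Longrightarrow> extension W c x \<in> carrier (hat W)"
proof -
  assume x: "x \<in> carrier (hat V)"
  then have "\<forall>n. \<exists>t \<in> carrier (ext V). x n = const_hat V t n" by (metis hat_approx[OF V])
  then obtain t where t: "\<And>n. t n \<in> carrier (ext V)" "\<And>n. x n = const_hat V (t n) n" by metis
  have e: "extension W c x = (\<lambda>n. ext_lift W c (t n) n)" by (rule HOL.ext) (rule extension_rep; fact)
  show ?thesis unfolding e
  proof (rule hat_glue[where y = "\<lambda>n. ext_lift W c (t n)", OF W])
    fix n
    have "x n = const_hat V (t (Suc n)) n"
      using hat_level_mono[OF V x const_hat_closed[OF V t(1)] _ t(2)[of "Suc n"], of n] by simp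
    then show "ext_lift W c (t (Suc n)) n = ext_lift W c (t n) n"
      using extension_rep[where x = x and n = n, OF t(1)[of "Suc n"]]
        extension_rep[where x = x and n = n, OF t(1)[of n] t(2)[of n]] by simp
  qed (rule ext_lift_closed[OF t(1)])
qed

lemma linear_extension: "linear_map R (hat V) (hat W) (extension W c)"
proof (rule linear_mapI)
  fix x assume x: "x \<in> carrier (hat V)"
  show "extension W c x \<in> carrier (hat W)" by (rule extension_closed[OF x])
  show "extension W c (r \<odot>\<^bsub>hat V\<^esub> x) = r \<odot>\<^bsub>hat W\<^esub> extension W c x" if r: "r \<in> carrier R" for r
  proof
    fix n
    obtain t where t: "t \<in> carrier (ext V)" "x n = const_hat V t n" by (rule hat_approx[OF V x])
    have "(r \<odot>\<^bsub>hat V\<^esub> x) n = const_hat V (ext_smult V r t) n"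
      using hat_smult_level[where x = x and n = n and y = "const_hat V t", OF V t(2)] const_hat_smult[OF V t(1) r] by simp
    then have "extension W c (r \<odot>\<^bsub>hat V\<^esub> x) n = (r \<odot>\<^bsub>hat W\<^esub> ext_lift W c t) n"
      using extension_rep[OF ext_smult_closed[OF V r t(1)]] ext_lift_smult[OF t(1) r] by simp
    also have "\<dots> = (r \<odot>\<^bsub>hat W\<^esub> extension W c x) n"
      by (rule hat_smult_level[OF W]) (simp add: extension_rep[where x = x and n = n, OF t])
    finally show "extension W c (r \<odot>\<^bsub>hat V\<^esub> x) n = (r \<odot>\<^bsub>hat W\<^esub> extension W c x) n" .
  qed
  fix y assume y: "y \<in> carrier (hat V)"
  show "extension W c (x \<oplus>\<^bsub>hat V\<^esub> y) = extension W c x \<oplus>\<^bsub>hat W\<^esub> extension W c y"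
  proof
    fix n
    obtain t where t: "t \<in> carrier (ext V)" "x n = const_hat V t n" by (rule hat_approx[OF V x])
    obtain u where u: "u \<in> carrier (ext V)" "y n = const_hat V u n" by (rule hat_approx[OF V y])
    have "(x \<oplus>\<^bsub>hat V\<^esub> y) n = const_hat V (t \<oplus>\<^bsub>ext V\<^esub> u) n"
      using t u by (simp add: const_hat_add[OF V] hat_add_level[OF V])
    then show "extension W c (x \<oplus>\<^bsub>hat V\<^esub> y) n = (extension W c x \<oplus>\<^bsub>hat W\<^esub> extension W c y) n"
      using extension_rep[where t = "t \<oplus>\<^bsub>ext V\<^esub> u" and x = "x \<oplus>\<^bsub>hat V\<^esub> y" and n = n] t u
      by (simp add: ext_lift_add hat_add_level[OF W] extension_rep[where x = x and n = n, OF t] extension_rep[where x = y and n = n, OF u])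
  qed
qed

lemma extension_level: "x \<in> carrier (hat V) \<Longrightarrow> y n = x n \<Longrightarrow> extension W c y n = extension W c x n"
  by (simp add: extension_def)

lemma continuous_extension: "continuous_hat V (extension W c)"
  unfolding continuous_hat_def using extension_level by blast

lemma extension_incl: "v \<in> carrier V \<Longrightarrow> extension W c (incl V v) = c v"
proof
  fix n assume v: "v \<in> carrier V"
  show "extension W c (incl V v) n = c v n"
    using extension_rep[where t = "pure_tensor K V R v \<one>\<^bsub>R\<^esub>" and x = "incl V v" and n = n] v
    by (simp add: pure_closed[OF V] incl_const_hat[OF V] ext_lift_pure_tensor c_closed)
qed

end

end

end

lemma compose_eq_iff: "compose A f g = compose A h k \<longleftrightarrow> (\<forall>x \<in> A. f (g x) = h (k x))"
proof
  assume e: "compose A f g = compose A h k"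
  show "\<forall>x \<in> A. f (g x) = h (k x)"
  proof
    fix x assume "x \<in> A"
    then show "f (g x) = h (k x)" using fun_cong[OF e, of x] by (simp add: compose_def)
  qed
qed (auto simp: compose_def restrict_def fun_eq_iff)

context complete_local_algebra
begin

interpretation K: field K by (rule field_K)
interpretation R: algebra K R by (rule algebra_R)

subsection \<open>Reduction modulo the maximal ideal\<close>

interpretation Max: maximalideal \<mm> R by (rule maximal)

lemma scal_closed: "a \<in> carrier K \<Longrightarrow> scal a \<in> carrier R"
  by simp

lemma coset_max_eq_iff: "r \<in> carrier R \<Longrightarrow> s \<in> carrier R \<Longrightarrow> \<mm> +>\<^bsub>R\<^esub> r = \<mm> +>\<^bsub>R\<^esub> s \<longleftrightarrow> r \<ominus>\<^bsub>R\<^esub> s \<in> \<mm>"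
  using Max.a_rcos_module[of s r] Max.a_repr_independence'[of r s] Max.a_rcos_self
  by (auto simp: a_minus_def)

lemma residue_ex1:
  assumes r: "r \<in> carrier R"
  shows "\<exists>!a. a \<in> carrier K \<and> r \<ominus>\<^bsub>R\<^esub> scal a \<in> \<mm>"
proof -
  have "\<mm> +>\<^bsub>R\<^esub> r \<in> carrier (R Quot \<mm>)"
    using r by (auto simp: FactRing_def A_RCOSETS_def RCOSETS_def a_r_coset_def)
  then obtain a where a: "a \<in> carrier K" "\<mm> +>\<^bsub>R\<^esub> r = \<mm> +>\<^bsub>R\<^esub> scal a"
    using residue_field unfolding bij_betw_def by blast
  show ?thesis
  proof (rule ex1I[of _ a])
    show "a \<in> carrier K \<and> r \<ominus>\<^bsub>R\<^esub> scal a \<in> \<mm>"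
      using a coset_max_eq_iff[OF r scal_closed[OF a(1)]] by simp
    fix b assume b: "b \<in> carrier K \<and> r \<ominus>\<^bsub>R\<^esub> scal b \<in> \<mm>"
    then have "\<mm> +>\<^bsub>R\<^esub> scal b = \<mm> +>\<^bsub>R\<^esub> scal a"
      using a coset_max_eq_iff[OF r scal_closed[of b]] by simp
    then show "b = a" using a(1) b residue_field unfolding bij_betw_def inj_on_def by blast
  qed
qed

lemma residue: "r \<in> carrier R \<Longrightarrow> residue r \<in> carrier K" "r \<in> carrier R \<Longrightarrow> r \<ominus>\<^bsub>R\<^esub> scal (residue r) \<in> \<mm>"
  using theI'[OF residue_ex1] unfolding residue_def by auto

lemma residue_eqI: "r \<in> carrier R \<Longrightarrow> a \<in> carrier K \<Longrightarrow> r \<ominus>\<^bsub>R\<^esub> scal a \<in> \<mm> \<Longrightarrow> residue r = a"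
  using residue_ex1 residue by blast

lemma residue_add: "r \<in> carrier R \<Longrightarrow> s \<in> carrier R \<Longrightarrow> residue (r \<oplus>\<^bsub>R\<^esub> s) = residue r \<oplus>\<^bsub>K\<^esub> residue s"
proof (rule residue_eqI)
  assume r: "r \<in> carrier R" and s: "s \<in> carrier R"
  have "(r \<oplus>\<^bsub>R\<^esub> s) \<ominus>\<^bsub>R\<^esub> scal (residue r \<oplus>\<^bsub>K\<^esub> residue s) =
      (r \<ominus>\<^bsub>R\<^esub> scal (residue r)) \<oplus>\<^bsub>R\<^esub> (s \<ominus>\<^bsub>R\<^esub> scal (residue s))"
    using r s residue by (simp add: R.smult_l_distr a_minus_def R.minus_add R.a_ac)
  then show "(r \<oplus>\<^bsub>R\<^esub> s) \<ominus>\<^bsub>R\<^esub> scal (residue r \<oplus>\<^bsub>K\<^esub> residue s) \<in> \<mm>"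
    using r s residue(2) Max.a_closed by simp
qed (use residue in auto)

lemma residue_smult: "a \<in> carrier K \<Longrightarrow> r \<in> carrier R \<Longrightarrow> residue (a \<odot>\<^bsub>R\<^esub> r) = a \<otimes>\<^bsub>K\<^esub> residue r"
proof (rule residue_eqI)
  assume a: "a \<in> carrier K" and r: "r \<in> carrier R"
  have "(a \<odot>\<^bsub>R\<^esub> r) \<ominus>\<^bsub>R\<^esub> scal (a \<otimes>\<^bsub>K\<^esub> residue r) = scal a \<otimes>\<^bsub>R\<^esub> (r \<ominus>\<^bsub>R\<^esub> scal (residue r))"
    using a r residue(1) by (simp add: scal_mult R.smult_r_distr a_minus_def R.smult_r_minus R.smult_assoc1)
  then show "(a \<odot>\<^bsub>R\<^esub> r) \<ominus>\<^bsub>R\<^esub> scal (a \<otimes>\<^bsub>K\<^esub> residue r) \<in> \<mm>"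
    using a r residue(2) Max.I_l_closed by simp
qed (use residue in auto)

lemma residue_max: "r \<in> \<mm> \<Longrightarrow> residue r = \<zero>\<^bsub>K\<^esub>"
  by (rule residue_eqI) (simp_all add: a_minus_def)

context
  fixes V :: "('k, 'v, 'z) module_scheme"
  assumes V: "module K V"
begin

interpretation V: module K V by (rule V)
interpretation E: module K "ext V" by (rule module_ext[OF V])
interpretation H: module R "hat V" by (rule module_hat[OF V])

abbreviation ext_reduction :: "('v \<times> 'r \<Rightarrow> 'k) set \<Rightarrow> 'v" where
  "ext_reduction \<equiv> tensor_lift K V (\<lambda>(v, r). residue r \<odot>\<^bsub>V\<^esub> v)"

lemma bilinear_residue: "bilinear_map K V R V (\<lambda>(v, r). residue r \<odot>\<^bsub>V\<^esub> v)"
  unfolding bilinear_map_def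
  by (auto intro!: linear_mapI simp: residue residue_add residue_smult V.smult_l_distr V.smult_r_distr
      V.smult_assoc1[symmetric] K.m_comm)

lemmas linear_ext_reduction = linear_ext_lift[OF V V bilinear_residue]

lemma ext_reduction_pure: "v \<in> carrier V \<Longrightarrow> r \<in> carrier R \<Longrightarrow> ext_reduction (pure_tensor K V R v r) = residue r \<odot>\<^bsub>V\<^esub> v"
  by (simp add: ext_lift_pure[OF V V bilinear_residue])

text \<open>The kernel of the reduction is the first step of the filtration because a tensor differs
  from its reduction by an element of it.\<close>

lemma ext_reduction_zero_iff:
  assumes t: "t \<in> carrier (ext V)"
  shows "ext_reduction t = \<zero>\<^bsub>V\<^esub> \<longleftrightarrow> t \<in> filt V 1"
proof
  assume "t \<in> filt V 1"
  then show "ext_reduction t = \<zero>\<^bsub>V\<^esub>"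
    by (induction t rule: filt_induct[OF V, consumes 1, case_names pure add])
      (use mpow_1 Max.Icarr in \<open>simp_all add: ext_reduction_pure residue_max linear_map_add[OF linear_ext_reduction]\<close>)
next
  note p1 = linear_pure(2)[OF V R.one_closed]
  from t have *: "t \<ominus>\<^bsub>ext V\<^esub> pure_tensor K V R (ext_reduction t) \<one>\<^bsub>R\<^esub> \<in> filt V 1"
  proof (induction t rule: ext_induct[OF V, consumes 1, case_names pure add])
    case (pure v r)
    have "pure_tensor K V R (residue r \<odot>\<^bsub>V\<^esub> v) \<one>\<^bsub>R\<^esub> = pure_tensor K V R v (scal (residue r))"
      using pure residue(1)
      by (simp add: linear_map_smult[OF p1] linear_map_smult[OF linear_pure(1)[OF V pure(1)]])
    then have "pure_tensor K V R v r \<ominus>\<^bsub>ext V\<^esub> pure_tensor K V R (residue r \<odot>\<^bsub>V\<^esub> v) \<one>\<^bsub>R\<^esub> =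
        pure_tensor K V R v (r \<ominus>\<^bsub>R\<^esub> scal (residue r))"
      using pure residue(1)
      by (simp add: linear_map_minus[OF module_R module_ext[OF V] linear_pure(1)[OF V pure(1)]])
    then show ?case
      using pure filt_pure[OF V pure(1), of "r \<ominus>\<^bsub>R\<^esub> scal (residue r)" "Suc 0", unfolded mpow_1] residue(2)
      by (simp add: ext_reduction_pure)
  next
    case (add t u)
    let ?p = "\<lambda>t. pure_tensor K V R (ext_reduction t) \<one>\<^bsub>R\<^esub>"
    have cl: "?p t \<in> carrier (ext V)" "?p u \<in> carrier (ext V)"
      using add.hyps by (auto intro!: pure_closed[OF V] linear_map_closed[OF linear_ext_reduction])
    have "(t \<oplus>\<^bsub>ext V\<^esub> u) \<ominus>\<^bsub>ext V\<^esub> ?p (t \<oplus>\<^bsub>ext V\<^esub> u) = (t \<ominus>\<^bsub>ext V\<^esub> ?p t) \<oplus>\<^bsub>ext V\<^esub> (u \<ominus>\<^bsub>ext V\<^esub> ?p u)"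
      using add.hyps cl
      by (simp add: linear_map_add[OF linear_ext_reduction] linear_map_add[OF p1]
          linear_map_closed[OF linear_ext_reduction] a_minus_def E.minus_add E.a_ac)
    then show ?case using filt_closed(2)[OF V add.IH] by simp
  qed
  assume "ext_reduction t = \<zero>\<^bsub>V\<^esub>"
  then show "t \<in> filt V 1"
    using * t E.minus_equality[of "\<zero>\<^bsub>ext V\<^esub>" "\<zero>\<^bsub>ext V\<^esub>"]
    by (simp add: linear_map_zero[OF V module_ext[OF V] p1] a_minus_def)
qed

lemma hat_max_iff: "x \<in> hat_max V \<longleftrightarrow> x \<in> carrier (hat V) \<and> x 1 = \<zero>\<^bsub>hat V\<^esub> 1"
proof -
  have "reduction V x = \<zero>\<^bsub>V\<^esub> \<longleftrightarrow> x 1 = \<zero>\<^bsub>hat V\<^esub> 1" if x: "x \<in> carrier (hat V)"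
  proof -
    obtain t where t: "t \<in> carrier (ext V)" "x 1 = filt V 1 +>\<^bsub>ext V\<^esub> t" by (rule hat_rep[OF V x])
    have "(SOME u. u \<in> x 1) \<in> x 1" by (rule someI[of _ t]) (simp only: t(2) cls_self[OF V t(1)])
    then have m: "(SOME u. u \<in> x 1) \<in> filt V 1 +>\<^bsub>ext V\<^esub> t" by (simp only: t(2))
    then have u: "(SOME u. u \<in> x 1) \<in> carrier (ext V)" by (rule subsetD[OF cls_subset[OF V t(1)]])
    moreover have "x 1 = filt V 1 +>\<^bsub>ext V\<^esub> (SOME u. u \<in> x 1)"
      using cls_mem_iff[OF V t(1) u, of 1] m by (simp only: t(2))
    ultimately have u: "(SOME u. u \<in> x 1) \<in> carrier (ext V)" "x 1 = filt V 1 +>\<^bsub>ext V\<^esub> (SOME u. u \<in> x 1)"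
      by blast+
    show ?thesis
      unfolding reduction_def
      using ext_reduction_zero_iff[OF u(1)] hat_level_zero_iff[OF V x u] by simp
  qed
  then show ?thesis by (auto simp: hat_max_def)
qed

lemma minus_mem_hat_max_iff:
  assumes x: "x \<in> carrier (hat V)" and y: "y \<in> carrier (hat V)"
  shows "x \<ominus>\<^bsub>hat V\<^esub> y \<in> hat_max V \<longleftrightarrow> x 1 = y 1"
  using hat_max_iff[of "x \<ominus>\<^bsub>hat V\<^esub> y"] hat_level_eq_iff[OF V x y, of 1] H.minus_closed[OF x y] by blast

end


subsection \<open>Homogeneous elements\<close>

lemma graded_module: "graded_vector_space K V \<Longrightarrow> module K V"
  by (simp add: graded_vector_space_def)

lemma component_carrier: "graded_vector_space K V \<Longrightarrow> v \<in> component V i \<Longrightarrow> v \<in> carrier V"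
  using module.submoduleE(1)[OF graded_module] by (auto simp: graded_vector_space_def)

definition ext_component :: "('k, 'v, 'z) graded_module_scheme \<Rightarrow> int \<Rightarrow> ('v \<times> 'r \<Rightarrow> 'k) set set" where
  "ext_component V i = lin_span K (ext V) {pure_tensor K V R v r | v r. v \<in> component V i \<and> r \<in> carrier R}"

lemma hat_component_iff:
  "x \<in> hat_component V i \<longleftrightarrow> x \<in> carrier (hat V) \<and> (\<forall>n. \<exists>t \<in> ext_component V i. x n = const_hat V t n)"
  by (simp add: hat_component_def ext_component_def const_hat_def)

context
  fixes V :: "('k, 'v, 'z) graded_module_scheme"
  assumes gV: "graded_vector_space K V"
begin

lemmas graded_mod = graded_module[OF gV]

interpretation V: module K V by (rule graded_mod)
interpretation E: module K "ext V" by (rule module_ext[OF graded_mod])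
interpretation H: module R "hat V" by (rule module_hat[OF graded_mod])

lemma submodule_component: "submodule (component V i) K V"
  using gV by (simp add: graded_vector_space_def)

lemma component_closed:
  "\<zero>\<^bsub>V\<^esub> \<in> component V i"
  "v \<in> component V i \<Longrightarrow> w \<in> component V i \<Longrightarrow> v \<oplus>\<^bsub>V\<^esub> w \<in> component V i"
  "a \<in> carrier K \<Longrightarrow> v \<in> component V i \<Longrightarrow> a \<odot>\<^bsub>V\<^esub> v \<in> component V i"
  using V.submoduleE(4,5)[OF submodule_component] subgroup.one_closed[OF submodule.axioms(1)[OF submodule_component]]
  by auto

lemma ext_component_gens: "{pure_tensor K V R v r | v r. v \<in> component V i \<and> r \<in> carrier R} \<subseteq> carrier (ext V)"
  using pure_closed[OF graded_mod] component_carrier[OF gV] by blast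

lemma submodule_ext_component: "submodule (ext_component V i) K (ext V)"
  unfolding ext_component_def by (rule submodule_lin_span[OF module_ext[OF graded_mod] ext_component_gens])

lemma ext_component_carrier: "t \<in> ext_component V i \<Longrightarrow> t \<in> carrier (ext V)"
  using E.submoduleE(1)[OF submodule_ext_component] by auto

lemma ext_component_pure: "v \<in> component V i \<Longrightarrow> r \<in> carrier R \<Longrightarrow> pure_tensor K V R v r \<in> ext_component V i"
  unfolding ext_component_def by (rule lin_span_superset[OF module_ext[OF graded_mod]]) blast

lemma ext_component_closed:
  "\<zero>\<^bsub>ext V\<^esub> \<in> ext_component V i"
  "t \<in> ext_component V i \<Longrightarrow> u \<in> ext_component V i \<Longrightarrow> t \<oplus>\<^bsub>ext V\<^esub> u \<in> ext_component V i"
  using E.submoduleE(5)[OF submodule_ext_component]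
    subgroup.one_closed[OF submodule.axioms(1)[OF submodule_ext_component]]
  by auto

lemma ext_component_induct [consumes 1, case_names pure add]:
  assumes "t \<in> ext_component V i"
    and pure: "\<And>v r. v \<in> component V i \<Longrightarrow> r \<in> carrier R \<Longrightarrow> P (pure_tensor K V R v r)"
    and add: "\<And>t u. t \<in> carrier (ext V) \<Longrightarrow> u \<in> carrier (ext V) \<Longrightarrow> P t \<Longrightarrow> P u \<Longrightarrow> P (t \<oplus>\<^bsub>ext V\<^esub> u)"
  shows "P t"
proof -
  have "\<forall>a \<in> carrier K. P (a \<odot>\<^bsub>ext V\<^esub> t)"
    using assms(1) ext_component_gens[of i] unfolding ext_component_def
  proof (induction t rule: lin_span_induct[OF module_ext[OF graded_mod], consumes 2, case_names zero gen add smult])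
    case zero
    have "P (pure_tensor K V R \<zero>\<^bsub>V\<^esub> \<zero>\<^bsub>R\<^esub>)" using component_closed(1) by (intro pure) auto
    then show ?case using linear_map_zero[OF module_R module_ext[OF graded_mod] linear_pure(1)[OF graded_mod, of "\<zero>\<^bsub>V\<^esub>"]] by simp
  next
    case (gen x)
    then obtain v r where x: "x = pure_tensor K V R v r" "v \<in> component V i" "r \<in> carrier R" by auto
    show ?case
    proof
      fix a assume "a \<in> carrier K"
      then show "P (a \<odot>\<^bsub>ext V\<^esub> x)"
        using pure[of v "a \<odot>\<^bsub>R\<^esub> r"] x component_carrier[OF gV x(2)]
        by (simp add: linear_map_smult[OF linear_pure(1)[OF graded_mod]])
    qed
  next
    case (add x y)
    then show ?case by (simp add: E.smult_r_distr assms(3))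
  next
    case (smult a x)
    then show ?case by (simp add: E.smult_assoc1[symmetric])
  qed
  from this[rule_format, of "\<one>\<^bsub>K\<^esub>"] show ?thesis using ext_component_carrier[OF assms(1)] by simp
qed

lemma ext_component_smult: "t \<in> ext_component V i \<Longrightarrow> r \<in> carrier R \<Longrightarrow> ext_smult V r t \<in> ext_component V i"
  by (induction t rule: ext_component_induct)
    (simp_all add: ext_smult_pure[OF graded_mod] ext_component_pure component_carrier[OF gV] ext_smult_r_distr[OF graded_mod]
      ext_component_closed)

lemma hat_component_carrier: "x \<in> hat_component V i \<Longrightarrow> x \<in> carrier (hat V)"
  by (simp add: hat_component_iff)

lemma hat_component_const: "t \<in> ext_component V i \<Longrightarrow> const_hat V t \<in> hat_component V i"
  using const_hat_closed[OF graded_mod] ext_component_carrier by (auto simp: hat_component_iff)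

lemma hat_component_incl: "v \<in> component V i \<Longrightarrow> incl V v \<in> hat_component V i"
  by (simp add: incl_const_hat hat_component_const ext_component_pure graded_mod)

lemma hat_component_limit:
  assumes "x \<in> carrier (hat V)" "\<And>n. \<exists>y \<in> hat_component V i. x n = y n"
  shows "x \<in> hat_component V i"
  unfolding hat_component_iff
proof (intro conjI allI)
  fix n
  obtain y where "y \<in> hat_component V i" "x n = y n" using assms(2) by blast
  then show "\<exists>t \<in> ext_component V i. x n = const_hat V t n" by (simp add: hat_component_iff)
qed (rule assms(1))

lemma hat_component_zero: "\<zero>\<^bsub>hat V\<^esub> \<in> hat_component V i"
  using ext_component_closed(1) H.zero_closed
  by (auto simp: hat_component_iff hat_zero_rep[OF graded_mod] const_hat_def intro!: bexI[of _ "\<zero>\<^bsub>ext V\<^esub>"])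

lemma hat_component_add:
  assumes "x \<in> hat_component V i" "y \<in> hat_component V i"
  shows "x \<oplus>\<^bsub>hat V\<^esub> y \<in> hat_component V i"
proof (rule hat_component_limit)
  show "x \<oplus>\<^bsub>hat V\<^esub> y \<in> carrier (hat V)" using assms hat_component_carrier by simp
  fix n
  obtain t u where t: "t \<in> ext_component V i" "x n = const_hat V t n"
    and u: "u \<in> ext_component V i" "y n = const_hat V u n" using assms unfolding hat_component_iff by meson
  have "(x \<oplus>\<^bsub>hat V\<^esub> y) n = const_hat V (t \<oplus>\<^bsub>ext V\<^esub> u) n"
    using t u ext_component_carrier by (simp add: const_hat_add[OF graded_mod] hat_add_level[OF graded_mod])
  then show "\<exists>z \<in> hat_component V i. (x \<oplus>\<^bsub>hat V\<^esub> y) n = z n"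
    using ext_component_closed(2)[OF t(1) u(1)] hat_component_const by blast
qed

lemma hat_component_smult:
  assumes "x \<in> hat_component V i" "r \<in> carrier R"
  shows "r \<odot>\<^bsub>hat V\<^esub> x \<in> hat_component V i"
proof (rule hat_component_limit)
  show "r \<odot>\<^bsub>hat V\<^esub> x \<in> carrier (hat V)" using assms hat_component_carrier by simp
  fix n
  obtain t where t: "t \<in> ext_component V i" "x n = const_hat V t n"
    using assms unfolding hat_component_iff by meson
  have "(r \<odot>\<^bsub>hat V\<^esub> x) n = const_hat V (ext_smult V r t) n"
    using hat_smult_level[where x = x and y = "const_hat V t" and n = n, OF graded_mod t(2)]
      const_hat_smult[OF graded_mod ext_component_carrier[OF t(1)] assms(2)] by simp
  then show "\<exists>z \<in> hat_component V i. (r \<odot>\<^bsub>hat V\<^esub> x) n = z n"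
    using ext_component_smult[OF t(1) assms(2)] hat_component_const by blast
qed

end


subsection \<open>Spaces of continuous linear maps\<close>

lemma lin_maps_iff: "f \<in> lin_maps V W d \<longleftrightarrow> f \<in> extensional (carrier (hat V)) \<and>
    linear_map R (hat V) (hat W) f \<and> continuous_hat V f \<and>
    (\<forall>i. \<forall>x \<in> hat_component V i. f x \<in> hat_component W (i + d))"
  unfolding lin_maps_def continuous_hat_def linear_map_def by (auto simp: PiE_def image_subset_iff)

lemma lin_maps_level_cong:
  assumes "module K V" "module K W" "f \<in> lin_maps V W d"
    "x \<in> carrier (hat V)" "y \<in> carrier (hat V)" "x n = y n"
  shows "f x n = f y n"
  using continuous_level_cong[OF assms(1,2) _ _ assms(4-6)] assms(3) by (simp add: lin_maps_iff)

lemma lin_maps_eqI: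
  assumes V: "module K V" and W: "module K W" and f: "f \<in> lin_maps V W d" and g: "g \<in> lin_maps V W d'"
    and eq: "\<And>v. v \<in> carrier V \<Longrightarrow> f (incl V v) = g (incl V v)"
  shows "f = g"
proof (rule extensionalityI[of _ "carrier (hat V)"])
  fix x assume "x \<in> carrier (hat V)"
  then show "f x = g x"
    using continuous_linear_eqI[OF V W, of f g _ x] f g eq by (intro HOL.ext) (auto simp: lin_maps_iff)
qed (use f g in \<open>auto simp: lin_maps_iff\<close>)

lemma lin_maps_id:
  assumes "graded_vector_space K V"
  shows "(\<lambda>x \<in> carrier (hat V). x) \<in> lin_maps V V 0"
proof -
  interpret H: module R "hat V" by (rule module_hat[OF graded_module[OF assms]])
  show ?thesis
    using hat_component_carrier[OF assms]
    by (auto simp: lin_maps_iff continuous_hat_def intro!: linear_mapI)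
qed

lemma lin_maps_compose:
  assumes U: "graded_vector_space K U" and V: "graded_vector_space K V" and W: "graded_vector_space K W"
    and f: "f \<in> lin_maps U V d" and g: "g \<in> lin_maps V W e"
  shows "compose (carrier (hat U)) g f \<in> lin_maps U W (d + e)"
proof -
  interpret U: module R "hat U" by (rule module_hat[OF graded_module[OF U]])
  note lf = f[unfolded lin_maps_iff] and lg = g[unfolded lin_maps_iff]
  have fc: "x \<in> carrier (hat U) \<Longrightarrow> f x \<in> carrier (hat V)" for x
    by (rule linear_map_closed[OF lf[THEN conjunct2, THEN conjunct1]])
  have "linear_map R (hat U) (hat W) (compose (carrier (hat U)) g f)"
    by (rule linear_map_cong[OF module_hat[OF graded_module[OF U]]
          linear_map_comp[OF lf[THEN conjunct2, THEN conjunct1] lg[THEN conjunct2, THEN conjunct1]]])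
      (simp add: compose_def)
  moreover have "continuous_hat U (compose (carrier (hat U)) g f)"
    unfolding continuous_hat_def
  proof (intro ballI allI exI impI)
    fix x n y assume x: "x \<in> carrier (hat U)" and y: "y \<in> carrier (hat U)" and "y n = x n"
    then have "f y n = f x n" by (intro lin_maps_level_cong[OF graded_module[OF U] graded_module[OF V] f])
    then have "g (f y) n = g (f x) n"
      using fc x y by (intro lin_maps_level_cong[OF graded_module[OF V] graded_module[OF W] g])
    then show "compose (carrier (hat U)) g f y n = compose (carrier (hat U)) g f x n"
      using x y by (simp add: compose_def)
  qed
  moreover have "compose (carrier (hat U)) g f x \<in> hat_component W (i + (d + e))" if "x \<in> hat_component U i" for x i
    using that lf lg hat_component_carrier[OF U that] by (simp add: compose_def add.assoc[symmetric])
  ultimately show ?thesis by (auto simp: lin_maps_iff compose_def)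
qed

lemma extension_in_lin_maps:
  assumes V: "graded_vector_space K V" and W: "graded_vector_space K W"
    and c: "linear_map K V (hat_over_field W) c"
    and deg: "\<And>i v. v \<in> component V i \<Longrightarrow> c v \<in> hat_component W i"
  shows "restrict (extension W c) (carrier (hat V)) \<in> lin_maps V W 0"
proof -
  note V' = graded_module[OF V] and W' = graded_module[OF W]
  interpret HV: module R "hat V" by (rule module_hat[OF V'])
  have 1: "ext_lift W c t \<in> hat_component W i" if "t \<in> ext_component V i" for t i
    using that
    by (induction t rule: ext_component_induct[OF V, consumes 1, case_names pure add])
      (simp_all add: ext_lift_pure_tensor[OF V' W' c] component_carrier[OF V] deg hat_component_smult[OF W]
        ext_lift_add[OF V' W' c] hat_component_add[OF W])
  have 2: "extension W c x \<in> hat_component W i" if x: "x \<in> hat_component V i" for x i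
  proof (rule hat_component_limit[OF W])
    show "extension W c x \<in> carrier (hat W)"
      using extension_closed[OF V' W' c] hat_component_carrier[OF V x] by simp
    fix n
    obtain t where t: "t \<in> ext_component V i" "x n = const_hat V t n" using x unfolding hat_component_iff by meson
    have "extension W c x n = ext_lift W c t n"
      using ext_component_carrier[OF V t(1)] t(2) by (intro extension_rep[OF V' W' c])
    then show "\<exists>y\<in>hat_component W i. extension W c x n = y n" using 1[OF t(1)] by blast
  qed
  have "continuous_hat V (restrict (extension W c) (carrier (hat V)))"
    using continuous_extension[OF V' W' c] by (auto simp: continuous_hat_def)
  moreover have "linear_map R (hat V) (hat W) (restrict (extension W c) (carrier (hat V)))"
    by (rule linear_map_cong[OF module_hat[OF V'] linear_extension[OF V' W' c]]) simp
  ultimately show ?thesis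
    using 2 hat_component_carrier[OF V] by (auto simp: lin_maps_iff)
qed

lemma
  assumes V: "graded_vector_space K V" and W: "graded_vector_space K W"
    and c: "linear_map K V (hat_over_field W) c"
    and deg: "\<And>i v. v \<in> component V i \<Longrightarrow> c v \<in> hat_component W i"
  shows hat_extend_in_lin_maps: "hat_extend V W c \<in> lin_maps V W 0"
    and hat_extend_incl: "v \<in> carrier V \<Longrightarrow> hat_extend V W c (incl V v) = c v"
proof -
  note V' = graded_module[OF V] and W' = graded_module[OF W]
  have "\<exists>!f. f \<in> lin_maps V W 0 \<and> (\<forall>v \<in> carrier V. f (incl V v) = c v)"
  proof (rule ex1I)
    show "restrict (extension W c) (carrier (hat V)) \<in> lin_maps V W 0 \<and>
        (\<forall>v \<in> carrier V. restrict (extension W c) (carrier (hat V)) (incl V v) = c v)"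
      using extension_in_lin_maps[OF assms] extension_incl[OF V' W' c] incl_closed[OF V'] by simp
    then show "f = restrict (extension W c) (carrier (hat V))"
      if "f \<in> lin_maps V W 0 \<and> (\<forall>v \<in> carrier V. f (incl V v) = c v)" for f
      using that by (intro lin_maps_eqI[OF V' W']) auto
  qed
  from theI'[OF this] show "hat_extend V W c \<in> lin_maps V W 0"
    and "v \<in> carrier V \<Longrightarrow> hat_extend V W c (incl V v) = c v"
    unfolding hat_extend_def by auto
qed


section \<open>The category of pointed complexes\<close>

text \<open>The congruence modulo the maximal ideal is preserved under composition because it is an equality
  at level 1, and continuous linear maps respect levels.\<close>

lemma category_Chn: "category Chn"
proof -
  have g: "graded_vector_space K V" if "is_pointed_complex V" for V :: "('k, 'v, 'r) pointed_complex"
    using that by (simp add: is_pointed_complex_def)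
  note m = graded_module[OF g]
  have pt: "pc_point V a \<in> carrier V" if "is_pointed_complex V" "a \<in> carrier K"
    for V :: "('k, 'v, 'r) pointed_complex" and a
    using that by (auto simp: is_pointed_complex_def intro: component_carrier)
  have ipt: "incl V (pc_point V a) \<in> carrier (hat V)" if "is_pointed_complex V" "a \<in> carrier K"
    for V :: "('k, 'v, 'r) pointed_complex" and a
    by (rule incl_closed[OF m pt]; fact)
  have cl: "f x \<in> carrier (hat W)" if "f \<in> lin_maps V W d" "x \<in> carrier (hat V)"
    for f x d and V W :: "('k, 'v, 'r) pointed_complex"
    using that by (auto simp: lin_maps_iff linear_map_closed)
  have dc: "pc_diff V x \<in> carrier (hat V)" if "is_pointed_complex V" "x \<in> carrier (hat V)"
    for V :: "('k, 'v, 'r) pointed_complex" and x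
    using cl[of "pc_diff V" V V 1] that by (simp add: is_pointed_complex_def)
  have mor: "f \<in> Mor Chn V W \<longleftrightarrow> f \<in> lin_maps V W 0 \<and>
      (\<forall>x \<in> carrier (hat V). pc_diff W (f x) = f (pc_diff V x)) \<and>
      (\<forall>a \<in> carrier K. f (incl V (pc_point V a)) 1 = incl W (pc_point W a) 1)"
    if "is_pointed_complex V" "is_pointed_complex W" for V W :: "('k, 'v, 'r) pointed_complex" and f
  proof (cases "f \<in> lin_maps V W 0")
    case True
    have "compose (carrier (hat V)) (pc_diff W) f = compose (carrier (hat V)) f (pc_diff V) \<longleftrightarrow>
        (\<forall>x \<in> carrier (hat V). pc_diff W (f x) = f (pc_diff V x))"
      by (rule compose_eq_iff)
    moreover have "f (incl V (pc_point V a)) \<ominus>\<^bsub>hat W\<^esub> incl W (pc_point W a) \<in> hat_max W \<longleftrightarrow>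
        f (incl V (pc_point V a)) 1 = incl W (pc_point W a) 1" if "a \<in> carrier K" for a
      by (rule minus_mem_hat_max_iff[OF m]) (use \<open>is_pointed_complex V\<close> \<open>is_pointed_complex W\<close> that
          in \<open>auto intro: ipt cl[OF True]\<close>)
    ultimately show ?thesis using True by (simp add: Chn_def)
  qed (simp add: Chn_def)
  have obj: "V \<in> Obj Chn \<longleftrightarrow> is_pointed_complex V" for V :: "('k, 'v, 'r) pointed_complex"
    by (simp add: Chn_def)
  have cmp: "Cmp Chn U V W g f = compose (carrier (hat U)) g f"
    for U V W :: "('k, 'v, 'r) pointed_complex" and f g by (simp add: Chn_def)
  have idt: "Idt Chn V = (\<lambda>x \<in> carrier (hat V). x)" for V :: "('k, 'v, 'r) pointed_complex"
    by (simp add: Chn_def)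
  have ex: "f \<in> extensional (carrier (hat V))" if "f \<in> lin_maps V W d"
    for f d and V W :: "('k, 'v, 'r) pointed_complex"
    using that by (simp add: lin_maps_iff)
  show ?thesis
  proof (unfold_locales; unfold obj cmp idt)
    fix V :: "('k, 'v, 'r) pointed_complex" assume V: "is_pointed_complex V"
    then show "(\<lambda>x \<in> carrier (hat V). x) \<in> Mor Chn V V"
      by (simp add: mor lin_maps_id g dc ipt)
  next
    fix U V W :: "('k, 'v, 'r) pointed_complex" and f g
    assume o: "is_pointed_complex U" "is_pointed_complex V" "is_pointed_complex W"
      and "f \<in> Mor Chn U V" "g \<in> Mor Chn V W"
    then have f: "f \<in> lin_maps U V 0" "\<And>x. x \<in> carrier (hat U) \<Longrightarrow> pc_diff V (f x) = f (pc_diff U x)"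
        "\<And>a. a \<in> carrier K \<Longrightarrow> f (incl U (pc_point U a)) 1 = incl V (pc_point V a) 1"
      and gg: "g \<in> lin_maps V W 0" "\<And>x. x \<in> carrier (hat V) \<Longrightarrow> pc_diff W (g x) = g (pc_diff V x)"
        "\<And>a. a \<in> carrier K \<Longrightarrow> g (incl V (pc_point V a)) 1 = incl W (pc_point W a) 1"
      by (simp_all add: mor)
    have "g (f (incl U (pc_point U a))) 1 = incl W (pc_point W a) 1" if a: "a \<in> carrier K" for a
      using lin_maps_level_cong[OF m[OF o(2)] m[OF o(3)] gg(1) cl[OF f(1) ipt[OF o(1) a]] ipt[OF o(2) a] f(3)[OF a]]
        gg(3)[OF a] by simp
    then show "compose (carrier (hat U)) g f \<in> Mor Chn U W"
      using o f gg lin_maps_compose[OF g g g f(1) gg(1)] by (simp add: mor compose_def cl dc ipt)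
  next
    fix U V W Z :: "('k, 'v, 'r) pointed_complex" and f g h
    assume o: "is_pointed_complex U" "is_pointed_complex V" "f \<in> Mor Chn U V"
    then have "f \<in> lin_maps U V 0" by (simp add: mor)
    then show "compose (carrier (hat U)) (compose (carrier (hat V)) h g) f =
        compose (carrier (hat U)) h (compose (carrier (hat U)) g f)"
      by (intro HOL.ext) (simp add: compose_def cl)
  next
    fix V W :: "('k, 'v, 'r) pointed_complex" and f
    assume o: "is_pointed_complex V" "is_pointed_complex W" "f \<in> Mor Chn V W"
    then have f: "f \<in> lin_maps V W 0" by (simp add: mor)
    show "compose (carrier (hat V)) f (\<lambda>x \<in> carrier (hat V). x) = f"
      by (rule extensionalityI[OF _ ex[OF f]]) (auto simp: compose_def)
    show "compose (carrier (hat V)) (\<lambda>x \<in> carrier (hat W). x) f = f"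
      by (rule extensionalityI[OF _ ex[OF f]]) (auto simp: compose_def cl[OF f])
  qed
qed

end

section \<open>Multiplication on the completion\<close>

definition K_algebra :: "('k, 'x) ring_scheme \<Rightarrow> ('k, 'v, 'y) module_scheme \<Rightarrow> bool" where
  "K_algebra K V \<longleftrightarrow> module K V \<and> ring V \<and>
    (\<forall>a \<in> carrier K. \<forall>v \<in> carrier V. \<forall>w \<in> carrier V.
      (a \<odot>\<^bsub>V\<^esub> v) \<otimes>\<^bsub>V\<^esub> w = a \<odot>\<^bsub>V\<^esub> (v \<otimes>\<^bsub>V\<^esub> w) \<and> v \<otimes>\<^bsub>V\<^esub> (a \<odot>\<^bsub>V\<^esub> w) = a \<odot>\<^bsub>V\<^esub> (v \<otimes>\<^bsub>V\<^esub> w))"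

context complete_local_algebra
begin

interpretation K: field K by (rule field_K)
interpretation R: algebra K R by (rule algebra_R)

context
  fixes V :: "('k, 'v, 'z) module_scheme"
  assumes algV: "K_algebra K V"
begin

lemma V: "module K V" and rV: "ring V"
  using algV by (auto simp: K_algebra_def)

interpretation V: module K V by (rule V)
interpretation rV: ring V by (rule rV)
interpretation E: module K "ext V" by (rule module_ext[OF V])
interpretation H: module R "hat V" by (rule module_hat[OF V])

lemma linear_mult:
  "v \<in> carrier V \<Longrightarrow> linear_map K V V (\<lambda>w. v \<otimes>\<^bsub>V\<^esub> w)"
  "w \<in> carrier V \<Longrightarrow> linear_map K V V (\<lambda>v. v \<otimes>\<^bsub>V\<^esub> w)"
  using algV by (auto intro!: linear_mapI simp: K_algebra_def rV.l_distr rV.r_distr)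

lemma linear_R_mult': "r \<in> carrier R \<Longrightarrow> linear_map K R R (\<lambda>s. s \<otimes>\<^bsub>R\<^esub> r)"
  by (rule linear_mapI) (simp_all add: R.l_distr R.smult_assoc2)

abbreviation ext_mult_left :: "'v \<Rightarrow> 'r \<Rightarrow> ('v \<times> 'r \<Rightarrow> 'k) set \<Rightarrow> ('v \<times> 'r \<Rightarrow> 'k) set" where
  "ext_mult_left v r \<equiv> tensor_lift K (ext V) (\<lambda>(w, s). pure_tensor K V R (v \<otimes>\<^bsub>V\<^esub> w) (r \<otimes>\<^bsub>R\<^esub> s))"

lemma bilinear_ext_mult_left: "v \<in> carrier V \<Longrightarrow> r \<in> carrier R \<Longrightarrow>
    bilinear_map K V R (ext V) (\<lambda>(w, s). pure_tensor K V R (v \<otimes>\<^bsub>V\<^esub> w) (r \<otimes>\<^bsub>R\<^esub> s))"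
  unfolding bilinear_map_def prod.case
  using linear_map_comp[OF linear_R_mult[OF V] linear_pure(1)[OF V]]
    linear_map_comp[OF linear_mult(1) linear_pure(2)[OF V]] by simp

lemma linear_ext_mult_left: "v \<in> carrier V \<Longrightarrow> r \<in> carrier R \<Longrightarrow> linear_map K (ext V) (ext V) (ext_mult_left v r)"
  by (rule linear_ext_lift[OF V module_ext[OF V] bilinear_ext_mult_left])

lemma ext_mult_left_pure: "v \<in> carrier V \<Longrightarrow> r \<in> carrier R \<Longrightarrow> w \<in> carrier V \<Longrightarrow> s \<in> carrier R \<Longrightarrow>
    ext_mult_left v r (pure_tensor K V R w s) = pure_tensor K V R (v \<otimes>\<^bsub>V\<^esub> w) (r \<otimes>\<^bsub>R\<^esub> s)"
  by (simp add: ext_lift_pure[OF V module_ext[OF V] bilinear_ext_mult_left])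

lemma bilinear_ext_mult: "u \<in> carrier (ext V) \<Longrightarrow> bilinear_map K V R (ext V) (\<lambda>(v, r). ext_mult_left v r u)"
  unfolding bilinear_map_def prod.case
proof (intro conjI ballI)
  assume u: "u \<in> carrier (ext V)"
  then have u': "u \<in> carrier (tensor K V R)" by (simp add: ext_def)
  fix v assume v: "v \<in> carrier V"
  show "linear_map K R (ext V) (\<lambda>r. ext_mult_left v r u)"
  proof (rule linear_map_bilinear_lift_param[OF field_K V module_R module_ext[OF V] module_R _ _ u'])
    show "linear_map K R (ext V) (\<lambda>r. case (w, s) of (w, s) \<Rightarrow> pure_tensor K V R (v \<otimes>\<^bsub>V\<^esub> w) (r \<otimes>\<^bsub>R\<^esub> s))"
      if "w \<in> carrier V" "s \<in> carrier R" for w s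
      using linear_map_comp[OF linear_R_mult'[OF that(2)] linear_pure(1)[OF V, of "v \<otimes>\<^bsub>V\<^esub> w"]] v that by simp
  qed (rule bilinear_ext_mult_left[OF v])
next
  assume u: "u \<in> carrier (ext V)"
  then have u': "u \<in> carrier (tensor K V R)" by (simp add: ext_def)
  fix r assume r: "r \<in> carrier R"
  show "linear_map K V (ext V) (\<lambda>v. ext_mult_left v r u)"
  proof (rule linear_map_bilinear_lift_param[OF field_K V module_R module_ext[OF V] V _ _ u'])
    show "linear_map K V (ext V) (\<lambda>v. case (w, s) of (w, s) \<Rightarrow> pure_tensor K V R (v \<otimes>\<^bsub>V\<^esub> w) (r \<otimes>\<^bsub>R\<^esub> s))"
      if "w \<in> carrier V" "s \<in> carrier R" for w s
      using linear_map_comp[OF linear_mult(2)[OF that(1)] linear_pure(2)[OF V, of "r \<otimes>\<^bsub>R\<^esub> s"]] r that by simp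
  qed (rule bilinear_ext_mult_left[OF _ r])
qed

lemma linear_ext_mult:
  "u \<in> carrier (ext V) \<Longrightarrow> linear_map K (ext V) (ext V) (\<lambda>t. ext_mult V t u)"
  "t \<in> carrier (ext V) \<Longrightarrow> linear_map K (ext V) (ext V) (ext_mult V t)"
proof -
  show "u \<in> carrier (ext V) \<Longrightarrow> linear_map K (ext V) (ext V) (\<lambda>t. ext_mult V t u)"
    unfolding ext_mult_def by (rule linear_ext_lift[OF V module_ext[OF V] bilinear_ext_mult])
  assume t: "t \<in> carrier (ext V)"
  then have t': "t \<in> carrier (tensor K V R)" by (simp add: ext_def)
  show "linear_map K (ext V) (ext V) (ext_mult V t)"
    unfolding ext_mult_def
  proof (rule linear_map_bilinear_lift_param[OF field_K V module_R module_ext[OF V] module_ext[OF V] _ _ t'])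
    show "linear_map K (ext V) (ext V) (\<lambda>u. case (v, r) of (v, r) \<Rightarrow> ext_mult_left v r u)"
      if "v \<in> carrier V" "r \<in> carrier R" for v r
      using linear_ext_mult_left[OF that] by simp
  qed (rule bilinear_ext_mult)
qed

lemma ext_mult_pure: "v \<in> carrier V \<Longrightarrow> r \<in> carrier R \<Longrightarrow> w \<in> carrier V \<Longrightarrow> s \<in> carrier R \<Longrightarrow>
    ext_mult V (pure_tensor K V R v r) (pure_tensor K V R w s) = pure_tensor K V R (v \<otimes>\<^bsub>V\<^esub> w) (r \<otimes>\<^bsub>R\<^esub> s)"
  unfolding ext_mult_def
  by (subst ext_lift_pure[OF V module_ext[OF V] bilinear_ext_mult[OF pure_closed[OF V]]])
    (simp_all add: ext_mult_left_pure)

lemma ext_mult_closed: "t \<in> carrier (ext V) \<Longrightarrow> u \<in> carrier (ext V) \<Longrightarrow> ext_mult V t u \<in> carrier (ext V)"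
  by (rule linear_map_closed[OF linear_ext_mult(2)])

lemma ext_mult_distr:
  "t \<in> carrier (ext V) \<Longrightarrow> u \<in> carrier (ext V) \<Longrightarrow> x \<in> carrier (ext V) \<Longrightarrow>
    ext_mult V (t \<oplus>\<^bsub>ext V\<^esub> u) x = ext_mult V t x \<oplus>\<^bsub>ext V\<^esub> ext_mult V u x"
  "t \<in> carrier (ext V) \<Longrightarrow> u \<in> carrier (ext V) \<Longrightarrow> x \<in> carrier (ext V) \<Longrightarrow>
    ext_mult V x (t \<oplus>\<^bsub>ext V\<^esub> u) = ext_mult V x t \<oplus>\<^bsub>ext V\<^esub> ext_mult V x u"
  by (rule linear_map_add[OF linear_ext_mult(1)] linear_map_add[OF linear_ext_mult(2)]; assumption)+

text \<open>The filtration is multiplicative, so that multiplication passes to the completion.\<close>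

lemma ext_mult_filt: "t \<in> filt V m \<Longrightarrow> u \<in> filt V n \<Longrightarrow> ext_mult V t u \<in> filt V (m + n)"
proof (induction t rule: filt_induct[OF V, consumes 1, case_names pure add])
  case (pure v r)
  from pure(3) show ?case
    by (induction u rule: filt_induct[OF V, consumes 1, case_names pure add])
      (use pure in \<open>simp_all add: ext_mult_pure mpow_carrier filt_pure[OF V] mpow_mult ext_mult_distr
        pure_closed[OF V] filt_closed[OF V]\<close>)
qed (simp add: ext_mult_distr filt_carrier[OF V] filt_closed[OF V])

lemma ext_mult_smult:
  assumes r: "r \<in> carrier R" and t: "t \<in> carrier (ext V)" and u: "u \<in> carrier (ext V)"
  shows "ext_mult V (ext_smult V r t) u = ext_smult V r (ext_mult V t u)"
    and "ext_mult V t (ext_smult V r u) = ext_smult V r (ext_mult V t u)"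
proof -
  have "ext_mult V (ext_smult V r t) u = ext_smult V r (ext_mult V t u) \<and>
    ext_mult V t (ext_smult V r u) = ext_smult V r (ext_mult V t u)"
    using t
  proof (induction t rule: ext_induct[OF V, consumes 1, case_names pure add])
    case (pure v s)
    from u show ?case
    proof (induction u rule: ext_induct[OF V, consumes 1, case_names pure add])
      case (pure w q)
      then show ?case using \<open>v \<in> carrier V\<close> \<open>s \<in> carrier R\<close> r
        by (simp add: ext_mult_pure ext_smult_pure[OF V] R.m_assoc R.m_lcomm)
    next
      case (add t u)
      then show ?case using \<open>v \<in> carrier V\<close> \<open>s \<in> carrier R\<close> r
        by (simp add: ext_mult_distr pure_closed[OF V] ext_smult_pure[OF V] ext_smult_r_distr[OF V]
            ext_mult_closed ext_smult_closed[OF V])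
    qed
  next
    case (add t t')
    then show ?case using r u
      by (simp add: ext_mult_distr ext_smult_r_distr[OF V] ext_mult_closed ext_smult_closed[OF V])
  qed
  then show "ext_mult V (ext_smult V r t) u = ext_smult V r (ext_mult V t u)"
    "ext_mult V t (ext_smult V r u) = ext_smult V r (ext_mult V t u)" by auto
qed

lemma ext_mult_assoc:
  assumes t: "t \<in> carrier (ext V)" and u: "u \<in> carrier (ext V)" and x: "x \<in> carrier (ext V)"
  shows "ext_mult V (ext_mult V t u) x = ext_mult V t (ext_mult V u x)"
  using t
proof (induction t rule: ext_induct[OF V, consumes 1, case_names pure add])
  case (pure v r)
  note v = pure
  from u show ?case
  proof (induction u rule: ext_induct[OF V, consumes 1, case_names pure add])
    case (pure w s)
    note w = pure
    from x show ?case
    proof (induction x rule: ext_induct[OF V, consumes 1, case_names pure add])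
      case (pure z q)
      then show ?case using v w by (simp add: ext_mult_pure rV.m_assoc R.m_assoc)
    qed (use v w in \<open>simp add: ext_mult_distr pure_closed[OF V] ext_mult_closed\<close>)
  qed (use v x in \<open>simp add: ext_mult_distr pure_closed[OF V] ext_mult_closed\<close>)
qed (use u x in \<open>simp add: ext_mult_distr ext_mult_closed\<close>)

lemma ext_mult_one:
  assumes "t \<in> carrier (ext V)"
  shows "ext_mult V (pure_tensor K V R \<one>\<^bsub>V\<^esub> \<one>\<^bsub>R\<^esub>) t = t" "ext_mult V t (pure_tensor K V R \<one>\<^bsub>V\<^esub> \<one>\<^bsub>R\<^esub>) = t"
  using assms
  by (induction t rule: ext_induct[OF V, consumes 1, case_names pure add])
    (simp_all add: ext_mult_pure ext_mult_distr pure_closed[OF V])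

lemma cls_ext_mult_cong:
  assumes "t \<in> carrier (ext V)" "t' \<in> carrier (ext V)" "u \<in> carrier (ext V)" "u' \<in> carrier (ext V)"
    "filt V n +>\<^bsub>ext V\<^esub> t = filt V n +>\<^bsub>ext V\<^esub> t'" "filt V n +>\<^bsub>ext V\<^esub> u = filt V n +>\<^bsub>ext V\<^esub> u'"
  shows "filt V n +>\<^bsub>ext V\<^esub> ext_mult V t u = filt V n +>\<^bsub>ext V\<^esub> ext_mult V t' u'"
proof -
  have "ext_mult V (t \<ominus>\<^bsub>ext V\<^esub> t') u \<in> filt V n" "ext_mult V t' (u \<ominus>\<^bsub>ext V\<^esub> u') \<in> filt V n"
    using assms ext_mult_filt[of "t \<ominus>\<^bsub>ext V\<^esub> t'" n u 0] ext_mult_filt[of t' 0 "u \<ominus>\<^bsub>ext V\<^esub> u'" n]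
    by (simp_all add: cls_eq_iff[OF V] filt_0[OF V])
  then have "filt V n +>\<^bsub>ext V\<^esub> ext_mult V t u = filt V n +>\<^bsub>ext V\<^esub> ext_mult V t' u"
    "filt V n +>\<^bsub>ext V\<^esub> ext_mult V t' u = filt V n +>\<^bsub>ext V\<^esub> ext_mult V t' u'"
    using assms by (simp_all add: cls_eq_iff[OF V] ext_mult_closed
        linear_map_minus[OF module_ext[OF V] module_ext[OF V] linear_ext_mult(1)]
        linear_map_minus[OF module_ext[OF V] module_ext[OF V] linear_ext_mult(2)])
  then show ?thesis by simp
qed

lemma hat_mult_rep:
  assumes t: "t \<in> carrier (ext V)" "x n = const_hat V t n" and u: "u \<in> carrier (ext V)" "y n = const_hat V u n"
  shows "hat_mult V x y n = const_hat V (ext_mult V t u) n"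
proof -
  let ?c = "\<lambda>t. filt V n +>\<^bsub>ext V\<^esub> t"
  have tt: "t' \<in> carrier (ext V)" "?c t' = ?c t" if "t' \<in> ?c t" for t'
    using subsetD[OF cls_subset[OF V t(1)] that] cls_mem_iff[OF V t(1)] that by auto
  have uu: "u' \<in> carrier (ext V)" "?c u' = ?c u" if "u' \<in> ?c u" for u'
    using subsetD[OF cls_subset[OF V u(1)] that] cls_mem_iff[OF V u(1)] that by auto
  have "(\<Union>u' \<in> ?c u. ?c (ext_mult V t' u')) = ?c (ext_mult V t u)" if "t' \<in> ?c t" for t'
  proof (rule SUP_eq_const)
    show "?c u \<noteq> {}" using cls_self[OF V u(1), of n] by blast
  qed (rule cls_ext_mult_cong[OF tt(1)[OF that] t(1) uu(1) u(1) tt(2)[OF that] uu(2)])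
  moreover have "?c t \<noteq> {}" using cls_self[OF V t(1), of n] by blast
  ultimately have "(\<Union>t' \<in> ?c t. \<Union>u' \<in> ?c u. ?c (ext_mult V t' u')) = ?c (ext_mult V t u)"
    by (rule SUP_eq_const[rotated])
  then show ?thesis using t(2) u(2) by (simp add: hat_mult_def const_hat_def)
qed

lemma hat_mult_const: "t \<in> carrier (ext V) \<Longrightarrow> u \<in> carrier (ext V) \<Longrightarrow>
    hat_mult V (const_hat V t) (const_hat V u) = const_hat V (ext_mult V t u)"
  by (rule HOL.ext) (rule hat_mult_rep, auto)

lemma hat_mult_level: "x n = x' n \<Longrightarrow> y n = y' n \<Longrightarrow> hat_mult V x y n = hat_mult V x' y' n"
  by (simp add: hat_mult_def)

lemma hat_mult_closed:
  assumes x: "x \<in> carrier (hat V)" and y: "y \<in> carrier (hat V)"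
  shows "hat_mult V x y \<in> carrier (hat V)"
proof -
  have "\<forall>n. \<exists>t. t \<in> carrier (ext V) \<and> x n = const_hat V t n" "\<forall>n. \<exists>t. t \<in> carrier (ext V) \<and> y n = const_hat V t n"
    by (metis hat_approx[OF V x], metis hat_approx[OF V y])
  then obtain t u where t: "\<And>n. t n \<in> carrier (ext V)" "\<And>n. x n = const_hat V (t n) n"
    and u: "\<And>n. u n \<in> carrier (ext V)" "\<And>n. y n = const_hat V (u n) n" by metis
  have e: "hat_mult V x y = (\<lambda>n. const_hat V (ext_mult V (t n) (u n)) n)"
    by (rule HOL.ext) (rule hat_mult_rep[OF t(1) _ u(1)]; fact)
  show ?thesis unfolding e
  proof (rule hat_glue[where y = "\<lambda>n. const_hat V (ext_mult V (t n) (u n))", OF V])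
    fix n
    have "const_hat V (t (Suc n)) n = x n" "const_hat V (u (Suc n)) n = y n"
      using hat_level_mono[OF V x const_hat_closed[OF V t(1)] _ t(2)[of "Suc n"], of n]
        hat_level_mono[OF V y const_hat_closed[OF V u(1)] _ u(2)[of "Suc n"], of n] by simp_all
    then show "const_hat V (ext_mult V (t (Suc n)) (u (Suc n))) n = const_hat V (ext_mult V (t n) (u n)) n"
      using t u hat_mult_level[of "const_hat V (t (Suc n))" n "const_hat V (t n)" "const_hat V (u (Suc n))" "const_hat V (u n)"]
      by (simp add: hat_mult_const)
  qed (intro const_hat_closed[OF V] ext_mult_closed t u)
qed

text \<open>An identity between expressions in the operations holds on the completion if it holds for
  tensors, because at each level elements of the completion may be replaced by tensors.\<close>

lemma linear_hat_mult:
  "y \<in> carrier (hat V) \<Longrightarrow> linear_map R (hat V) (hat V) (\<lambda>x. hat_mult V x y)"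
  "y \<in> carrier (hat V) \<Longrightarrow> linear_map R (hat V) (hat V) (hat_mult V y)"
proof -
  assume y: "y \<in> carrier (hat V)"
  have add: "hat_mult V (x \<oplus>\<^bsub>hat V\<^esub> x') y = hat_mult V x y \<oplus>\<^bsub>hat V\<^esub> hat_mult V x' y"
    "hat_mult V y (x \<oplus>\<^bsub>hat V\<^esub> x') = hat_mult V y x \<oplus>\<^bsub>hat V\<^esub> hat_mult V y x'"
    if x: "x \<in> carrier (hat V)" and x': "x' \<in> carrier (hat V)" for x x'
  proof (rule_tac [!] HOL.ext)
    fix n
    obtain u where u: "u \<in> carrier (ext V)" "y n = const_hat V u n" by (rule hat_approx[OF V y])
    obtain t where t: "t \<in> carrier (ext V)" "x n = const_hat V t n" by (rule hat_approx[OF V x])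
    obtain t' where t': "t' \<in> carrier (ext V)" "x' n = const_hat V t' n" by (rule hat_approx[OF V x'])
    have s: "(x \<oplus>\<^bsub>hat V\<^esub> x') n = const_hat V (t \<oplus>\<^bsub>ext V\<^esub> t') n"
      using t t' by (simp add: const_hat_add[OF V] hat_add_level[OF V])
    note r = hat_mult_rep[where n = n]
    show "hat_mult V (x \<oplus>\<^bsub>hat V\<^esub> x') y n = (hat_mult V x y \<oplus>\<^bsub>hat V\<^esub> hat_mult V x' y) n"
      using t t' u r[where x = "x \<oplus>\<^bsub>hat V\<^esub> x'" and y = y, OF _ s u] r[where x = x and y = y, OF t u] r[where x = x' and y = y, OF t' u]
      by (simp add: hat_add_level[OF V] ext_mult_distr const_hat_add[OF V] ext_mult_closed)
    show "hat_mult V y (x \<oplus>\<^bsub>hat V\<^esub> x') n = (hat_mult V y x \<oplus>\<^bsub>hat V\<^esub> hat_mult V y x') n"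
      using t t' u r[where x = y and y = "x \<oplus>\<^bsub>hat V\<^esub> x'", OF u _ s] r[where x = y and y = x, OF u t] r[where x = y and y = x', OF u t']
      by (simp add: hat_add_level[OF V] ext_mult_distr const_hat_add[OF V] ext_mult_closed)
  qed
  have smult: "hat_mult V (r \<odot>\<^bsub>hat V\<^esub> x) y = r \<odot>\<^bsub>hat V\<^esub> hat_mult V x y"
    "hat_mult V y (r \<odot>\<^bsub>hat V\<^esub> x) = r \<odot>\<^bsub>hat V\<^esub> hat_mult V y x"
    if x: "x \<in> carrier (hat V)" and r: "r \<in> carrier R" for x r
  proof (rule_tac [!] HOL.ext)
    fix n
    obtain u where u: "u \<in> carrier (ext V)" "y n = const_hat V u n" by (rule hat_approx[OF V y])
    obtain t where t: "t \<in> carrier (ext V)" "x n = const_hat V t n" by (rule hat_approx[OF V x])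
    have s: "(r \<odot>\<^bsub>hat V\<^esub> x) n = const_hat V (ext_smult V r t) n"
      using hat_smult_level[where x = x and y = "const_hat V t" and n = n, OF V t(2)] const_hat_smult[OF V t(1) r] by simp
    note m = hat_mult_rep[where n = n]
    show "hat_mult V (r \<odot>\<^bsub>hat V\<^esub> x) y n = (r \<odot>\<^bsub>hat V\<^esub> hat_mult V x y) n"
      using t u r m[where x = "r \<odot>\<^bsub>hat V\<^esub> x" and y = y, OF _ s u] hat_smult_level[where x = "hat_mult V x y" and y = "const_hat V (ext_mult V t u)" and n = n, OF V m[where x = x and y = y, OF t u]]
      by (simp add: ext_mult_smult const_hat_smult[OF V] ext_mult_closed ext_smult_closed[OF V])
    show "hat_mult V y (r \<odot>\<^bsub>hat V\<^esub> x) n = (r \<odot>\<^bsub>hat V\<^esub> hat_mult V y x) n"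
      using t u r m[where x = y and y = "r \<odot>\<^bsub>hat V\<^esub> x", OF u _ s] hat_smult_level[where x = "hat_mult V y x" and y = "const_hat V (ext_mult V u t)" and n = n, OF V m[where x = y and y = x, OF u t]]
      by (simp add: ext_mult_smult const_hat_smult[OF V] ext_mult_closed ext_smult_closed[OF V])
  qed
  show "linear_map R (hat V) (hat V) (\<lambda>x. hat_mult V x y)" "linear_map R (hat V) (hat V) (hat_mult V y)"
    using y by (auto intro!: linear_mapI hat_mult_closed add smult)
qed

lemma hat_mult_assoc:
  assumes x: "x \<in> carrier (hat V)" and y: "y \<in> carrier (hat V)" and z: "z \<in> carrier (hat V)"
  shows "hat_mult V (hat_mult V x y) z = hat_mult V x (hat_mult V y z)"
proof
  fix n
  obtain t where t: "t \<in> carrier (ext V)" "x n = const_hat V t n" by (rule hat_approx[OF V x])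
  obtain u where u: "u \<in> carrier (ext V)" "y n = const_hat V u n" by (rule hat_approx[OF V y])
  obtain w where w: "w \<in> carrier (ext V)" "z n = const_hat V w n" by (rule hat_approx[OF V z])
  note r = hat_mult_rep[where n = n]
  show "hat_mult V (hat_mult V x y) z n = hat_mult V x (hat_mult V y z) n"
    using t u w r[where x = "hat_mult V x y" and y = z, OF _ r[where x = x and y = y, OF t u] w]
      r[where x = x and y = "hat_mult V y z", OF t _ r[where x = y and y = z, OF u w]]
    by (simp add: ext_mult_closed ext_mult_assoc)
qed

lemma hat_mult_one:
  assumes x: "x \<in> carrier (hat V)"
  shows "hat_mult V (incl V \<one>\<^bsub>V\<^esub>) x = x" "hat_mult V x (incl V \<one>\<^bsub>V\<^esub>) = x"
proof (rule_tac [!] HOL.ext)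
  fix n
  obtain t where t: "t \<in> carrier (ext V)" "x n = const_hat V t n" by (rule hat_approx[OF V x])
  have o: "pure_tensor K V R \<one>\<^bsub>V\<^esub> \<one>\<^bsub>R\<^esub> \<in> carrier (ext V)"
    "incl V \<one>\<^bsub>V\<^esub> n = const_hat V (pure_tensor K V R \<one>\<^bsub>V\<^esub> \<one>\<^bsub>R\<^esub>) n"
    by (simp_all add: pure_closed[OF V] incl_const_hat[OF V])
  show "hat_mult V (incl V \<one>\<^bsub>V\<^esub>) x n = x n" "hat_mult V x (incl V \<one>\<^bsub>V\<^esub>) n = x n"
    using hat_mult_rep[where x = "incl V \<one>\<^bsub>V\<^esub>" and y = x and n = n, OF o t]
      hat_mult_rep[where y = "incl V \<one>\<^bsub>V\<^esub>" and x = x and n = n, OF t o] t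
    by (simp_all add: ext_mult_one)
qed

text \<open>Multiplication by an element of the maximal ideal raises the level.\<close>

lemma hat_mult_level_zero:
  assumes x: "x \<in> carrier (hat V)" "x m = \<zero>\<^bsub>hat V\<^esub> m" and y: "y \<in> carrier (hat V)" "y n = \<zero>\<^bsub>hat V\<^esub> n"
  shows "hat_mult V x y (m + n) = \<zero>\<^bsub>hat V\<^esub> (m + n)"
proof -
  obtain t where t: "t \<in> carrier (ext V)" "x (m + n) = const_hat V t (m + n)" by (rule hat_approx[OF V x(1)])
  obtain u where u: "u \<in> carrier (ext V)" "y (m + n) = const_hat V u (m + n)" by (rule hat_approx[OF V y(1)])
  have "x m = const_hat V t m" "y n = const_hat V u n"
    using hat_level_mono[OF V x(1) const_hat_closed[OF V t(1)] _ t(2)]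
      hat_level_mono[OF V y(1) const_hat_closed[OF V u(1)] _ u(2)] by simp_all
  then have "t \<in> filt V m" "u \<in> filt V n"
    using hat_level_zero_iff[OF V x(1) t(1), of m] hat_level_zero_iff[OF V y(1) u(1), of n] x(2) y(2)
    by (simp_all add: const_hat_def)
  then have "ext_mult V t u \<in> filt V (m + n)" by (rule ext_mult_filt)
  then show ?thesis
    using hat_mult_rep[where x = x and y = y and n = "m + n", OF t u] hat_level_zero_iff[OF V hat_mult_closed[OF x(1) y(1)]]
      ext_mult_closed[OF t(1) u(1)] by (simp add: const_hat_def)
qed

end

end

section \<open>Rational polynomials and power series in algebras of characteristic zero\<close>

subsection \<open>Truncated power series\<close>

definition truncate_fps :: "nat \<Rightarrow> rat fps \<Rightarrow> rat poly" where
  "truncate_fps M P = (\<Sum>i<M. Polynomial.monom (fps_nth P i) i)"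

lemma truncate_fps_Suc: "truncate_fps (Suc M) P = truncate_fps M P + Polynomial.monom (fps_nth P M) M"
  by (simp add: truncate_fps_def)

lemma coeff_truncate_fps: "Polynomial.coeff (truncate_fps M P) k = (if k < M then fps_nth P k else 0)"
  by (simp add: truncate_fps_def Polynomial.coeff_sum Polynomial.coeff_monom if_distrib sum.delta' cong: if_cong)

lemma fps_power_nth_cong:
  fixes P Q :: "rat fps"
  assumes "\<And>i. i \<le> k \<Longrightarrow> fps_nth P i = fps_nth Q i"
  shows "fps_nth (P ^ n) k = fps_nth (Q ^ n) k"
  using assms
proof (induction n arbitrary: k)
  case (Suc n)
  then show ?case by (auto simp: fps_mult_nth intro!: sum.cong)
qed simp

text \<open>Coefficients of a composite up to \<open>k\<close> only depend on the coefficients up to \<open>k\<close>.\<close>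

lemma coeff_pcompose_truncate:
  assumes Q: "fps_nth Q 0 = 0" and k: "k < M" "k < M'"
  shows "Polynomial.coeff (pcompose (truncate_fps M P) (truncate_fps M' Q)) k = fps_nth (fps_compose P Q) k"
proof -
  have "Polynomial.coeff (pcompose (truncate_fps M P) (truncate_fps M' Q)) k
      = fps_nth (fps_compose (fps_of_poly (truncate_fps M P)) (fps_of_poly (truncate_fps M' Q))) k"
    using Q by (subst fps_of_poly_pcompose[symmetric]) (auto simp: coeff_truncate_fps)
  also have "\<dots> = fps_nth (fps_compose P Q) k"
    unfolding fps_compose_nth
  proof (rule sum.cong)
    fix i assume i: "i \<in> {0..k}"
    have "fps_nth (fps_of_poly (truncate_fps M' Q) ^ i) k = fps_nth (Q ^ i) k"
      by (rule fps_power_nth_cong) (use k in \<open>simp add: coeff_truncate_fps\<close>)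
    then show "fps_nth (fps_of_poly (truncate_fps M P)) i * fps_nth (fps_of_poly (truncate_fps M' Q) ^ i) k
        = fps_nth P i * fps_nth (Q ^ i) k"
      using i k by (simp add: coeff_truncate_fps)
  qed simp
  finally show ?thesis .
qed

text \<open>The two power series identities behind the inversion of \<open>exp\<close> and \<open>log\<close>.\<close>

lemma exp_ln_compose:
  "fps_compose (fps_exp 1) (fps_ln 1) = 1 + (fps_X :: rat fps)"
  "fps_compose (fps_ln 1) (fps_exp 1 - 1) = (fps_X :: rat fps)"
proof -
  have "fps_compose (fps_exp 1 - 1) (fps_ln 1) = (fps_X :: rat fps)"
    using fps_inv_fps_exp_compose(2)[of "1 :: rat"] fps_ln_fps_exp_inv[of "1 :: rat"] by simp
  then show "fps_compose (fps_exp 1) (fps_ln 1) = 1 + (fps_X :: rat fps)"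
    by (simp add: fps_compose_sub_distrib algebra_simps)
  show "fps_compose (fps_ln 1) (fps_exp 1 - 1) = (fps_X :: rat fps)"
    using fps_inv_fps_exp_compose(1)[of "1 :: rat"] fps_ln_fps_exp_inv[of "1 :: rat"] by simp
qed


subsection \<open>Rational scalars in a field of characteristic zero\<close>

text \<open>The embedding of the rational numbers as the prime field. It allows the coefficients of the exponential and the
  logarithm to be taken from rational power series.\<close>

definition rat_embed :: "('k, 'x) ring_scheme \<Rightarrow> rat \<Rightarrow> 'k" where
  "rat_embed K q = (case quotient_of q of (a, b) \<Rightarrow> add_pow K a \<one>\<^bsub>K\<^esub> \<otimes>\<^bsub>K\<^esub> inv\<^bsub>K\<^esub> (add_pow K b \<one>\<^bsub>K\<^esub>))"

context
  fixes K :: "('k, 'x) ring_scheme"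
  assumes K: "field K" and char_zero: "\<forall>n::nat > 0. add_pow K n \<one>\<^bsub>K\<^esub> \<noteq> \<zero>\<^bsub>K\<^esub>"
begin

interpretation K: field K by (rule K)

abbreviation int_embed :: "int \<Rightarrow> 'k" where
  "int_embed a \<equiv> add_pow K a \<one>\<^bsub>K\<^esub>"

lemma int_embed_closed: "int_embed a \<in> carrier K"
  by (rule K.add.int_pow_closed) simp

lemma int_embed_add: "int_embed (a + b) = int_embed a \<oplus>\<^bsub>K\<^esub> int_embed b"
  using K.add.int_pow_mult[of "\<one>\<^bsub>K\<^esub>" a b] by simp

lemma int_embed_mult: "int_embed (a * b) = int_embed a \<otimes>\<^bsub>K\<^esub> int_embed b"
  using K.add.int_pow_pow[of "\<one>\<^bsub>K\<^esub>" a b] K.add_pow_ldistr_int[of "\<one>\<^bsub>K\<^esub>" "int_embed b" a] int_embed_closed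
  by (simp add: mult.commute)

lemma int_embed_nonzero: "a \<noteq> 0 \<Longrightarrow> int_embed a \<noteq> \<zero>\<^bsub>K\<^esub>"
proof
  assume a: "a \<noteq> 0" and "int_embed a = \<zero>\<^bsub>K\<^esub>"
  moreover have "int_embed (a * a) = add_pow K (nat (a * a)) \<one>\<^bsub>K\<^esub>" by (rule add_pow_int_ge) simp
  ultimately have "add_pow K (nat (a * a)) \<one>\<^bsub>K\<^esub> = \<zero>\<^bsub>K\<^esub>" by (simp add: int_embed_mult)
  moreover have "0 < nat (a * a)" using a by (simp add: zero_less_mult_iff) linarith
  ultimately show False using char_zero by blast
qed

lemma rat_embed_closed: "rat_embed K q \<in> carrier K"
proof -
  obtain a b where ab: "quotient_of q = (a, b)" by fastforce
  then have "b > 0" by (rule quotient_of_denom_pos)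
  then have "int_embed b \<in> Units K" using int_embed_closed int_embed_nonzero by (simp add: K.field_Units)
  then show ?thesis using ab int_embed_closed by (simp add: rat_embed_def)
qed

text \<open>The embedding may be computed from any fraction that represents the number, reduced or not.\<close>

lemma rat_embed_iff:
  assumes q: "q * of_int b = of_int a" and b: "b \<noteq> 0" and x: "x \<in> carrier K"
  shows "rat_embed K q = x \<longleftrightarrow> x \<otimes>\<^bsub>K\<^esub> int_embed b = int_embed a"
proof -
  obtain m d where md: "quotient_of q = (m, d)" by fastforce
  then have d: "d > 0" by (rule quotient_of_denom_pos)
  have "q = of_int m / of_int d" by (rule quotient_of_div[OF md])
  then have "of_int m = q * of_int d" using d by simp
  then have "(of_int (m * b) :: rat) = of_int (a * d)" by (simp add: ac_simps flip: q)
  then have e: "m * b = a * d" by (simp only: of_int_eq_iff)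
  let ?q = "rat_embed K q"
  have dU: "int_embed d \<in> Units K" using d int_embed_closed int_embed_nonzero by (simp add: K.field_Units)
  then have qd: "?q \<otimes>\<^bsub>K\<^esub> int_embed d = int_embed m"
    using md int_embed_closed by (simp add: rat_embed_def K.m_assoc)
  have "(?q \<otimes>\<^bsub>K\<^esub> int_embed b) \<otimes>\<^bsub>K\<^esub> int_embed d = (?q \<otimes>\<^bsub>K\<^esub> int_embed d) \<otimes>\<^bsub>K\<^esub> int_embed b"
    using rat_embed_closed int_embed_closed by (simp add: K.m_ac)
  also have "\<dots> = int_embed a \<otimes>\<^bsub>K\<^esub> int_embed d" unfolding qd by (simp add: e flip: int_embed_mult)
  finally have "?q \<otimes>\<^bsub>K\<^esub> int_embed b = int_embed a"
    using K.m_rcancel[OF int_embed_nonzero int_embed_closed, of d] d rat_embed_closed int_embed_closed by simp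
  then show ?thesis
    using K.m_rcancel[OF int_embed_nonzero[OF b] int_embed_closed x rat_embed_closed, of q] by auto
qed

lemma rat_embed_spec:
  obtains a b where "q * of_int b = of_int a" "b \<noteq> 0" "rat_embed K q \<otimes>\<^bsub>K\<^esub> int_embed b = int_embed a"
proof -
  obtain m d where md: "quotient_of q = (m, d)" by fastforce
  have d: "d > 0" by (rule quotient_of_denom_pos[OF md])
  have "q * of_int d = of_int m" using quotient_of_div[OF md] d by simp
  with d show ?thesis using that[of d m] rat_embed_iff[of q d m "rat_embed K q"] rat_embed_closed by simp
qed

lemma rat_embed_add: "rat_embed K (p + q) = rat_embed K p \<oplus>\<^bsub>K\<^esub> rat_embed K q"
proof -
  obtain a b where a: "p * of_int b = of_int a" "b \<noteq> 0" "rat_embed K p \<otimes>\<^bsub>K\<^esub> int_embed b = int_embed a"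
    by (rule rat_embed_spec)
  obtain c d where c: "q * of_int d = of_int c" "d \<noteq> 0" "rat_embed K q \<otimes>\<^bsub>K\<^esub> int_embed d = int_embed c"
    by (rule rat_embed_spec)
  have "(p + q) * of_int (b * d) = of_int (a * d + c * b)"
    using a(1) c(1) by (simp add: algebra_simps flip: a(1) c(1))
  moreover have "(rat_embed K p \<oplus>\<^bsub>K\<^esub> rat_embed K q) \<otimes>\<^bsub>K\<^esub> int_embed (b * d) = int_embed (a * d + c * b)"
    unfolding int_embed_mult int_embed_add a(3)[symmetric] c(3)[symmetric]
    using rat_embed_closed int_embed_closed by (simp add: K.l_distr K.r_distr K.m_ac)
  ultimately show ?thesis
    using rat_embed_iff[of "p + q" "b * d" "a * d + c * b"] a(2) c(2) rat_embed_closed by simp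
qed

lemma rat_embed_mult: "rat_embed K (p * q) = rat_embed K p \<otimes>\<^bsub>K\<^esub> rat_embed K q"
proof -
  obtain a b where a: "p * of_int b = of_int a" "b \<noteq> 0" "rat_embed K p \<otimes>\<^bsub>K\<^esub> int_embed b = int_embed a"
    by (rule rat_embed_spec)
  obtain c d where c: "q * of_int d = of_int c" "d \<noteq> 0" "rat_embed K q \<otimes>\<^bsub>K\<^esub> int_embed d = int_embed c"
    by (rule rat_embed_spec)
  have "(p * q) * of_int (b * d) = of_int (a * c)"
    by (simp add: algebra_simps flip: a(1) c(1))
  moreover have "(rat_embed K p \<otimes>\<^bsub>K\<^esub> rat_embed K q) \<otimes>\<^bsub>K\<^esub> int_embed (b * d) = int_embed (a * c)"
    unfolding int_embed_mult a(3)[symmetric] c(3)[symmetric]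
    using rat_embed_closed int_embed_closed by (simp add: K.m_ac)
  ultimately show ?thesis
    using rat_embed_iff[of "p * q" "b * d" "a * c"] a(2) c(2) rat_embed_closed by simp
qed

lemma rat_embed_of_int: "rat_embed K (of_int a) = int_embed a"
  using rat_embed_iff[of "of_int a" 1 a "int_embed a"] int_embed_closed by simp

lemma rat_embed_simps:
  "rat_embed K 0 = \<zero>\<^bsub>K\<^esub>" "rat_embed K 1 = \<one>\<^bsub>K\<^esub>" "rat_embed K (of_nat n) = add_pow K n \<one>\<^bsub>K\<^esub>"
  using rat_embed_of_int[of 0] rat_embed_of_int[of 1] rat_embed_of_int[of "int n"]
  by (simp_all add: add_pow_int_ge)

lemma rat_embed_inverse: "n > 0 \<Longrightarrow> rat_embed K (1 / of_nat n) = inv\<^bsub>K\<^esub> (add_pow K n \<one>\<^bsub>K\<^esub>)"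
proof -
  assume n: "n > 0"
  have "rat_embed K (1 / of_nat n) \<otimes>\<^bsub>K\<^esub> add_pow K n \<one>\<^bsub>K\<^esub> = \<one>\<^bsub>K\<^esub>"
    using n rat_embed_mult[of "1 / of_nat n" "of_nat n"] by (simp add: rat_embed_simps)
  then show ?thesis
    using rat_embed_closed by (intro K.comm_inv_char[symmetric]) (auto simp: K.m_comm)
qed

lemma rat_embed_minus_one_power: "rat_embed K ((- 1) ^ n) = (\<ominus>\<^bsub>K\<^esub> \<one>\<^bsub>K\<^esub>) [^]\<^bsub>K\<^esub> n"
proof (induction n)
  case (Suc n)
  have "rat_embed K (- 1) = \<ominus>\<^bsub>K\<^esub> \<one>\<^bsub>K\<^esub>"
    using rat_embed_add[of "-1" 1] rat_embed_closed by (intro K.minus_equality[symmetric]) (auto simp: rat_embed_simps)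
  then show ?case using Suc rat_embed_closed by (simp only: power_Suc rat_embed_mult) (simp add: K.m_comm)
qed (simp add: rat_embed_simps)


subsection \<open>Evaluation of polynomials\<close>

context
  fixes A :: "('k, 'a, 'y) module_scheme"
  assumes A: "K_algebra K A"
begin

interpretation M: module K A using A by (simp add: K_algebra_def)
interpretation A: ring A using A by (simp add: K_algebra_def)

lemma algebra_smult:
  "a \<in> carrier K \<Longrightarrow> v \<in> carrier A \<Longrightarrow> w \<in> carrier A \<Longrightarrow> (a \<odot>\<^bsub>A\<^esub> v) \<otimes>\<^bsub>A\<^esub> w = a \<odot>\<^bsub>A\<^esub> (v \<otimes>\<^bsub>A\<^esub> w)"
  "a \<in> carrier K \<Longrightarrow> v \<in> carrier A \<Longrightarrow> w \<in> carrier A \<Longrightarrow> v \<otimes>\<^bsub>A\<^esub> (a \<odot>\<^bsub>A\<^esub> w) = a \<odot>\<^bsub>A\<^esub> (v \<otimes>\<^bsub>A\<^esub> w)"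
  using A by (auto simp: K_algebra_def)

definition poly_eval :: "'a \<Rightarrow> rat poly \<Rightarrow> 'a" where
  "poly_eval c p = fold_coeffs (\<lambda>a x. (rat_embed K a \<odot>\<^bsub>A\<^esub> \<one>\<^bsub>A\<^esub>) \<oplus>\<^bsub>A\<^esub> (c \<otimes>\<^bsub>A\<^esub> x)) p \<zero>\<^bsub>A\<^esub>"

context
  fixes c assumes c: "c \<in> carrier A"
begin

lemma poly_eval_0: "poly_eval c 0 = \<zero>\<^bsub>A\<^esub>"
  by (simp add: poly_eval_def)

lemma poly_eval_pCons: "poly_eval c (pCons a p) = (rat_embed K a \<odot>\<^bsub>A\<^esub> \<one>\<^bsub>A\<^esub>) \<oplus>\<^bsub>A\<^esub> (c \<otimes>\<^bsub>A\<^esub> poly_eval c p)"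
proof (cases "p = 0 \<and> a = 0")
  case True
  then show ?thesis using c by (simp add: poly_eval_def rat_embed_simps)
next
  case False
  then show ?thesis by (auto simp: poly_eval_def)
qed

lemma poly_eval_closed: "poly_eval c p \<in> carrier A"
  by (induction p) (simp_all add: poly_eval_0 poly_eval_pCons c rat_embed_closed)

lemma poly_eval_add: "poly_eval c (p + q) = poly_eval c p \<oplus>\<^bsub>A\<^esub> poly_eval c q"
proof (induction p q rule: poly_induct2)
  case (pCons a p b q)
  then show ?case
    by (simp add: poly_eval_pCons c rat_embed_closed poly_eval_closed rat_embed_add M.smult_l_distr A.r_distr M.a_ac)
qed (simp add: poly_eval_0)

lemma poly_eval_smult: "poly_eval c (Polynomial.smult a p) = rat_embed K a \<odot>\<^bsub>A\<^esub> poly_eval c p"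
  by (induction p)
    (simp_all add: poly_eval_0 poly_eval_pCons c rat_embed_closed poly_eval_closed rat_embed_mult M.smult_assoc1
      M.smult_r_distr algebra_smult)

lemma poly_eval_const: "poly_eval c [:a:] = rat_embed K a \<odot>\<^bsub>A\<^esub> \<one>\<^bsub>A\<^esub>"
  by (simp add: poly_eval_pCons poly_eval_0 c rat_embed_closed)

lemma poly_eval_mult: "poly_eval c (p * q) = poly_eval c p \<otimes>\<^bsub>A\<^esub> poly_eval c q"
  by (induction p)
    (simp_all add: poly_eval_0 poly_eval_pCons poly_eval_add poly_eval_smult c rat_embed_closed poly_eval_closed
      A.l_distr algebra_smult rat_embed_simps A.m_assoc)

lemma poly_eval_monom: "poly_eval c (Polynomial.monom a n) = rat_embed K a \<odot>\<^bsub>A\<^esub> (c [^]\<^bsub>A\<^esub> n)"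
proof (induction n)
  case 0
  then show ?case by (simp add: monom_0 poly_eval_const)
next
  case (Suc n)
  have "c \<otimes>\<^bsub>A\<^esub> c [^]\<^bsub>A\<^esub> n = c [^]\<^bsub>A\<^esub> Suc n" using c A.nat_pow_Suc2 by metis
  then show ?case using Suc by (simp add: monom_Suc poly_eval_pCons rat_embed_simps c rat_embed_closed algebra_smult)
qed

end

text \<open>Evaluation turns substitution of polynomials into iterated evaluation; it is applied to
  truncations of power series.\<close>

lemma poly_eval_pcompose:
  assumes c: "c \<in> carrier A"
  shows "poly_eval c (pcompose p q) = poly_eval (poly_eval c q) p"
  by (induction p)
    (simp_all add: poly_eval_0 poly_eval_closed c pcompose_pCons poly_eval_add poly_eval_const poly_eval_mult rat_embed_closed
      poly_eval_pCons)

end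

end

section \<open>The convolution algebra\<close>

lemma words_two: "vs \<in> words V 2 \<longleftrightarrow> (\<exists>v w. vs = [v, w] \<and> v \<in> carrier V \<and> w \<in> carrier V)"
  by (auto simp: words_def numeral_2_eq_2 length_Suc_conv)

lemma multilinear_two:
  assumes "\<And>v. v \<in> carrier V \<Longrightarrow> linear_map K V M (B v)"
    and "\<And>w. w \<in> carrier V \<Longrightarrow> linear_map K V M (\<lambda>v. B v w)"
  shows "multilinear_map K V 2 M (\<lambda>vs. B (vs ! 0) (vs ! 1))"
  unfolding multilinear_map_def
proof (intro conjI ballI allI impI; (elim conjE)?)
  fix vs assume "vs \<in> words V 2"
  then show "B (vs ! 0) (vs ! 1) \<in> carrier M"
    using linear_map_closed[OF assms(1)] by (auto simp: words_two)
next
  fix us ws assume *: "set us \<subseteq> carrier V" "set ws \<subseteq> carrier V" "Suc (length us + length ws) = 2"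
  then consider w where "us = []" "ws = [w]" | u where "us = [u]" "ws = []"
    by (cases us; cases ws) auto
  then show "linear_map K V M (\<lambda>v. B ((us @ v # ws) ! 0) ((us @ v # ws) ! 1))"
    by cases (use * assms in auto)
qed

lemma tensor_lift_linear_comp:
  assumes K: "field K" and V: "module K V" and M: "module K M" and N: "module K N"
    and b: "multilinear_map K V n M b" and L: "linear_map K M N L" and t: "t \<in> carrier (tensor_power K V n)"
  shows "multilinear_map K V n N (\<lambda>vs. L (b vs))"
    and "L (tensor_lift K M b t) = tensor_lift K N (\<lambda>vs. L (b vs)) t"
proof -
  show b': "multilinear_map K V n N (\<lambda>vs. L (b vs))"
    unfolding multilinear_map_def
  proof (intro conjI ballI allI impI)
    show "L (b vs) \<in> carrier N" if "vs \<in> words V n" for vs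
      using b that linear_map_closed[OF L] by (simp add: multilinear_map_def)
    show "linear_map K V N (\<lambda>v. L (b (us @ v # ws)))"
      if "set us \<subseteq> carrier V \<and> set ws \<subseteq> carrier V \<and> Suc (length us + length ws) = n" for us ws
      by (rule linear_map_comp[OF _ L]) (use b that in \<open>simp add: multilinear_map_def\<close>)
  qed
  show "L (tensor_lift K M b t) = tensor_lift K N (\<lambda>vs. L (b vs)) t"
    by (rule tensor_power_map_eqI[OF K V N linear_map_comp[OF linear_map_multilinear_lift[OF K V M b] L]
          linear_map_multilinear_lift[OF K V N b'] _ t])
      (simp add: multilinear_lift_pure[OF K V M b] multilinear_lift_pure[OF K V N b'])
qed

lemma tensor_lift_cong:
  assumes K: "field K" and V: "module K V" and M: "module K M"
    and b: "multilinear_map K V n M b" and b': "multilinear_map K V n M b'"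
    and eq: "\<And>vs. vs \<in> words V n \<Longrightarrow> b vs = b' vs" and t: "t \<in> carrier (tensor_power K V n)"
  shows "tensor_lift K M b t = tensor_lift K M b' t"
  by (rule tensor_power_map_eqI[OF K V M linear_map_multilinear_lift[OF K V M b]
        linear_map_multilinear_lift[OF K V M b'] _ t])
    (simp add: multilinear_lift_pure[OF K V M b] multilinear_lift_pure[OF K V M b'] eq)

lemma graded_comm_algebra_K_algebra: "graded_comm_algebra K W \<Longrightarrow> K_algebra K W"
  unfolding graded_comm_algebra_def K_algebra_def graded_vector_space_def by blast

context complete_local_algebra
begin

interpretation K: field K by (rule field_K)
interpretation R: algebra K R by (rule algebra_R)

lemma hat_component_mult:
  assumes alg: "graded_comm_algebra K W" and x: "x \<in> hat_component W i" and y: "y \<in> hat_component W j"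
  shows "hat_mult W x y \<in> hat_component W (i + j)"
proof -
  have g: "graded_vector_space K W" using alg by (simp add: graded_comm_algebra_def)
  note A = graded_comm_algebra_K_algebra[OF alg] and M = graded_module[OF g]
  have m: "v \<otimes>\<^bsub>W\<^esub> w \<in> component W (i + j)" if "v \<in> component W i" "w \<in> component W j" for v w
    using alg that unfolding graded_comm_algebra_def by blast
  have e: "ext_mult W t u \<in> ext_component W (i + j)"
    if "t \<in> ext_component W i" and u: "u \<in> ext_component W j" for t u
    using that(1)
  proof (induction t rule: ext_component_induct[OF g, consumes 1, case_names pure add])
    case (pure v r)
    note v = pure component_carrier[OF g pure(1)]
    from u show ?case
      by (induction u rule: ext_component_induct[OF g, consumes 1, case_names pure add])
        (use v in \<open>simp_all add: ext_mult_pure[OF A] component_carrier[OF g] ext_component_pure[OF g] m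
          ext_mult_distr[OF A] pure_closed[OF M] ext_component_closed[OF g]\<close>)
  next
    case (add t t')
    then show ?case
      by (simp add: ext_mult_distr[OF A] ext_component_carrier[OF g u] ext_component_closed[OF g])
  qed
  show ?thesis
  proof (rule hat_component_limit[OF g])
    show "hat_mult W x y \<in> carrier (hat W)"
      using hat_mult_closed[OF A] hat_component_carrier[OF g] x y by blast
    fix n
    obtain t where t: "t \<in> ext_component W i" "x n = const_hat W t n" using x unfolding hat_component_iff by meson
    obtain u where u: "u \<in> ext_component W j" "y n = const_hat W u n" using y unfolding hat_component_iff by meson
    have "hat_mult W x y n = const_hat W (ext_mult W t u) n"
      by (rule hat_mult_rep[where x = x and y = y and n = n, OF A ext_component_carrier[OF g t(1)] t(2) ext_component_carrier[OF g u(1)] u(2)])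
    then show "\<exists>z\<in>hat_component W (i + j). hat_mult W x y n = z n"
      using hat_component_const[OF g e[OF t(1) u(1)]] by blast
  qed
qed

text \<open>Linear maps on \<open>V\<close> take the place of continuous maps on its completion: they form the same
  algebra, but no extension by continuity is involved in the product.\<close>

definition conv_algebra ::
  "('k, 'v, 'z) graded_bimodule_scheme \<Rightarrow> ('k, 'w, 'u) graded_bimodule_scheme
    \<Rightarrow> ('k, 'v \<Rightarrow> ('w, 'r, 'k) hat) module" where
  "conv_algebra V W = \<lparr>carrier = {c \<in> extensional (carrier V). linear_map K V (hat_over_field W) c},
    monoid.mult = (\<lambda>f g. \<lambda>v \<in> carrier V. tensor_lift K (hat_over_field W)
      (\<lambda>vs. hat_mult W (f (vs ! 0)) (g (vs ! 1))) (comult V v)),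
    monoid.one = (\<lambda>v \<in> carrier V. incl W (counit V v \<odot>\<^bsub>W\<^esub> \<one>\<^bsub>W\<^esub>)),
    ring.zero = (\<lambda>v \<in> carrier V. \<zero>\<^bsub>hat W\<^esub>),
    ring.add = (\<lambda>f g. \<lambda>v \<in> carrier V. f v \<oplus>\<^bsub>hat W\<^esub> g v),
    module.smult = (\<lambda>a f. \<lambda>v \<in> carrier V. scal a \<odot>\<^bsub>hat W\<^esub> f v)\<rparr>"

end

locale convolution = complete_local_algebra K R \<mm>
  for K :: "('k, 'x) ring_scheme" and R :: "('k, 'r, 'y) module_scheme" and \<mm> :: "'r set" +
  fixes V :: "('k, 'v, 'z) graded_bimodule_scheme" and W :: "('k, 'w, 'u) graded_bimodule_scheme"
  assumes coV: "graded_cocomm_coalgebra K V" and oneV: "\<one>\<^bsub>V\<^esub> \<in> component V 0" and coaugV: "coaugmented K V"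
    and conilV: "conilpotent K V" and algW: "graded_comm_algebra K W"
begin

abbreviation "\<C> \<equiv> conv_algebra V W"

interpretation K: field K by (rule field_K)
interpretation R: algebra K R by (rule algebra_R)

lemma gradedV: "graded_vector_space K V" and gradedW: "graded_vector_space K W"
  using coV algW by (auto simp: graded_cocomm_coalgebra_def graded_comm_algebra_def)

lemmas modV = graded_module[OF gradedV] and modW = graded_module[OF gradedW]
  and kalgW = graded_comm_algebra_K_algebra[OF algW]

lemma oneV_carrier: "\<one>\<^bsub>V\<^esub> \<in> carrier V"
  by (rule component_carrier[OF gradedV oneV])

lemma oneW_component: "\<one>\<^bsub>W\<^esub> \<in> component W 0"
  using algW by (simp add: graded_comm_algebra_def)

lemma oneW_carrier: "\<one>\<^bsub>W\<^esub> \<in> carrier W"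
  by (rule component_carrier[OF gradedW oneW_component])

interpretation V: module K V by (rule modV)
interpretation W: module K W by (rule modW)
interpretation HR: module R "hat W" by (rule module_hat[OF modW])
interpretation H: module K "hat_over_field W" by (rule module_hat_over_field[OF modW])
interpretation T2: module K "tensor_power K V 2" by (rule module_tensor_power[OF field_K modV])

lemmas modH = module_hat_over_field[OF modW]
  and H_simps = hat_over_field_simps[OF modW]
  and conv_defs = conv_algebra_def

lemma linear_comult: "linear_map K V (tensor_power K V 2) (comult V)"
  using coV by (simp add: graded_cocomm_coalgebra_def)

lemma linear_counit: "a \<in> carrier K \<Longrightarrow> v \<in> carrier V \<Longrightarrow> counit V (a \<odot>\<^bsub>V\<^esub> v) = a \<otimes>\<^bsub>K\<^esub> counit V v"
  "v \<in> carrier V \<Longrightarrow> w \<in> carrier V \<Longrightarrow> counit V (v \<oplus>\<^bsub>V\<^esub> w) = counit V v \<oplus>\<^bsub>K\<^esub> counit V w"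
  "v \<in> carrier V \<Longrightarrow> counit V v \<in> carrier K"
proof -
  have "linear_map K V (self_module K) (counit V)" using coV by (simp add: graded_cocomm_coalgebra_def)
  then show "a \<in> carrier K \<Longrightarrow> v \<in> carrier V \<Longrightarrow> counit V (a \<odot>\<^bsub>V\<^esub> v) = a \<otimes>\<^bsub>K\<^esub> counit V v"
    "v \<in> carrier V \<Longrightarrow> w \<in> carrier V \<Longrightarrow> counit V (v \<oplus>\<^bsub>V\<^esub> w) = counit V v \<oplus>\<^bsub>K\<^esub> counit V w"
    "v \<in> carrier V \<Longrightarrow> counit V v \<in> carrier K"
    by (auto simp: linear_map_def self_module_def)
qed

lemma comult_closed: "v \<in> carrier V \<Longrightarrow> comult V v \<in> carrier (tensor_power K V 2)"
  by (rule linear_map_closed[OF linear_comult])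

lemma conv_carrier: "c \<in> carrier \<C> \<longleftrightarrow>
    c \<in> extensional (carrier V) \<and> linear_map K V (hat_over_field W) c"
  by (simp add: conv_algebra_def)

lemma conv_linear: "c \<in> carrier \<C> \<Longrightarrow> linear_map K V (hat_over_field W) c"
  by (simp add: conv_carrier)

lemma conv_closed: "c \<in> carrier \<C> \<Longrightarrow> v \<in> carrier V \<Longrightarrow> c v \<in> carrier (hat W)"
  using linear_map_closed[OF conv_linear] by (simp add: H_simps)

lemma conv_eqI: "c \<in> carrier \<C> \<Longrightarrow> d \<in> carrier \<C> \<Longrightarrow>
    (\<And>v. v \<in> carrier V \<Longrightarrow> c v = d v) \<Longrightarrow> c = d"
  by (rule extensionalityI[of _ "carrier V"]) (auto simp: conv_carrier)

lemma restrict_conv: "linear_map K V (hat_over_field W) c \<Longrightarrow> restrict c (carrier V) \<in> carrier \<C>"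
  by (auto simp: conv_carrier intro: linear_map_cong[OF modV])

lemma linear_hat_mult_K:
  "y \<in> carrier (hat W) \<Longrightarrow> linear_map K (hat_over_field W) (hat_over_field W) (\<lambda>x. hat_mult W x y)"
  "y \<in> carrier (hat W) \<Longrightarrow> linear_map K (hat_over_field W) (hat_over_field W) (hat_mult W y)"
  by (rule linear_R_imp_K[OF modW modW linear_hat_mult(1)[OF kalgW]], assumption)
    (rule linear_R_imp_K[OF modW modW linear_hat_mult(2)[OF kalgW]])

abbreviation pairing :: "('v \<Rightarrow> ('w, 'r, 'k) hat) \<Rightarrow> ('v \<Rightarrow> ('w, 'r, 'k) hat) \<Rightarrow> 'v list \<Rightarrow> ('w, 'r, 'k) hat" where
  "pairing f g \<equiv> \<lambda>vs. hat_mult W (f (vs ! 0)) (g (vs ! 1))"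

lemma multilinear_pairing:
  assumes "f \<in> carrier \<C>" "g \<in> carrier \<C>"
  shows "multilinear_map K V 2 (hat_over_field W) (pairing f g)"
  using multilinear_two[of V K "hat_over_field W" "\<lambda>v w. hat_mult W (f v) (g w)"]
    linear_map_comp[OF conv_linear[OF assms(2)] linear_hat_mult_K(2)]
    linear_map_comp[OF conv_linear[OF assms(1)] linear_hat_mult_K(1)] conv_closed assms by blast

lemma conv_mult: "v \<in> carrier V \<Longrightarrow>
    (f \<otimes>\<^bsub>\<C>\<^esub> g) v = tensor_lift K (hat_over_field W) (pairing f g) (comult V v)"
  and conv_one: "v \<in> carrier V \<Longrightarrow> \<one>\<^bsub>\<C>\<^esub> v = incl W (counit V v \<odot>\<^bsub>W\<^esub> \<one>\<^bsub>W\<^esub>)"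
  and conv_zero: "v \<in> carrier V \<Longrightarrow> \<zero>\<^bsub>\<C>\<^esub> v = \<zero>\<^bsub>hat W\<^esub>"
  and conv_add: "v \<in> carrier V \<Longrightarrow> (f \<oplus>\<^bsub>\<C>\<^esub> g) v = f v \<oplus>\<^bsub>hat W\<^esub> g v"
  and conv_smult: "v \<in> carrier V \<Longrightarrow> (a \<odot>\<^bsub>\<C>\<^esub> f) v = scal a \<odot>\<^bsub>hat W\<^esub> f v"
  by (simp_all add: conv_algebra_def)

lemma linear_pairing_lift:
  "f \<in> carrier \<C> \<Longrightarrow> g \<in> carrier \<C> \<Longrightarrow>
    linear_map K (tensor_power K V 2) (hat_over_field W) (tensor_lift K (hat_over_field W) (pairing f g))"
  by (rule linear_map_multilinear_lift[OF field_K modV modH multilinear_pairing])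

lemma pairing_lift_pure:
  "f \<in> carrier \<C> \<Longrightarrow> g \<in> carrier \<C> \<Longrightarrow> v \<in> carrier V \<Longrightarrow> w \<in> carrier V \<Longrightarrow>
    tensor_lift K (hat_over_field W) (pairing f g) (pure_power K V [v, w]) = hat_mult W (f v) (g w)"
  by (subst multilinear_lift_pure[OF field_K modV modH multilinear_pairing])
    (auto simp: words_two)

lemma incl_one_smult: "a \<in> carrier K \<Longrightarrow> incl W (a \<odot>\<^bsub>W\<^esub> \<one>\<^bsub>W\<^esub>) = scal a \<odot>\<^bsub>hat W\<^esub> incl W \<one>\<^bsub>W\<^esub>"
  using linear_map_smult[OF linear_incl[OF modW], of a "\<one>\<^bsub>W\<^esub>"] oneW_carrier by (simp add: H_simps)

lemma conv_mult_closed: "f \<in> carrier \<C> \<Longrightarrow> g \<in> carrier \<C> \<Longrightarrow>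
    f \<otimes>\<^bsub>\<C>\<^esub> g \<in> carrier \<C>"
  using restrict_conv[OF linear_map_comp[OF linear_comult linear_pairing_lift[of f g]]]
  by (simp add: conv_algebra_def restrict_def)

lemma linear_unit: "linear_map K V (hat_over_field W) (\<lambda>v. incl W (counit V v \<odot>\<^bsub>W\<^esub> \<one>\<^bsub>W\<^esub>))"
  by (rule linear_mapI)
    (simp_all add: linear_counit oneW_carrier W.smult_l_distr W.smult_assoc1 H_simps
      linear_map_add[OF linear_incl[OF modW], unfolded H_simps] incl_closed[OF modW]
      linear_map_smult[OF linear_incl[OF modW], unfolded H_simps])

lemma conv_one_closed: "\<one>\<^bsub>\<C>\<^esub> \<in> carrier \<C>"
  using restrict_conv[OF linear_unit] by (simp add: conv_algebra_def restrict_def)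

lemma conv_zero_closed: "\<zero>\<^bsub>\<C>\<^esub> \<in> carrier \<C>"
  using restrict_conv[OF linear_map_const_zero[OF modV modH]] by (simp add: conv_algebra_def restrict_def H_simps)

lemma conv_add_closed: "f \<in> carrier \<C> \<Longrightarrow> g \<in> carrier \<C> \<Longrightarrow>
    f \<oplus>\<^bsub>\<C>\<^esub> g \<in> carrier \<C>"
  using restrict_conv[OF linear_map_sum[OF modV modH, of f g]]
  by (simp add: conv_algebra_def restrict_def H_simps)

lemma conv_smult_closed: "a \<in> carrier K \<Longrightarrow> f \<in> carrier \<C> \<Longrightarrow>
    a \<odot>\<^bsub>\<C>\<^esub> f \<in> carrier \<C>"
  using restrict_conv[OF linear_map_scale[OF modV modH, of f a]]
  by (simp add: conv_algebra_def restrict_def H_simps)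

lemma module_conv: "module K \<C>"
proof (rule moduleI)
  let ?A = "\<C>"
  note cl = conv_closed conv_zero_closed conv_add_closed conv_smult_closed
  note ap = conv_zero conv_add conv_smult
  show "cring K" by (rule K.is_cring)
  show "abelian_group ?A"
  proof (rule abelian_groupI)
    fix f assume f: "f \<in> carrier ?A"
    show "\<zero>\<^bsub>?A\<^esub> \<oplus>\<^bsub>?A\<^esub> f = f" by (rule conv_eqI) (use f in \<open>simp_all add: cl ap\<close>)
    have "(\<ominus>\<^bsub>K\<^esub> \<one>\<^bsub>K\<^esub>) \<odot>\<^bsub>?A\<^esub> f \<oplus>\<^bsub>?A\<^esub> f = \<zero>\<^bsub>?A\<^esub>"
    proof (rule conv_eqI)
      fix v assume v: "v \<in> carrier V"
      have "scal (\<ominus>\<^bsub>K\<^esub> \<one>\<^bsub>K\<^esub>) = \<ominus>\<^bsub>R\<^esub> \<one>\<^bsub>R\<^esub>" by (simp add: R.smult_l_minus)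
      then show "((\<ominus>\<^bsub>K\<^esub> \<one>\<^bsub>K\<^esub>) \<odot>\<^bsub>?A\<^esub> f \<oplus>\<^bsub>?A\<^esub> f) v = \<zero>\<^bsub>?A\<^esub> v"
        using v conv_closed[OF f v] by (simp add: ap HR.smult_l_minus HR.l_neg)
    qed (use f in \<open>simp_all add: cl\<close>)
    then show "\<exists>g\<in>carrier ?A. g \<oplus>\<^bsub>?A\<^esub> f = \<zero>\<^bsub>?A\<^esub>"
      using conv_smult_closed[OF _ f, of "\<ominus>\<^bsub>K\<^esub> \<one>\<^bsub>K\<^esub>"] by auto
    fix g assume g: "g \<in> carrier ?A"
    show "f \<oplus>\<^bsub>?A\<^esub> g = g \<oplus>\<^bsub>?A\<^esub> f" by (rule conv_eqI) (use f g in \<open>simp_all add: cl ap HR.a_comm\<close>)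
    fix h assume h: "h \<in> carrier ?A"
    show "f \<oplus>\<^bsub>?A\<^esub> g \<oplus>\<^bsub>?A\<^esub> h = f \<oplus>\<^bsub>?A\<^esub> (g \<oplus>\<^bsub>?A\<^esub> h)"
      by (rule conv_eqI) (use f g h in \<open>simp_all add: cl ap HR.a_assoc\<close>)
  qed (simp_all add: cl)
  fix a b f assume a: "a \<in> carrier K" "b \<in> carrier K" and f: "f \<in> carrier ?A"
  show "(a \<oplus>\<^bsub>K\<^esub> b) \<odot>\<^bsub>?A\<^esub> f = a \<odot>\<^bsub>?A\<^esub> f \<oplus>\<^bsub>?A\<^esub> b \<odot>\<^bsub>?A\<^esub> f"
    by (rule conv_eqI) (use a f in \<open>simp_all add: cl ap R.smult_l_distr HR.smult_l_distr\<close>)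
  show "(a \<otimes>\<^bsub>K\<^esub> b) \<odot>\<^bsub>?A\<^esub> f = a \<odot>\<^bsub>?A\<^esub> (b \<odot>\<^bsub>?A\<^esub> f)"
  proof (rule conv_eqI)
    have "scal (a \<otimes>\<^bsub>K\<^esub> b) = scal a \<otimes>\<^bsub>R\<^esub> scal b" using a by (simp add: scal_mult R.smult_assoc1)
    then show "((a \<otimes>\<^bsub>K\<^esub> b) \<odot>\<^bsub>?A\<^esub> f) v = (a \<odot>\<^bsub>?A\<^esub> (b \<odot>\<^bsub>?A\<^esub> f)) v" if "v \<in> carrier V" for v
      using that a conv_closed[OF f that] by (simp add: ap HR.smult_assoc1)
  qed (use a f in \<open>simp_all add: cl\<close>)
next
  fix a f assume a: "a \<in> carrier K" and f: "f \<in> carrier \<C>"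
  then show "a \<odot>\<^bsub>\<C>\<^esub> f \<in> carrier \<C>" by (rule conv_smult_closed)
  fix g assume g: "g \<in> carrier \<C>"
  show "a \<odot>\<^bsub>\<C>\<^esub> (f \<oplus>\<^bsub>\<C>\<^esub> g) =
      a \<odot>\<^bsub>\<C>\<^esub> f \<oplus>\<^bsub>\<C>\<^esub> a \<odot>\<^bsub>\<C>\<^esub> g"
    by (rule conv_eqI)
      (use a f g in \<open>simp_all add: conv_closed conv_add_closed conv_smult_closed conv_add conv_smult HR.smult_r_distr\<close>)
next
  fix f assume f: "f \<in> carrier \<C>"
  show "\<one>\<^bsub>K\<^esub> \<odot>\<^bsub>\<C>\<^esub> f = f"
    by (rule conv_eqI) (use f in \<open>simp_all add: conv_closed conv_smult_closed conv_smult\<close>)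
qed

text \<open>Iterated convolution products are induced by these multilinear maps on iterated coproducts.\<close>

primrec left_product :: "('w, 'r, 'k) hat \<Rightarrow> ('v \<Rightarrow> ('w, 'r, 'k) hat) list \<Rightarrow> 'v list \<Rightarrow> ('w, 'r, 'k) hat" where
  "left_product x [] vs = x"
| "left_product x (g # gs) vs = left_product (hat_mult W x (g (hd vs))) gs (tl vs)"

lemma linear_left_product:
  "set gs \<subseteq> carrier \<C> \<Longrightarrow> set vs \<subseteq> carrier V \<Longrightarrow> length vs = length gs \<Longrightarrow>
    linear_map K (hat_over_field W) (hat_over_field W) (\<lambda>x. left_product x gs vs)"
proof (induction gs arbitrary: vs)
  case Nil
  show ?case by (rule linear_mapI) simp_all
next
  case (Cons g gs)
  then obtain v vs' where vs: "vs = v # vs'" by (cases vs) auto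
  then show ?case
    using Cons.prems linear_map_comp[OF linear_hat_mult_K(1)[OF conv_closed[of g v]] Cons.IH[of vs']] by simp
qed

lemma left_product_slot:
  "set gs \<subseteq> carrier \<C> \<Longrightarrow> set us \<subseteq> carrier V \<Longrightarrow> set ws \<subseteq> carrier V \<Longrightarrow>
    Suc (length us + length ws) = length gs \<Longrightarrow> x \<in> carrier (hat W) \<Longrightarrow>
    linear_map K V (hat_over_field W) (\<lambda>v. left_product x gs (us @ v # ws))"
proof (induction gs arbitrary: us x)
  case (Cons g gs)
  show ?case
  proof (cases us)
    case Nil
    have "linear_map K V (hat_over_field W) (\<lambda>v. hat_mult W x (g v))"
      using Cons.prems by (intro linear_map_comp[OF conv_linear linear_hat_mult_K(2)]) auto
    from linear_map_comp[OF this linear_left_product[of gs ws]] show ?thesis using Cons.prems Nil by simp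
  next
    case (Cons u us')
    then show ?thesis
      using Cons.IH[of us' "hat_mult W x (g u)"] Cons.prems
      by (simp add: hat_mult_closed[OF kalgW] conv_closed)
  qed
qed simp

lemma left_product_closed:
  "set gs \<subseteq> carrier \<C> \<Longrightarrow> set vs \<subseteq> carrier V \<Longrightarrow> length vs = length gs \<Longrightarrow>
    x \<in> carrier (hat W) \<Longrightarrow> left_product x gs vs \<in> carrier (hat W)"
  using linear_map_closed[OF linear_left_product] by (simp add: H_simps)

lemma incl_oneW: "incl W \<one>\<^bsub>W\<^esub> \<in> carrier (hat W)"
  by (rule incl_closed[OF modW oneW_carrier])

lemma multilinear_left_product:
  "set gs \<subseteq> carrier \<C> \<Longrightarrow>
    multilinear_map K V (length gs) (hat_over_field W) (left_product (incl W \<one>\<^bsub>W\<^esub>) gs)"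
  using left_product_slot[of gs _ _ "incl W \<one>\<^bsub>W\<^esub>"] left_product_closed[of gs _ "incl W \<one>\<^bsub>W\<^esub>"] incl_oneW
  by (simp add: multilinear_map_def words_def H_simps)

lemma tensor_lift_comp_left_product:
  assumes f: "f \<in> carrier \<C>" and g: "g \<in> carrier \<C>"
    and L: "linear_map K (hat_over_field W) (hat_over_field W) L" and t: "t \<in> carrier (tensor_power K V 2)"
  shows "L (tensor_lift K (hat_over_field W) (pairing f g) t) =
    tensor_lift K (hat_over_field W) (\<lambda>vs. L (pairing f g vs)) t"
  by (rule tensor_lift_linear_comp(2)[OF field_K modV modH modH multilinear_pairing[OF f g] L t])

lemma coassoc: "v \<in> carrier V \<Longrightarrow>
    apply_at K V 2 0 (comult V) (comult V v) = apply_at K V 2 1 (comult V) (comult V v)"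
  using coV by (simp add: graded_cocomm_coalgebra_def)

text \<open>Both sides are lifts of the product of three values along the two threefold coproducts, which
  agree by coassociativity.\<close>

lemma conv_assoc:
  assumes f: "f \<in> carrier \<C>" and g: "g \<in> carrier \<C>"
    and h: "h \<in> carrier \<C>"
  shows "(f \<otimes>\<^bsub>\<C>\<^esub> g) \<otimes>\<^bsub>\<C>\<^esub> h = f \<otimes>\<^bsub>\<C>\<^esub> (g \<otimes>\<^bsub>\<C>\<^esub> h)"
proof (rule conv_eqI)
  let ?A = "\<C>" and ?H = "hat_over_field W"
  fix v assume v: "v \<in> carrier V"
  note fg = conv_mult_closed[OF f g] and gh = conv_mult_closed[OF g h]
  let ?B = "left_product (incl W \<one>\<^bsub>W\<^esub>) [f, g, h]"
  have B: "multilinear_map K V (Suc 2) ?H ?B"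
    using multilinear_left_product[of "[f, g, h]"] f g h by (simp add: numeral_eq_Suc)
  have B3: "?B [x, y, z] = hat_mult W (hat_mult W (f x) (g y)) (h z)"
    "?B [x, y, z] = hat_mult W (f x) (hat_mult W (g y) (h z))"
    if "x \<in> carrier V" "y \<in> carrier V" "z \<in> carrier V" for x y z
    using that f g h by (simp_all add: hat_mult_one[OF kalgW] conv_closed hat_mult_assoc[OF kalgW])
  note ins = multilinear_insert[OF field_K modV linear_comult _ modH B]
  have "((f \<otimes>\<^bsub>?A\<^esub> g) \<otimes>\<^bsub>?A\<^esub> h) v = tensor_lift K ?H (pairing (f \<otimes>\<^bsub>?A\<^esub> g) h) (comult V v)"
    using v by (simp add: conv_mult)
  also have "\<dots> = tensor_lift K ?H (\<lambda>vs. tensor_lift K ?H (\<lambda>ws. ?B (take 0 vs @ ws @ drop (Suc 0) vs))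
      (comult V (vs ! 0))) (comult V v)"
  proof (rule tensor_lift_cong[OF field_K modV modH multilinear_pairing[OF fg h] ins(2)[OF pos2] _ comult_closed[OF v]])
    fix vs assume vs: "vs \<in> words V 2"
    then obtain x z where vs': "vs = [x, z]" "x \<in> carrier V" "z \<in> carrier V" by (auto simp: words_two)
    have "hat_mult W ((f \<otimes>\<^bsub>?A\<^esub> g) x) (h z) = tensor_lift K ?H (\<lambda>ws. hat_mult W (pairing f g ws) (h z)) (comult V x)"
      using vs' tensor_lift_comp_left_product[OF f g linear_hat_mult_K(1)[OF conv_closed[OF h vs'(3)]] comult_closed[OF vs'(2)]]
      by (simp add: conv_mult)
    also have "\<dots> = tensor_lift K ?H (\<lambda>ws. ?B (take 0 vs @ ws @ drop (Suc 0) vs)) (comult V (vs ! 0))"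
      unfolding vs'(1) nth_Cons_0
    proof (rule tensor_lift_cong[OF field_K modV modH _ ins(1)[OF pos2 vs, unfolded vs'(1)] _ comult_closed[OF vs'(2)]])
      show "multilinear_map K V 2 ?H (\<lambda>ws. hat_mult W (pairing f g ws) (h z))"
        by (rule tensor_lift_linear_comp(1)[OF field_K modV modH modH multilinear_pairing[OF f g]
              linear_hat_mult_K(1)[OF conv_closed[OF h vs'(3)]] comult_closed[OF v]])
      fix ws assume "ws \<in> words V 2"
      then obtain a b where "ws = [a, b]" "a \<in> carrier V" "b \<in> carrier V" by (auto simp: words_two)
      then show "hat_mult W (pairing f g ws) (h z) = ?B (take 0 [x, z] @ ws @ drop (Suc 0) [x, z])"
        using B3(1)[of a b z] vs' by simp
    qed
    finally show "pairing (f \<otimes>\<^bsub>?A\<^esub> g) h vs =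
        tensor_lift K ?H (\<lambda>ws. ?B (take 0 vs @ ws @ drop (Suc 0) vs)) (comult V (vs ! 0))"
      using vs' by simp
  qed
  also have "\<dots> = tensor_lift K ?H ?B (apply_at K V 2 0 (comult V) (comult V v))"
    by (rule multilinear_lift_apply_at[OF field_K modV linear_comult pos2 modH B comult_closed[OF v], symmetric])
  also have "\<dots> = tensor_lift K ?H ?B (apply_at K V 2 1 (comult V) (comult V v))"
    using coassoc[OF v] by simp
  also have "\<dots> = tensor_lift K ?H (\<lambda>vs. tensor_lift K ?H (\<lambda>ws. ?B (take 1 vs @ ws @ drop (Suc 1) vs))
      (comult V (vs ! 1))) (comult V v)"
    by (rule multilinear_lift_apply_at[OF field_K modV linear_comult one_less_numeral_iff[THEN iffD2] modH B
          comult_closed[OF v]]) simp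
  also have "\<dots> = tensor_lift K ?H (pairing f (g \<otimes>\<^bsub>?A\<^esub> h)) (comult V v)"
  proof (rule tensor_lift_cong[OF field_K modV modH ins(2) multilinear_pairing[OF f gh] _ comult_closed[OF v]])
    fix vs assume vs: "vs \<in> words V 2"
    then obtain x z where vs': "vs = [x, z]" "x \<in> carrier V" "z \<in> carrier V" by (auto simp: words_two)
    have "hat_mult W (f x) ((g \<otimes>\<^bsub>?A\<^esub> h) z) = tensor_lift K ?H (\<lambda>ws. hat_mult W (f x) (pairing g h ws)) (comult V z)"
      using vs' tensor_lift_comp_left_product[OF g h linear_hat_mult_K(2)[OF conv_closed[OF f vs'(2)]] comult_closed[OF vs'(3)]]
      by (simp add: conv_mult)
    also have "\<dots> = tensor_lift K ?H (\<lambda>ws. ?B (take 1 vs @ ws @ drop (Suc 1) vs)) (comult V z)"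
      unfolding vs'(1)
    proof (rule tensor_lift_cong[OF field_K modV modH _ ins(1)[OF _ vs, of 1, unfolded vs'(1)] _ comult_closed[OF vs'(3)]])
      show "multilinear_map K V 2 ?H (\<lambda>ws. hat_mult W (f x) (pairing g h ws))"
        by (rule tensor_lift_linear_comp(1)[OF field_K modV modH modH multilinear_pairing[OF g h]
              linear_hat_mult_K(2)[OF conv_closed[OF f vs'(2)]] comult_closed[OF v]])
      fix ws assume "ws \<in> words V 2"
      then obtain a b where "ws = [a, b]" "a \<in> carrier V" "b \<in> carrier V" by (auto simp: words_two)
      then show "hat_mult W (f x) (pairing g h ws) = ?B (take 1 [x, z] @ ws @ drop (Suc 1) [x, z])"
        using B3(2)[of x a b] vs' by simp
    qed simp
    finally show "tensor_lift K ?H (\<lambda>ws. ?B (take 1 vs @ ws @ drop (Suc 1) vs)) (comult V (vs ! 1)) =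
        pairing f (g \<otimes>\<^bsub>?A\<^esub> h) vs"
      using vs' by simp
  qed simp
  also have "\<dots> = (f \<otimes>\<^bsub>?A\<^esub> (g \<otimes>\<^bsub>?A\<^esub> h)) v"
    using v by (simp add: conv_mult)
  finally show "((f \<otimes>\<^bsub>?A\<^esub> g) \<otimes>\<^bsub>?A\<^esub> h) v = (f \<otimes>\<^bsub>?A\<^esub> (g \<otimes>\<^bsub>?A\<^esub> h)) v" .
qed (intro conv_mult_closed f g h)+

lemma counit_laws: "v \<in> carrier V \<Longrightarrow> tensor_lift K V (\<lambda>vs. counit V (vs ! 0) \<odot>\<^bsub>V\<^esub> (vs ! 1)) (comult V v) = v"
  "v \<in> carrier V \<Longrightarrow> tensor_lift K V (\<lambda>vs. counit V (vs ! 1) \<odot>\<^bsub>V\<^esub> (vs ! 0)) (comult V v) = v"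
  using coV by (simp_all add: graded_cocomm_coalgebra_def)

text \<open>By the counit laws, convolution with this map is multiplication of the values by \<open>z\<close>. The cases
  of interest are the convolution unit and the part of a map that is visible on the unit.\<close>

definition counit_map :: "('w, 'r, 'k) hat \<Rightarrow> 'v \<Rightarrow> ('w, 'r, 'k) hat" where
  "counit_map z = (\<lambda>v \<in> carrier V. scal (counit V v) \<odot>\<^bsub>hat W\<^esub> z)"

lemma counit_map_closed: "z \<in> carrier (hat W) \<Longrightarrow> counit_map z \<in> carrier \<C>"
  unfolding counit_map_def
proof (rule restrict_conv, rule linear_mapI)
  assume z: "z \<in> carrier (hat W)"
  fix a v assume a: "a \<in> carrier K" and v: "v \<in> carrier V"
  have "scal (a \<otimes>\<^bsub>K\<^esub> counit V v) = scal a \<otimes>\<^bsub>R\<^esub> scal (counit V v)"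
    using a v linear_counit(3)[OF v] by (simp add: scal_mult R.smult_assoc1)
  then show "scal (counit V (a \<odot>\<^bsub>V\<^esub> v)) \<odot>\<^bsub>hat W\<^esub> z = a \<odot>\<^bsub>hat_over_field W\<^esub> (scal (counit V v) \<odot>\<^bsub>hat W\<^esub> z)"
    using a v z by (simp add: H_simps linear_counit HR.smult_assoc1)
qed (simp_all add: H_simps linear_counit R.smult_l_distr HR.smult_l_distr)

lemma conv_one_counit_map: "\<one>\<^bsub>\<C>\<^esub> = counit_map (incl W \<one>\<^bsub>W\<^esub>)"
  by (rule conv_eqI)
    (use counit_map_closed[OF incl_oneW] in
      \<open>simp_all add: conv_one_closed conv_one counit_map_def incl_one_smult linear_counit\<close>)

lemma conv_counit_map:
  assumes f: "f \<in> carrier \<C>" and z: "z \<in> carrier (hat W)" and v: "v \<in> carrier V"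
  shows "(counit_map z \<otimes>\<^bsub>\<C>\<^esub> f) v = hat_mult W z (f v)"
    and "(f \<otimes>\<^bsub>\<C>\<^esub> counit_map z) v = hat_mult W (f v) z"
proof -
  let ?A = "\<C>" and ?H = "hat_over_field W"
  have sc: "hat_mult W (scal a \<odot>\<^bsub>hat W\<^esub> z) (f w) = hat_mult W z (f (a \<odot>\<^bsub>V\<^esub> w))"
    "hat_mult W (f w) (scal a \<odot>\<^bsub>hat W\<^esub> z) = hat_mult W (f (a \<odot>\<^bsub>V\<^esub> w)) z"
    if "a \<in> carrier K" "w \<in> carrier V" for a w
    using that z conv_closed[OF f that(2)]
      linear_map_smult[OF linear_hat_mult_K(1)[OF conv_closed[OF f that(2)]] that(1), of z]
      linear_map_smult[OF linear_hat_mult_K(2)[OF conv_closed[OF f that(2)]] that(1), of z]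
      linear_map_smult[OF linear_hat_mult_K(1)[OF z] that(1), of "f w"]
      linear_map_smult[OF linear_hat_mult_K(2)[OF z] that(1), of "f w"] linear_map_smult[OF conv_linear[OF f] that]
    by (simp_all add: H_simps)
  have eps1: "linear_map K V V (\<lambda>v. counit V v \<odot>\<^bsub>V\<^esub> w)" if "w \<in> carrier V" for w
    by (rule linear_mapI) (use that in \<open>simp_all add: linear_counit V.smult_l_distr V.smult_assoc1\<close>)
  have eps2: "linear_map K V V (\<lambda>v. a \<odot>\<^bsub>V\<^esub> v)" if "a \<in> carrier K" for a
    by (rule linear_mapI)
      (use that in \<open>simp_all add: V.smult_r_distr V.smult_assoc1[symmetric] K.m_comm[of a]\<close>)
  have m1: "multilinear_map K V 2 V (\<lambda>vs. counit V (vs ! 0) \<odot>\<^bsub>V\<^esub> (vs ! 1))"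
    and m2: "multilinear_map K V 2 V (\<lambda>vs. counit V (vs ! 1) \<odot>\<^bsub>V\<^esub> (vs ! 0))"
    using multilinear_two[of V K V "\<lambda>v w. counit V v \<odot>\<^bsub>V\<^esub> w"]
      multilinear_two[of V K V "\<lambda>v w. counit V w \<odot>\<^bsub>V\<^esub> v"] eps1 eps2 linear_counit(3) by simp_all
  note L1 = linear_map_comp[OF conv_linear[OF f] linear_hat_mult_K(2)[OF z]]
  note L2 = linear_map_comp[OF conv_linear[OF f] linear_hat_mult_K(1)[OF z]]
  have "(counit_map z \<otimes>\<^bsub>?A\<^esub> f) v = tensor_lift K ?H (\<lambda>vs. hat_mult W z (f (counit V (vs ! 0) \<odot>\<^bsub>V\<^esub> (vs ! 1)))) (comult V v)"
    unfolding conv_mult[OF v]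
    by (rule tensor_lift_cong[OF field_K modV modH multilinear_pairing[OF counit_map_closed[OF z] f]
          tensor_lift_linear_comp(1)[OF field_K modV modV modH m1 L1 comult_closed[OF v]] _ comult_closed[OF v]])
      (auto simp: words_two counit_map_def sc linear_counit)
  also have "\<dots> = hat_mult W z (f v)"
    using tensor_lift_linear_comp(2)[OF field_K modV modV modH m1 L1 comult_closed[OF v]] counit_laws[OF v] by simp
  finally show "(counit_map z \<otimes>\<^bsub>?A\<^esub> f) v = hat_mult W z (f v)" .
  have "(f \<otimes>\<^bsub>?A\<^esub> counit_map z) v = tensor_lift K ?H (\<lambda>vs. hat_mult W (f (counit V (vs ! 1) \<odot>\<^bsub>V\<^esub> (vs ! 0))) z) (comult V v)"
    unfolding conv_mult[OF v]
    by (rule tensor_lift_cong[OF field_K modV modH multilinear_pairing[OF f counit_map_closed[OF z]]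
          tensor_lift_linear_comp(1)[OF field_K modV modV modH m2 L2 comult_closed[OF v]] _ comult_closed[OF v]])
      (auto simp: words_two counit_map_def sc linear_counit)
  also have "\<dots> = hat_mult W (f v) z"
    using tensor_lift_linear_comp(2)[OF field_K modV modV modH m2 L2 comult_closed[OF v]] counit_laws[OF v] by simp
  finally show "(f \<otimes>\<^bsub>?A\<^esub> counit_map z) v = hat_mult W (f v) z" .
qed

lemma tensor_lift_pairing_distr:
  assumes f: "f \<in> carrier \<C>" and g: "g \<in> carrier \<C>"
    and h: "h \<in> carrier \<C>" and v: "v \<in> carrier V" and a: "a \<in> carrier K"
  shows "((f \<oplus>\<^bsub>\<C>\<^esub> g) \<otimes>\<^bsub>\<C>\<^esub> h) v =
      (f \<otimes>\<^bsub>\<C>\<^esub> h) v \<oplus>\<^bsub>hat W\<^esub> (g \<otimes>\<^bsub>\<C>\<^esub> h) v"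
    and "(h \<otimes>\<^bsub>\<C>\<^esub> (f \<oplus>\<^bsub>\<C>\<^esub> g)) v =
      (h \<otimes>\<^bsub>\<C>\<^esub> f) v \<oplus>\<^bsub>hat W\<^esub> (h \<otimes>\<^bsub>\<C>\<^esub> g) v"
    and "((a \<odot>\<^bsub>\<C>\<^esub> f) \<otimes>\<^bsub>\<C>\<^esub> h) v = scal a \<odot>\<^bsub>hat W\<^esub> (f \<otimes>\<^bsub>\<C>\<^esub> h) v"
    and "(h \<otimes>\<^bsub>\<C>\<^esub> (a \<odot>\<^bsub>\<C>\<^esub> f)) v = scal a \<odot>\<^bsub>hat W\<^esub> (h \<otimes>\<^bsub>\<C>\<^esub> f) v"
proof -
  let ?H = "hat_over_field W"
  note eqI = tensor_power_map_eqI[OF field_K modV modH _ _ _ comult_closed[OF v]]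
  note L = linear_pairing_lift linear_map_sum[OF module_tensor_power[OF field_K modV] modH, unfolded H_simps]
    linear_map_scale[OF module_tensor_power[OF field_K modV] modH, unfolded H_simps]
  note cl = f g h a conv_add_closed conv_smult_closed
  note m = linear_map_add[OF linear_hat_mult_K(1), unfolded H_simps] linear_map_add[OF linear_hat_mult_K(2), unfolded H_simps]
    linear_map_smult[OF linear_hat_mult_K(1), unfolded H_simps] linear_map_smult[OF linear_hat_mult_K(2), unfolded H_simps]
  show "((f \<oplus>\<^bsub>\<C>\<^esub> g) \<otimes>\<^bsub>\<C>\<^esub> h) v =
      (f \<otimes>\<^bsub>\<C>\<^esub> h) v \<oplus>\<^bsub>hat W\<^esub> (g \<otimes>\<^bsub>\<C>\<^esub> h) v"
    unfolding conv_mult[OF v]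
    by (rule eqI; (intro L cl)?) (auto simp: words_two pairing_lift_pure cl conv_add conv_closed m simp del: One_nat_def)
  show "(h \<otimes>\<^bsub>\<C>\<^esub> (f \<oplus>\<^bsub>\<C>\<^esub> g)) v =
      (h \<otimes>\<^bsub>\<C>\<^esub> f) v \<oplus>\<^bsub>hat W\<^esub> (h \<otimes>\<^bsub>\<C>\<^esub> g) v"
    unfolding conv_mult[OF v]
    by (rule eqI; (intro L cl)?) (auto simp: words_two pairing_lift_pure cl conv_add conv_closed m simp del: One_nat_def)
  show "((a \<odot>\<^bsub>\<C>\<^esub> f) \<otimes>\<^bsub>\<C>\<^esub> h) v = scal a \<odot>\<^bsub>hat W\<^esub> (f \<otimes>\<^bsub>\<C>\<^esub> h) v"
    unfolding conv_mult[OF v]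
    by (rule eqI; (intro L cl)?) (auto simp: words_two pairing_lift_pure cl conv_smult conv_closed m simp del: One_nat_def)
  show "(h \<otimes>\<^bsub>\<C>\<^esub> (a \<odot>\<^bsub>\<C>\<^esub> f)) v = scal a \<odot>\<^bsub>hat W\<^esub> (h \<otimes>\<^bsub>\<C>\<^esub> f) v"
    unfolding conv_mult[OF v]
    by (rule eqI; (intro L cl)?) (auto simp: words_two pairing_lift_pure cl conv_smult conv_closed m simp del: One_nat_def)
qed

lemma K_algebra_conv: "K_algebra K \<C>"
  unfolding K_algebra_def
proof (intro conjI ballI)
  let ?A = "\<C>"
  show "module K ?A" by (rule module_conv)
  have one: "\<one>\<^bsub>?A\<^esub> \<otimes>\<^bsub>?A\<^esub> f = f" "f \<otimes>\<^bsub>?A\<^esub> \<one>\<^bsub>?A\<^esub> = f" if f: "f \<in> carrier ?A" for f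
    unfolding conv_one_counit_map
    by (rule conv_eqI; use f incl_oneW in \<open>simp add: conv_mult_closed counit_map_closed conv_counit_map
        hat_mult_one[OF kalgW] conv_closed\<close>)+
  show "ring ?A"
  proof (rule ringI)
    show "abelian_group ?A" using module_conv by (simp add: module_def)
    show "Group.monoid ?A" by (rule monoidI) (simp_all add: conv_mult_closed conv_one_closed conv_assoc one)
  next
    fix f g h assume fgh: "f \<in> carrier ?A" "g \<in> carrier ?A" "h \<in> carrier ?A"
    show "(f \<oplus>\<^bsub>?A\<^esub> g) \<otimes>\<^bsub>?A\<^esub> h = f \<otimes>\<^bsub>?A\<^esub> h \<oplus>\<^bsub>?A\<^esub> g \<otimes>\<^bsub>?A\<^esub> h"
      by (rule conv_eqI)
        (use fgh in \<open>simp_all add: conv_mult_closed conv_add_closed conv_add tensor_lift_pairing_distr(1)[OF _ _ _ _ K.zero_closed]\<close>)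
    show "h \<otimes>\<^bsub>?A\<^esub> (f \<oplus>\<^bsub>?A\<^esub> g) = h \<otimes>\<^bsub>?A\<^esub> f \<oplus>\<^bsub>?A\<^esub> h \<otimes>\<^bsub>?A\<^esub> g"
      by (rule conv_eqI)
        (use fgh in \<open>simp_all add: conv_mult_closed conv_add_closed conv_add tensor_lift_pairing_distr(2)[OF _ _ _ _ K.zero_closed]\<close>)
  qed
  fix a f g assume *: "a \<in> carrier K" "f \<in> carrier ?A" "g \<in> carrier ?A"
  show "(a \<odot>\<^bsub>?A\<^esub> f) \<otimes>\<^bsub>?A\<^esub> g = a \<odot>\<^bsub>?A\<^esub> (f \<otimes>\<^bsub>?A\<^esub> g)"
    by (rule conv_eqI) (use * in \<open>simp_all add: conv_mult_closed conv_smult_closed conv_smult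
        tensor_lift_pairing_distr(3)[OF *(2) *(2)]\<close>)
  show "f \<otimes>\<^bsub>?A\<^esub> (a \<odot>\<^bsub>?A\<^esub> g) = a \<odot>\<^bsub>?A\<^esub> (f \<otimes>\<^bsub>?A\<^esub> g)"
    by (rule conv_eqI) (use * in \<open>simp_all add: conv_mult_closed conv_smult_closed conv_smult
        tensor_lift_pairing_distr(4)[OF *(3) *(3)]\<close>)
qed

end

subsection \<open>Local nilpotence\<close>

lemma (in abelian_group) a_inv_zero: "\<ominus> \<zero> = \<zero>"
  by (rule minus_equality) auto

lemma linear_map_diff:
  assumes "module K M" "module K N" "linear_map K M N f" "linear_map K M N g"
  shows "linear_map K M N (\<lambda>x. f x \<ominus>\<^bsub>N\<^esub> g x)"
proof -
  interpret M: module K M by fact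
  interpret N: module K N by fact
  note cl = linear_map_closed[OF assms(3)] linear_map_closed[OF assms(4)]
  show ?thesis
    by (rule linear_mapI)
      (use assms cl in \<open>simp_all add: linear_map_add linear_map_smult N.smult_r_distr N.smult_r_minus
        a_minus_def N.minus_add N.a_ac\<close>)
qed

context convolution
begin

interpretation K: field K by (rule field_K)
interpretation R: algebra K R by (rule algebra_R)
interpretation V: module K V by (rule modV)
interpretation W: module K W by (rule modW)
interpretation HR: module R "hat W" by (rule module_hat[OF modW])
interpretation H: module K "hat_over_field W" by (rule module_hat_over_field[OF modW])
interpretation T2: module K "tensor_power K V 2" by (rule module_tensor_power[OF field_K modV])
interpretation AM: module K "\<C>" by (rule module_conv)
interpretation AR: ring "\<C>" using K_algebra_conv by (simp add: K_algebra_def)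

lemma linear_pure_power_one:
  "linear_map K V (tensor_power K V 2) (\<lambda>v. pure_power K V [v, \<one>\<^bsub>V\<^esub>])"
  "linear_map K V (tensor_power K V 2) (\<lambda>v. pure_power K V [\<one>\<^bsub>V\<^esub>, v])"
proof -
  have *: "linear_map K V (tensor_power K V 2) (\<lambda>v. pure_power K V (us @ v # ws))"
    if "set us \<subseteq> carrier V" "set ws \<subseteq> carrier V" "Suc (length us + length ws) = 2" for us ws
    using multilinear_pure_power[OF field_K modV, of 2] that unfolding multilinear_map_def by blast
  show "linear_map K V (tensor_power K V 2) (\<lambda>v. pure_power K V [v, \<one>\<^bsub>V\<^esub>])"
    "linear_map K V (tensor_power K V 2) (\<lambda>v. pure_power K V [\<one>\<^bsub>V\<^esub>, v])"
    using *[of "[]" "[\<one>\<^bsub>V\<^esub>]"] *[of "[\<one>\<^bsub>V\<^esub>]" "[]"] oneV_carrier by simp_all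
qed

lemma linear_counit_projection: "linear_map K V V (\<lambda>v. v \<ominus>\<^bsub>V\<^esub> (counit V v \<odot>\<^bsub>V\<^esub> \<one>\<^bsub>V\<^esub>))"
proof (rule linear_map_diff[OF modV modV])
  show "linear_map K V V (\<lambda>v. v)" by (rule linear_mapI) simp_all
  show "linear_map K V V (\<lambda>v. counit V v \<odot>\<^bsub>V\<^esub> \<one>\<^bsub>V\<^esub>)"
    by (rule linear_mapI) (simp_all add: linear_counit oneV_carrier V.smult_l_distr V.smult_assoc1)
qed

lemma linear_reduced_comult: "linear_map K V (tensor_power K V 2) (reduced_comult K V)"
proof -
  have "linear_map K V (tensor_power K V 2) (\<lambda>u. comult V u \<ominus>\<^bsub>tensor_power K V 2\<^esub> pure_power K V [u, \<one>\<^bsub>V\<^esub>]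
      \<ominus>\<^bsub>tensor_power K V 2\<^esub> pure_power K V [\<one>\<^bsub>V\<^esub>, u])"
    by (intro linear_map_diff[OF modV module_tensor_power[OF field_K modV]] linear_comult linear_pure_power_one)
  from linear_map_comp[OF linear_counit_projection this] show ?thesis
    unfolding reduced_comult_def[abs_def] Let_def .
qed

lemma conv_mult_at_one:
  "f \<in> carrier \<C> \<Longrightarrow> g \<in> carrier \<C> \<Longrightarrow>
    (f \<otimes>\<^bsub>\<C>\<^esub> g) \<one>\<^bsub>V\<^esub> = hat_mult W (f \<one>\<^bsub>V\<^esub>) (g \<one>\<^bsub>V\<^esub>)"
  using coaugV by (simp add: conv_mult oneV_carrier coaugmented_def pairing_lift_pure del: One_nat_def)

text \<open>The maps that vanish on the unit form an ideal, on which convolution may be computed with the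
  reduced coproduct.\<close>

definition unit_ideal :: "('v \<Rightarrow> ('w, 'r, 'k) hat) set" where
  "unit_ideal = {c \<in> carrier \<C>. c \<one>\<^bsub>V\<^esub> = \<zero>\<^bsub>hat W\<^esub>}"

lemma hat_mult_zero:
  "x \<in> carrier (hat W) \<Longrightarrow> hat_mult W \<zero>\<^bsub>hat W\<^esub> x = \<zero>\<^bsub>hat W\<^esub>"
  "x \<in> carrier (hat W) \<Longrightarrow> hat_mult W x \<zero>\<^bsub>hat W\<^esub> = \<zero>\<^bsub>hat W\<^esub>"
  using linear_map_zero[OF modH modH linear_hat_mult_K(1)] linear_map_zero[OF modH modH linear_hat_mult_K(2)]
  by (simp_all add: H_simps)

lemma unit_ideal_mult:
  "f \<in> unit_ideal \<Longrightarrow> g \<in> carrier \<C> \<Longrightarrow> f \<otimes>\<^bsub>\<C>\<^esub> g \<in> unit_ideal"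
  "g \<in> unit_ideal \<Longrightarrow> f \<in> carrier \<C> \<Longrightarrow> f \<otimes>\<^bsub>\<C>\<^esub> g \<in> unit_ideal"
  by (auto simp: unit_ideal_def conv_mult_at_one hat_mult_zero conv_closed oneV_carrier conv_mult_closed)

text \<open>The reduced coproduct differs from the coproduct by terms that contain the unit, on which \<open>f\<close>
  and \<open>g\<close> vanish.\<close>

lemma reduced_pairing:
  assumes f: "f \<in> unit_ideal" and g: "g \<in> unit_ideal" and v: "v \<in> carrier V"
  shows "tensor_lift K (hat_over_field W) (pairing f g) (reduced_comult K V v) = (f \<otimes>\<^bsub>\<C>\<^esub> g) v"
proof -
  note f' = f[unfolded unit_ideal_def, simplified] and g' = g[unfolded unit_ideal_def, simplified]
  have fg: "f \<otimes>\<^bsub>\<C>\<^esub> g \<in> carrier \<C>" "(f \<otimes>\<^bsub>\<C>\<^esub> g) \<one>\<^bsub>V\<^esub> = \<zero>\<^bsub>hat W\<^esub>"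
    using unit_ideal_mult(1)[OF f] g' by (auto simp: unit_ideal_def)
  define u where "u = v \<ominus>\<^bsub>V\<^esub> (counit V v \<odot>\<^bsub>V\<^esub> \<one>\<^bsub>V\<^esub>)"
  have u: "u \<in> carrier V" using v by (simp add: u_def linear_counit oneV_carrier)
  note L = linear_pairing_lift[of f g] and T = module_tensor_power[OF field_K modV]
  have pc: "pure_power K V [u, \<one>\<^bsub>V\<^esub>] \<in> carrier (tensor_power K V 2)" "pure_power K V [\<one>\<^bsub>V\<^esub>, u] \<in> carrier (tensor_power K V 2)"
    using linear_map_closed[OF linear_pure_power_one(1) u] linear_map_closed[OF linear_pure_power_one(2) u] by auto
  have "tensor_lift K (hat_over_field W) (pairing f g) (reduced_comult K V v) = (f \<otimes>\<^bsub>\<C>\<^esub> g) u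
      \<ominus>\<^bsub>hat W\<^esub> hat_mult W (f u) (g \<one>\<^bsub>V\<^esub>) \<ominus>\<^bsub>hat W\<^esub> hat_mult W (f \<one>\<^bsub>V\<^esub>) (g u)"
    using f' g' u pc comult_closed[OF u]
    by (simp add: reduced_comult_def Let_def u_def[symmetric] linear_map_minus[OF T modH L] H_simps
        pairing_lift_pure oneV_carrier conv_mult del: One_nat_def)
  also have "\<dots> = (f \<otimes>\<^bsub>\<C>\<^esub> g) u"
    using f' g' conv_closed[OF _ u] conv_closed[OF fg(1) u]
    by (simp add: hat_mult_zero a_minus_def HR.a_inv_zero)
  also have "\<dots> = (f \<otimes>\<^bsub>\<C>\<^esub> g) v"
    using v fg conv_closed[OF fg(1) v] linear_counit(3)[OF v]
    by (simp add: u_def linear_map_minus[OF modV modH conv_linear[OF fg(1)]] oneV_carrier H_simps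
        linear_map_smult[OF conv_linear[OF fg(1)]] linear_map_neg[OF modV modH conv_linear[OF fg(1)]]
        linear_map_add[OF conv_linear[OF fg(1)]] a_minus_def HR.a_inv_zero)
  finally show ?thesis .
qed

lemma iterated_reduced_comult_closed:
  "v \<in> carrier V \<Longrightarrow> iterated_reduced_comult K V k v \<in> carrier (tensor_power K V (Suc k))"
proof (induction k)
  case 0
  then show ?case using pure_power_closed[OF field_K modV, of "[v]" 1] by (simp add: words_def)
next
  case (Suc k)
  then show ?case
    using linear_map_closed[OF linear_map_apply_at[OF field_K modV linear_reduced_comult, of 0 "Suc k"]] by simp
qed

text \<open>A product of \<open>k + 1\<close> maps that vanish on the unit factors through the \<open>k\<close>-th iterated reduced
  coproduct: each step of the iteration multiplies the first two of the remaining factors.\<close>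

lemma product_factors_through_reduced:
  "v \<in> carrier V \<Longrightarrow> g \<in> unit_ideal \<Longrightarrow> set gs \<subseteq> unit_ideal \<Longrightarrow> length gs = k \<Longrightarrow>
    tensor_lift K (hat_over_field W) (left_product (incl W \<one>\<^bsub>W\<^esub>) (g # gs)) (iterated_reduced_comult K V k v) =
      foldl (\<otimes>\<^bsub>\<C>\<^esub>) g gs v"
proof (induction k arbitrary: g gs)
  case 0
  have g: "g \<in> carrier \<C>" using 0 by (simp add: unit_ideal_def)
  have "tensor_lift K (hat_over_field W) (left_product (incl W \<one>\<^bsub>W\<^esub>) [g]) (pure_power K V [v])
      = left_product (incl W \<one>\<^bsub>W\<^esub>) [g] [v]"
    by (rule multilinear_lift_pure[OF field_K modV modH multilinear_left_product])
      (use g 0 in \<open>auto simp: words_def\<close>)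
  also have "\<dots> = g v" using 0 g by (simp add: hat_mult_one[OF kalgW] conv_closed)
  finally show ?case using 0 by (simp del: left_product.simps)
next
  case (Suc k)
  let ?A = "\<C>" and ?H = "hat_over_field W" and ?o = "incl W \<one>\<^bsub>W\<^esub>"
  obtain g' gs' where gs: "gs = g' # gs'" using Suc.prems by (cases gs) auto
  have in_A: "g \<in> carrier ?A" "g' \<in> carrier ?A" "set gs' \<subseteq> carrier ?A" and len: "length gs' = k"
    and I: "g \<in> unit_ideal" "g' \<in> unit_ideal"
    using Suc.prems gs by (auto simp: unit_ideal_def)
  let ?t = "iterated_reduced_comult K V k v"
  have t: "?t \<in> carrier (tensor_power K V (Suc k))" using iterated_reduced_comult_closed Suc.prems by blast
  have B: "multilinear_map K V (Suc (Suc k)) ?H (left_product ?o (g # g' # gs'))"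
    using multilinear_left_product[of "g # g' # gs'"] in_A len by simp
  have B': "multilinear_map K V (Suc k) ?H (left_product ?o ((g \<otimes>\<^bsub>?A\<^esub> g') # gs'))"
    using multilinear_left_product[of "(g \<otimes>\<^bsub>?A\<^esub> g') # gs'"] in_A len conv_mult_closed by simp
  note ins = multilinear_insert[OF field_K modV linear_reduced_comult _ modH B]
  have "tensor_lift K ?H (left_product ?o (g # g' # gs')) (apply_at K V (Suc k) 0 (reduced_comult K V) ?t) =
    tensor_lift K ?H (\<lambda>vs. tensor_lift K ?H (\<lambda>ws. left_product ?o (g # g' # gs') (take 0 vs @ ws @ drop (Suc 0) vs))
      (reduced_comult K V (vs ! 0))) ?t"
    by (rule multilinear_lift_apply_at[OF field_K modV linear_reduced_comult _ modH B t]) simp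
  also have "\<dots> = tensor_lift K ?H (left_product ?o ((g \<otimes>\<^bsub>?A\<^esub> g') # gs')) ?t"
  proof (rule tensor_lift_cong[OF field_K modV modH ins(2) B' _ t])
    fix vs assume vs: "vs \<in> words V (Suc k)"
    then obtain x xs where x: "vs = x # xs" "x \<in> carrier V" "set xs \<subseteq> carrier V" "length xs = length gs'"
      using len by (cases vs) (auto simp: words_def)
    have LP: "linear_map K ?H ?H (\<lambda>y. left_product y gs' xs)"
      by (rule linear_left_product) (use in_A x in auto)
    have r: "reduced_comult K V x \<in> carrier (tensor_power K V 2)"
      by (rule linear_map_closed[OF linear_reduced_comult x(2)])
    have "tensor_lift K ?H (\<lambda>ws. left_product ?o (g # g' # gs') (take 0 vs @ ws @ drop (Suc 0) vs)) (reduced_comult K V (vs ! 0))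
      = tensor_lift K ?H (\<lambda>ws. left_product (pairing g g' ws) gs' xs) (reduced_comult K V x)"
      unfolding x(1) nth_Cons_0
    proof (rule tensor_lift_cong[OF field_K modV modH ins(1)[OF _ vs, unfolded x(1)] _ _ r])
      show "multilinear_map K V 2 ?H (\<lambda>ws. left_product (pairing g g' ws) gs' xs)"
        by (rule tensor_lift_linear_comp(1)[OF field_K modV modH modH multilinear_pairing LP r]) (use in_A in auto)
      fix ws assume "ws \<in> words V 2"
      then obtain a b where "ws = [a, b]" "a \<in> carrier V" "b \<in> carrier V" by (auto simp: words_two)
      then show "left_product ?o (g # g' # gs') (take 0 (x # xs) @ ws @ drop (Suc 0) (x # xs)) =
          left_product (pairing g g' ws) gs' xs"
        using in_A by (simp add: hat_mult_one[OF kalgW] conv_closed)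
    qed simp
    also have "\<dots> = left_product (tensor_lift K ?H (pairing g g') (reduced_comult K V x)) gs' xs"
      by (rule tensor_lift_comp_left_product[OF in_A(1,2) LP r, symmetric])
    also have "\<dots> = left_product ?o ((g \<otimes>\<^bsub>?A\<^esub> g') # gs') vs"
      using reduced_pairing[OF I x(2)] x in_A by (simp add: hat_mult_one[OF kalgW] conv_closed conv_mult_closed)
    finally show "tensor_lift K ?H (\<lambda>ws. left_product ?o (g # g' # gs') (take 0 vs @ ws @ drop (Suc 0) vs))
        (reduced_comult K V (vs ! 0)) = left_product ?o ((g \<otimes>\<^bsub>?A\<^esub> g') # gs') vs" .
  qed simp
  also have "\<dots> = foldl (\<otimes>\<^bsub>?A\<^esub>) (g \<otimes>\<^bsub>?A\<^esub> g') gs' v"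
    by (rule Suc.IH) (use Suc.prems gs unit_ideal_mult(1) in_A len in auto)
  finally show ?case by (simp add: gs del: left_product.simps)
qed

lemma product_vanishes:
  assumes "v \<in> carrier V" "g \<in> unit_ideal" "set gs \<subseteq> unit_ideal"
    "iterated_reduced_comult K V (length gs) v = \<zero>\<^bsub>tensor_power K V (Suc (length gs))\<^esub>"
  shows "foldl (\<otimes>\<^bsub>\<C>\<^esub>) g gs v = \<zero>\<^bsub>hat W\<^esub>"
proof -
  have gs: "set (g # gs) \<subseteq> carrier \<C>" using assms(2,3) by (auto simp: unit_ideal_def)
  from linear_map_zero[OF module_tensor_power[OF field_K modV] modH
      linear_map_multilinear_lift[OF field_K modV modH multilinear_left_product[OF gs]]]
  show ?thesis
    using product_factors_through_reduced[OF assms(1-3) refl] assms(4) by (simp add: H_simps)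
qed

text \<open>A map \<open>c\<close> with \<open>c(1)\<close> in the maximal ideal is the sum of the multiple \<open>s\<close> of the counit by
  \<open>c(1)\<close> and of a map \<open>g\<close> that vanishes on the unit. In a product of many factors \<open>s\<close> and \<open>g\<close>, many
  factors \<open>s\<close> make the value small, and many factors \<open>g\<close> make it vanish by conilpotence.\<close>

context
  fixes c :: "'v \<Rightarrow> ('w, 'r, 'k) hat"
  assumes c: "c \<in> carrier \<C>" and c1: "c \<one>\<^bsub>V\<^esub> 1 = \<zero>\<^bsub>hat W\<^esub> 1"
begin

definition unit_part :: "'v \<Rightarrow> ('w, 'r, 'k) hat" where "unit_part = counit_map (c \<one>\<^bsub>V\<^esub>)"
definition reduced_part :: "'v \<Rightarrow> ('w, 'r, 'k) hat" where "reduced_part = c \<ominus>\<^bsub>\<C>\<^esub> unit_part"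

text \<open>Products of \<open>b\<close> factors \<open>g\<close> and \<open>a\<close> factors \<open>s\<close>, in any order, and the sums of products with \<open>m\<close>
  factors, to which the \<open>m\<close>-th power of \<open>c\<close> belongs.\<close>

inductive word :: "nat \<Rightarrow> nat \<Rightarrow> ('v \<Rightarrow> ('w, 'r, 'k) hat) \<Rightarrow> bool" where
  word_one: "word 0 0 \<one>\<^bsub>\<C>\<^esub>"
| word_reduced: "word b a x \<Longrightarrow> word (Suc b) a (x \<otimes>\<^bsub>\<C>\<^esub> reduced_part)"
| word_unit: "word b a x \<Longrightarrow> word b (Suc a) (x \<otimes>\<^bsub>\<C>\<^esub> unit_part)"

inductive word_sum :: "nat \<Rightarrow> ('v \<Rightarrow> ('w, 'r, 'k) hat) \<Rightarrow> bool" where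
  word_sum_word: "word b a x \<Longrightarrow> word_sum (b + a) x"
| word_sum_add: "word_sum m x \<Longrightarrow> word_sum m y \<Longrightarrow> word_sum m (x \<oplus>\<^bsub>\<C>\<^esub> y)"

lemma c1_closed: "c \<one>\<^bsub>V\<^esub> \<in> carrier (hat W)"
  by (rule conv_closed[OF c oneV_carrier])

lemma unit_part_closed: "unit_part \<in> carrier \<C>"
  unfolding unit_part_def by (rule counit_map_closed[OF c1_closed])

lemma reduced_part_closed: "reduced_part \<in> carrier \<C>"
  unfolding reduced_part_def using c unit_part_closed by simp

lemma parts_sum: "c = reduced_part \<oplus>\<^bsub>\<C>\<^esub> unit_part"
  unfolding reduced_part_def using c unit_part_closed by (simp add: a_minus_def AM.a_assoc AM.l_neg)

lemma reduced_part_ideal: "reduced_part \<in> unit_ideal"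
proof -
  have "unit_part \<one>\<^bsub>V\<^esub> = c \<one>\<^bsub>V\<^esub>"
    using coaugV c1_closed by (simp add: unit_part_def counit_map_def oneV_carrier coaugmented_def)
  then have "reduced_part \<one>\<^bsub>V\<^esub> \<oplus>\<^bsub>hat W\<^esub> c \<one>\<^bsub>V\<^esub> = \<zero>\<^bsub>hat W\<^esub> \<oplus>\<^bsub>hat W\<^esub> c \<one>\<^bsub>V\<^esub>"
    using arg_cong[OF parts_sum, of "\<lambda>f. f \<one>\<^bsub>V\<^esub>"] c1_closed by (simp add: conv_add oneV_carrier)
  then show ?thesis
    using conv_closed[OF reduced_part_closed oneV_carrier] c1_closed reduced_part_closed
    by (auto simp: unit_ideal_def)
qed

lemma word_closed: "word b a x \<Longrightarrow> x \<in> carrier \<C>"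
  by (induction rule: word.induct)
    (simp_all add: unit_part_closed reduced_part_closed)

lemma word_sum_closed: "word_sum m x \<Longrightarrow> x \<in> carrier \<C>"
  by (induction rule: word_sum.induct) (simp_all add: word_closed)

lemma word_sum_mult: "word_sum m x \<Longrightarrow> word_sum (Suc m) (x \<otimes>\<^bsub>\<C>\<^esub> c)"
proof (induction rule: word_sum.induct)
  case (word_sum_word b a x)
  have "x \<otimes>\<^bsub>\<C>\<^esub> c = x \<otimes>\<^bsub>\<C>\<^esub> reduced_part \<oplus>\<^bsub>\<C>\<^esub> x \<otimes>\<^bsub>\<C>\<^esub> unit_part"
    using word_closed[OF word_sum_word] unit_part_closed reduced_part_closed
    by (subst parts_sum) (simp add: AR.r_distr)
  moreover have "word_sum (Suc (b + a)) (x \<otimes>\<^bsub>\<C>\<^esub> reduced_part)"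
    using word_sum.word_sum_word[OF word_reduced[OF word_sum_word]] by simp
  moreover have "word_sum (Suc (b + a)) (x \<otimes>\<^bsub>\<C>\<^esub> unit_part)"
    using word_sum.word_sum_word[OF word_unit[OF word_sum_word]] by simp
  ultimately show ?case using word_sum_add by simp
next
  case (word_sum_add m x y)
  then show ?case using c word_sum_closed word_sum.word_sum_add by (simp add: AR.l_distr)
qed

lemma word_sum_power: "word_sum m (c [^]\<^bsub>\<C>\<^esub> m)"
  by (induction m) (use word_sum_word[OF word_one] word_sum_mult in auto)

lemma tensor_lift_level_zero:
  assumes f: "f \<in> carrier \<C>" and g: "g \<in> carrier \<C>"
    and z: "\<And>v. v \<in> carrier V \<Longrightarrow> f v n = \<zero>\<^bsub>hat W\<^esub> n" and t: "t \<in> carrier (tensor_power K V 2)"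
  shows "tensor_lift K (hat_over_field W) (pairing f g) t n = \<zero>\<^bsub>hat W\<^esub> n"
  using t
proof (induction t rule: tensor_power_induct[OF field_K modV, consumes 1, case_names zero pure add smult])
  case zero
  then show ?case
    using linear_map_zero[OF module_tensor_power[OF field_K modV] modH linear_pairing_lift[OF f g]] by (simp add: H_simps)
next
  case (pure vs)
  then obtain v w where vs: "vs = [v, w]" "v \<in> carrier V" "w \<in> carrier V" by (auto simp: words_two)
  have "hat_mult W (f v) (g w) (n + 0) = \<zero>\<^bsub>hat W\<^esub> (n + 0)"
    by (rule hat_mult_level_zero[OF kalgW conv_closed[OF f vs(2)] z[OF vs(2)] conv_closed[OF g vs(3)]])
      (rule hat_level_0[OF modW conv_closed[OF g vs(3)]])
  then show ?case using vs by (simp add: pairing_lift_pure f g del: One_nat_def)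
next
  case (add t u)
  then show ?case
    using hat_level_add_zero[OF modW] linear_map_closed[OF linear_pairing_lift[OF f g]]
    by (simp add: linear_map_add[OF linear_pairing_lift[OF f g]] H_simps del: One_nat_def)
next
  case (smult a t)
  then have "tensor_lift K (hat_over_field W) (pairing f g) t \<in> carrier (hat W)"
    using linear_map_closed[OF linear_pairing_lift[OF f g]] by (simp add: H_simps del: One_nat_def)
  then show ?case
    using hat_smult_mpow[OF modW, of "scal a" 0 _ n] smult
    by (simp add: linear_map_smult[OF linear_pairing_lift[OF f g]] H_simps one_ideals del: One_nat_def)
qed

lemma word_level: "word b a x \<Longrightarrow> v \<in> carrier V \<Longrightarrow> x v a = \<zero>\<^bsub>hat W\<^esub> a"
proof (induction arbitrary: v rule: word.induct)
  case word_one
  then show ?case using hat_level_0[OF modW conv_closed[OF conv_one_closed]] by blast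
next
  case (word_reduced b a x)
  then show ?case
    using tensor_lift_level_zero[OF word_closed[OF word_reduced.hyps] reduced_part_closed _ comult_closed]
    by (simp add: conv_mult del: One_nat_def)
next
  case (word_unit b a x)
  then show ?case
    using hat_mult_level_zero[OF kalgW conv_closed[OF word_closed[OF word_unit.hyps]] _ c1_closed c1, of v a]
    by (simp add: unit_part_def conv_counit_map[OF word_closed[OF word_unit.hyps] c1_closed])
qed

text \<open>Factors \<open>s\<close> are absorbed into a neighbouring factor \<open>g\<close>, because the maps that vanish on the
  unit form an ideal.\<close>

lemma word_product: "word b a x \<Longrightarrow> b = 0 \<or>
    (\<exists>g gs. g \<in> unit_ideal \<and> set gs \<subseteq> unit_ideal \<and> Suc (length gs) = b \<and> x = foldl (\<otimes>\<^bsub>\<C>\<^esub>) g gs)"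
proof (induction rule: word.induct)
  case (word_reduced b a x)
  show ?case
  proof (cases "b = 0")
    case True
    have "x \<otimes>\<^bsub>\<C>\<^esub> reduced_part \<in> unit_ideal"
      by (rule unit_ideal_mult(2)[OF reduced_part_ideal word_closed[OF word_reduced.hyps]])
    then show ?thesis using True by (intro disjI2 exI[of _ "x \<otimes>\<^bsub>\<C>\<^esub> reduced_part"] exI[of _ "[]"]) simp
  next
    case False
    then obtain g gs where "g \<in> unit_ideal" "set gs \<subseteq> unit_ideal" "Suc (length gs) = b"
      "x = foldl (\<otimes>\<^bsub>\<C>\<^esub>) g gs" using word_reduced.IH by blast
    then show ?thesis using reduced_part_ideal by (intro disjI2 exI[of _ g] exI[of _ "gs @ [reduced_part]"]) auto
  qed
next
  case (word_unit b a x)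
  show ?case
  proof (cases "b = 0")
    case False
    then obtain g gs where *: "g \<in> unit_ideal" "set gs \<subseteq> unit_ideal" "Suc (length gs) = b"
      "x = foldl (\<otimes>\<^bsub>\<C>\<^esub>) g gs" using word_unit.IH by blast
    show ?thesis
    proof (cases gs rule: rev_cases)
      case Nil
      then show ?thesis using * unit_ideal_mult(1)[OF *(1) unit_part_closed]
        by (intro disjI2 exI[of _ "g \<otimes>\<^bsub>\<C>\<^esub> unit_part"] exI[of _ "[]"]) simp
    next
      case (snoc hs h)
      have "foldl (\<otimes>\<^bsub>\<C>\<^esub>) g hs \<in> carrier \<C>"
      proof -
        have "g \<in> carrier \<C>" "set hs \<subseteq> carrier \<C>"
          using * snoc by (auto simp: unit_ideal_def)
        then show ?thesis by (induction hs arbitrary: g) auto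
      qed
      moreover have "h \<in> unit_ideal" using * snoc by simp
      ultimately show ?thesis using * snoc unit_ideal_mult(1)[OF _ unit_part_closed, of h] unit_part_closed
        by (intro disjI2 exI[of _ g] exI[of _ "hs @ [h \<otimes>\<^bsub>\<C>\<^esub> unit_part]"])
          (auto simp: AR.m_assoc unit_ideal_def)
    qed
  qed simp
qed simp

lemma locally_nilpotent:
  assumes v: "v \<in> carrier V"
  shows "\<exists>M. \<forall>m \<ge> (M :: nat). (c [^]\<^bsub>\<C>\<^esub> m) v n = \<zero>\<^bsub>hat W\<^esub> n"
proof -
  obtain N where N: "\<And>k. k \<ge> N \<Longrightarrow> iterated_reduced_comult K V k v = \<zero>\<^bsub>tensor_power K V (Suc k)\<^esub>"
    using conilV v unfolding conilpotent_def by blast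
  \<comment> \<open>A word with more than \<open>N + n\<close> factors has at least \<open>n\<close> factors \<open>s\<close> or more than \<open>N\<close> factors \<open>g\<close>.\<close>
  have w: "x v n = \<zero>\<^bsub>hat W\<^esub> n" if x: "word b a x" and "b + a \<ge> Suc (N + n)" for b a x
  proof (cases "a \<ge> n")
    case True
    show ?thesis
      by (rule hat_level_mono[OF modW conv_closed[OF word_closed[OF x] v] HR.zero_closed True word_level[OF x v]])
  next
    case False
    then have "b > N" using that by simp
    then obtain g gs where "g \<in> unit_ideal" "set gs \<subseteq> unit_ideal" "Suc (length gs) = b"
      "x = foldl (\<otimes>\<^bsub>\<C>\<^esub>) g gs" using word_product[OF x] by auto
    then show ?thesis using product_vanishes[OF v, of g gs] N[of "length gs"] \<open>b > N\<close> by simp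
  qed
  have ws: "x v n = \<zero>\<^bsub>hat W\<^esub> n" if "word_sum m x" "m \<ge> Suc (N + n)" for m x
    using that
  proof (induction rule: word_sum.induct)
    case (word_sum_add m x y)
    show ?case
      unfolding conv_add[OF v]
      by (rule hat_level_add_zero[OF modW conv_closed[OF word_sum_closed[OF word_sum_add.hyps(1)] v]
            conv_closed[OF word_sum_closed[OF word_sum_add.hyps(2)] v]
            word_sum_add.IH(1)[OF word_sum_add.prems] word_sum_add.IH(2)[OF word_sum_add.prems]])
  qed (rule w)
  show ?thesis
  proof (rule exI, intro allI impI)
    fix m assume "m \<ge> Suc (N + n)"
    then show "(c [^]\<^bsub>\<C>\<^esub> m) v n = \<zero>\<^bsub>hat W\<^esub> n" by (rule ws[OF word_sum_power])
  qed
qed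

end

end

section \<open>Exponential and logarithm\<close>

subsection \<open>Power series in locally nilpotent elements\<close>

context convolution
begin

interpretation K: field K by (rule field_K)
interpretation R: algebra K R by (rule algebra_R)
interpretation V: module K V by (rule modV)
interpretation W: module K W by (rule modW)
interpretation HR: module R "hat W" by (rule module_hat[OF modW])
interpretation H: module K "hat_over_field W" by (rule module_hat_over_field[OF modW])
interpretation AM: module K "\<C>" by (rule module_conv)
interpretation AR: ring "\<C>" using K_algebra_conv by (simp add: K_algebra_def)

lemma char_zero_all: "\<forall>n::nat > 0. add_pow K n \<one>\<^bsub>K\<^esub> \<noteq> \<zero>\<^bsub>K\<^esub>"
  using char_zero by blast

abbreviation evaluate :: "('v \<Rightarrow> ('w, 'r, 'k) hat) \<Rightarrow> rat poly \<Rightarrow> 'v \<Rightarrow> ('w, 'r, 'k) hat" where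
  "evaluate \<equiv> poly_eval K \<C>"

lemmas evaluate_closed = poly_eval_closed[OF field_K char_zero_all K_algebra_conv]
  and evaluate_0 = poly_eval_0[OF field_K char_zero_all K_algebra_conv]
  and evaluate_pCons = poly_eval_pCons[OF field_K char_zero_all K_algebra_conv]
  and evaluate_add = poly_eval_add[OF field_K char_zero_all K_algebra_conv]
  and evaluate_smult = poly_eval_smult[OF field_K char_zero_all K_algebra_conv]
  and evaluate_monom = poly_eval_monom[OF field_K char_zero_all K_algebra_conv]
  and evaluate_pcompose = poly_eval_pcompose[OF field_K char_zero_all K_algebra_conv]
  and rat_closed = rat_embed_closed[OF field_K char_zero_all]

lemma hat_level_add_cong: "x n = x' n \<Longrightarrow> y n = y' n \<Longrightarrow> (x \<oplus>\<^bsub>hat W\<^esub> y) n = (x' \<oplus>\<^bsub>hat W\<^esub> y') n"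
  by (simp add: hat_add_level[OF modW])

text \<open>Pointwise convergence in the adic topology, in which each level becomes stationary.\<close>

definition levelwise_limit ::
  "(nat \<Rightarrow> 'v \<Rightarrow> ('w, 'r, 'k) hat) \<Rightarrow> ('v \<Rightarrow> ('w, 'r, 'k) hat) \<Rightarrow> bool" where
  "levelwise_limit F G \<longleftrightarrow> (\<forall>v \<in> carrier V. \<forall>n. \<forall>\<^sub>F M in sequentially. F M v n = G v n)"

lemma levelwise_limitD: "levelwise_limit F G \<Longrightarrow> v \<in> carrier V \<Longrightarrow> \<forall>\<^sub>F M in sequentially. F M v n = G v n"
  by (simp add: levelwise_limit_def)

text \<open>Convolution is continuous: a coproduct involves only finitely many values.\<close>

lemma levelwise_limit_mult:
  assumes A: "\<And>M. F M \<in> carrier \<C>" "\<And>M. F' M \<in> carrier \<C>"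
      "G \<in> carrier \<C>" "G' \<in> carrier \<C>"
    and lim: "levelwise_limit F G" "levelwise_limit F' G'"
  shows "levelwise_limit (\<lambda>M. F M \<otimes>\<^bsub>\<C>\<^esub> F' M) (G \<otimes>\<^bsub>\<C>\<^esub> G')"
  unfolding levelwise_limit_def
proof (intro ballI allI)
  fix v n assume v: "v \<in> carrier V"
  let ?H = "hat_over_field W"
  have "\<forall>\<^sub>F M in sequentially. tensor_lift K ?H (pairing (F M) (F' M)) t n = tensor_lift K ?H (pairing G G') t n"
    if t: "t \<in> carrier (tensor_power K V 2)" for t
    using t
  proof (induction t rule: tensor_power_induct[OF field_K modV, consumes 1, case_names zero pure add smult])
    case zero
    show ?case
      by (simp add: linear_map_zero[OF module_tensor_power[OF field_K modV] modH linear_pairing_lift[OF A(1,2)]]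
          linear_map_zero[OF module_tensor_power[OF field_K modV] modH linear_pairing_lift[OF A(3,4)]] del: One_nat_def)
  next
    case (pure vs)
    then obtain x y where vs: "vs = [x, y]" "x \<in> carrier V" "y \<in> carrier V" by (auto simp: words_two)
    show ?case
      unfolding vs(1) pairing_lift_pure[OF A(1,2) vs(2,3)] pairing_lift_pure[OF A(3,4) vs(2,3)]
      using levelwise_limitD[OF lim(1) vs(2), of n] levelwise_limitD[OF lim(2) vs(3), of n]
      by eventually_elim (rule hat_mult_level[OF kalgW])
  next
    case (add t u)
    from add.IH show ?case
      unfolding linear_map_add[OF linear_pairing_lift[OF A(1,2)] add.hyps]
        linear_map_add[OF linear_pairing_lift[OF A(3,4)] add.hyps] H_simps
      by eventually_elim (rule hat_level_add_cong)
  next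
    case (smult a t)
    from smult.IH show ?case
      unfolding linear_map_smult[OF linear_pairing_lift[OF A(1,2)] smult.hyps]
        linear_map_smult[OF linear_pairing_lift[OF A(3,4)] smult.hyps] H_simps
      by eventually_elim (rule hat_smult_level[OF modW])
  qed
  from this[OF comult_closed[OF v]] show "\<forall>\<^sub>F M in sequentially.
      (F M \<otimes>\<^bsub>\<C>\<^esub> F' M) v n = (G \<otimes>\<^bsub>\<C>\<^esub> G') v n"
    unfolding conv_mult[OF v] .
qed

lemma levelwise_limit_add:
  assumes "levelwise_limit F G" "levelwise_limit F' G'"
  shows "levelwise_limit (\<lambda>M. F M \<oplus>\<^bsub>\<C>\<^esub> F' M) (G \<oplus>\<^bsub>\<C>\<^esub> G')"
  unfolding levelwise_limit_def
proof (intro ballI allI)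
  fix v n assume v: "v \<in> carrier V"
  show "\<forall>\<^sub>F M in sequentially. (F M \<oplus>\<^bsub>\<C>\<^esub> F' M) v n = (G \<oplus>\<^bsub>\<C>\<^esub> G') v n"
    unfolding conv_add[OF v]
    using levelwise_limitD[OF assms(1) v, of n] levelwise_limitD[OF assms(2) v, of n]
    by eventually_elim (rule hat_level_add_cong)
qed

lemma levelwise_limit_const: "levelwise_limit (\<lambda>M. G) G"
  by (simp add: levelwise_limit_def)

lemma levelwise_limit_evaluate:
  assumes F: "\<And>M. F M \<in> carrier \<C>" and G: "G \<in> carrier \<C>"
    and lim: "levelwise_limit F G"
  shows "levelwise_limit (\<lambda>M. evaluate (F M) p) (evaluate G p)"
proof (induction p)
  case 0
  then show ?case by (simp add: evaluate_0 F G levelwise_limit_const)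
next
  case (pCons a p)
  show ?case
    unfolding evaluate_pCons[OF F] evaluate_pCons[OF G]
    by (intro levelwise_limit_add levelwise_limit_const levelwise_limit_mult F G evaluate_closed lim pCons.IH)
qed

lemma levelwise_limit_unique:
  assumes "levelwise_limit F G" "levelwise_limit F G'" "v \<in> carrier V"
  shows "G v = G' v"
proof
  fix n
  have "\<forall>\<^sub>F M in sequentially. G v n = G' v n"
    using levelwise_limitD[OF assms(1,3), of n] levelwise_limitD[OF assms(2,3), of n]
    by eventually_elim simp
  then show "G v n = G' v n" by simp
qed

lemma levelwise_limit_carrier:
  assumes F: "\<And>M. F M \<in> carrier \<C>" and lim: "levelwise_limit F G" and ext: "G \<in> extensional (carrier V)"
  shows "G \<in> carrier \<C>"
proof -
  have cl: "G v \<in> carrier (hat W)" if v: "v \<in> carrier V" for v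
  proof -
    have "\<exists>M. F M v n = G v n \<and> F M v (Suc n) = G v (Suc n)" for n
    proof -
      have "\<forall>\<^sub>F M in sequentially. F M v n = G v n \<and> F M v (Suc n) = G v (Suc n)"
        using levelwise_limitD[OF lim v, of n] levelwise_limitD[OF lim v, of "Suc n"] by eventually_elim simp
      then show ?thesis by (auto dest: eventually_happens)
    qed
    then obtain M where M: "\<And>n. F (M n) v n = G v n" "\<And>n. F (M n) v (Suc n) = G v (Suc n)" by metis
    have "(\<lambda>n. F (M n) v n) \<in> carrier (hat W)"
    proof (rule hat_glue[where y = "\<lambda>n. F (M n) v", OF modW conv_closed[OF F v]])
      fix n
      have "F (M (Suc n)) v n = F (M n) v n"
        by (rule hat_level_mono[where n = "Suc n", OF modW conv_closed[OF F v] conv_closed[OF F v]]) (simp_all add: M)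
      then show "F (M (Suc n)) v n = F (M n) v n" .
    qed
    then show ?thesis using M(1) by simp
  qed
  have "linear_map K V (hat_over_field W) G"
  proof (rule linear_mapI; unfold H_simps)
    fix v assume v: "v \<in> carrier V"
    show "G v \<in> carrier (hat W)" by (rule cl[OF v])
    show "G (a \<odot>\<^bsub>V\<^esub> v) = scal a \<odot>\<^bsub>hat W\<^esub> G v" if a: "a \<in> carrier K" for a
    proof
      fix n
      have "\<forall>\<^sub>F M in sequentially. G (a \<odot>\<^bsub>V\<^esub> v) n = (scal a \<odot>\<^bsub>hat W\<^esub> G v) n"
        using levelwise_limitD[OF lim v, of n] levelwise_limitD[OF lim V.smult_closed[OF a v], of n]
      proof eventually_elim
        case (elim M)
        then show ?case
          using linear_map_smult[OF conv_linear[OF F] a v, of M] hat_smult_level[where x = "F M v" and y = "G v" and n = n, OF modW]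
          by (simp add: H_simps)
      qed
      then show "G (a \<odot>\<^bsub>V\<^esub> v) n = (scal a \<odot>\<^bsub>hat W\<^esub> G v) n" by simp
    qed
    fix w assume w: "w \<in> carrier V"
    show "G (v \<oplus>\<^bsub>V\<^esub> w) = G v \<oplus>\<^bsub>hat W\<^esub> G w"
    proof
      fix n
      have "\<forall>\<^sub>F M in sequentially. G (v \<oplus>\<^bsub>V\<^esub> w) n = (G v \<oplus>\<^bsub>hat W\<^esub> G w) n"
        using levelwise_limitD[OF lim v, of n] levelwise_limitD[OF lim w, of n] levelwise_limitD[OF lim V.a_closed[OF v w], of n]
      proof eventually_elim
        case (elim M)
        then show ?case
          using linear_map_add[OF conv_linear[OF F] v w, of M] hat_level_add_cong[of "F M v" n "G v" "F M w" "G w"]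
          by (simp add: H_simps)
      qed
      then show "G (v \<oplus>\<^bsub>V\<^esub> w) n = (G v \<oplus>\<^bsub>hat W\<^esub> G w) n" by simp
    qed
  qed
  then show ?thesis using ext by (simp add: conv_carrier)
qed

text \<open>Vanishing at level 1 means membership in the maximal ideal. These are the maps in which power
  series converge.\<close>

definition small :: "('v \<Rightarrow> ('w, 'r, 'k) hat) \<Rightarrow> bool" where
  "small c \<longleftrightarrow> c \<in> carrier \<C> \<and> c \<one>\<^bsub>V\<^esub> 1 = \<zero>\<^bsub>hat W\<^esub> 1"

lemma small_closed: "small c \<Longrightarrow> c \<in> carrier \<C>"
  by (simp add: small_def)

lemma small_mult:
  assumes c: "small c" and d: "d \<in> carrier \<C>"
  shows "small (c \<otimes>\<^bsub>\<C>\<^esub> d)"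
proof -
  have "hat_mult W (c \<one>\<^bsub>V\<^esub>) (d \<one>\<^bsub>V\<^esub>) (1 + 0) = \<zero>\<^bsub>hat W\<^esub> (1 + 0)"
    using c conv_closed[OF small_closed[OF c] oneV_carrier] conv_closed[OF d oneV_carrier]
    by (intro hat_mult_level_zero[OF kalgW] hat_level_0[OF modW]) (auto simp: small_def)
  then show ?thesis
    using small_closed[OF c] d by (simp add: small_def conv_mult_at_one del: One_nat_def)
qed

lemma evaluate_at_one:
  assumes c: "small c"
  shows "evaluate c (pCons a p) \<one>\<^bsub>V\<^esub> 1 = (rat_embed K a \<odot>\<^bsub>\<C>\<^esub> \<one>\<^bsub>\<C>\<^esub>) \<one>\<^bsub>V\<^esub> 1"
proof -
  let ?x = "rat_embed K a \<odot>\<^bsub>\<C>\<^esub> \<one>\<^bsub>\<C>\<^esub>"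
  have x: "?x \<in> carrier \<C>" by (simp add: rat_closed)
  have "(c \<otimes>\<^bsub>\<C>\<^esub> evaluate c p) \<one>\<^bsub>V\<^esub> 1 = \<zero>\<^bsub>hat W\<^esub> 1"
    using small_mult[OF c evaluate_closed[OF small_closed[OF c]]] by (simp add: small_def)
  then have "(?x \<one>\<^bsub>V\<^esub> \<oplus>\<^bsub>hat W\<^esub> (c \<otimes>\<^bsub>\<C>\<^esub> evaluate c p) \<one>\<^bsub>V\<^esub>) 1 = (?x \<one>\<^bsub>V\<^esub> \<oplus>\<^bsub>hat W\<^esub> \<zero>\<^bsub>hat W\<^esub>) 1"
    by (intro hat_level_add_cong) auto
  then show ?thesis
    using conv_closed[OF x oneV_carrier]
    by (simp add: evaluate_pCons[OF small_closed[OF c]] conv_add[OF oneV_carrier])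
qed

lemma evaluate_vanishes:
  assumes c: "c \<in> carrier \<C>" and v: "v \<in> carrier V"
    and nil: "\<And>m. m \<ge> M \<Longrightarrow> (c [^]\<^bsub>\<C>\<^esub> (m::nat)) v n = \<zero>\<^bsub>hat W\<^esub> n"
    and p: "\<And>k. k < M \<Longrightarrow> Polynomial.coeff p k = 0"
  shows "evaluate c p v n = \<zero>\<^bsub>hat W\<^esub> n"
proof -
  have "evaluate c (Polynomial.monom 1 m * r) v n = \<zero>\<^bsub>hat W\<^esub> n" if "m \<ge> M" for m r
    using that
  proof (induction r arbitrary: m)
    case 0
    then show ?case by (simp add: evaluate_0 c conv_zero v)
  next
    case (pCons a r)
    have e: "Polynomial.monom 1 m * pCons a r = Polynomial.smult a (Polynomial.monom 1 m) + Polynomial.monom 1 (Suc m) * r"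
      by (simp add: monom_Suc)
    have m: "c [^]\<^bsub>\<C>\<^esub> m \<in> carrier \<C>" using c by simp
    have "evaluate c (Polynomial.smult a (Polynomial.monom 1 m)) v n = \<zero>\<^bsub>hat W\<^esub> n"
      using hat_smult_mpow[OF modW, of "scal (rat_embed K a)" 0 _ n] nil[OF pCons.prems] conv_closed[OF m v]
      by (simp add: evaluate_smult evaluate_monom c rat_embed_simps[OF field_K char_zero_all] m conv_smult v one_ideals rat_closed)
    moreover have "evaluate c (Polynomial.monom 1 (Suc m) * r) v n = \<zero>\<^bsub>hat W\<^esub> n"
      using pCons.prems by (intro pCons.IH) simp
    ultimately show ?case
      unfolding e evaluate_add[OF c] conv_add[OF v]
      by (intro hat_level_add_zero[OF modW] conv_closed[OF evaluate_closed[OF c] v])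
  qed
  moreover obtain r where "p = Polynomial.monom 1 M * r"
    using p monom_1_dvd_iff'[of M p] by (auto elim: dvdE)
  ultimately show ?thesis by simp
qed

lemma evaluate_cong_level:
  assumes c: "c \<in> carrier \<C>" and v: "v \<in> carrier V"
    and nil: "\<And>m. m \<ge> M \<Longrightarrow> (c [^]\<^bsub>\<C>\<^esub> (m::nat)) v n = \<zero>\<^bsub>hat W\<^esub> n"
    and p: "\<And>k. k < M \<Longrightarrow> Polynomial.coeff p k = Polynomial.coeff q k"
  shows "evaluate c p v n = evaluate c q v n"
proof -
  have "evaluate c (p - q) v n = \<zero>\<^bsub>hat W\<^esub> n"
    by (rule evaluate_vanishes[OF c v, of M]) (simp_all add: nil p)
  then have "(evaluate c q v \<oplus>\<^bsub>hat W\<^esub> evaluate c (p - q) v) n = (evaluate c q v \<oplus>\<^bsub>hat W\<^esub> \<zero>\<^bsub>hat W\<^esub>) n"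
    by (intro hat_level_add_cong) auto
  then show ?thesis
    using evaluate_add[OF c, of q "p - q"] conv_closed[OF evaluate_closed[OF c] v, of q] by (simp add: conv_add v)
qed

definition nil_bound :: "('v \<Rightarrow> ('w, 'r, 'k) hat) \<Rightarrow> 'v \<Rightarrow> nat \<Rightarrow> nat" where
  "nil_bound c v n = (LEAST M. \<forall>m \<ge> M. (c [^]\<^bsub>\<C>\<^esub> m) v n = \<zero>\<^bsub>hat W\<^esub> n)"

text \<open>At each level, the polynomial that consists of the terms before the powers start to vanish.\<close>

definition series :: "('v \<Rightarrow> ('w, 'r, 'k) hat) \<Rightarrow> rat fps \<Rightarrow> 'v \<Rightarrow> ('w, 'r, 'k) hat" where
  "series c P = (\<lambda>v \<in> carrier V. \<lambda>n. evaluate c (truncate_fps (nil_bound c v n) P) v n)"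

lemma nil_bound: "small c \<Longrightarrow> v \<in> carrier V \<Longrightarrow> m \<ge> nil_bound c v n \<Longrightarrow>
    (c [^]\<^bsub>\<C>\<^esub> m) v n = \<zero>\<^bsub>hat W\<^esub> n"
  using LeastI_ex[OF locally_nilpotent[of c v n]] unfolding nil_bound_def small_def by blast

lemma series_level:
  assumes c: "small c" and v: "v \<in> carrier V" and M: "M \<ge> nil_bound c v n"
  shows "series c P v n = evaluate c (truncate_fps M P) v n"
  unfolding series_def restrict_apply'[OF v]
  by (rule evaluate_cong_level[OF small_closed[OF c] v nil_bound[OF c v]])
    (use M in \<open>auto simp: coeff_truncate_fps\<close>)

lemma levelwise_limit_series: "small c \<Longrightarrow> levelwise_limit (\<lambda>M. evaluate c (truncate_fps M P)) (series c P)"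
  unfolding levelwise_limit_def eventually_sequentially by (metis series_level)

lemma series_closed: "small c \<Longrightarrow> series c P \<in> carrier \<C>"
  by (rule levelwise_limit_carrier[OF evaluate_closed[OF small_closed] levelwise_limit_series])
    (auto simp: series_def)

lemma series_eqI:
  assumes c: "small c" and G: "G \<in> carrier \<C>"
    and "\<And>M. M \<ge> N \<Longrightarrow> evaluate c (truncate_fps M P) = G"
  shows "series c P = G"
proof (rule conv_eqI[OF series_closed[OF c] G])
  have "levelwise_limit (\<lambda>M. evaluate c (truncate_fps M P)) G"
    unfolding levelwise_limit_def eventually_sequentially using assms(3) by blast
  then show "series c P v = G v" if "v \<in> carrier V" for v
    by (rule levelwise_limit_unique[OF levelwise_limit_series[OF c] _ that])
qed

text \<open>Modulo the maximal ideal, only the constant coefficient contributes on the unit.\<close>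

lemma series_at_one:
  assumes c: "small c"
  shows "series c P \<one>\<^bsub>V\<^esub> 1 = (rat_embed K (fps_nth P 0) \<odot>\<^bsub>\<C>\<^esub> \<one>\<^bsub>\<C>\<^esub>) \<one>\<^bsub>V\<^esub> 1"
proof -
  let ?M = "Suc (nil_bound c \<one>\<^bsub>V\<^esub> 1)"
  obtain a p where p: "truncate_fps ?M P = pCons a p" by (cases "truncate_fps ?M P") auto
  have "a = fps_nth P 0" using arg_cong[OF p, of "\<lambda>p. Polynomial.coeff p 0"] by (simp add: coeff_truncate_fps)
  then show ?thesis
    using series_level[OF c oneV_carrier, of 1 ?M P] evaluate_at_one[OF c, of a p] p by simp
qed

lemma small_series: "small c \<Longrightarrow> fps_nth P 0 = 0 \<Longrightarrow> small (series c P)"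
  using series_at_one[of c P]
  by (simp add: small_def series_closed[unfolded small_def] rat_embed_simps[OF field_K char_zero_all] conv_zero oneV_carrier)

text \<open>Only finitely many coefficients matter for a given value at a given level, so that
  composition of power series reduces to composition of polynomials.\<close>

lemma series_compose:
  assumes c: "small c" and Q: "fps_nth Q 0 = 0"
  shows "series (series c Q) P = series c (fps_compose P Q)"
proof (rule conv_eqI)
  let ?d = "series c Q"
  have d: "small ?d" by (rule small_series[OF c Q])
  show "series ?d P \<in> carrier \<C>" "series c (fps_compose P Q) \<in> carrier \<C>"
    by (rule series_closed[OF d] series_closed[OF c])+
  fix v assume v: "v \<in> carrier V"
  show "series ?d P v = series c (fps_compose P Q) v"
  proof
    fix n
    define M where "M = max (nil_bound ?d v n) (nil_bound c v n)"
    have "levelwise_limit (\<lambda>N. evaluate (evaluate c (truncate_fps N Q)) (truncate_fps M P)) (evaluate ?d (truncate_fps M P))"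
      by (intro levelwise_limit_evaluate evaluate_closed small_closed c d levelwise_limit_series)
    from levelwise_limitD[OF this v, of n] obtain N0 where N0: "\<And>N. N \<ge> N0 \<Longrightarrow>
        evaluate (evaluate c (truncate_fps N Q)) (truncate_fps M P) v n = evaluate ?d (truncate_fps M P) v n"
      unfolding eventually_sequentially by blast
    define N where "N = max N0 M"
    have "series ?d P v n = evaluate ?d (truncate_fps M P) v n"
      by (rule series_level[OF d v]) (simp add: M_def)
    also have "\<dots> = evaluate (evaluate c (truncate_fps N Q)) (truncate_fps M P) v n"
      by (rule N0[symmetric]) (simp add: N_def)
    also have "\<dots> = evaluate c (pcompose (truncate_fps M P) (truncate_fps N Q)) v n"
      by (simp add: evaluate_pcompose small_closed[OF c])
    also have "\<dots> = evaluate c (truncate_fps M (fps_compose P Q)) v n"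
    proof (rule evaluate_cong_level[OF small_closed[OF c] v, of M])
      show "(c [^]\<^bsub>\<C>\<^esub> m) v n = \<zero>\<^bsub>hat W\<^esub> n" if "m \<ge> M" for m
        by (rule nil_bound[OF c v]) (use that in \<open>simp add: M_def\<close>)
      show "Polynomial.coeff (pcompose (truncate_fps M P) (truncate_fps N Q)) k =
          Polynomial.coeff (truncate_fps M (fps_compose P Q)) k" if "k < M" for k
        using that by (simp add: coeff_truncate_fps coeff_pcompose_truncate[OF Q] N_def)
    qed
    also have "\<dots> = series c (fps_compose P Q) v n"
      by (rule series_level[OF c v, symmetric]) (simp add: M_def)
    finally show "series ?d P v n = series c (fps_compose P Q) v n" .
  qed
qed

lemma series_X: "small c \<Longrightarrow> series c fps_X = c"
proof (rule series_eqI[of _ _ 2])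
  assume c: "small c"
  fix M :: nat assume "M \<ge> 2"
  then have "truncate_fps M fps_X = Polynomial.monom 1 1"
    by (intro poly_eqI) (auto simp: coeff_truncate_fps fps_X_def)
  then show "evaluate c (truncate_fps M fps_X) = c"
    using c by (simp add: evaluate_monom small_closed rat_embed_simps[OF field_K char_zero_all])
qed (simp_all add: small_closed)

lemma series_one_add:
  assumes c: "small c"
  shows "series c (1 + P) = \<one>\<^bsub>\<C>\<^esub> \<oplus>\<^bsub>\<C>\<^esub> series c P"
proof (rule conv_eqI)
  have "levelwise_limit (\<lambda>M. \<one>\<^bsub>\<C>\<^esub> \<oplus>\<^bsub>\<C>\<^esub> evaluate c (truncate_fps M P))
      (\<one>\<^bsub>\<C>\<^esub> \<oplus>\<^bsub>\<C>\<^esub> series c P)"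
    by (intro levelwise_limit_add levelwise_limit_const levelwise_limit_series c)
  moreover have e: "\<one>\<^bsub>\<C>\<^esub> \<oplus>\<^bsub>\<C>\<^esub> evaluate c (truncate_fps M P) = evaluate c (truncate_fps M (1 + P))"
    if "M \<ge> 1" for M
  proof -
    have "truncate_fps M (1 + P) = Polynomial.monom 1 0 + truncate_fps M P"
      using that by (intro poly_eqI) (auto simp: coeff_truncate_fps)
    then show ?thesis
      by (simp only: evaluate_add[OF small_closed[OF c]] evaluate_monom[OF small_closed[OF c]])
        (simp add: rat_embed_simps[OF field_K char_zero_all])
  qed
  ultimately have "levelwise_limit (\<lambda>M. evaluate c (truncate_fps M (1 + P)))
      (\<one>\<^bsub>\<C>\<^esub> \<oplus>\<^bsub>\<C>\<^esub> series c P)"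
    unfolding levelwise_limit_def
  proof (intro ballI allI)
    fix v n assume *: "\<forall>v \<in> carrier V. \<forall>n. \<forall>\<^sub>F M in sequentially.
        (\<one>\<^bsub>\<C>\<^esub> \<oplus>\<^bsub>\<C>\<^esub> evaluate c (truncate_fps M P)) v n =
        (\<one>\<^bsub>\<C>\<^esub> \<oplus>\<^bsub>\<C>\<^esub> series c P) v n" and v: "v \<in> carrier V"
    show "\<forall>\<^sub>F M in sequentially. evaluate c (truncate_fps M (1 + P)) v n =
        (\<one>\<^bsub>\<C>\<^esub> \<oplus>\<^bsub>\<C>\<^esub> series c P) v n"
      using *[rule_format, OF v, of n] eventually_ge_at_top[of 1]
      by eventually_elim (simp only: e)
  qed
  then show "series c (1 + P) v = (\<one>\<^bsub>\<C>\<^esub> \<oplus>\<^bsub>\<C>\<^esub> series c P) v" if "v \<in> carrier V" for v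
    by (rule levelwise_limit_unique[OF levelwise_limit_series[OF c] _ that])
qed (simp_all add: series_closed c)

end

subsection \<open>The convolution exponential and logarithm of continuous maps\<close>

context convolution
begin

interpretation K: field K by (rule field_K)
interpretation R: algebra K R by (rule algebra_R)
interpretation V: module K V by (rule modV)
interpretation W: module K W by (rule modW)
interpretation HV: module R "hat V" by (rule module_hat[OF modV])
interpretation HR: module R "hat W" by (rule module_hat[OF modW])
interpretation H: module K "hat_over_field W" by (rule module_hat_over_field[OF modW])
interpretation AM: module K "\<C>" by (rule module_conv)
interpretation AR: ring "\<C>" using K_algebra_conv by (simp add: K_algebra_def)

text \<open>A subalgebra that is closed under limits, hence under power series; its elements extend to
  continuous maps of degree 0.\<close>

definition conv_degree_0 :: "('v \<Rightarrow> ('w, 'r, 'k) hat) set" where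
  "conv_degree_0 = {c \<in> carrier \<C>. \<forall>i. \<forall>v \<in> component V i. c v \<in> hat_component W i}"

lemma conv_degree_0_closed: "c \<in> conv_degree_0 \<Longrightarrow> c \<in> carrier \<C>"
  by (simp add: conv_degree_0_def)

lemma conv_degree_0_comp: "c \<in> conv_degree_0 \<Longrightarrow> v \<in> component V i \<Longrightarrow> c v \<in> hat_component W i"
  by (simp add: conv_degree_0_def)

lemma conv_degree_0I: "c \<in> carrier \<C> \<Longrightarrow>
    (\<And>i v. v \<in> component V i \<Longrightarrow> v \<in> carrier V \<Longrightarrow> c v \<in> hat_component W i) \<Longrightarrow> c \<in> conv_degree_0"
  using component_carrier[OF gradedV] by (simp add: conv_degree_0_def)

lemma conv_degree_0_one: "\<one>\<^bsub>\<C>\<^esub> \<in> conv_degree_0"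
proof (rule conv_degree_0I[OF conv_one_closed])
  fix i v assume v: "v \<in> component V i" "v \<in> carrier V"
  have "counit V v = \<zero>\<^bsub>K\<^esub>" if "i \<noteq> 0"
    using coV v that unfolding graded_cocomm_coalgebra_def by blast
  then have "counit V v \<odot>\<^bsub>W\<^esub> \<one>\<^bsub>W\<^esub> \<in> component W i"
    using component_closed[OF gradedW] oneW_component oneW_carrier linear_counit(3)[OF v(2)]
    by (cases "i = 0") simp_all
  then show "\<one>\<^bsub>\<C>\<^esub> v \<in> hat_component W i"
    unfolding conv_one[OF v(2)] by (rule hat_component_incl[OF gradedW])
qed

lemma conv_degree_0_mult:
  assumes f: "f \<in> conv_degree_0" and g: "g \<in> conv_degree_0"
  shows "f \<otimes>\<^bsub>\<C>\<^esub> g \<in> conv_degree_0"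
proof (rule conv_degree_0I[OF conv_mult_closed[OF f[THEN conv_degree_0_closed] g[THEN conv_degree_0_closed]]])
  note fc = f[THEN conv_degree_0_closed] and gc = g[THEN conv_degree_0_closed]
  note L = linear_pairing_lift[OF fc gc] and T = module_tensor_power[OF field_K modV]
  fix n v assume v: "v \<in> component V n" "v \<in> carrier V"
  have "comult V v \<in> square_component K V n"
    using coV v unfolding graded_cocomm_coalgebra_def by blast
  moreover have "{pure_power K V [v, w] | v w i j. v \<in> component V i \<and> w \<in> component V j \<and> i + j = n}
      \<subseteq> carrier (tensor_power K V 2)"
    by (auto intro!: pure_power_closed[OF field_K modV] simp: words_two intro: component_carrier[OF gradedV])
  ultimately have "tensor_lift K (hat_over_field W) (pairing f g) (comult V v) \<in> hat_component W n"
    unfolding square_component_def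
  proof (induction rule: lin_span_induct[OF T, consumes 2, case_names zero gen add smult])
    case zero
    show ?case using hat_component_zero[OF gradedW] by (simp add: linear_map_zero[OF T modH L] H_simps del: One_nat_def)
  next
    case (gen x)
    then obtain v w i j where x: "x = pure_power K V [v, w]" "v \<in> component V i" "w \<in> component V j" "i + j = n"
      by blast
    then show ?case
      using hat_component_mult[OF algW conv_degree_0_comp[OF f x(2)] conv_degree_0_comp[OF g x(3)]]
      by (simp add: pairing_lift_pure fc gc component_carrier[OF gradedV] del: One_nat_def)
  next
    case (add x y)
    then show ?case by (simp add: linear_map_add[OF L] H_simps hat_component_add[OF gradedW] del: One_nat_def)
  next
    case (smult a x)
    then show ?case by (simp add: linear_map_smult[OF L] H_simps hat_component_smult[OF gradedW] del: One_nat_def)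
  qed
  then show "(f \<otimes>\<^bsub>\<C>\<^esub> g) v \<in> hat_component W n" unfolding conv_mult[OF v(2)] .
qed

lemma conv_degree_0_add: "f \<in> conv_degree_0 \<Longrightarrow> g \<in> conv_degree_0 \<Longrightarrow> f \<oplus>\<^bsub>\<C>\<^esub> g \<in> conv_degree_0"
  by (rule conv_degree_0I)
    (simp_all add: conv_degree_0_closed conv_add conv_degree_0_comp hat_component_add[OF gradedW])

lemma conv_degree_0_smult: "a \<in> carrier K \<Longrightarrow> f \<in> conv_degree_0 \<Longrightarrow> a \<odot>\<^bsub>\<C>\<^esub> f \<in> conv_degree_0"
  by (rule conv_degree_0I)
    (simp_all add: conv_degree_0_closed conv_smult conv_degree_0_comp hat_component_smult[OF gradedW])

lemma conv_degree_0_minus: "f \<in> conv_degree_0 \<Longrightarrow> g \<in> conv_degree_0 \<Longrightarrow> f \<ominus>\<^bsub>\<C>\<^esub> g \<in> conv_degree_0"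
proof -
  assume f: "f \<in> conv_degree_0" and g: "g \<in> conv_degree_0"
  have "f \<ominus>\<^bsub>\<C>\<^esub> g = f \<oplus>\<^bsub>\<C>\<^esub> (\<ominus>\<^bsub>K\<^esub> \<one>\<^bsub>K\<^esub>) \<odot>\<^bsub>\<C>\<^esub> g"
    using g by (simp add: a_minus_def AM.smult_l_minus conv_degree_0_closed)
  then show ?thesis using f g by (simp add: conv_degree_0_add conv_degree_0_smult)
qed

lemma conv_degree_0_power: "f \<in> conv_degree_0 \<Longrightarrow> f [^]\<^bsub>\<C>\<^esub> (n::nat) \<in> conv_degree_0"
  by (induction n) (simp_all add: conv_degree_0_one conv_degree_0_mult)

lemma conv_degree_0_zero: "\<zero>\<^bsub>\<C>\<^esub> \<in> conv_degree_0"
  by (rule conv_degree_0I) (simp_all add: conv_zero hat_component_zero[OF gradedW])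

lemma conv_degree_0_evaluate: "f \<in> conv_degree_0 \<Longrightarrow> evaluate f p \<in> conv_degree_0"
  by (induction p)
    (simp_all add: evaluate_0 evaluate_pCons conv_degree_0_closed conv_degree_0_zero conv_degree_0_one
      conv_degree_0_add conv_degree_0_smult conv_degree_0_mult rat_closed)

lemma conv_degree_0_series:
  assumes f: "f \<in> conv_degree_0" and s: "small f"
  shows "series f P \<in> conv_degree_0"
proof (rule conv_degree_0I[OF series_closed[OF s]])
  fix i v assume v: "v \<in> component V i" "v \<in> carrier V"
  show "series f P v \<in> hat_component W i"
  proof (rule hat_component_limit[OF gradedW conv_closed[OF series_closed[OF s] v(2)]])
    show "\<exists>y\<in>hat_component W i. series f P v n = y n" for n
      using series_level[where n = n and P = P, OF s v(2) order_refl] conv_degree_0_comp[OF conv_degree_0_evaluate[OF f] v(1)] by blast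
  qed
qed

text \<open>Continuous maps of degree 0 correspond to their restrictions to \<open>V\<close>.\<close>

definition on_generators :: "(('v, 'r, 'k) hat \<Rightarrow> ('w, 'r, 'k) hat) \<Rightarrow> 'v \<Rightarrow> ('w, 'r, 'k) hat" where
  "on_generators f = (\<lambda>v \<in> carrier V. f (incl V v))"

lemma conv_hat_extend:
  assumes "c \<in> conv_degree_0"
  shows "hat_extend V W c \<in> lin_maps V W 0" "on_generators (hat_extend V W c) = c"
    "hat_extend V W c = restrict (extension W c) (carrier (hat V))"
proof -
  note h = gradedV gradedW conv_linear[OF conv_degree_0_closed[OF assms]]
  note c = h conv_degree_0_comp[OF assms]
  show 1: "hat_extend V W c \<in> lin_maps V W 0" by (rule hat_extend_in_lin_maps[OF c])
  show "on_generators (hat_extend V W c) = c"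
    by (rule extensionalityI[of _ "carrier V"])
      (use conv_degree_0_closed[OF assms] hat_extend_incl[OF c] in \<open>auto simp: on_generators_def conv_carrier\<close>)
  show "hat_extend V W c = restrict (extension W c) (carrier (hat V))"
    by (rule lin_maps_eqI[OF modV modW 1 extension_in_lin_maps[OF c]])
      (simp_all add: hat_extend_incl[OF c] incl_closed[OF modV] extension_incl[OF modV modW h(3)])
qed

lemma on_generators_apply: "v \<in> carrier V \<Longrightarrow> on_generators f v = f (incl V v)"
  by (simp add: on_generators_def)

lemma conv_hat_extend_incl: "c \<in> conv_degree_0 \<Longrightarrow> v \<in> carrier V \<Longrightarrow> hat_extend V W c (incl V v) = c v"
  using on_generators_apply[of v "hat_extend V W c"] by (simp add: conv_hat_extend(2))

lemma on_generators_lin_maps: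
  assumes f: "f \<in> lin_maps V W 0"
  shows "on_generators f \<in> conv_degree_0" "hat_extend V W (on_generators f) = f"
proof -
  have l: "linear_map R (hat V) (hat W) f" using f by (simp add: lin_maps_iff)
  have "linear_map K V (hat_over_field W) (\<lambda>v. f (incl V v))"
    by (rule linear_map_comp[OF linear_incl[OF modV] linear_R_imp_K[OF modV modW l]])
  then have c: "on_generators f \<in> carrier \<C>" unfolding on_generators_def by (rule restrict_conv)
  show 1: "on_generators f \<in> conv_degree_0"
  proof (rule conv_degree_0I[OF c])
    fix i v assume v: "v \<in> component V i" "v \<in> carrier V"
    have "f (incl V v) \<in> hat_component W (i + 0)"
      using f hat_component_incl[OF gradedV v(1)] unfolding lin_maps_iff by blast
    then show "on_generators f v \<in> hat_component W i" using v by (simp add: on_generators_def)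
  qed
  show "hat_extend V W (on_generators f) = f"
  proof (rule lin_maps_eqI[OF modV modW conv_hat_extend(1)[OF 1] f])
    fix v assume "v \<in> carrier V"
    then show "hat_extend V W (on_generators f) (incl V v) = f (incl V v)"
      using fun_cong[OF conv_hat_extend(2)[OF 1], of v] by (simp add: on_generators_def)
  qed
qed

lemma hat_extend_rep:
  assumes c: "c \<in> conv_degree_0" and x: "x \<in> carrier (hat V)" and t: "t \<in> carrier (ext V)" "x n = const_hat V t n"
  shows "hat_extend V W c x n = ext_lift W c t n"
  unfolding conv_hat_extend(3)[OF c] restrict_apply'[OF x]
  by (rule extension_rep[where x = x and n = n, OF modV modW conv_linear[OF conv_degree_0_closed[OF c]] t])

lemma hat_extend_closed: "c \<in> conv_degree_0 \<Longrightarrow> x \<in> carrier (hat V) \<Longrightarrow> hat_extend V W c x \<in> carrier (hat W)"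
proof -
  assume "c \<in> conv_degree_0"
  then have "linear_map R (hat V) (hat W) (hat_extend V W c)"
    using conv_hat_extend(1)[of c] by (simp add: lin_maps_iff)
  then show "x \<in> carrier (hat V) \<Longrightarrow> hat_extend V W c x \<in> carrier (hat W)" by (rule linear_map_closed)
qed

lemmas ext_lift_facts =
  ext_lift_pure_tensor[OF modV modW conv_linear[OF conv_degree_0_closed]]
  ext_lift_add[OF modV modW conv_linear[OF conv_degree_0_closed]]
  ext_lift_closed[OF modV modW conv_linear[OF conv_degree_0_closed]]

lemma hat_extend_add:
  assumes c: "c \<in> conv_degree_0" and d: "d \<in> conv_degree_0" and x: "x \<in> carrier (hat V)"
  shows "hat_extend V W (c \<oplus>\<^bsub>\<C>\<^esub> d) x = hat_extend V W c x \<oplus>\<^bsub>hat W\<^esub> hat_extend V W d x"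
proof
  fix n
  obtain t where t: "t \<in> carrier (ext V)" "x n = const_hat V t n" by (rule hat_approx[OF modV x])
  note cd = conv_degree_0_add[OF c d]
  from t(1) have "ext_lift W (c \<oplus>\<^bsub>\<C>\<^esub> d) t = ext_lift W c t \<oplus>\<^bsub>hat W\<^esub> ext_lift W d t"
    by (induction t rule: ext_induct[OF modV, consumes 1, case_names pure add])
      (simp_all add: ext_lift_facts c d cd conv_add HR.smult_r_distr conv_closed conv_degree_0_closed HR.a_ac)
  then show "hat_extend V W (c \<oplus>\<^bsub>\<C>\<^esub> d) x n = (hat_extend V W c x \<oplus>\<^bsub>hat W\<^esub> hat_extend V W d x) n"
    using hat_extend_rep[OF cd x t] hat_extend_rep[OF c x t] hat_extend_rep[OF d x t]
      hat_level_add_cong[of "hat_extend V W c x" n "ext_lift W c t" "hat_extend V W d x" "ext_lift W d t"] by simp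
qed

lemma hat_extend_smult:
  assumes c: "c \<in> conv_degree_0" and a: "a \<in> carrier K" and x: "x \<in> carrier (hat V)"
  shows "hat_extend V W (a \<odot>\<^bsub>\<C>\<^esub> c) x = scal a \<odot>\<^bsub>hat W\<^esub> hat_extend V W c x"
proof
  fix n
  obtain t where t: "t \<in> carrier (ext V)" "x n = const_hat V t n" by (rule hat_approx[OF modV x])
  note ac = conv_degree_0_smult[OF a c]
  from t(1) have "ext_lift W (a \<odot>\<^bsub>\<C>\<^esub> c) t = scal a \<odot>\<^bsub>hat W\<^esub> ext_lift W c t"
    by (induction t rule: ext_induct[OF modV, consumes 1, case_names pure add])
      (simp_all add: ext_lift_facts c ac a conv_smult HR.smult_r_distr conv_closed conv_degree_0_closed
        HR.smult_assoc1[symmetric] R.m_comm)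
  then show "hat_extend V W (a \<odot>\<^bsub>\<C>\<^esub> c) x n = (scal a \<odot>\<^bsub>hat W\<^esub> hat_extend V W c x) n"
    using hat_extend_rep[OF ac x t]
      hat_smult_level[where x = "hat_extend V W c x" and y = "ext_lift W c t" and n = n, OF modW hat_extend_rep[OF c x t]]
    by simp
qed

lemma hat_extend_zero: "x \<in> carrier (hat V) \<Longrightarrow> hat_extend V W \<zero>\<^bsub>\<C>\<^esub> x = \<zero>\<^bsub>hat W\<^esub>"
  using hat_extend_smult[OF conv_degree_0_zero K.zero_closed, of x] hat_extend_closed[OF conv_degree_0_zero] by simp

text \<open>Limits are preserved by the extension to the completion, because at each level an element of the
  completion is a finite sum of elements \<open>r \<cdot> v\<close>.\<close>

lemma hat_extend_limit:
  assumes F: "\<And>M. F M \<in> conv_degree_0" and G: "G \<in> conv_degree_0" and lim: "levelwise_limit F G"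
    and x: "x \<in> carrier (hat V)"
  shows "\<forall>\<^sub>F M in sequentially. hat_extend V W (F M) x n = hat_extend V W G x n"
proof -
  obtain t where t: "t \<in> carrier (ext V)" "x n = const_hat V t n" by (rule hat_approx[OF modV x])
  from t(1) have "\<forall>\<^sub>F M in sequentially. ext_lift W (F M) t n = ext_lift W G t n"
  proof (induction t rule: ext_induct[OF modV, consumes 1, case_names pure add])
    case (pure v r)
    show ?case
      unfolding ext_lift_facts(1)[OF F pure] ext_lift_facts(1)[OF G pure]
      using levelwise_limitD[OF lim pure(1), of n] by eventually_elim (rule hat_smult_level[OF modW])
  next
    case (add t u)
    from add.IH show ?case
      unfolding ext_lift_facts(2)[OF F add.hyps] ext_lift_facts(2)[OF G add.hyps]
      by eventually_elim (rule hat_level_add_cong)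
  qed
  then show ?thesis
    unfolding hat_extend_rep[OF F x t] hat_extend_rep[OF G x t] .
qed

lemma hat_extend_cong: "(\<And>v. v \<in> carrier V \<Longrightarrow> c v = d v) \<Longrightarrow> hat_extend V W c = hat_extend V W d"
  by (simp add: hat_extend_def)

lemma multilinear_map_cong:
  assumes V: "module K V" and b: "multilinear_map K V n M b" and eq: "\<And>vs. vs \<in> words V n \<Longrightarrow> b vs = b' vs"
  shows "multilinear_map K V n M b'"
  unfolding multilinear_map_def
proof (intro conjI ballI allI impI)
  show "b' vs \<in> carrier M" if "vs \<in> words V n" for vs
    using b eq[OF that, symmetric] that by (simp add: multilinear_map_def)
  show "linear_map K V M (\<lambda>v. b' (us @ v # ws))"
    if "set us \<subseteq> carrier V \<and> set ws \<subseteq> carrier V \<and> Suc (length us + length ws) = n" for us ws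
    by (rule linear_map_cong[OF V, of _ "\<lambda>v. b (us @ v # ws)"])
      (use b that eq in \<open>auto simp: multilinear_map_def words_append\<close>)
qed

lemma conv_pow_hat_extend:
  assumes c: "on_generators f \<in> conv_degree_0"
  shows "conv_pow V W f n = hat_extend V W (on_generators f [^]\<^bsub>\<C>\<^esub> n)"
proof (induction n)
  case 0
  show ?case by (simp add: conv_unit_def) (rule hat_extend_cong, simp add: conv_one)
next
  case (Suc n)
  let ?c = "on_generators f" and ?A = "\<C>"
  let ?p = "?c [^]\<^bsub>?A\<^esub> n"
  note p = conv_degree_0_power[OF c, of n]
  have cp: "?c [^]\<^bsub>?A\<^esub> Suc n = ?c \<otimes>\<^bsub>?A\<^esub> ?p" using AR.nat_pow_Suc2[OF conv_degree_0_closed[OF c]] .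
  have "conv V W f (hat_extend V W ?p) = hat_extend V W (?c \<otimes>\<^bsub>?A\<^esub> ?p)"
    unfolding conv_def
  proof (rule hat_extend_cong)
    fix v assume v: "v \<in> carrier V"
    have eq: "pairing ?c ?p vs = hat_mult W (f (incl V (vs ! 0))) (hat_extend V W ?p (incl V (vs ! 1)))"
      if "vs \<in> words V 2" for vs
      using that by (auto simp: words_two on_generators_apply conv_hat_extend_incl[OF p])
    note m = multilinear_pairing[OF conv_degree_0_closed[OF c] conv_degree_0_closed[OF p]]
    show "tensor_lift K (hat_over_field W)
        (\<lambda>vs. hat_mult W (f (incl V (vs ! 0))) (hat_extend V W ?p (incl V (vs ! 1)))) (comult V v) =
        (?c \<otimes>\<^bsub>?A\<^esub> ?p) v"
      unfolding conv_mult[OF v]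
      by (rule tensor_lift_cong[OF field_K modV modH multilinear_map_cong[OF modV m eq] m eq[symmetric] comult_closed[OF v]])
  qed
  then show ?case unfolding cp by (simp add: Suc.IH)
qed

lemma hat_sum_series:
  assumes c: "c \<in> conv_degree_0" and s: "small c" and x: "x \<in> carrier (hat V)"
    and a: "\<And>k. (\<Oplus>\<^bsub>hat W\<^esub>i \<in> {..<k}. a i) = hat_extend V W (evaluate c (truncate_fps (k + j) P)) x"
  shows "hat_sum W a = hat_extend V W (series c P) x"
proof -
  let ?y = "hat_extend V W (series c P) x"
  have lim: "\<exists>N. \<forall>k \<ge> N. (\<Oplus>\<^bsub>hat W\<^esub>i \<in> {..<k}. a i) n = ?y n" for n
  proof -
    have "\<forall>\<^sub>F M in sequentially. hat_extend V W (evaluate c (truncate_fps M P)) x n = ?y n"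
      by (rule hat_extend_limit[OF conv_degree_0_evaluate[OF c] conv_degree_0_series[OF c s] levelwise_limit_series[OF s] x])
    then obtain N where "\<And>M. M \<ge> N \<Longrightarrow> hat_extend V W (evaluate c (truncate_fps M P)) x n = ?y n"
      unfolding eventually_sequentially by blast
    then show ?thesis unfolding a by (intro exI[of _ N]) simp
  qed
  show ?thesis
    unfolding hat_sum_def
  proof (rule the_equality)
    show "?y \<in> carrier (hat W) \<and> (\<forall>n. \<exists>N. \<forall>k \<ge> N. (\<Oplus>\<^bsub>hat W\<^esub>i \<in> {..<k}. a i) n = ?y n)"
      using lim hat_extend_closed[OF conv_degree_0_series[OF c s] x] by blast
    fix z assume z: "z \<in> carrier (hat W) \<and> (\<forall>n. \<exists>N. \<forall>k \<ge> N. (\<Oplus>\<^bsub>hat W\<^esub>i \<in> {..<k}. a i) n = z n)"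
    show "z = ?y"
    proof
      fix n
      obtain N where "\<forall>k \<ge> N. (\<Oplus>\<^bsub>hat W\<^esub>i \<in> {..<k}. a i) n = z n" using z by blast
      moreover obtain N' where "\<forall>k \<ge> N'. (\<Oplus>\<^bsub>hat W\<^esub>i \<in> {..<k}. a i) n = ?y n" using lim by blast
      ultimately show "z n = ?y n" by (metis max.cobounded1 max.cobounded2)
    qed
  qed
qed

text \<open>The partial sums of the defining series are values of truncated power series. The shift \<open>j\<close>
  accounts for the logarithm having no constant term.\<close>

lemma hat_sum_conv_pow:
  assumes c: "on_generators f \<in> conv_degree_0" and s: "small (on_generators f)" and x: "x \<in> carrier (hat V)"
    and b: "\<And>i. b i = rat_embed K (fps_nth P (i + j))" and P: "\<And>i. i < j \<Longrightarrow> fps_nth P i = 0"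
  shows "hat_sum W (\<lambda>i. b i \<odot>\<^bsub>hat_over_field W\<^esub> conv_pow V W f (i + j) x) =
    hat_extend V W (series (on_generators f) P) x"
proof (rule hat_sum_series[OF c s x])
  let ?c = "on_generators f" and ?A = "\<C>"
  fix k
  have summand: "b i \<odot>\<^bsub>hat_over_field W\<^esub> conv_pow V W f (i + j) x =
      hat_extend V W (evaluate ?c (Polynomial.monom (fps_nth P (i + j)) (i + j))) x" for i
    using hat_extend_smult[OF conv_degree_0_power[OF c] rat_closed x]
    by (simp add: H_simps conv_pow_hat_extend[OF c] b evaluate_monom conv_degree_0_closed[OF c])
  have tc: "b i \<odot>\<^bsub>hat_over_field W\<^esub> conv_pow V W f (i + j) x \<in> carrier (hat W)" for i
    unfolding summand by (rule hat_extend_closed[OF conv_degree_0_evaluate[OF c] x])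
  show "(\<Oplus>\<^bsub>hat W\<^esub>i \<in> {..<k}. b i \<odot>\<^bsub>hat_over_field W\<^esub> conv_pow V W f (i + j) x) =
      hat_extend V W (evaluate ?c (truncate_fps (k + j) P)) x"
  proof (induction k)
    case 0
    have "truncate_fps j P = 0" by (rule poly_eqI) (simp add: coeff_truncate_fps P)
    then show ?case by (simp add: evaluate_0 conv_degree_0_closed[OF c] hat_extend_zero x)
  next
    case (Suc k)
    have "(\<Oplus>\<^bsub>hat W\<^esub>i \<in> {..<Suc k}. b i \<odot>\<^bsub>hat_over_field W\<^esub> conv_pow V W f (i + j) x) =
        b k \<odot>\<^bsub>hat_over_field W\<^esub> conv_pow V W f (k + j) x \<oplus>\<^bsub>hat W\<^esub> hat_extend V W (evaluate ?c (truncate_fps (k + j) P)) x"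
      unfolding lessThan_Suc using tc by (subst HR.finsum_insert) (auto simp: Suc.IH)
    also have "\<dots> = hat_extend V W (evaluate ?c (truncate_fps (k + j) P)) x \<oplus>\<^bsub>hat W\<^esub>
        hat_extend V W (evaluate ?c (Polynomial.monom (fps_nth P (k + j)) (k + j))) x"
      unfolding summand by (rule HR.a_comm) (intro hat_extend_closed conv_degree_0_evaluate c x)+
    also have "\<dots> = hat_extend V W (evaluate ?c (truncate_fps (Suc k + j) P)) x"
      by (simp add: truncate_fps_Suc evaluate_add conv_degree_0_closed[OF c] hat_extend_add x
          conv_degree_0_evaluate[OF c])
    finally show ?case .
  qed
qed

lemma lin_maps_restrict: "f \<in> lin_maps V W 0 \<Longrightarrow> (\<lambda>x \<in> carrier (hat V). f x) = f"
  by (auto simp: lin_maps_iff extensional_restrict restrict_def extensional_def)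

lemma conv_exp_series:
  assumes c: "on_generators f \<in> conv_degree_0" and s: "small (on_generators f)"
  shows "conv_exp V W f = hat_extend V W (series (on_generators f) (fps_exp 1))"
proof -
  have b: "inv\<^bsub>K\<^esub> (add_pow K (fact n :: nat) \<one>\<^bsub>K\<^esub>) = rat_embed K (fps_nth (fps_exp 1) (n + 0))" for n
    using rat_embed_inverse[OF field_K char_zero_all, of "fact n"] by (simp add: of_nat_fact)
  have "conv_exp V W f = (\<lambda>x \<in> carrier (hat V). hat_extend V W (series (on_generators f) (fps_exp 1)) x)"
    unfolding conv_exp_def
    using hat_sum_conv_pow[OF c s, where j = 0, OF _ b] by (intro restrict_ext) simp
  then show ?thesis using lin_maps_restrict[OF conv_hat_extend(1)[OF conv_degree_0_series[OF c s]]] by simp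
qed

lemma conv_minus_apply: "f \<in> carrier \<C> \<Longrightarrow> g \<in> carrier \<C> \<Longrightarrow> v \<in> carrier V \<Longrightarrow>
    (f \<ominus>\<^bsub>\<C>\<^esub> g) v = f v \<ominus>\<^bsub>hat W\<^esub> g v"
  using linear_map_minus[OF module_conv modH, of "\<lambda>f. f v"]
  by (simp add: linear_map_def conv_closed conv_add conv_smult H_simps)

lemma conv_log_series:
  assumes \<phi>: "\<phi> \<in> lin_maps V W 0" and s: "small (on_generators \<phi> \<ominus>\<^bsub>\<C>\<^esub> \<one>\<^bsub>\<C>\<^esub>)"
  shows "conv_log V W \<phi> = hat_extend V W (series (on_generators \<phi> \<ominus>\<^bsub>\<C>\<^esub> \<one>\<^bsub>\<C>\<^esub>) (fps_ln 1))"
proof -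
  let ?A = "\<C>"
  define g where "g = (\<lambda>x \<in> carrier (hat V). \<phi> x \<ominus>\<^bsub>hat W\<^esub> conv_unit V W x)"
  have u: "conv_unit V W = hat_extend V W \<one>\<^bsub>?A\<^esub>"
    unfolding conv_unit_def by (rule hat_extend_cong) (simp add: conv_one)
  have g': "on_generators g = on_generators \<phi> \<ominus>\<^bsub>?A\<^esub> \<one>\<^bsub>?A\<^esub>"
  proof (rule extensionalityI[of _ "carrier V"])
    show "on_generators \<phi> \<ominus>\<^bsub>?A\<^esub> \<one>\<^bsub>?A\<^esub> \<in> extensional (carrier V)"
      using small_closed[OF s] by (simp add: conv_carrier)
    fix v assume v: "v \<in> carrier V"
    have "conv_unit V W (incl V v) = \<one>\<^bsub>?A\<^esub> v"
      using v fun_cong[OF conv_hat_extend(2)[OF conv_degree_0_one], of v] by (simp add: u on_generators_def)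
    then show "on_generators g v = (on_generators \<phi> \<ominus>\<^bsub>?A\<^esub> \<one>\<^bsub>?A\<^esub>) v"
      using v conv_minus_apply[OF conv_degree_0_closed[OF on_generators_lin_maps(1)[OF \<phi>]] conv_one_closed v]
      by (simp add: on_generators_def g_def incl_closed[OF modV])
  qed (simp add: on_generators_def)
  have c: "on_generators g \<in> conv_degree_0"
    unfolding g' by (intro conv_degree_0_minus on_generators_lin_maps(1) \<phi> conv_degree_0_one)
  have sg: "small (on_generators g)" unfolding g' by (rule s)
  have b: "(\<ominus>\<^bsub>K\<^esub> \<one>\<^bsub>K\<^esub>) [^]\<^bsub>K\<^esub> n \<otimes>\<^bsub>K\<^esub> inv\<^bsub>K\<^esub> (add_pow K (Suc n) \<one>\<^bsub>K\<^esub>) = rat_embed K (fps_nth (fps_ln 1) (n + 1))" for n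
    using rat_embed_mult[OF field_K char_zero_all, of "(- 1) ^ n" "1 / of_nat (Suc n)"]
    by (simp add: fps_ln_nth rat_embed_inverse[OF field_K char_zero_all, of "Suc n"]
        rat_embed_minus_one_power[OF field_K char_zero_all] del: of_nat_Suc)
  have "conv_log V W \<phi> = (\<lambda>x \<in> carrier (hat V). hat_extend V W (series (on_generators g) (fps_ln 1)) x)"
    unfolding conv_log_def Let_def g_def[symmetric]
    using hat_sum_conv_pow[OF c sg, where j = 1, OF _ b] by (intro restrict_ext) simp
  then show ?thesis
    using lin_maps_restrict[OF conv_hat_extend(1)[OF conv_degree_0_series[OF c sg]]] by (simp add: g')
qed


subsection \<open>Exponential and logarithm are mutually inverse\<close>

lemma on_generators_scal:
  assumes f: "f \<in> lin_maps V W 0" and a: "a \<in> carrier K"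
  shows "f (incl V (a \<odot>\<^bsub>V\<^esub> \<one>\<^bsub>V\<^esub>)) = scal a \<odot>\<^bsub>hat W\<^esub> on_generators f \<one>\<^bsub>V\<^esub>"
proof -
  note c = on_generators_lin_maps(1)[OF f]
  show ?thesis
    using linear_map_smult[OF conv_linear[OF conv_degree_0_closed[OF c]] a oneV_carrier] a oneV_carrier
    by (simp add: on_generators_def H_simps)
qed

text \<open>The condition is only about scalar multiples of the unit, so it may be tested on the unit.\<close>

lemma lin0_iff: "f \<in> lin0 V W \<longleftrightarrow> f \<in> lin_maps V W 0 \<and> small (on_generators f)"
proof (cases "f \<in> lin_maps V W 0")
  case True
  note c = conv_degree_0_closed[OF on_generators_lin_maps(1)[OF True]]
  let ?y = "on_generators f \<one>\<^bsub>V\<^esub>"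
  have y: "?y \<in> carrier (hat W)" by (rule conv_closed[OF c oneV_carrier])
  have "f \<in> lin0 V W \<longleftrightarrow> (\<forall>a \<in> carrier K. scal a \<odot>\<^bsub>hat W\<^esub> ?y \<in> hat_max W)"
    using True by (simp add: lin0_def on_generators_scal)
  also have "\<dots> \<longleftrightarrow> ?y 1 = \<zero>\<^bsub>hat W\<^esub> 1"
  proof
    assume "\<forall>a \<in> carrier K. scal a \<odot>\<^bsub>hat W\<^esub> ?y \<in> hat_max W"
    from this[rule_format, of "\<one>\<^bsub>K\<^esub>"] show "?y 1 = \<zero>\<^bsub>hat W\<^esub> 1" using y by (simp add: hat_max_iff[OF modW])
  next
    assume "?y 1 = \<zero>\<^bsub>hat W\<^esub> 1"
    then show "\<forall>a \<in> carrier K. scal a \<odot>\<^bsub>hat W\<^esub> ?y \<in> hat_max W"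
      using hat_smult_mpow[OF modW, of "scal _" 0 ?y 1] y by (auto simp: hat_max_iff[OF modW] one_ideals)
  qed
  finally show ?thesis using True c by (simp add: small_def)
qed (simp add: lin0_def)

definition pointed_maps :: "(('v, 'r, 'k) hat \<Rightarrow> ('w, 'r, 'k) hat) set" where
  "pointed_maps = {\<phi> \<in> lin_maps V W 0.
    \<forall>a \<in> carrier K. \<phi> (incl V (a \<odot>\<^bsub>V\<^esub> \<one>\<^bsub>V\<^esub>)) \<ominus>\<^bsub>hat W\<^esub> incl W (a \<odot>\<^bsub>W\<^esub> \<one>\<^bsub>W\<^esub>) \<in> hat_max W}"

lemma pointed_maps_iff: "\<phi> \<in> pointed_maps \<longleftrightarrow> \<phi> \<in> lin_maps V W 0 \<and>
    small (on_generators \<phi> \<ominus>\<^bsub>\<C>\<^esub> \<one>\<^bsub>\<C>\<^esub>)"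
proof (cases "\<phi> \<in> lin_maps V W 0")
  case True
  note c = conv_degree_0_closed[OF on_generators_lin_maps(1)[OF True]]
  let ?A = "\<C>"
  let ?y = "on_generators \<phi> \<one>\<^bsub>V\<^esub>" and ?o = "incl W \<one>\<^bsub>W\<^esub>"
  have y: "?y \<in> carrier (hat W)" by (rule conv_closed[OF c oneV_carrier])
  note lv = hat_level_eq_iff[OF modW y incl_oneW, of 1]
  have "\<one>\<^bsub>?A\<^esub> \<one>\<^bsub>V\<^esub> = ?o"
    using coaugV oneW_carrier by (simp add: conv_one[OF oneV_carrier] coaugmented_def)
  then have "small (on_generators \<phi> \<ominus>\<^bsub>?A\<^esub> \<one>\<^bsub>?A\<^esub>) \<longleftrightarrow> ?y 1 = ?o 1"
    using lv c by (simp add: small_def conv_minus_apply[OF c conv_one_closed oneV_carrier])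
  also have "\<dots> \<longleftrightarrow> (\<forall>a \<in> carrier K. (scal a \<odot>\<^bsub>hat W\<^esub> ?y) 1 = (scal a \<odot>\<^bsub>hat W\<^esub> ?o) 1)"
  proof
    assume "\<forall>a \<in> carrier K. (scal a \<odot>\<^bsub>hat W\<^esub> ?y) 1 = (scal a \<odot>\<^bsub>hat W\<^esub> ?o) 1"
    from this[rule_format, of "\<one>\<^bsub>K\<^esub>"] show "?y 1 = ?o 1" using y incl_oneW by simp
  qed (use hat_smult_level[where x = ?y and y = ?o and n = 1, OF modW] in blast)
  also have "\<dots> \<longleftrightarrow> (\<forall>a \<in> carrier K. \<phi> (incl V (a \<odot>\<^bsub>V\<^esub> \<one>\<^bsub>V\<^esub>)) \<ominus>\<^bsub>hat W\<^esub> incl W (a \<odot>\<^bsub>W\<^esub> \<one>\<^bsub>W\<^esub>) \<in> hat_max W)"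
  proof (rule ball_cong[OF refl])
    fix a assume a: "a \<in> carrier K"
    show "(scal a \<odot>\<^bsub>hat W\<^esub> ?y) 1 = (scal a \<odot>\<^bsub>hat W\<^esub> ?o) 1 \<longleftrightarrow>
        \<phi> (incl V (a \<odot>\<^bsub>V\<^esub> \<one>\<^bsub>V\<^esub>)) \<ominus>\<^bsub>hat W\<^esub> incl W (a \<odot>\<^bsub>W\<^esub> \<one>\<^bsub>W\<^esub>) \<in> hat_max W"
      unfolding on_generators_scal[OF True a] incl_one_smult[OF a]
      by (rule minus_mem_hat_max_iff[OF modW, symmetric]) (use a y incl_oneW in simp_all)
  qed
  finally show ?thesis using True by (simp add: pointed_maps_def)
qed (simp add: pointed_maps_def)

lemma small_exp_minus_one:
  assumes c: "small c"
  shows "series c (fps_exp 1) \<ominus>\<^bsub>\<C>\<^esub> \<one>\<^bsub>\<C>\<^esub> = series c (fps_exp 1 - 1)"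
    and "small (series c (fps_exp 1 - 1))"
proof -
  show "small (series c (fps_exp 1 - 1))" by (rule small_series[OF c]) simp
  have "series c (fps_exp 1) = \<one>\<^bsub>\<C>\<^esub> \<oplus>\<^bsub>\<C>\<^esub> series c (fps_exp 1 - 1)"
    using series_one_add[OF c, of "fps_exp 1 - 1"] by simp
  then show "series c (fps_exp 1) \<ominus>\<^bsub>\<C>\<^esub> \<one>\<^bsub>\<C>\<^esub> = series c (fps_exp 1 - 1)"
    using series_closed[OF c]
    by (simp add: a_minus_def AM.a_comm[of "\<one>\<^bsub>\<C>\<^esub>"] AM.a_assoc AM.r_neg)
qed

text \<open>With \<open>c\<close> the restriction of \<open>f\<close> to \<open>V\<close>, the exponential is the series \<open>exp\<close> in \<open>c\<close>, and the logarithm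
  of the result is the series \<open>log (1 + x)\<close> in the series \<open>exp - 1\<close> in \<open>c\<close>.\<close>

theorem
  assumes f: "f \<in> lin0 V W"
  shows conv_exp_pointed: "conv_exp V W f \<in> pointed_maps"
    and conv_log_exp: "conv_log V W (conv_exp V W f) = f"
proof -
  have fl: "f \<in> lin_maps V W 0" and s: "small (on_generators f)" using f by (auto simp: lin0_iff)
  note c = on_generators_lin_maps(1)[OF fl]
  note E = conv_exp_series[OF c s] and d = conv_degree_0_series[OF c s, of "fps_exp 1"]
  have g: "on_generators (conv_exp V W f) \<ominus>\<^bsub>\<C>\<^esub> \<one>\<^bsub>\<C>\<^esub> =
      series (on_generators f) (fps_exp 1 - 1)"
    unfolding E conv_hat_extend(2)[OF d] by (rule small_exp_minus_one(1)[OF s])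
  have l: "conv_exp V W f \<in> lin_maps V W 0" unfolding E by (rule conv_hat_extend(1)[OF d])
  show "conv_exp V W f \<in> pointed_maps"
    unfolding pointed_maps_iff g using l small_exp_minus_one(2)[OF s] by simp
  have "conv_log V W (conv_exp V W f) = hat_extend V W (series (series (on_generators f) (fps_exp 1 - 1)) (fps_ln 1))"
    using conv_log_series[OF l] small_exp_minus_one(2)[OF s] unfolding g by simp
  also have "series (series (on_generators f) (fps_exp 1 - 1)) (fps_ln 1) = on_generators f"
    using series_compose[OF s, of "fps_exp 1 - 1" "fps_ln 1"] by (simp add: exp_ln_compose series_X[OF s])
  finally show "conv_log V W (conv_exp V W f) = f" using on_generators_lin_maps(2)[OF fl] by simp
qed

theorem
  assumes \<phi>: "\<phi> \<in> pointed_maps"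
  shows conv_log_lin0: "conv_log V W \<phi> \<in> lin0 V W"
    and conv_exp_log: "conv_exp V W (conv_log V W \<phi>) = \<phi>"
proof -
  let ?A = "\<C>"
  let ?g = "on_generators \<phi> \<ominus>\<^bsub>?A\<^esub> \<one>\<^bsub>?A\<^esub>"
  have l: "\<phi> \<in> lin_maps V W 0" and s: "small ?g" using \<phi> by (auto simp: pointed_maps_iff)
  note c0 = on_generators_lin_maps(1)[OF l]
  have c: "?g \<in> conv_degree_0" by (intro conv_degree_0_minus c0 conv_degree_0_one)
  note L = conv_log_series[OF l s] and d = conv_degree_0_series[OF c s, of "fps_ln 1"]
  have sL: "small (series ?g (fps_ln 1))" by (rule small_series[OF s]) simp
  have gL: "on_generators (conv_log V W \<phi>) = series ?g (fps_ln 1)" unfolding L by (rule conv_hat_extend(2)[OF d])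
  show "conv_log V W \<phi> \<in> lin0 V W"
    unfolding lin0_iff gL using sL conv_hat_extend(1)[OF d] unfolding L by simp
  have "conv_exp V W (conv_log V W \<phi>) = hat_extend V W (series (series ?g (fps_ln 1)) (fps_exp 1))"
    using conv_exp_series[of "conv_log V W \<phi>"] d sL unfolding gL by simp
  also have "series (series ?g (fps_ln 1)) (fps_exp 1) = \<one>\<^bsub>?A\<^esub> \<oplus>\<^bsub>?A\<^esub> ?g"
    using series_compose[OF s, of "fps_ln 1" "fps_exp 1"] series_one_add[OF s, of fps_X]
    by (simp add: exp_ln_compose series_X[OF s])
  also have "\<dots> = on_generators \<phi>"
    using conv_degree_0_closed[OF c0] by (simp add: a_minus_def AM.a_lcomm AM.r_neg)
  finally show "conv_exp V W (conv_log V W \<phi>) = \<phi>" using on_generators_lin_maps(2)[OF l] by simp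
qed

end

section \<open>The trivial structure on a pointed graded vector space\<close>

subsection \<open>Homogeneous parts\<close>

lemma linear_map_finsum:
  assumes M: "module K M" and N: "module K N" and f: "linear_map K M N f"
    and A: "finite A" and g: "\<And>i. i \<in> A \<Longrightarrow> g i \<in> carrier M"
  shows "f (\<Oplus>\<^bsub>M\<^esub>i \<in> A. g i) = (\<Oplus>\<^bsub>N\<^esub>i \<in> A. f (g i))"
proof -
  interpret M: module K M by fact
  interpret N: module K N by fact
  show ?thesis
    using A g
    by (induction A rule: finite_induct)
      (simp_all add: linear_map_zero[OF M N f] linear_map_add[OF f] linear_map_closed[OF f] Pi_iff)
qed

lemma linear_map_finsum_maps:
  assumes M: "module K M" and N: "module K N" and A: "finite A" and f: "\<And>i. i \<in> A \<Longrightarrow> linear_map K M N (f i)"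
  shows "linear_map K M N (\<lambda>x. \<Oplus>\<^bsub>N\<^esub>i \<in> A. f i x)"
  using A f
proof (induction A rule: finite_induct)
  case empty
  interpret N: module K N by fact
  show ?case by (simp add: linear_map_const_zero[OF M N])
next
  case (insert a A)
  interpret N: module K N by fact
  have "linear_map K M N (\<lambda>x. f a x \<oplus>\<^bsub>N\<^esub> (\<Oplus>\<^bsub>N\<^esub>i \<in> A. f i x))"
    using insert by (intro linear_map_sum[OF M N]) auto
  then show ?case
    by (rule linear_map_cong[OF M])
      (use insert in \<open>simp add: Pi_iff linear_map_closed[OF insert.prems]\<close>)
qed

context
  fixes K :: "('k, 'x) ring_scheme" and V :: "('k, 'v, 'z) graded_module_scheme"
  assumes K: "field K" and gV: "graded_vector_space K V"
begin

interpretation K: field K by (rule K)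

lemma homogeneous_module: "module K V" and homogeneous_submodule: "submodule (component V i) K V"
  using gV by (auto simp: graded_vector_space_def)

interpretation V: module K V by (rule homogeneous_module)

lemma homogeneous_closed: "v \<in> component V i \<Longrightarrow> v \<in> carrier V"
  "\<zero>\<^bsub>V\<^esub> \<in> component V i"
  "v \<in> component V i \<Longrightarrow> w \<in> component V i \<Longrightarrow> v \<oplus>\<^bsub>V\<^esub> w \<in> component V i"
  "a \<in> carrier K \<Longrightarrow> v \<in> component V i \<Longrightarrow> a \<odot>\<^bsub>V\<^esub> v \<in> component V i"
  "v \<in> component V i \<Longrightarrow> \<ominus>\<^bsub>V\<^esub> v \<in> component V i"
  using V.submoduleE[OF homogeneous_submodule] subgroup.one_closed[OF submodule.axioms(1)[OF homogeneous_submodule]]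
  by auto

lemma hom_part_decomposition: "v \<in> carrier V \<Longrightarrow> homogeneous_decomposition V v (hom_part V v)"
proof -
  assume "v \<in> carrier V"
  then have "\<exists>!c. homogeneous_decomposition V v c" using gV unfolding graded_vector_space_def by blast
  then show ?thesis unfolding hom_part_def by (rule theI')
qed

lemma hom_part_eqI: "v \<in> carrier V \<Longrightarrow> homogeneous_decomposition V v c \<Longrightarrow> hom_part V v = c"
  using hom_part_decomposition gV unfolding graded_vector_space_def by blast

lemma hom_part:
  assumes "v \<in> carrier V"
  shows "hom_part V v i \<in> component V i" "hom_part V v i \<in> carrier V" "finite {i. hom_part V v i \<noteq> \<zero>\<^bsub>V\<^esub>}"
    "(\<Oplus>\<^bsub>V\<^esub>i \<in> {i. hom_part V v i \<noteq> \<zero>\<^bsub>V\<^esub>}. hom_part V v i) = v"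
  using hom_part_decomposition[OF assms] homogeneous_closed(1) by (auto simp: homogeneous_decomposition_def)

text \<open>Sums over the degrees that occur may be extended to any finite set of degrees, which makes
  the sets of degrees of several vectors comparable.\<close>

lemma hom_part_sum_superset:
  assumes M: "module K M" and f: "\<And>i. linear_map K V M (f i)" and v: "v \<in> carrier V"
    and A: "finite A" "{i. hom_part V v i \<noteq> \<zero>\<^bsub>V\<^esub>} \<subseteq> A"
  shows "(\<Oplus>\<^bsub>M\<^esub>i \<in> {i. hom_part V v i \<noteq> \<zero>\<^bsub>V\<^esub>}. f i (hom_part V v i)) = (\<Oplus>\<^bsub>M\<^esub>i \<in> A. f i (hom_part V v i))"
proof -
  interpret M: module K M by fact
  show ?thesis
    by (rule M.add.finprod_mono_neutral_cong_left)
      (use A hom_part[OF v] linear_map_closed[OF f] linear_map_zero[OF homogeneous_module M f] in auto)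
qed

lemma linear_map_id: "linear_map K V V (\<lambda>v. v)"
  by (rule linear_mapI) auto

text \<open>Componentwise sums and multiples are again homogeneous decompositions, and these are unique.\<close>

lemma hom_part_add_smult:
  assumes v: "v \<in> carrier V" and w: "w \<in> carrier V" and a: "a \<in> carrier K"
  shows "hom_part V (v \<oplus>\<^bsub>V\<^esub> w) i = hom_part V v i \<oplus>\<^bsub>V\<^esub> hom_part V w i"
    and "hom_part V (a \<odot>\<^bsub>V\<^esub> v) i = a \<odot>\<^bsub>V\<^esub> hom_part V v i"
proof -
  let ?A = "{i. hom_part V v i \<noteq> \<zero>\<^bsub>V\<^esub>} \<union> {i. hom_part V w i \<noteq> \<zero>\<^bsub>V\<^esub>}"
  have A: "finite ?A" using hom_part(3) v w by simp
  have sv: "(\<Oplus>\<^bsub>V\<^esub>i \<in> ?A. hom_part V v i) = v" and sw: "(\<Oplus>\<^bsub>V\<^esub>i \<in> ?A. hom_part V w i) = w"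
    using hom_part_sum_superset[OF homogeneous_module linear_map_id v A] hom_part_sum_superset[OF homogeneous_module linear_map_id w A]
      hom_part(4) v w by auto
  have "homogeneous_decomposition V (v \<oplus>\<^bsub>V\<^esub> w) (\<lambda>i. hom_part V v i \<oplus>\<^bsub>V\<^esub> hom_part V w i)"
    unfolding homogeneous_decomposition_def
  proof (intro conjI allI)
    show "hom_part V v i \<oplus>\<^bsub>V\<^esub> hom_part V w i \<in> component V i" for i using hom_part v w homogeneous_closed by simp
    have sub: "{i. hom_part V v i \<oplus>\<^bsub>V\<^esub> hom_part V w i \<noteq> \<zero>\<^bsub>V\<^esub>} \<subseteq> ?A" using hom_part v w by auto
    then show "finite {i. hom_part V v i \<oplus>\<^bsub>V\<^esub> hom_part V w i \<noteq> \<zero>\<^bsub>V\<^esub>}" using A by (rule finite_subset)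
    have "(\<Oplus>\<^bsub>V\<^esub>i \<in> {i. hom_part V v i \<oplus>\<^bsub>V\<^esub> hom_part V w i \<noteq> \<zero>\<^bsub>V\<^esub>}. hom_part V v i \<oplus>\<^bsub>V\<^esub> hom_part V w i)
        = (\<Oplus>\<^bsub>V\<^esub>i \<in> ?A. hom_part V v i \<oplus>\<^bsub>V\<^esub> hom_part V w i)"
      by (rule V.add.finprod_mono_neutral_cong_left) (use A sub hom_part v w in auto)
    also have "\<dots> = v \<oplus>\<^bsub>V\<^esub> w"
      using V.finsum_addf[of "hom_part V v" ?A "hom_part V w"] hom_part(2) v w sv sw by simp
    finally show "v \<oplus>\<^bsub>V\<^esub> w = (\<Oplus>\<^bsub>V\<^esub>i \<in> {i. hom_part V v i \<oplus>\<^bsub>V\<^esub> hom_part V w i \<noteq> \<zero>\<^bsub>V\<^esub>}. hom_part V v i \<oplus>\<^bsub>V\<^esub> hom_part V w i)" by simp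
  qed
  then show "hom_part V (v \<oplus>\<^bsub>V\<^esub> w) i = hom_part V v i \<oplus>\<^bsub>V\<^esub> hom_part V w i"
    using hom_part_eqI v w by simp
  let ?B = "{i. hom_part V v i \<noteq> \<zero>\<^bsub>V\<^esub>}"
  have "homogeneous_decomposition V (a \<odot>\<^bsub>V\<^esub> v) (\<lambda>i. a \<odot>\<^bsub>V\<^esub> hom_part V v i)"
    unfolding homogeneous_decomposition_def
  proof (intro conjI allI)
    show "a \<odot>\<^bsub>V\<^esub> hom_part V v i \<in> component V i" for i using hom_part v a homogeneous_closed by simp
    have sub: "{i. a \<odot>\<^bsub>V\<^esub> hom_part V v i \<noteq> \<zero>\<^bsub>V\<^esub>} \<subseteq> ?B" using a by auto
    then show "finite {i. a \<odot>\<^bsub>V\<^esub> hom_part V v i \<noteq> \<zero>\<^bsub>V\<^esub>}" using hom_part(3)[OF v] by (rule finite_subset)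
    have "(\<Oplus>\<^bsub>V\<^esub>i \<in> {i. a \<odot>\<^bsub>V\<^esub> hom_part V v i \<noteq> \<zero>\<^bsub>V\<^esub>}. a \<odot>\<^bsub>V\<^esub> hom_part V v i) = (\<Oplus>\<^bsub>V\<^esub>i \<in> ?B. a \<odot>\<^bsub>V\<^esub> hom_part V v i)"
      by (rule V.add.finprod_mono_neutral_cong_left) (use sub hom_part v a in auto)
    also have "\<dots> = a \<odot>\<^bsub>V\<^esub> v"
      using V.finsum_smult_ldistr[of ?B a "hom_part V v"] hom_part[OF v] a by simp
    finally show "a \<odot>\<^bsub>V\<^esub> v = (\<Oplus>\<^bsub>V\<^esub>i \<in> {i. a \<odot>\<^bsub>V\<^esub> hom_part V v i \<noteq> \<zero>\<^bsub>V\<^esub>}. a \<odot>\<^bsub>V\<^esub> hom_part V v i)" by simp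
  qed
  then show "hom_part V (a \<odot>\<^bsub>V\<^esub> v) i = a \<odot>\<^bsub>V\<^esub> hom_part V v i"
    using hom_part_eqI v a by simp
qed

lemma hom_part_homogeneous:
  assumes v: "v \<in> component V i"
  shows "hom_part V v = (\<lambda>j. if j = i then v else \<zero>\<^bsub>V\<^esub>)"
proof (rule hom_part_eqI[OF homogeneous_closed(1)[OF v]])
  have "{j. (if j = i then v else \<zero>\<^bsub>V\<^esub>) \<noteq> \<zero>\<^bsub>V\<^esub>} = (if v = \<zero>\<^bsub>V\<^esub> then {} else {i})" by auto
  then show "homogeneous_decomposition V v (\<lambda>j. if j = i then v else \<zero>\<^bsub>V\<^esub>)"
    using v homogeneous_closed by (auto simp: homogeneous_decomposition_def)
qed

text \<open>A linear map may be prescribed degree by degree. The symmetry of the tensor square, whose sign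
  depends on the degrees, is of this kind in each argument.\<close>

lemma linear_graded_sum:
  assumes M: "module K M" and f: "\<And>i. linear_map K V M (f i)"
  shows "linear_map K V M (\<lambda>v. \<Oplus>\<^bsub>M\<^esub>i \<in> {i. hom_part V v i \<noteq> \<zero>\<^bsub>V\<^esub>}. f i (hom_part V v i))"
    (is "linear_map K V M ?S")
proof (rule linear_mapI)
  interpret M: module K M by fact
  note sup = hom_part_sum_superset[OF M f]
  fix v assume v: "v \<in> carrier V"
  let ?A = "{i. hom_part V v i \<noteq> \<zero>\<^bsub>V\<^esub>}"
  have fc: "(\<lambda>i. f i (hom_part V v i)) \<in> B \<rightarrow> carrier M" if "v \<in> carrier V" for B v
    using linear_map_closed[OF f] hom_part(2)[OF that] by auto
  show "?S v \<in> carrier M" by (rule M.finsum_closed[OF fc[OF v]])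
  show "?S (a \<odot>\<^bsub>V\<^esub> v) = a \<odot>\<^bsub>M\<^esub> ?S v" if a: "a \<in> carrier K" for a
  proof -
    have "?S (a \<odot>\<^bsub>V\<^esub> v) = (\<Oplus>\<^bsub>M\<^esub>i \<in> ?A. f i (hom_part V (a \<odot>\<^bsub>V\<^esub> v) i))"
      using a v hom_part(3)[OF v] hom_part_add_smult(2)[OF v v a] by (intro sup) auto
    also have "\<dots> = (\<Oplus>\<^bsub>M\<^esub>i \<in> ?A. a \<odot>\<^bsub>M\<^esub> f i (hom_part V v i))"
      using linear_map_smult[OF f a] hom_part_add_smult(2)[OF v v a] hom_part(2)[OF v] by simp
    also have "\<dots> = a \<odot>\<^bsub>M\<^esub> ?S v"
      using M.finsum_smult_ldistr[OF hom_part(3)[OF v] a fc[OF v]] by simp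
    finally show ?thesis .
  qed
  fix w assume w: "w \<in> carrier V"
  let ?A = "{i. hom_part V v i \<noteq> \<zero>\<^bsub>V\<^esub>} \<union> {i. hom_part V w i \<noteq> \<zero>\<^bsub>V\<^esub>}"
  have A: "finite ?A" using hom_part(3) v w by simp
  note a = hom_part_add_smult(1)[OF v w K.one_closed]
  have "?S (v \<oplus>\<^bsub>V\<^esub> w) = (\<Oplus>\<^bsub>M\<^esub>i \<in> ?A. f i (hom_part V (v \<oplus>\<^bsub>V\<^esub> w) i))"
    using v w A a by (intro sup) auto
  also have "\<dots> = (\<Oplus>\<^bsub>M\<^esub>i \<in> ?A. f i (hom_part V v i) \<oplus>\<^bsub>M\<^esub> f i (hom_part V w i))"
    using linear_map_add[OF f] a hom_part(2) v w by simp
  also have "\<dots> = (\<Oplus>\<^bsub>M\<^esub>i \<in> ?A. f i (hom_part V v i)) \<oplus>\<^bsub>M\<^esub> (\<Oplus>\<^bsub>M\<^esub>i \<in> ?A. f i (hom_part V w i))"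
    by (rule M.finsum_addf[OF fc[OF v] fc[OF w]])
  also have "\<dots> = ?S v \<oplus>\<^bsub>M\<^esub> ?S w"
    using sup[OF v A] sup[OF w A] by simp
  finally show "?S (v \<oplus>\<^bsub>V\<^esub> w) = ?S v \<oplus>\<^bsub>M\<^esub> ?S w" .
qed


subsection \<open>A graded complement of a line\<close>

text \<open>Subspaces that contain all elements of degree other than 0 are graded, so gradedness is no
  further condition on a complement of an element of degree 0.\<close>

definition complements :: "'v \<Rightarrow> 'v set set" where
  "complements p = {N. submodule N K V \<and> (\<forall>i. i \<noteq> 0 \<longrightarrow> component V i \<subseteq> N) \<and> p \<notin> N}"

context
  fixes p :: 'v
  assumes p: "p \<in> component V 0" and p0: "p \<noteq> \<zero>\<^bsub>V\<^esub>"
begin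

lemma p_closed: "p \<in> carrier V"
  by (rule homogeneous_closed(1)[OF p])

text \<open>By Zorn's lemma there is a maximal graded subspace that avoids \<open>p\<close>; together with \<open>p\<close> it
  spans everything, since otherwise a further vector could be added to it.\<close>

lemma maximal_complement: "\<exists>N \<in> complements p. \<forall>N' \<in> complements p. N \<subseteq> N' \<longrightarrow> N' = N"
proof (rule subset_Zorn_nonempty)
  let ?N = "{v \<in> carrier V. hom_part V v 0 = \<zero>\<^bsub>V\<^esub>}"
  have "submodule ?N K V"
  proof (rule V.submoduleI)
    have h: "hom_part V (\<zero>\<^bsub>K\<^esub> \<odot>\<^bsub>V\<^esub> v) 0 = \<zero>\<^bsub>V\<^esub>" if "v \<in> carrier V" for v
      using hom_part_add_smult(2)[OF that that K.zero_closed, of 0] hom_part(2)[OF that] by simp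
    show "\<zero>\<^bsub>V\<^esub> \<in> ?N" using h[OF V.zero_closed] by simp
    fix v assume v: "v \<in> ?N"
    have "(\<ominus>\<^bsub>K\<^esub> \<one>\<^bsub>K\<^esub>) \<odot>\<^bsub>V\<^esub> v = \<ominus>\<^bsub>V\<^esub> v" using v by (simp add: V.smult_l_minus)
    then show "\<ominus>\<^bsub>V\<^esub> v \<in> ?N" using hom_part_add_smult(2)[of v v "\<ominus>\<^bsub>K\<^esub> \<one>\<^bsub>K\<^esub>" 0] v by simp
  qed (auto simp: hom_part_add_smult[OF _ _ K.one_closed] hom_part_add_smult(2))
  moreover have "component V i \<subseteq> ?N" if "i \<noteq> 0" for i
    using that homogeneous_closed(1) by (auto simp: hom_part_homogeneous)
  moreover have "p \<notin> ?N" using p p0 by (simp add: hom_part_homogeneous)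
  ultimately have "?N \<in> complements p" by (auto simp: complements_def)
  then show "complements p \<noteq> {}" by blast
next
  fix C assume C: "C \<noteq> {}" "subset.chain (complements p) C"
  then have sub: "C \<subseteq> complements p" and ch: "\<And>A B. A \<in> C \<Longrightarrow> B \<in> C \<Longrightarrow> A \<subseteq> B \<or> B \<subseteq> A"
    by (auto simp: subset.chain_def)
  have m: "submodule A K V" if "A \<in> C" for A using sub that by (auto simp: complements_def)
  have "submodule (\<Union>C) K V"
  proof (rule V.submoduleI)
    show "\<Union>C \<subseteq> carrier V" using V.submoduleE(1)[OF m] by blast
    show "\<zero>\<^bsub>V\<^esub> \<in> \<Union>C"
      using C(1) subgroup.one_closed[OF submodule.axioms(1)[OF m]] by auto
    show "\<ominus>\<^bsub>V\<^esub> a \<in> \<Union>C" if "a \<in> \<Union>C" for a using that V.submoduleE(3)[OF m] by blast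
    show "a \<odot>\<^bsub>V\<^esub> x \<in> \<Union>C" if "a \<in> carrier K" "x \<in> \<Union>C" for a x using that V.submoduleE(4)[OF m] by blast
    fix a b assume "a \<in> \<Union>C" "b \<in> \<Union>C"
    then obtain A B where "A \<in> C" "a \<in> A" "B \<in> C" "b \<in> B" by blast
    with ch[of A B] obtain D where "D \<in> C" "a \<in> D" "b \<in> D" by blast
    then show "a \<oplus>\<^bsub>V\<^esub> b \<in> \<Union>C" using V.submoduleE(5)[OF m] by blast
  qed
  then show "\<Union>C \<in> complements p" using sub C(1) unfolding complements_def by blast
qed

lemma coordinate_exists:
  assumes N: "N \<in> complements p" and max: "\<And>N'. N' \<in> complements p \<Longrightarrow> N \<subseteq> N' \<Longrightarrow> N' = N"
    and v: "v \<in> carrier V"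
  shows "\<exists>!a. a \<in> carrier K \<and> v \<ominus>\<^bsub>V\<^esub> (a \<odot>\<^bsub>V\<^esub> p) \<in> N"
proof -
  have sub: "submodule N K V" and comp: "\<And>i. i \<noteq> 0 \<Longrightarrow> component V i \<subseteq> N" and pN: "p \<notin> N"
    using N by (auto simp: complements_def)
  note Nc = V.submoduleE[OF sub]
  have "\<exists>a \<in> carrier K. v \<ominus>\<^bsub>V\<^esub> (a \<odot>\<^bsub>V\<^esub> p) \<in> N"
  proof (cases "v \<in> N")
    case True
    then have "v \<ominus>\<^bsub>V\<^esub> (\<zero>\<^bsub>K\<^esub> \<odot>\<^bsub>V\<^esub> p) \<in> N" using v p_closed by (simp add: a_minus_def V.a_inv_zero)
    then show ?thesis using K.zero_closed by blast
  next
    case False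
    let ?N' = "{n \<oplus>\<^bsub>V\<^esub> b \<odot>\<^bsub>V\<^esub> v | n b. n \<in> N \<and> b \<in> carrier K}"
    have NN: "n \<in> carrier V" if "n \<in> N" for n using Nc(1) that by blast
    have zN: "\<zero>\<^bsub>V\<^esub> \<in> N" using subgroup.one_closed[OF submodule.axioms(1)[OF sub]] by simp
    have "submodule ?N' K V"
    proof (rule V.submoduleI)
      show "?N' \<subseteq> carrier V" using NN v by auto
      show "\<zero>\<^bsub>V\<^esub> \<in> ?N'" using zN v by (auto intro!: exI[of _ "\<zero>\<^bsub>V\<^esub>"] exI[of _ "\<zero>\<^bsub>K\<^esub>"])
      fix a assume "a \<in> ?N'"
      then obtain n b where a: "a = n \<oplus>\<^bsub>V\<^esub> b \<odot>\<^bsub>V\<^esub> v" "n \<in> N" "b \<in> carrier K" by blast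
      then have "\<ominus>\<^bsub>V\<^esub> a = (\<ominus>\<^bsub>V\<^esub> n) \<oplus>\<^bsub>V\<^esub> (\<ominus>\<^bsub>K\<^esub> b) \<odot>\<^bsub>V\<^esub> v"
        using NN v by (simp add: V.minus_add V.smult_l_minus)
      then show "\<ominus>\<^bsub>V\<^esub> a \<in> ?N'" using a Nc(3) by blast
      fix d assume "d \<in> ?N'"
      then obtain m c where d: "d = m \<oplus>\<^bsub>V\<^esub> c \<odot>\<^bsub>V\<^esub> v" "m \<in> N" "c \<in> carrier K" by blast
      have "a \<oplus>\<^bsub>V\<^esub> d = (n \<oplus>\<^bsub>V\<^esub> m) \<oplus>\<^bsub>V\<^esub> (b \<oplus>\<^bsub>K\<^esub> c) \<odot>\<^bsub>V\<^esub> v"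
        using a d NN v by (simp add: V.smult_l_distr V.a_ac)
      then show "a \<oplus>\<^bsub>V\<^esub> d \<in> ?N'" using a d Nc(5) K.add.m_closed by blast
    next
      fix c x assume c: "c \<in> carrier K" and "x \<in> ?N'"
      then obtain n b where a: "x = n \<oplus>\<^bsub>V\<^esub> b \<odot>\<^bsub>V\<^esub> v" "n \<in> N" "b \<in> carrier K" by blast
      then have "c \<odot>\<^bsub>V\<^esub> x = c \<odot>\<^bsub>V\<^esub> n \<oplus>\<^bsub>V\<^esub> (c \<otimes>\<^bsub>K\<^esub> b) \<odot>\<^bsub>V\<^esub> v"
        using NN v c by (simp add: V.smult_r_distr V.smult_assoc1)
      then show "c \<odot>\<^bsub>V\<^esub> x \<in> ?N'" using a c Nc(4) K.m_closed by blast
    qed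
    moreover have incl: "N \<subseteq> ?N'"
    proof
      fix n assume n: "n \<in> N"
      then have "n = n \<oplus>\<^bsub>V\<^esub> \<zero>\<^bsub>K\<^esub> \<odot>\<^bsub>V\<^esub> v" using NN v by simp
      then show "n \<in> ?N'" using n K.zero_closed by blast
    qed
    moreover have "v \<in> ?N'"
    proof -
      have "v = \<zero>\<^bsub>V\<^esub> \<oplus>\<^bsub>V\<^esub> \<one>\<^bsub>K\<^esub> \<odot>\<^bsub>V\<^esub> v" using v by simp
      then show ?thesis using zN K.one_closed by blast
    qed
    ultimately have "p \<in> ?N'" using max[of ?N'] comp False unfolding complements_def by blast
    then obtain n b where nb: "p = n \<oplus>\<^bsub>V\<^esub> b \<odot>\<^bsub>V\<^esub> v" "n \<in> N" "b \<in> carrier K" by blast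
    have "b \<noteq> \<zero>\<^bsub>K\<^esub>" using nb pN NN v by auto
    then have b: "b \<in> Units K" using nb by (simp add: K.field_Units)
    then have bi: "inv\<^bsub>K\<^esub> b \<in> carrier K" by simp
    have "(inv\<^bsub>K\<^esub> b) \<odot>\<^bsub>V\<^esub> p = (inv\<^bsub>K\<^esub> b) \<odot>\<^bsub>V\<^esub> n \<oplus>\<^bsub>V\<^esub> v"
      unfolding nb(1) using nb(2,3) b bi NN v by (simp add: V.smult_r_distr V.smult_assoc1[symmetric])
    then have "v \<ominus>\<^bsub>V\<^esub> ((inv\<^bsub>K\<^esub> b) \<odot>\<^bsub>V\<^esub> p) = \<ominus>\<^bsub>V\<^esub> ((inv\<^bsub>K\<^esub> b) \<odot>\<^bsub>V\<^esub> n)"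
      using NN[OF nb(2)] v bi
      by (simp add: a_minus_def V.minus_add V.a_comm[of "\<ominus>\<^bsub>V\<^esub> (inv\<^bsub>K\<^esub> b \<odot>\<^bsub>V\<^esub> n)"] V.a_assoc[symmetric] V.r_neg)
    moreover have "\<ominus>\<^bsub>V\<^esub> ((inv\<^bsub>K\<^esub> b) \<odot>\<^bsub>V\<^esub> n) \<in> N" by (rule Nc(3)[OF Nc(4)[OF bi nb(2)]])
    ultimately have "v \<ominus>\<^bsub>V\<^esub> ((inv\<^bsub>K\<^esub> b) \<odot>\<^bsub>V\<^esub> p) \<in> N" by (simp only:)
    then show ?thesis using bi by blast
  qed
  then obtain a where a: "a \<in> carrier K" "v \<ominus>\<^bsub>V\<^esub> (a \<odot>\<^bsub>V\<^esub> p) \<in> N" by blast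
  show ?thesis
  proof (rule ex1I[of _ a])
    fix b assume b: "b \<in> carrier K \<and> v \<ominus>\<^bsub>V\<^esub> (b \<odot>\<^bsub>V\<^esub> p) \<in> N"
    show "b = a"
    proof (rule ccontr)
      assume "b \<noteq> a"
      have "(v \<ominus>\<^bsub>V\<^esub> (a \<odot>\<^bsub>V\<^esub> p)) \<oplus>\<^bsub>V\<^esub> \<ominus>\<^bsub>V\<^esub> (v \<ominus>\<^bsub>V\<^esub> (b \<odot>\<^bsub>V\<^esub> p)) \<in> N"
        using a(2) b Nc(3,5) by simp
      also have "(v \<ominus>\<^bsub>V\<^esub> (a \<odot>\<^bsub>V\<^esub> p)) \<oplus>\<^bsub>V\<^esub> \<ominus>\<^bsub>V\<^esub> (v \<ominus>\<^bsub>V\<^esub> (b \<odot>\<^bsub>V\<^esub> p)) = (b \<ominus>\<^bsub>K\<^esub> a) \<odot>\<^bsub>V\<^esub> p"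
        using a(1) b v p_closed
        by (simp add: a_minus_def V.minus_add V.smult_l_distr V.smult_l_minus V.a_ac V.r_neg1 V.r_neg2)
      finally have d: "(b \<ominus>\<^bsub>K\<^esub> a) \<odot>\<^bsub>V\<^esub> p \<in> N" .
      have "b \<ominus>\<^bsub>K\<^esub> a \<in> Units K" using a(1) b \<open>b \<noteq> a\<close> by (simp add: K.field_Units)
      then have "inv\<^bsub>K\<^esub> (b \<ominus>\<^bsub>K\<^esub> a) \<odot>\<^bsub>V\<^esub> ((b \<ominus>\<^bsub>K\<^esub> a) \<odot>\<^bsub>V\<^esub> p) = p" "inv\<^bsub>K\<^esub> (b \<ominus>\<^bsub>K\<^esub> a) \<in> carrier K"
        using a(1) b p_closed by (simp_all add: V.smult_assoc1[symmetric])
      then show False using Nc(4)[OF _ d] pN by metis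
    qed
  qed (use a in simp)
qed

lemma graded_functional_exists:
  obtains e where "\<And>v. v \<in> carrier V \<Longrightarrow> e v \<in> carrier K"
    "\<And>v w. v \<in> carrier V \<Longrightarrow> w \<in> carrier V \<Longrightarrow> e (v \<oplus>\<^bsub>V\<^esub> w) = e v \<oplus>\<^bsub>K\<^esub> e w"
    "\<And>a v. a \<in> carrier K \<Longrightarrow> v \<in> carrier V \<Longrightarrow> e (a \<odot>\<^bsub>V\<^esub> v) = a \<otimes>\<^bsub>K\<^esub> e v"
    "\<And>i v. i \<noteq> 0 \<Longrightarrow> v \<in> component V i \<Longrightarrow> e v = \<zero>\<^bsub>K\<^esub>" "e p = \<one>\<^bsub>K\<^esub>"
proof -
  obtain N where N: "N \<in> complements p" and max: "\<And>N'. N' \<in> complements p \<Longrightarrow> N \<subseteq> N' \<Longrightarrow> N' = N"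
    using maximal_complement by blast
  have sub: "submodule N K V" and comp: "\<And>i. i \<noteq> 0 \<Longrightarrow> component V i \<subseteq> N"
    using N by (auto simp: complements_def)
  note Nc = V.submoduleE[OF sub]
  define e where "e v = (THE a. a \<in> carrier K \<and> v \<ominus>\<^bsub>V\<^esub> (a \<odot>\<^bsub>V\<^esub> p) \<in> N)" for v
  have e: "e v \<in> carrier K" "v \<ominus>\<^bsub>V\<^esub> (e v \<odot>\<^bsub>V\<^esub> p) \<in> N" if "v \<in> carrier V" for v
    using theI'[OF coordinate_exists[OF N max that]] by (auto simp: e_def)
  have eI: "e v = a" if "v \<in> carrier V" "a \<in> carrier K" "v \<ominus>\<^bsub>V\<^esub> (a \<odot>\<^bsub>V\<^esub> p) \<in> N" for v a
    using coordinate_exists[OF N max that(1)] e[OF that(1)] that by blast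
  show thesis
  proof (rule that[of e])
    fix v w assume v: "v \<in> carrier V" and w: "w \<in> carrier V"
    have "(v \<oplus>\<^bsub>V\<^esub> w) \<ominus>\<^bsub>V\<^esub> ((e v \<oplus>\<^bsub>K\<^esub> e w) \<odot>\<^bsub>V\<^esub> p) = (v \<ominus>\<^bsub>V\<^esub> (e v \<odot>\<^bsub>V\<^esub> p)) \<oplus>\<^bsub>V\<^esub> (w \<ominus>\<^bsub>V\<^esub> (e w \<odot>\<^bsub>V\<^esub> p))"
      using v w e(1) p_closed by (simp add: a_minus_def V.smult_l_distr V.minus_add V.a_ac)
    then show "e (v \<oplus>\<^bsub>V\<^esub> w) = e v \<oplus>\<^bsub>K\<^esub> e w"
      using v w e Nc(5) by (intro eI) simp_all
  next
    fix a v assume a: "a \<in> carrier K" and v: "v \<in> carrier V"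
    have "(a \<odot>\<^bsub>V\<^esub> v) \<ominus>\<^bsub>V\<^esub> ((a \<otimes>\<^bsub>K\<^esub> e v) \<odot>\<^bsub>V\<^esub> p) = a \<odot>\<^bsub>V\<^esub> (v \<ominus>\<^bsub>V\<^esub> (e v \<odot>\<^bsub>V\<^esub> p))"
      using a v e(1) p_closed by (simp add: a_minus_def V.smult_r_distr V.smult_r_minus V.smult_assoc1)
    then show "e (a \<odot>\<^bsub>V\<^esub> v) = a \<otimes>\<^bsub>K\<^esub> e v"
      using a v e Nc(4) by (intro eI) simp_all
  next
    fix i :: int and v assume i: "i \<noteq> 0" and v: "v \<in> component V i"
    show "e v = \<zero>\<^bsub>K\<^esub>"
      using comp[OF i] v homogeneous_closed(1)[OF v] p_closed by (intro eI) (auto simp: a_minus_def V.a_inv_zero)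
  next
    show "e p = \<one>\<^bsub>K\<^esub>"
      using p_closed subgroup.one_closed[OF submodule.axioms(1)[OF sub]] by (intro eI) (simp_all add: a_minus_def V.r_neg)
  qed (rule e(1))
qed

end

end

subsection \<open>Product and coproduct\<close>

lemma module_self: assumes "field K" shows "module K (self_module K)"
proof -
  interpret K: field K by fact
  have [simp]: "carrier (self_module K) = carrier K" "\<zero>\<^bsub>self_module K\<^esub> = \<zero>\<^bsub>K\<^esub>"
    "x \<oplus>\<^bsub>self_module K\<^esub> y = x \<oplus>\<^bsub>K\<^esub> y" "x \<odot>\<^bsub>self_module K\<^esub> y = x \<otimes>\<^bsub>K\<^esub> y" for x y
    by (simp_all add: self_module_def)
  show ?thesis
    by (intro moduleI abelian_groupI K.is_cring)
      (auto simp: K.a_ac K.l_distr K.r_distr K.m_assoc intro: K.add.inv_closed K.l_neg)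
qed

lemma linear_map_neg_map:
  assumes M: "module K M" and N: "module K N" and f: "linear_map K M N f"
  shows "linear_map K M N (\<lambda>x. \<ominus>\<^bsub>N\<^esub> f x)"
proof -
  interpret N: module K N by fact
  show ?thesis
    by (rule linear_mapI)
      (simp_all add: linear_map_closed[OF f] linear_map_add[OF f] linear_map_smult[OF f] N.minus_add N.smult_r_minus)
qed

text \<open>The following is the square-zero extension of the ground field by the kernel of the counit,
  as an algebra and dually as a coalgebra: on the kernel all products vanish and all elements
  are primitive.\<close>

locale trivial_bimodule =
  fixes K :: "('k, 'x) ring_scheme" and V :: "('k, 'v, 'z) graded_bimodule_scheme"
  assumes K: "field K" and gV: "graded_vector_space K V" and one_degree: "\<one>\<^bsub>V\<^esub> \<in> component V 0"
    and linear_counit: "linear_map K V (self_module K) (counit V)"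
    and counit_degree: "i \<noteq> 0 \<Longrightarrow> v \<in> component V i \<Longrightarrow> counit V v = \<zero>\<^bsub>K\<^esub>"
    and counit_one: "counit V \<one>\<^bsub>V\<^esub> = \<one>\<^bsub>K\<^esub>"
    and mult: "\<lbrakk>v \<in> carrier V; w \<in> carrier V\<rbrakk> \<Longrightarrow> v \<otimes>\<^bsub>V\<^esub> w =
      (counit V v \<odot>\<^bsub>V\<^esub> w \<oplus>\<^bsub>V\<^esub> counit V w \<odot>\<^bsub>V\<^esub> v) \<ominus>\<^bsub>V\<^esub> ((counit V v \<otimes>\<^bsub>K\<^esub> counit V w) \<odot>\<^bsub>V\<^esub> \<one>\<^bsub>V\<^esub>)"
    and comult: "v \<in> carrier V \<Longrightarrow> comult V v =
      (pure_power K V [v, \<one>\<^bsub>V\<^esub>] \<oplus>\<^bsub>tensor_power K V 2\<^esub> pure_power K V [\<one>\<^bsub>V\<^esub>, v]) \<ominus>\<^bsub>tensor_power K V 2\<^esub>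
        (counit V v \<odot>\<^bsub>tensor_power K V 2\<^esub> pure_power K V [\<one>\<^bsub>V\<^esub>, \<one>\<^bsub>V\<^esub>])"
begin

interpretation K: field K by (rule K)

lemmas mV = homogeneous_module[OF K gV]

interpretation V: module K V by (rule mV)

lemmas mT = module_tensor_power[OF K mV]

interpretation T: module K "tensor_power K V n" for n by (rule mT)

abbreviation "T2 \<equiv> tensor_power K V 2"
abbreviation "pp \<equiv> pure_power K V"

lemma one_closed: "\<one>\<^bsub>V\<^esub> \<in> carrier V"
  by (rule homogeneous_closed(1)[OF K gV one_degree])

lemma counit:
  "v \<in> carrier V \<Longrightarrow> counit V v \<in> carrier K"
  "v \<in> carrier V \<Longrightarrow> w \<in> carrier V \<Longrightarrow> counit V (v \<oplus>\<^bsub>V\<^esub> w) = counit V v \<oplus>\<^bsub>K\<^esub> counit V w"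
  "a \<in> carrier K \<Longrightarrow> v \<in> carrier V \<Longrightarrow> counit V (a \<odot>\<^bsub>V\<^esub> v) = a \<otimes>\<^bsub>K\<^esub> counit V v"
  using linear_counit by (auto simp: linear_map_def self_module_def)

lemma counit_minus:
  assumes v: "v \<in> carrier V" and w: "w \<in> carrier V"
  shows "counit V (v \<ominus>\<^bsub>V\<^esub> w) = counit V v \<ominus>\<^bsub>K\<^esub> counit V w"
proof -
  have m: "\<ominus>\<^bsub>V\<^esub> w = (\<ominus>\<^bsub>K\<^esub> \<one>\<^bsub>K\<^esub>) \<odot>\<^bsub>V\<^esub> w" using w by (simp add: V.smult_l_minus)
  show ?thesis
    unfolding a_minus_def m using v w by (simp add: counit K.l_minus)
qed

lemma mult_closed: "v \<in> carrier V \<Longrightarrow> w \<in> carrier V \<Longrightarrow> v \<otimes>\<^bsub>V\<^esub> w \<in> carrier V"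
  by (simp add: mult counit one_closed)

lemma counit_mult: "v \<in> carrier V \<Longrightarrow> w \<in> carrier V \<Longrightarrow> counit V (v \<otimes>\<^bsub>V\<^esub> w) = counit V v \<otimes>\<^bsub>K\<^esub> counit V w"
  by (simp add: mult counit_minus counit one_closed counit_one)
    (simp add: a_minus_def K.m_comm[of "counit V w"] K.a_assoc K.r_neg counit)

lemma mult_comm: "v \<in> carrier V \<Longrightarrow> w \<in> carrier V \<Longrightarrow> v \<otimes>\<^bsub>V\<^esub> w = w \<otimes>\<^bsub>V\<^esub> v"
  by (simp add: mult counit V.a_comm K.m_comm)

lemma mult_assoc:
  assumes u: "u \<in> carrier V" and v: "v \<in> carrier V" and w: "w \<in> carrier V"
  shows "(u \<otimes>\<^bsub>V\<^esub> v) \<otimes>\<^bsub>V\<^esub> w = u \<otimes>\<^bsub>V\<^esub> (v \<otimes>\<^bsub>V\<^esub> w)"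
proof -
  let ?e = "counit V"
  note c = counit(1)[OF u] counit(1)[OF v] counit(1)[OF w] one_closed
  have "(u \<otimes>\<^bsub>V\<^esub> v) \<otimes>\<^bsub>V\<^esub> w = ((?e u \<otimes>\<^bsub>K\<^esub> ?e v) \<odot>\<^bsub>V\<^esub> w \<oplus>\<^bsub>V\<^esub> ?e w \<odot>\<^bsub>V\<^esub> (u \<otimes>\<^bsub>V\<^esub> v))
      \<ominus>\<^bsub>V\<^esub> ((?e u \<otimes>\<^bsub>K\<^esub> ?e v) \<otimes>\<^bsub>K\<^esub> ?e w) \<odot>\<^bsub>V\<^esub> \<one>\<^bsub>V\<^esub>"
    using u v w by (simp add: mult[of "u \<otimes>\<^bsub>V\<^esub> v"] mult_closed counit_mult)
  also have "\<dots> = (?e u \<odot>\<^bsub>V\<^esub> (v \<otimes>\<^bsub>V\<^esub> w) \<oplus>\<^bsub>V\<^esub> (?e v \<otimes>\<^bsub>K\<^esub> ?e w) \<odot>\<^bsub>V\<^esub> u)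
      \<ominus>\<^bsub>V\<^esub> (?e u \<otimes>\<^bsub>K\<^esub> (?e v \<otimes>\<^bsub>K\<^esub> ?e w)) \<odot>\<^bsub>V\<^esub> \<one>\<^bsub>V\<^esub>"
    using c u v w
    by (simp add: mult[OF u v] mult[OF v w] a_minus_def V.smult_r_distr V.smult_r_minus V.smult_assoc1[symmetric]
        V.a_ac K.m_ac)
  also have "\<dots> = u \<otimes>\<^bsub>V\<^esub> (v \<otimes>\<^bsub>V\<^esub> w)"
    using u v w by (simp add: mult[of u "v \<otimes>\<^bsub>V\<^esub> w"] mult_closed counit_mult)
  finally show ?thesis .
qed

lemma mult_one: "v \<in> carrier V \<Longrightarrow> \<one>\<^bsub>V\<^esub> \<otimes>\<^bsub>V\<^esub> v = v"
  by (simp add: mult one_closed counit_one counit a_minus_def V.a_assoc V.r_neg)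

lemma one_mult: "v \<in> carrier V \<Longrightarrow> v \<otimes>\<^bsub>V\<^esub> \<one>\<^bsub>V\<^esub> = v"
  using mult_one mult_comm[OF one_closed] by simp

lemma mult_distr:
  assumes "u \<in> carrier V" "v \<in> carrier V" "w \<in> carrier V"
  shows "(u \<oplus>\<^bsub>V\<^esub> v) \<otimes>\<^bsub>V\<^esub> w = u \<otimes>\<^bsub>V\<^esub> w \<oplus>\<^bsub>V\<^esub> v \<otimes>\<^bsub>V\<^esub> w"
  using assms
  by (simp add: mult counit one_closed a_minus_def V.smult_r_distr V.smult_l_distr K.l_distr V.minus_add V.a_ac)

lemma mult_smult:
  assumes "a \<in> carrier K" "v \<in> carrier V" "w \<in> carrier V"
  shows "(a \<odot>\<^bsub>V\<^esub> v) \<otimes>\<^bsub>V\<^esub> w = a \<odot>\<^bsub>V\<^esub> (v \<otimes>\<^bsub>V\<^esub> w)"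
  using assms
  by (simp add: mult counit one_closed a_minus_def V.smult_r_distr V.smult_r_minus V.smult_assoc1[symmetric] K.m_ac)

lemma mult_homogeneous:
  assumes v: "v \<in> component V i" and w: "w \<in> component V j"
  shows "v \<otimes>\<^bsub>V\<^esub> w \<in> component V (i + j)" "v \<otimes>\<^bsub>V\<^esub> w = koszul V i j (w \<otimes>\<^bsub>V\<^esub> v)"
proof -
  note h = homogeneous_closed[OF K gV]
  note vc = h(1)[OF v] and wc = h(1)[OF w]
  have z: "v \<otimes>\<^bsub>V\<^esub> w = \<zero>\<^bsub>V\<^esub>" if "i \<noteq> 0" "j \<noteq> 0"
    using that v w vc wc
    by (simp add: mult counit_degree[of i v] counit_degree[of j w] one_closed a_minus_def V.a_inv_zero)
  consider "i = 0" "j = 0" | "i = 0" "j \<noteq> 0" | "i \<noteq> 0" "j = 0" | "i \<noteq> 0" "j \<noteq> 0" by blast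
  then show "v \<otimes>\<^bsub>V\<^esub> w \<in> component V (i + j)"
  proof cases
    case 1
    then show ?thesis using v w one_degree vc wc by (auto simp: mult[OF vc wc] a_minus_def counit intro!: h)
  next
    case 2
    then show ?thesis using w vc wc
      by (simp add: mult[OF vc wc] counit_degree[of j w] counit one_closed a_minus_def V.a_inv_zero h(4))
  next
    case 3
    then show ?thesis using v vc wc
      by (simp add: mult[OF vc wc] counit_degree[of i v] counit one_closed a_minus_def V.a_inv_zero h(4))
  next
    case 4
    then show ?thesis using h(2) z by simp
  qed
  show "v \<otimes>\<^bsub>V\<^esub> w = koszul V i j (w \<otimes>\<^bsub>V\<^esub> v)"
  proof (cases "odd (i * j)")
    case True
    then have "i \<noteq> 0" "j \<noteq> 0" by auto
    then show ?thesis using z mult_comm[OF vc wc] by (simp add: koszul_def V.a_inv_zero)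
  qed (use mult_comm[OF vc wc] in \<open>simp add: koszul_def\<close>)
qed

theorem trivial_algebra: "graded_comm_algebra K V" and trivial_augmented: "augmented K V"
proof -
  have "ring V"
  proof (intro ringI V.abelian_group_axioms monoidI)
    fix u v w assume *: "u \<in> carrier V" "v \<in> carrier V" "w \<in> carrier V"
    show "w \<otimes>\<^bsub>V\<^esub> (u \<oplus>\<^bsub>V\<^esub> v) = w \<otimes>\<^bsub>V\<^esub> u \<oplus>\<^bsub>V\<^esub> w \<otimes>\<^bsub>V\<^esub> v"
      using * mult_comm[of w] mult_distr[of u v w] by simp
  qed (simp_all add: mult_closed one_closed mult_one one_mult mult_assoc mult_distr)
  moreover have "v \<otimes>\<^bsub>V\<^esub> (a \<odot>\<^bsub>V\<^esub> w) = a \<odot>\<^bsub>V\<^esub> (v \<otimes>\<^bsub>V\<^esub> w)"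
    if "a \<in> carrier K" "v \<in> carrier V" "w \<in> carrier V" for a v w
    using that mult_smult[of a w v] mult_comm[of v] by simp
  ultimately show "graded_comm_algebra K V"
    unfolding graded_comm_algebra_def
    by (intro conjI allI ballI gV mult_smult one_degree mult_homogeneous)
  show "augmented K V" by (simp add: augmented_def counit_one counit_mult)
qed

lemma pp_closed:
  "v \<in> carrier V \<Longrightarrow> w \<in> carrier V \<Longrightarrow> pp [v, w] \<in> carrier T2"
  by (rule pure_power_closed[OF K mV]) (auto simp: words_two)

lemma linear_pp:
  "v \<in> carrier V \<Longrightarrow> linear_map K V T2 (\<lambda>w. pp [v, w])"
  "w \<in> carrier V \<Longrightarrow> linear_map K V T2 (\<lambda>v. pp [v, w])"
proof -
  have p: "linear_map K V T2 (\<lambda>x. pp (us @ x # ws))"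
    if "set us \<subseteq> carrier V" "set ws \<subseteq> carrier V" "Suc (length us + length ws) = 2" for us ws
    using multilinear_pure_power[OF K mV, of 2] that unfolding multilinear_map_def by blast
  show "v \<in> carrier V \<Longrightarrow> linear_map K V T2 (\<lambda>w. pp [v, w])" using p[of "[v]" "[]"] by simp
  show "w \<in> carrier V \<Longrightarrow> linear_map K V T2 (\<lambda>v. pp [v, w])" using p[of "[]" "[w]"] by simp
qed

lemma linear_counit_smult:
  assumes M: "module K M" and t: "t \<in> carrier M"
  shows "linear_map K V M (\<lambda>v. counit V v \<odot>\<^bsub>M\<^esub> t)"
proof -
  interpret M: module K M by fact
  show ?thesis by (rule linear_mapI) (simp_all add: counit t M.smult_l_distr M.smult_assoc1)
qed

lemma linear_comult: "linear_map K V T2 (comult V)"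
  by (rule linear_map_cong[OF mV linear_map_diff[OF mV mT
        linear_map_sum[OF mV mT linear_pp(2)[OF one_closed] linear_pp(1)[OF one_closed]]
        linear_counit_smult[OF mT pp_closed[OF one_closed one_closed]]]])
    (simp add: comult)

lemma linear_map_comult:
  assumes M: "module K M" and L: "linear_map K T2 M L" and v: "v \<in> carrier V"
  shows "L (comult V v) = (L (pp [v, \<one>\<^bsub>V\<^esub>]) \<oplus>\<^bsub>M\<^esub> L (pp [\<one>\<^bsub>V\<^esub>, v])) \<ominus>\<^bsub>M\<^esub> (counit V v \<odot>\<^bsub>M\<^esub> L (pp [\<one>\<^bsub>V\<^esub>, \<one>\<^bsub>V\<^esub>]))"
proof -
  note c = pp_closed[OF v one_closed] pp_closed[OF one_closed v] pp_closed[OF one_closed one_closed]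
  show ?thesis
    unfolding comult[OF v] linear_map_minus[OF mT M L T.add.m_closed[OF c(1,2)] T.smult_closed[OF counit(1)[OF v] c(3)]]
    using c v by (simp add: linear_map_add[OF L] linear_map_smult[OF L] counit)
qed

text \<open>Computations with this coproduct are carried out by lifting multilinear maps, for which all terms
  are explicit.\<close>

lemma lift_comult:
  assumes M: "module K M" and b: "multilinear_map K V 2 M b" and v: "v \<in> carrier V"
  shows "tensor_lift K M b (comult V v) =
    (b [v, \<one>\<^bsub>V\<^esub>] \<oplus>\<^bsub>M\<^esub> b [\<one>\<^bsub>V\<^esub>, v]) \<ominus>\<^bsub>M\<^esub> (counit V v \<odot>\<^bsub>M\<^esub> b [\<one>\<^bsub>V\<^esub>, \<one>\<^bsub>V\<^esub>])"
proof -
  have w: "[x, y] \<in> words V 2" if "x \<in> carrier V" "y \<in> carrier V" for x y using that by (auto simp: words_two)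
  show ?thesis
    unfolding linear_map_comult[OF M linear_map_multilinear_lift[OF K mV M b] v]
    using v one_closed by (simp add: multilinear_lift_pure[OF K mV M b w])
qed

lemma comult_one: "comult V \<one>\<^bsub>V\<^esub> = pp [\<one>\<^bsub>V\<^esub>, \<one>\<^bsub>V\<^esub>]"
  using pp_closed[OF one_closed one_closed]
  by (simp add: comult[OF one_closed] counit_one a_minus_def T.a_assoc T.r_neg)

text \<open>Each side is the sum of the three placements of \<open>v\<close> among two units, minus twice the counit of \<open>v\<close>
  times the product of three units.\<close>

lemma comult_coassoc:
  assumes v: "v \<in> carrier V"
  shows "apply_at K V 2 0 (comult V) (comult V v) = apply_at K V 2 1 (comult V) (comult V v)"
proof -
  let ?T = "tensor_power K V (Suc 2)" and ?p = "\<one>\<^bsub>V\<^esub>"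
  have c: "pp [x, y, z] \<in> carrier ?T" if "x \<in> carrier V" "y \<in> carrier V" "z \<in> carrier V" for x y z
    by (rule pure_power_closed[OF K mV]) (use that in \<open>simp add: words_def\<close>)
  have w: "[x, y] \<in> words V 2" if "x \<in> carrier V" "y \<in> carrier V" for x y using that by (auto simp: words_two)
  note ins = multilinear_insert(1)[OF K mV linear_comult _ mT multilinear_pure_power[OF K mV, of "Suc 2"]]
  have A0: "apply_at K V 2 0 (comult V) (pp [x, y]) =
      (pp [x, ?p, y] \<oplus>\<^bsub>?T\<^esub> pp [?p, x, y]) \<ominus>\<^bsub>?T\<^esub> counit V x \<odot>\<^bsub>?T\<^esub> pp [?p, ?p, y]"
    if x: "x \<in> carrier V" and y: "y \<in> carrier V" for x y
    using apply_at_pure[OF K mV linear_comult _ w[OF x y], of 0] lift_comult[OF mT ins[OF _ w[OF x y], of 0] x]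
    by simp
  have A1: "apply_at K V 2 1 (comult V) (pp [x, y]) =
      (pp [x, y, ?p] \<oplus>\<^bsub>?T\<^esub> pp [x, ?p, y]) \<ominus>\<^bsub>?T\<^esub> counit V y \<odot>\<^bsub>?T\<^esub> pp [x, ?p, ?p]"
    if x: "x \<in> carrier V" and y: "y \<in> carrier V" for x y
    using apply_at_pure[OF K mV linear_comult _ w[OF x y], of 1] lift_comult[OF mT ins[OF _ w[OF x y], of 1] y]
    by simp
  have less: "0 < (2::nat)" "1 < (2::nat)" by simp_all
  note o = one_closed and e = counit(1)[OF v]
  note cs = c[OF v o o] c[OF o v o] c[OF o o v] c[OF o o o]
  have "apply_at K V 2 0 (comult V) (comult V v) = pp [v, ?p, ?p] \<oplus>\<^bsub>?T\<^esub> (pp [?p, v, ?p] \<oplus>\<^bsub>?T\<^esub> (pp [?p, ?p, v] \<oplus>\<^bsub>?T\<^esub>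
      (\<ominus>\<^bsub>?T\<^esub> (counit V v \<odot>\<^bsub>?T\<^esub> pp [?p, ?p, ?p]) \<oplus>\<^bsub>?T\<^esub> \<ominus>\<^bsub>?T\<^esub> (counit V v \<odot>\<^bsub>?T\<^esub> pp [?p, ?p, ?p]))))"
    unfolding linear_map_comult[OF mT linear_map_apply_at[OF K mV linear_comult less(1)] v]
      A0[OF v o] A0[OF o v] A0[OF o o]
    using cs e by (simp add: counit_one a_minus_def T.a_ac T.r_neg T.r_neg1 T.r_neg2)
  moreover have "apply_at K V 2 1 (comult V) (comult V v) = pp [v, ?p, ?p] \<oplus>\<^bsub>?T\<^esub> (pp [?p, v, ?p] \<oplus>\<^bsub>?T\<^esub> (pp [?p, ?p, v] \<oplus>\<^bsub>?T\<^esub>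
      (\<ominus>\<^bsub>?T\<^esub> (counit V v \<odot>\<^bsub>?T\<^esub> pp [?p, ?p, ?p]) \<oplus>\<^bsub>?T\<^esub> \<ominus>\<^bsub>?T\<^esub> (counit V v \<odot>\<^bsub>?T\<^esub> pp [?p, ?p, ?p]))))"
    unfolding linear_map_comult[OF mT linear_map_apply_at[OF K mV linear_comult less(2)] v]
      A1[OF v o] A1[OF o v] A1[OF o o]
    using cs e by (simp add: counit_one a_minus_def T.a_ac T.r_neg T.r_neg1 T.r_neg2)
  ultimately show ?thesis by simp
qed

lemma counit_comult:
  assumes v: "v \<in> carrier V"
  shows "tensor_lift K V (\<lambda>vs. counit V (vs ! 0) \<odot>\<^bsub>V\<^esub> (vs ! 1)) (comult V v) = v"
    "tensor_lift K V (\<lambda>vs. counit V (vs ! 1) \<odot>\<^bsub>V\<^esub> (vs ! 0)) (comult V v) = v"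
proof -
  have 1: "linear_map K V V (\<lambda>w. counit V u \<odot>\<^bsub>V\<^esub> w)" if "u \<in> carrier V" for u
    by (rule linear_map_scale[OF mV mV linear_map_id[OF K gV] counit(1)[OF that]])
  note b = multilinear_two[of V K V "\<lambda>u w. counit V u \<odot>\<^bsub>V\<^esub> w", OF 1 linear_counit_smult[OF mV]]
    multilinear_two[of V K V "\<lambda>u w. counit V w \<odot>\<^bsub>V\<^esub> u", OF linear_counit_smult[OF mV] 1]
  have e: "(counit V v \<odot>\<^bsub>V\<^esub> \<one>\<^bsub>V\<^esub> \<oplus>\<^bsub>V\<^esub> v) \<ominus>\<^bsub>V\<^esub> counit V v \<odot>\<^bsub>V\<^esub> \<one>\<^bsub>V\<^esub> = v"
    "(v \<oplus>\<^bsub>V\<^esub> counit V v \<odot>\<^bsub>V\<^esub> \<one>\<^bsub>V\<^esub>) \<ominus>\<^bsub>V\<^esub> counit V v \<odot>\<^bsub>V\<^esub> \<one>\<^bsub>V\<^esub> = v"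
    using v counit(1)[OF v] one_closed by (simp_all add: a_minus_def V.a_ac V.r_neg V.r_neg2 V.r_neg1)
  show "tensor_lift K V (\<lambda>vs. counit V (vs ! 0) \<odot>\<^bsub>V\<^esub> (vs ! 1)) (comult V v) = v"
    using lift_comult[OF mV b(1) v] v one_closed e by (simp add: counit_one)
  show "tensor_lift K V (\<lambda>vs. counit V (vs ! 1) \<odot>\<^bsub>V\<^esub> (vs ! 0)) (comult V v) = v"
    using lift_comult[OF mV b(2) v] v one_closed e by (simp add: counit_one)
qed

lemma one_nonzero: "\<one>\<^bsub>V\<^esub> \<noteq> \<zero>\<^bsub>V\<^esub>"
  using counit_one linear_map_zero[OF mV module_self[OF K] linear_counit] by (auto simp: self_module_def)

lemma linear_koszul: "linear_map K V T2 f \<Longrightarrow> linear_map K V T2 (\<lambda>x. koszul T2 i j (f x))"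
  using linear_map_neg_map[OF mV mT] by (cases "odd (i * j)") (simp_all add: koszul_def)

text \<open>The unit has degree 0, so no sign arises when it is moved past another element.\<close>

lemma swap_comult:
  assumes v: "v \<in> carrier V"
  shows "koszul_swap K V (comult V v) = comult V v"
proof -
  define B where "B u w = (\<Oplus>\<^bsub>T2\<^esub>i \<in> {i. hom_part V u i \<noteq> \<zero>\<^bsub>V\<^esub>}.
      \<Oplus>\<^bsub>T2\<^esub>j \<in> {j. hom_part V w j \<noteq> \<zero>\<^bsub>V\<^esub>}. koszul T2 i j (pp [hom_part V w j, hom_part V u i]))" for u w
  have b: "multilinear_map K V 2 T2 (\<lambda>vs. B (vs ! 0) (vs ! 1))"
  proof (rule multilinear_two)
    fix u assume u: "u \<in> carrier V"
    show "linear_map K V T2 (B u)"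
      unfolding B_def
      by (intro linear_map_finsum_maps[OF mV mT] linear_graded_sum[OF K gV mT,
            where f = "\<lambda>j x. koszul T2 _ j (pp [x, hom_part V u _])"]
          linear_koszul linear_pp hom_part[OF K gV] u)
    show "linear_map K V T2 (\<lambda>x. B x u)"
      unfolding B_def
      by (intro linear_graded_sum[OF K gV mT, where f = "\<lambda>i x. \<Oplus>\<^bsub>T2\<^esub>j \<in> {j. hom_part V u j \<noteq> \<zero>\<^bsub>V\<^esub>}.
            koszul T2 i j (pp [hom_part V u j, x])"] linear_map_finsum_maps[OF mV mT]
          linear_koszul linear_pp hom_part[OF K gV] u)
  qed
  have ps: "{i. hom_part V \<one>\<^bsub>V\<^esub> i \<noteq> \<zero>\<^bsub>V\<^esub>} = {0}" "hom_part V \<one>\<^bsub>V\<^esub> 0 = \<one>\<^bsub>V\<^esub>"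
    using one_nonzero by (auto simp: hom_part_homogeneous[OF K gV one_degree])
  have k: "koszul T2 i 0 t = t" "koszul T2 0 i t = t" for i t by (simp_all add: koszul_def)
  have B1: "B v \<one>\<^bsub>V\<^esub> = pp [\<one>\<^bsub>V\<^esub>, v]" if v: "v \<in> carrier V" for v
  proof -
    note h = hom_part[OF K gV v]
    have "B v \<one>\<^bsub>V\<^esub> = (\<Oplus>\<^bsub>T2\<^esub>i \<in> {i. hom_part V v i \<noteq> \<zero>\<^bsub>V\<^esub>}. pp [\<one>\<^bsub>V\<^esub>, hom_part V v i])"
      unfolding B_def ps(1) using h by (intro T.add.finprod_cong') (auto simp: ps k pp_closed one_closed)
    also have "\<dots> = pp [\<one>\<^bsub>V\<^esub>, v]"
      using linear_map_finsum[OF mV mT linear_pp(1)[OF one_closed] h(3), of "hom_part V v"] h by simp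
    finally show ?thesis .
  qed
  have B2: "B \<one>\<^bsub>V\<^esub> v = pp [v, \<one>\<^bsub>V\<^esub>]"
  proof -
    note h = hom_part[OF K gV v]
    have "B \<one>\<^bsub>V\<^esub> v = (\<Oplus>\<^bsub>T2\<^esub>j \<in> {j. hom_part V v j \<noteq> \<zero>\<^bsub>V\<^esub>}. pp [hom_part V v j, \<one>\<^bsub>V\<^esub>])"
      unfolding B_def ps(1) by (simp add: ps k pp_closed one_closed h)
    also have "\<dots> = pp [v, \<one>\<^bsub>V\<^esub>]"
      using linear_map_finsum[OF mV mT linear_pp(2)[OF one_closed] h(3), of "hom_part V v"] h by simp
    finally show ?thesis .
  qed
  have "koszul_swap K V = tensor_lift K T2 (\<lambda>vs. B (vs ! 0) (vs ! 1))"
    by (simp add: koszul_swap_def B_def Let_def)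
  then show ?thesis
    unfolding lift_comult[OF mT b v, folded \<open>koszul_swap K V = _\<close>]
    using B1[OF v] B1[OF one_closed] B2 pp_closed v one_closed
    by (simp add: comult T.a_comm[of "pp [\<one>\<^bsub>V\<^esub>, v]"])
qed

lemma comult_homogeneous:
  assumes v: "v \<in> component V n"
  shows "comult V v \<in> square_component K V n"
proof -
  let ?S = "{pp [v, w] | v w i j. v \<in> component V i \<and> w \<in> component V j \<and> i + j = n}"
  note vc = homogeneous_closed(1)[OF K gV v]
  have S: "?S \<subseteq> carrier T2" using homogeneous_closed(1)[OF K gV] pp_closed by blast
  note sub = T.submoduleE[OF submodule_lin_span[OF mT S]]
  have g: "pp [x, y] \<in> lin_span K T2 ?S" if "x \<in> component V i" "y \<in> component V j" "i + j = n" for x y i j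
    by (rule lin_span_superset[OF mT]) (use that in blast)
  have m: "pp [v, \<one>\<^bsub>V\<^esub>] \<in> lin_span K T2 ?S" "pp [\<one>\<^bsub>V\<^esub>, v] \<in> lin_span K T2 ?S"
    by (rule g[OF v one_degree] g[OF one_degree v], simp)+
  have o: "counit V v \<odot>\<^bsub>T2\<^esub> pp [\<one>\<^bsub>V\<^esub>, \<one>\<^bsub>V\<^esub>] \<in> lin_span K T2 ?S"
  proof (cases "n = 0")
    case True
    then show ?thesis by (intro sub(4) counit(1) vc g[OF one_degree one_degree]) simp
  next
    case False
    have "\<zero>\<^bsub>K\<^esub> \<odot>\<^bsub>T2\<^esub> pp [\<one>\<^bsub>V\<^esub>, v] \<in> lin_span K T2 ?S" by (rule sub(4)[OF K.zero_closed m(2)])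
    then show ?thesis using counit_degree[OF False v] pp_closed vc one_closed by simp
  qed
  show ?thesis
    unfolding square_component_def comult[OF vc] a_minus_def by (intro sub(5) sub(3) m o)
qed

theorem trivial_coalgebra: "graded_cocomm_coalgebra K V"
  unfolding graded_cocomm_coalgebra_def
  by (intro conjI allI ballI impI gV linear_comult linear_counit comult_homogeneous comult_coassoc
      counit_comult swap_comult counit_degree)

theorem trivial_coaugmented: "coaugmented K V"
  by (simp add: coaugmented_def comult_one counit_one)

text \<open>All elements of the kernel of the counit are primitive.\<close>

lemma reduced_comult_zero:
  assumes v: "v \<in> carrier V"
  shows "reduced_comult K V v = \<zero>\<^bsub>T2\<^esub>"
proof -
  let ?u = "v \<ominus>\<^bsub>V\<^esub> (counit V v \<odot>\<^bsub>V\<^esub> \<one>\<^bsub>V\<^esub>)"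
  have u: "?u \<in> carrier V" and e: "counit V ?u = \<zero>\<^bsub>K\<^esub>"
    using v counit(1)[OF v] one_closed
    by (simp_all add: counit_minus counit(3) counit_one)
  note c = pp_closed[OF u one_closed] pp_closed[OF one_closed u] pp_closed[OF one_closed one_closed]
  have "comult V ?u = pp [?u, \<one>\<^bsub>V\<^esub>] \<oplus>\<^bsub>T2\<^esub> pp [\<one>\<^bsub>V\<^esub>, ?u]"
    unfolding comult[OF u] e using c by (simp add: a_minus_def[of T2] T.a_inv_zero)
  then show ?thesis
    unfolding reduced_comult_def Let_def using c
    by (simp add: a_minus_def[of T2] T.a_ac T.r_neg T.r_neg1 T.r_neg2)
qed

theorem trivial_conilpotent: "conilpotent K V"
  unfolding conilpotent_def
proof (intro ballI exI allI impI)
  have lin: "linear_map K V T2 (reduced_comult K V)"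
    by (rule linear_map_cong[OF mV linear_map_const_zero[OF mV mT]]) (simp add: reduced_comult_zero)
  fix v and k :: nat assume v: "v \<in> carrier V" and k: "1 \<le> k"
  have cl: "iterated_reduced_comult K V k v \<in> carrier (tensor_power K V (Suc k))" for k
  proof (induction k)
    case 0
    show ?case using v by (auto intro!: pure_power_closed[OF K mV] simp: words_def)
  next
    case (Suc k)
    then show ?case by (simp add: linear_map_closed[OF linear_map_apply_at[OF K mV lin]])
  qed
  obtain m where m: "k = Suc m" using k by (cases k) auto
  have "apply_at K V (Suc m) 0 (reduced_comult K V) (iterated_reduced_comult K V m v) = \<zero>\<^bsub>tensor_power K V (Suc (Suc m))\<^esub>"
  proof (rule tensor_power_map_eqI[OF K mV mT linear_map_apply_at[OF K mV lin zero_less_Suc]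
        linear_map_const_zero[OF mT mT] _ cl])
    fix vs assume vs: "vs \<in> words V (Suc m)"
    then have "vs ! 0 \<in> carrier V" by (auto simp: words_def)
    then show "apply_at K V (Suc m) 0 (reduced_comult K V) (pp vs) = \<zero>\<^bsub>tensor_power K V (Suc (Suc m))\<^esub>"
      unfolding apply_at_pure[OF K mV lin zero_less_Suc vs]
      using linear_map_zero[OF mT mT linear_map_multilinear_lift[OF K mV mT
            multilinear_insert(1)[OF K mV lin zero_less_Suc mT multilinear_pure_power[OF K mV] vs]]]
      by (simp add: reduced_comult_zero)
  qed
  then show "iterated_reduced_comult K V k v = \<zero>\<^bsub>tensor_power K V (Suc k)\<^esub>" by (simp add: m)
qed

end

section \<open>Dependence on the underlying graded space\<close>

text \<open>Completions and their maps depend on the additive and graded structure only. This is what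
  allows an algebra with coproduct to be compared to the complex that it underlies, although the
  two are records of different types.\<close>

definition same_graded_space ::
  "('k, 'v, 'z) graded_module_scheme \<Rightarrow> ('k, 'v, 'u) graded_module_scheme \<Rightarrow> bool" where
  "same_graded_space V V' \<longleftrightarrow> carrier V = carrier V' \<and> ring.add V = ring.add V' \<and> \<zero>\<^bsub>V\<^esub> = \<zero>\<^bsub>V'\<^esub> \<and>
    module.smult V = module.smult V' \<and> component V = component V'"

lemma same_graded_space_refl: "same_graded_space V V"
  by (simp add: same_graded_space_def)

context
  fixes K :: "('k, 'x) ring_scheme" and V :: "('k, 'v, 'z) graded_module_scheme"
    and V' :: "('k, 'v, 'u) graded_module_scheme"
  assumes same: "same_graded_space V V'"
begin

lemma same_simps: "carrier V' = carrier V" "ring.add V' = ring.add V" "\<zero>\<^bsub>V'\<^esub> = \<zero>\<^bsub>V\<^esub>"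
    "module.smult V' = module.smult V" "component V' = component V"
  using same by (simp_all add: same_graded_space_def)

lemma same_uminus: "\<ominus>\<^bsub>V'\<^esub> x = \<ominus>\<^bsub>V\<^esub> x"
  by (simp add: a_inv_def m_inv_def same_simps)

lemma same_module:
  assumes "module K V"
  shows "module K V'"
proof -
  interpret V: module K V by fact
  show ?thesis
    by (intro moduleI abelian_groupI V.R.is_cring)
      (auto simp: same_simps V.a_ac V.smult_l_distr V.smult_r_distr V.smult_assoc1 intro: V.add.inv_closed V.l_neg)
qed

lemma same_submodule:
  assumes V: "module K V" and N: "submodule N K V"
  shows "submodule N K V'"
proof -
  interpret V: module K V by fact
  interpret V': module K V' by (rule same_module[OF V])
  show ?thesis
    using V.submoduleE[OF N] subgroup.one_closed[OF submodule.axioms(1)[OF N]]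
    by (intro V'.submoduleI) (auto simp: same_simps same_uminus)
qed

lemma same_finsum:
  assumes V: "module K V" and A: "finite A" and g: "g \<in> A \<rightarrow> carrier V"
  shows "(\<Oplus>\<^bsub>V'\<^esub>i \<in> A. g i) = (\<Oplus>\<^bsub>V\<^esub>i \<in> A. g i)"
proof -
  interpret V: module K V by fact
  interpret V': module K V' by (rule same_module[OF V])
  show ?thesis using A g by (induction A rule: finite_induct) (simp_all add: same_simps Pi_iff)
qed

lemma same_graded_vector_space:
  assumes gV: "graded_vector_space K V"
  shows "graded_vector_space K V'"
proof -
  have V: "module K V" and c: "\<And>i. submodule (component V i) K V"
    using gV by (simp_all add: graded_vector_space_def)
  have "homogeneous_decomposition V' = homogeneous_decomposition V"
  proof (intro HOL.ext)
    fix v c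
    show "homogeneous_decomposition V' v c \<longleftrightarrow> homogeneous_decomposition V v c"
    proof (cases "(\<forall>i. c i \<in> component V i) \<and> finite {i. c i \<noteq> \<zero>\<^bsub>V\<^esub>}")
      case True
      then have c': "c \<in> {i. c i \<noteq> \<zero>\<^bsub>V\<^esub>} \<rightarrow> carrier V"
        using module.submoduleE(1)[OF V c] by blast
      then show ?thesis
        using True same_finsum[OF V _ c'] by (simp add: homogeneous_decomposition_def same_simps)
    qed (auto simp: homogeneous_decomposition_def same_simps)
  qed
  then show ?thesis
    using gV same_module[OF V] same_submodule[OF V c]
    unfolding graded_vector_space_def same_simps by simp
qed

lemma same_tensor_power: "tensor_power K V' n = tensor_power K V n" "pure_power K V' = pure_power K V"
  by (simp_all add: tensor_power_def pure_power_def tensor_power_relations_def words_def same_simps fun_eq_iff)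

end

context complete_local_algebra
begin

context
  fixes V :: "('k, 'v, 'z) graded_module_scheme" and V' :: "('k, 'v, 'u) graded_module_scheme"
  assumes same: "same_graded_space V V'"
begin

lemmas simps = same_simps[OF same]

lemma same_ext: "ext V' = ext V" "pure_tensor K V' R = pure_tensor K V R"
  by (simp_all add: ext_def tensor_def pure_tensor_def tensor_relations_def simps fun_eq_iff)

lemma same_filt: "filt V' = filt V"
  by (rule HOL.ext) (simp only: filt_def same_ext simps)

lemma same_hat: "hat V' = hat V" "incl V' = incl V"
proof -
  have "ext_smult V' r = ext_smult V r" for r
    by (simp only: ext_smult_def same_ext)
  then show "hat V' = hat V"
    unfolding hat_def same_filt same_ext by (simp only:)
  show "incl V' = incl V"
    unfolding incl_def same_filt same_ext ..
qed

lemma same_hat_component: "hat_component V' = hat_component V"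
  by (rule HOL.ext) (simp only: hat_component_def same_filt same_ext same_hat simps)

lemma same_hat_max:
  assumes V: "module K V"
  shows "hat_max V' = hat_max V"
proof (rule Set.set_eqI)
  fix x
  show "x \<in> hat_max V' \<longleftrightarrow> x \<in> hat_max V"
    unfolding hat_max_iff[OF V] hat_max_iff[OF same_module[OF same V]] same_hat ..
qed

end

lemma same_lin_maps:
  assumes "same_graded_space V V'" "same_graded_space W W'"
  shows "lin_maps V' W' = lin_maps V W"
  unfolding lin_maps_def same_hat[OF assms(1)] same_hat[OF assms(2)]
    same_hat_component[OF assms(1)] same_hat_component[OF assms(2)] ..

end

section \<open>The equivalence\<close>

definition underlying_complex :: "('k, 'v, 'r) mv_algebra \<Rightarrow> ('k, 'v, 'r) pointed_complex" where
  "underlying_complex V = \<lparr>carrier = carrier V, monoid.mult = monoid.mult V, monoid.one = \<one>\<^bsub>V\<^esub>,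
    ring.zero = \<zero>\<^bsub>V\<^esub>, ring.add = ring.add V, module.smult = module.smult V, component = component V,
    pc_diff = mv_diff V, pc_point = (\<lambda>a. a \<odot>\<^bsub>V\<^esub> \<one>\<^bsub>V\<^esub>)\<rparr>"

text \<open>The functional \<open>e\<close> is to be linear, concentrated in degree 0 and 1 on the point; its kernel is the
  complement of the line spanned by the point.\<close>

definition trivial_mv_algebra ::
  "('k, 'x) ring_scheme \<Rightarrow> ('v \<Rightarrow> 'k) \<Rightarrow> ('k, 'v, 'r) pointed_complex \<Rightarrow> ('k, 'v, 'r) mv_algebra" where
  "trivial_mv_algebra K e V = (let p = pc_point V \<one>\<^bsub>K\<^esub>; T = tensor_power K V 2 in
    \<lparr>carrier = carrier V,
     monoid.mult = (\<lambda>v w. (e v \<odot>\<^bsub>V\<^esub> w \<oplus>\<^bsub>V\<^esub> e w \<odot>\<^bsub>V\<^esub> v) \<ominus>\<^bsub>V\<^esub> ((e v \<otimes>\<^bsub>K\<^esub> e w) \<odot>\<^bsub>V\<^esub> p)),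
     monoid.one = p, ring.zero = \<zero>\<^bsub>V\<^esub>, ring.add = ring.add V, module.smult = module.smult V, component = component V,
     comult = (\<lambda>v. (pure_power K V [v, p] \<oplus>\<^bsub>T\<^esub> pure_power K V [p, v]) \<ominus>\<^bsub>T\<^esub> (e v \<odot>\<^bsub>T\<^esub> pure_power K V [p, p])),
     counit = e, mv_diff = pc_diff V\<rparr>)"

lemma same_underlying_complex: "same_graded_space V (underlying_complex V)"
  by (simp add: same_graded_space_def underlying_complex_def)

lemma same_trivial_mv_algebra: "same_graded_space V (trivial_mv_algebra K e V)"
  by (simp add: same_graded_space_def trivial_mv_algebra_def Let_def)

context complete_local_algebra
begin

interpretation K: field K by (rule field_K)

lemma trivial_mv_algebra_exists:
  assumes V: "is_pointed_complex (V :: ('k, 'v, 'r) pointed_complex)"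
  obtains e where "is_mv_algebra (trivial_mv_algebra K e V)"
proof -
  have gV: "graded_vector_space K V" and lin: "linear_map K (self_module K) V (pc_point V)"
    and inj: "inj_on (pc_point V) (carrier K)" and p: "pc_point V \<one>\<^bsub>K\<^esub> \<in> component V 0"
    using V by (auto simp: is_pointed_complex_def)
  note mV = graded_module[OF gV]
  have z: "pc_point V \<zero>\<^bsub>K\<^esub> = \<zero>\<^bsub>V\<^esub>"
    using linear_map_zero[OF module_self[OF field_K] mV lin] by (simp add: self_module_def)
  have "pc_point V \<one>\<^bsub>K\<^esub> \<noteq> pc_point V \<zero>\<^bsub>K\<^esub>" using inj by (auto dest: inj_onD)
  then have p0: "pc_point V \<one>\<^bsub>K\<^esub> \<noteq> \<zero>\<^bsub>V\<^esub>" by (simp add: z)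
  obtain e where e: "\<And>v. v \<in> carrier V \<Longrightarrow> e v \<in> carrier K"
    "\<And>v w. v \<in> carrier V \<Longrightarrow> w \<in> carrier V \<Longrightarrow> e (v \<oplus>\<^bsub>V\<^esub> w) = e v \<oplus>\<^bsub>K\<^esub> e w"
    "\<And>a v. a \<in> carrier K \<Longrightarrow> v \<in> carrier V \<Longrightarrow> e (a \<odot>\<^bsub>V\<^esub> v) = a \<otimes>\<^bsub>K\<^esub> e v"
    "\<And>i v. i \<noteq> 0 \<Longrightarrow> v \<in> component V i \<Longrightarrow> e v = \<zero>\<^bsub>K\<^esub>" "e (pc_point V \<one>\<^bsub>K\<^esub>) = \<one>\<^bsub>K\<^esub>"
    by (rule graded_functional_exists[OF field_K gV p p0]) blast
  let ?T = "trivial_mv_algebra K e V"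
  note same = same_trivial_mv_algebra[of V K e]
  note s = same_simps[OF same]
  have one: "\<one>\<^bsub>?T\<^esub> = pc_point V \<one>\<^bsub>K\<^esub>" and counit: "counit ?T = e" and diff: "mv_diff ?T = pc_diff V"
    by (simp_all add: trivial_mv_algebra_def Let_def)
  interpret T: trivial_bimodule K ?T
  proof (unfold_locales, goal_cases)
    case 1 show ?case by (rule same_graded_vector_space[OF same gV])
  next
    case 2 show ?case using p by (simp only: one s)
  next
    case 3 show ?case by (rule linear_mapI) (simp_all add: counit s e self_module_def)
  next
    case (4 i v) then show ?case using e(4) unfolding counit s by blast
  next
    case 5 show ?case using e(5) by (simp only: counit one)
  next
    case (6 v w) show ?case
      by (simp add: a_minus_def same_uminus[OF same]) (simp add: trivial_mv_algebra_def Let_def a_minus_def)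
  next
    case (7 v) show ?case
      unfolding same_tensor_power[OF same] by (simp add: trivial_mv_algebra_def Let_def)
  qed
  have "pc_diff V \<in> lin_maps V V 1" "\<And>x. x \<in> carrier (hat V) \<Longrightarrow> pc_diff V (pc_diff V x) = \<zero>\<^bsub>hat V\<^esub>"
    "pc_diff V (incl V (pc_point V \<one>\<^bsub>K\<^esub>)) = \<zero>\<^bsub>hat V\<^esub>"
    using V by (simp_all add: is_pointed_complex_def)
  then have "is_mv_algebra ?T"
    unfolding is_mv_algebra_def diff one same_hat[OF same] same_lin_maps[OF same same]
    using T.trivial_algebra T.trivial_coalgebra T.trivial_coaugmented T.trivial_augmented T.trivial_conilpotent by blast
  then show thesis by (rule that)
qed

lemma is_pointed_complex_underlying:
  assumes V: "is_mv_algebra (V :: ('k, 'v, 'r) mv_algebra)"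
  shows "is_pointed_complex (underlying_complex V)"
proof -
  let ?U = "underlying_complex V"
  note same = same_underlying_complex[of V]
  note s = same_simps[OF same]
  have gV: "graded_vector_space K V" and one: "\<one>\<^bsub>V\<^esub> \<in> component V 0"
    and e1: "counit V \<one>\<^bsub>V\<^esub> = \<one>\<^bsub>K\<^esub>" and e: "linear_map K V (self_module K) (counit V)"
    and d: "mv_diff V \<in> lin_maps V V 1" and d1: "mv_diff V (incl V \<one>\<^bsub>V\<^esub>) = \<zero>\<^bsub>hat V\<^esub>"
    using V unfolding is_mv_algebra_def graded_comm_algebra_def graded_cocomm_coalgebra_def augmented_def by blast+
  note mV = graded_module[OF gV]
  interpret V: module K V by (rule mV)
  interpret H: module R "hat V" by (rule module_hat[OF mV])
  have o: "\<one>\<^bsub>V\<^esub> \<in> carrier V" by (rule component_carrier[OF gV one])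
  have lin: "linear_map K (self_module K) ?U (\<lambda>a. a \<odot>\<^bsub>V\<^esub> \<one>\<^bsub>V\<^esub>)"
    by (rule linear_mapI) (simp_all add: s o self_module_def V.smult_l_distr V.smult_assoc1)
  have "counit V (a \<odot>\<^bsub>V\<^esub> \<one>\<^bsub>V\<^esub>) = a" if "a \<in> carrier K" for a
    using linear_map_smult[OF e that o] that by (simp add: e1 self_module_def)
  then have inj: "inj_on (\<lambda>a. a \<odot>\<^bsub>V\<^esub> \<one>\<^bsub>V\<^esub>) (carrier K)" by (rule inj_on_inverseI)
  have comp: "a \<odot>\<^bsub>V\<^esub> \<one>\<^bsub>V\<^esub> \<in> component V 0" if "a \<in> carrier K" for a
    by (rule homogeneous_closed(4)[OF field_K gV that one])
  have "mv_diff V (incl V (a \<odot>\<^bsub>V\<^esub> \<one>\<^bsub>V\<^esub>)) = \<zero>\<^bsub>hat V\<^esub>" if a: "a \<in> carrier K" for a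
  proof -
    have "incl V (a \<odot>\<^bsub>V\<^esub> \<one>\<^bsub>V\<^esub>) = scal a \<odot>\<^bsub>hat V\<^esub> incl V \<one>\<^bsub>V\<^esub>"
      using linear_map_smult[OF linear_incl[OF mV] a o] by (simp add: hat_over_field_simps[OF mV])
    moreover have "linear_map R (hat V) (hat V) (mv_diff V)" using d by (simp add: lin_maps_iff)
    ultimately show ?thesis
      using a d1 linear_map_smult[of R "hat V" "hat V" "mv_diff V" "scal a" "incl V \<one>\<^bsub>V\<^esub>"] incl_closed[OF mV o] by (simp add: scal_closed)
  qed
  then show ?thesis
    using V same_graded_vector_space[OF same gV] lin inj comp
    unfolding is_pointed_complex_def is_mv_algebra_def same_hat[OF same] same_lin_maps[OF same same] s
    by (simp add: underlying_complex_def)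
qed

text \<open>An MV-algebra built on a pointed complex has an underlying complex that may differ from the given
  one in the record fields that carry no information and in the values of the point outside the field.\<close>

lemma same_complex_iso:
  fixes V W :: "('k, 'v, 'r) pointed_complex"
  assumes V: "is_pointed_complex V" and W: "is_pointed_complex W"
    and same: "same_graded_space V W" and d: "pc_diff W = pc_diff V"
    and p: "\<And>a. a \<in> carrier K \<Longrightarrow> pc_point W a = pc_point V a"
  shows "is_iso Chn V W (\<lambda>x \<in> carrier (hat V). x)"
proof -
  have gV: "graded_vector_space K V" using V by (simp add: is_pointed_complex_def)
  note mV = graded_module[OF gV]
  have W': "same_graded_space W V" using same by (simp add: same_graded_space_def)
  note s = same_hat[OF same] same_hat_max[OF same mV] same_lin_maps[OF same same]
    same_lin_maps[OF same_graded_space_refl same] same_lin_maps[OF same same_graded_space_refl]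
  have id: "(\<lambda>x \<in> carrier (hat V). x) \<in> Mor Chn V V"
    using category.Idt_mem[OF category_Chn, of V] V by (simp add: Chn_def)
  have "Mor Chn V W = Mor Chn V V" "Mor Chn W V = Mor Chn V V"
    unfolding Chn_def by (simp_all add: s d p)
  moreover have "Cmp Chn V W V (\<lambda>x \<in> carrier (hat V). x) (\<lambda>x \<in> carrier (hat V). x) = Idt Chn V"
    "Cmp Chn W V W (\<lambda>x \<in> carrier (hat V). x) (\<lambda>x \<in> carrier (hat V). x) = Idt Chn W"
    by (simp_all add: Chn_def s compose_def cong: restrict_cong)
  ultimately show ?thesis using id unfolding is_iso_def by blast
qed

theorem equivalent_MV_Chn:
  "equivalent_categories
    (MV :: (('k, 'v, 'r) mv_algebra, ('v, 'r, 'k) hat \<Rightarrow> ('v, 'r, 'k) hat) cat)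
    (Chn :: (('k, 'v, 'r) pointed_complex, ('v, 'r, 'k) hat \<Rightarrow> ('v, 'r, 'k) hat) cat)"
proof -
  let ?U = "underlying_complex :: ('k, 'v, 'r) mv_algebra \<Rightarrow> ('k, 'v, 'r) pointed_complex"
  have obj: "V \<in> Obj MV \<longleftrightarrow> is_mv_algebra V" for V :: "('k, 'v, 'r) mv_algebra"
    by (simp add: MV_def)
  have obj': "V \<in> Obj Chn \<longleftrightarrow> is_pointed_complex V" for V :: "('k, 'v, 'r) pointed_complex"
    by (simp add: Chn_def)
  have conv: "convolution K R \<mm> V W" if "is_mv_algebra V" "is_mv_algebra W" for V W :: "('k, 'v, 'r) mv_algebra"
    using that unfolding is_mv_algebra_def
    by (intro convolution.intro complete_local_algebra_axioms convolution_axioms.intro)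
      (auto simp only: graded_comm_algebra_def)
  note same = same_underlying_complex
  have mV: "module K V" if "is_mv_algebra V" for V :: "('k, 'v, 'r) mv_algebra"
    using that unfolding is_mv_algebra_def graded_comm_algebra_def graded_vector_space_def by blast
  have mor: "\<phi> \<in> Mor Chn (?U V) (?U W) \<longleftrightarrow> \<phi> \<in> convolution.pointed_maps K R \<mm> V W \<and>
      compose (carrier (hat V)) (mv_diff W) \<phi> = compose (carrier (hat V)) \<phi> (mv_diff V)"
    if "is_mv_algebra V" "is_mv_algebra W" for V W and \<phi> :: "('v, 'r, 'k) hat \<Rightarrow> ('v, 'r, 'k) hat"
  proof -
    have "pc_diff (?U V) = mv_diff V" "pc_point (?U V) = (\<lambda>a. a \<odot>\<^bsub>V\<^esub> \<one>\<^bsub>V\<^esub>)" for V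
      by (simp_all add: underlying_complex_def)
    then show ?thesis
      using same_lin_maps[OF same[of V] same[of W]]
      by (auto simp: Chn_def convolution.pointed_maps_def[OF conv[OF that]] same_hat[OF same]
          same_hat_max[OF same mV[OF that(2)]])
  qed
  have exp: "conv_exp V W f \<in> Mor Chn (?U V) (?U W)" "conv_log V W (conv_exp V W f) = f"
    if "is_mv_algebra V" "is_mv_algebra W" "f \<in> Mor MV V W" for V W f
    using that convolution.conv_exp_pointed[OF conv] convolution.conv_log_exp[OF conv]
    by (auto simp: mor MV_def)
  have log: "conv_log V W \<phi> \<in> Mor MV V W" "conv_exp V W (conv_log V W \<phi>) = \<phi>"
    if "is_mv_algebra V" "is_mv_algebra W" "\<phi> \<in> Mor Chn (?U V) (?U W)" for V W \<phi>
    using that convolution.conv_log_lin0[OF conv] convolution.conv_exp_log[OF conv]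
    by (auto simp: mor MV_def)
  have U: "?U V \<in> Obj Chn" if "is_mv_algebra V" for V
    using is_pointed_complex_underlying[OF that] by (simp add: obj')
  define E where "E V = (SOME e. is_mv_algebra (trivial_mv_algebra K e V))" for V :: "('k, 'v, 'r) pointed_complex"
  have T: "is_mv_algebra (trivial_mv_algebra K (E V) V)" if "is_pointed_complex V" for V
    unfolding E_def
    by (rule trivial_mv_algebra_exists[OF that], erule someI[where P = "\<lambda>e. is_mv_algebra (trivial_mv_algebra K e V)"])
  show ?thesis
  proof (rule equivalent_categories_by_transport[where Fo = ?U and E = conv_exp
        and Go = "\<lambda>V. trivial_mv_algebra K (E V) V" and \<beta> = "\<lambda>V. \<lambda>x \<in> carrier (hat V). x", OF category_Chn];
      (unfold obj obj')?)
    fix V W :: "('k, 'v, 'r) mv_algebra" assume o: "is_mv_algebra V" "is_mv_algebra W"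
    show "bij_betw (conv_exp V W) (Mor MV V W) (Mor Chn (?U V) (?U W))"
      by (rule bij_betw_byWitness[where f' = "conv_log V W"]) (use exp[OF o] log[OF o] in blast)+
  next
    fix V :: "('k, 'v, 'r) mv_algebra" assume o: "is_mv_algebra V"
    have "Idt Chn (?U V) \<in> Mor Chn (?U V) (?U V)"
      by (rule category.Idt_mem[OF category_Chn U[OF o]])
    moreover have "Idt MV V = conv_log V V (Idt Chn (?U V))"
      by (simp add: MV_def Chn_def same_hat[OF same])
    ultimately show "Idt MV V \<in> Mor MV V V \<and> conv_exp V V (Idt MV V) = Idt Chn (?U V)"
      using log[OF o o, of "Idt Chn (?U V)"] by (simp only:)
  next
    fix V W Z :: "('k, 'v, 'r) mv_algebra" and f g
    assume o: "is_mv_algebra V" "is_mv_algebra W" "is_mv_algebra Z" and f: "f \<in> Mor MV V W" and g: "g \<in> Mor MV W Z"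
    let ?c = "Cmp Chn (?U V) (?U W) (?U Z) (conv_exp W Z g) (conv_exp V W f)"
    have "?c \<in> Mor Chn (?U V) (?U Z)"
      by (rule category.Cmp_mem[OF category_Chn U[OF o(1)] U[OF o(2)] U[OF o(3)] exp(1)[OF o(1,2) f] exp(1)[OF o(2,3) g]])
    moreover have "Cmp MV V W Z g f = conv_log V Z ?c"
      by (simp add: MV_def Chn_def same_hat[OF same])
    ultimately show "Cmp MV V W Z g f \<in> Mor MV V Z \<and> conv_exp V Z (Cmp MV V W Z g f) = ?c"
      using log[OF o(1,3), of ?c] by (simp only:)
  next
    fix V :: "('k, 'v, 'r) pointed_complex" assume V: "is_pointed_complex V"
    let ?V = "trivial_mv_algebra K (E V) V"
    have s: "same_graded_space (?U ?V) V"
      using same_trivial_mv_algebra[of V K "E V"] same[of ?V] by (simp add: same_graded_space_def)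
    have gV: "graded_vector_space K V" and lin: "linear_map K (self_module K) V (pc_point V)"
      using V by (auto simp: is_pointed_complex_def)
    have "pc_point V a = pc_point (?U ?V) a" if a: "a \<in> carrier K" for a
      using linear_map_smult[OF lin a, of "\<one>\<^bsub>K\<^esub>"] a
      by (simp add: self_module_def underlying_complex_def trivial_mv_algebra_def Let_def)
    moreover have "pc_diff V = pc_diff (?U ?V)"
      by (simp add: underlying_complex_def trivial_mv_algebra_def Let_def)
    ultimately have "is_iso Chn (?U ?V) V (\<lambda>x \<in> carrier (hat (?U ?V)). x)"
      by (intro same_complex_iso is_pointed_complex_underlying T V s)
    then show "is_iso Chn (?U ?V) V (\<lambda>x \<in> carrier (hat V). x)"
      by (simp only: same_hat(1)[OF s])
  qed (fact is_pointed_complex_underlying T)+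
qed

end

theorem corollary29:
  fixes K :: "'k ring" and R :: "('k, 'r) module" and \<mm> :: "'r set"
  assumes "complete_local_algebra K R \<mm>"
  shows "equivalent_categories
    (complete_local_algebra.MV K R \<mm> ::
      (('k, 'v, 'r) mv_algebra, ('v, 'r, 'k) hat \<Rightarrow> ('v, 'r, 'k) hat) cat)
    (complete_local_algebra.Chn K R \<mm> ::
      (('k, 'v, 'r) pointed_complex, ('v, 'r, 'k) hat \<Rightarrow> ('v, 'r, 'k) hat) cat)"
  by (rule complete_local_algebra.equivalent_MV_Chn[OF assms])


end
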